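(* Let $\theta>0$, and let $X$ be the sub-fractional Ornstein–Uhlenbeck process with parameter $H$ described in the context. If $0<H<3/4$, there is a constant $C>0$, not depending on $n$, such that for all $n>1$ $$d_W\left(\frac{\sqrt n}{\sigma_H}(\hat f_n(X)-f_H(\theta)),N\right)\le C\sqrt{\psi_H(n)},$$ and if $H=3/4$, there is a constant $C>0$ such that for all $n>1$ $$d_W\left(\frac{\sqrt n(\hat f_n(X)-f_H(\theta))}{\sigma_H\sqrt{\log(n)}},N\right)\le C\log(n)^{-1/2}.$$ In particular, if $0<H<3/4$, then as $n\to\infty$ $$\sqrt n(\hat f_n(X)-f_H(\theta))\xrightarrow{\text{law}}\mathcal N(0,\sigma_H^2),$$ and if $H=3/4$, then as $n\to\infty$ $$\frac{\sqrt n(\hat f_n(X)-f_H(\theta))}{\sqrt{\log(n)}}\xrightarrow{\text{law}}\mathcal N(0,\sigma_H^2).$$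
   Context: The sub-fractional Brownian motion $S^H=\{S^H_t\}_{t\ge0}$ with parameter $H\in(0,1)$ is the mean-zero continuous Gaussian process with covariance $E(S^H_tS^H_s)=t^{2H}+s^{2H}-\frac12\left((t+s)^{2H}+|t-s|^{2H}\right)$. The process $X$ solves $dX_t=-\theta X_tdt+dS^H_t$, $X_0=0$, i.e. $X_t=e^{-\theta t}\int_0^te^{\theta s}dS^H_s=S^H_t-\theta e^{-\theta t}\int_0^te^{\theta s}S^H_sds$ (Young/Wiener integral). Set $\hat f_n(X):=\frac1n\sum_{i=1}^nX_i^2$ and $f_H(\theta):=H\Gamma(2H)/\theta^{2H}$. Let $Z^H_t:=e^{-\theta t}\int_{-\infty}^te^{\theta u}dB^H_u$, $t\in\mathbb R$, where $B^H$ is a two-sided fractional Brownian motion with Hurst parameter $H$, and $\rho_H(k):=E[Z^H_kZ^H_0]$, $k\in\mathbb Z$ (an even function). For $0<H<3/4$, $\sigma_H>0$ is given by $\sigma_H^2:=2\rho_H(0)^2+2\sum_{i\in\mathbb Z\setminus\{0\}}\rho_H(i)^2$; for $H=3/4$, $\sigma_{3/4}^2:=\frac{9}{16\theta^4}$. Also $\psi_H(n):=n^{-1}$ if $0<H<1/2$ and $\psi_H(n):=n^{4H-3}$ if $1/2\le H<3/4$. $N\sim\mathcal N(0,1)$; $d_W(Y,Z)=\sup_f|Ef(Y)-Ef(Z)|$ over all $f:\mathbb R\to\mathbb R$ Lipschitz with constant $\le1$. *)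

theory Defs
  imports "HOL-Probability.Probability"
begin

definition normal_law :: "real \<Rightarrow> real \<Rightarrow> real measure" where
  "normal_law m s = (if s = 0 then return borel m else density lborel (normal_density m s))"

definition gaussian_process :: "'a measure \<Rightarrow> real set \<Rightarrow> (real \<Rightarrow> 'a \<Rightarrow> real) \<Rightarrow> bool" where
  "gaussian_process M T Y \<longleftrightarrow>
     (\<forall>t\<in>T. Y t \<in> borel_measurable M) \<and>
     (\<forall>F c. finite F \<and> F \<subseteq> T \<longrightarrow>
        (\<exists>m s. s \<ge> 0 \<and> distr M borel (\<lambda>\<omega>. \<Sum>t\<in>F. c t * Y t \<omega>) = normal_law m s))"

definition continuous_centred_gaussian ::
    "'a measure \<Rightarrow> real set \<Rightarrow> (real \<Rightarrow> real \<Rightarrow> real) \<Rightarrow> (real \<Rightarrow> 'a \<Rightarrow> real) \<Rightarrow> bool" where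
  "continuous_centred_gaussian M T R Y \<longleftrightarrow>
     prob_space M \<and> gaussian_process M T Y \<and>
     (AE \<omega> in M. continuous_on T (\<lambda>t. Y t \<omega>)) \<and>
     (\<forall>t\<in>T. integral\<^sup>L M (Y t) = 0) \<and>
     (\<forall>t\<in>T. \<forall>s\<in>T. integral\<^sup>L M (\<lambda>\<omega>. Y t \<omega> * Y s \<omega>) = R t s)"

definition sub_fractional_BM :: "'a measure \<Rightarrow> real \<Rightarrow> (real \<Rightarrow> 'a \<Rightarrow> real) \<Rightarrow> bool" where
  "sub_fractional_BM M H S \<longleftrightarrow>
     continuous_centred_gaussian M {0..}
       (\<lambda>t s. t powr (2 * H) + s powr (2 * H)
              - 1 / 2 * ((t + s) powr (2 * H) + \<bar>t - s\<bar> powr (2 * H))) S"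

definition two_sided_fractional_BM :: "'a measure \<Rightarrow> real \<Rightarrow> (real \<Rightarrow> 'a \<Rightarrow> real) \<Rightarrow> bool" where
  "two_sided_fractional_BM M H B \<longleftrightarrow>
     continuous_centred_gaussian M UNIV
       (\<lambda>t s. 1 / 2 * (\<bar>t\<bar> powr (2 * H) + \<bar>s\<bar> powr (2 * H) - \<bar>t - s\<bar> powr (2 * H))) B"

text \<open>The Young integral of \<open>f\<close> against \<open>g\<close> over \<open>{a..b}\<close>: the limit of Riemann--Stieltjes sums as
  the mesh tends to zero. The gauge is a ball of constant radius, so this is the Riemann
  and not the Henstock version of the limit.\<close>

definition has_young_integral ::
    "(real \<Rightarrow> real) \<Rightarrow> (real \<Rightarrow> real) \<Rightarrow> real \<Rightarrow> real \<Rightarrow> real \<Rightarrow> bool" where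
  "has_young_integral f g a b I \<longleftrightarrow>
     (\<forall>e>0. \<exists>d>0. \<forall>D. D tagged_division_of {a..b} \<and> (\<lambda>x. ball x d) fine D \<longrightarrow>
        \<bar>(\<Sum>(x, K)\<in>D. f x * (g (Sup K) - g (Inf K))) - I\<bar> < e)"

definition has_young_integral_from_minus_infinity ::
    "(real \<Rightarrow> real) \<Rightarrow> (real \<Rightarrow> real) \<Rightarrow> real \<Rightarrow> real \<Rightarrow> bool" where
  "has_young_integral_from_minus_infinity f g b I \<longleftrightarrow>
     (\<exists>J. (\<forall>a\<le>b. has_young_integral f g a b (J a)) \<and> (J \<longlongrightarrow> I) at_bot)"

text \<open>\<open>X\<^sub>t = e\<^bsup>-\<theta>t\<^esup> \<integral>\<^sub>0\<^sup>t e\<^bsup>\<theta>s\<^esup> dS\<^sub>s\<close> almost surely, for each \<open>t \<ge> 0\<close>.\<close>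

definition sub_fractional_OU ::
    "'a measure \<Rightarrow> real \<Rightarrow> (real \<Rightarrow> 'a \<Rightarrow> real) \<Rightarrow> (real \<Rightarrow> 'a \<Rightarrow> real) \<Rightarrow> bool" where
  "sub_fractional_OU M \<theta> S X \<longleftrightarrow>
     (\<forall>t\<ge>0. X t \<in> borel_measurable M \<and>
        (AE \<omega> in M. \<exists>I. has_young_integral (\<lambda>s. exp (\<theta> * s)) (\<lambda>s. S s \<omega>) 0 t I \<and>
                        X t \<omega> = exp (- \<theta> * t) * I))"

text \<open>\<open>Z\<^sub>t = e\<^bsup>-\<theta>t\<^esup> \<integral>\<^bsub>-\<infinity>\<^esub>\<^sup>t e\<^bsup>\<theta>u\<^esup> dB\<^sub>u\<close> almost surely, for each real \<open>t\<close>.\<close>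

definition stationary_fractional_OU ::
    "'a measure \<Rightarrow> real \<Rightarrow> (real \<Rightarrow> 'a \<Rightarrow> real) \<Rightarrow> (real \<Rightarrow> 'a \<Rightarrow> real) \<Rightarrow> bool" where
  "stationary_fractional_OU M \<theta> B Z \<longleftrightarrow>
     (\<forall>t. Z t \<in> borel_measurable M \<and>
        (AE \<omega> in M. \<exists>I. has_young_integral_from_minus_infinity
                          (\<lambda>u. exp (\<theta> * u)) (\<lambda>u. B u \<omega>) t I \<and>
                        Z t \<omega> = exp (- \<theta> * t) * I))"

definition rho :: "'a measure \<Rightarrow> (real \<Rightarrow> 'a \<Rightarrow> real) \<Rightarrow> int \<Rightarrow> real" where
  "rho M Z k = integral\<^sup>L M (\<lambda>\<omega>. Z (of_int k) \<omega> * Z 0 \<omega>)"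

text \<open>The standard deviation \<open>\<sigma>\<^sub>H\<close>; only \<open>H \<le> 3/4\<close> is meaningful, since for
  \<open>H > 3/4\<close> the series diverges.\<close>

definition sigma_H :: "real \<Rightarrow> real \<Rightarrow> (int \<Rightarrow> real) \<Rightarrow> real" where
  "sigma_H H \<theta> r =
     sqrt (if H = 3 / 4 then 9 / (16 * \<theta> ^ 4)
           else 2 * (r 0)\<^sup>2 + 2 * (\<Sum>\<^sub>\<infinity>i\<in>UNIV - {0}. (r i)\<^sup>2))"

definition f_hat :: "(real \<Rightarrow> 'a \<Rightarrow> real) \<Rightarrow> nat \<Rightarrow> 'a \<Rightarrow> real" where
  "f_hat X n \<omega> = 1 / real n * (\<Sum>i=1..n. (X (real i) \<omega>)\<^sup>2)"

definition f_lim :: "real \<Rightarrow> real \<Rightarrow> real" where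
  "f_lim H \<theta> = H * Gamma (2 * H) / \<theta> powr (2 * H)"

definition psi :: "real \<Rightarrow> nat \<Rightarrow> real" where
  "psi H n = (if H < 1 / 2 then 1 / real n else real n powr (4 * H - 3))"

text \<open>The distance depends on the two laws only, so it is defined on measures. It is
  extended-valued, since over \<open>real\<close> a supremum of an unbounded set is unspecified. As Bochner
  integrals of non-integrable functions are 0, it is the Wasserstein distance only
  between laws with finite first moment.\<close>

definition wasserstein_dist :: "real measure \<Rightarrow> real measure \<Rightarrow> ennreal" where
  "wasserstein_dist \<mu> \<nu> =
     (SUP f\<in>{f :: real \<Rightarrow> real. 1-lipschitz_on UNIV f}.
        ennreal \<bar>integral\<^sup>L \<mu> f - integral\<^sup>L \<nu> f\<bar>)"

end

(* The quadratic functional Q of the Gaussian vector (X_1, ..., X_n) is treated by Stein's method.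
   If K is the covariance matrix of the vector and T = <X, K X>, then E[(Q - E Q) f(Q)] = 2 E[T f'(Q)]. For
   f = exp(-s q) this follows by writing exp(-s |x|^2) as a Gaussian average of cos<g, x>, and general f are
   limits of such functions. Inserting the solution of Stein's equation bounds the Wasserstein
   distance of the normalised Q to the normal law by the variance of T, hence by (largest absolute
   row sum of K) / sqrt(tr K^2).

   The Young integrals are limits of Riemann-Stieltjes sums, so that X and Z are Gaussian and their
   covariances are expectations, over two independent exponential variables, of second differences
   of |x|^(2H). A Taylor expansion shows that both covariances decay like |i - j|^(2H-2) and
   differ by O(max(i, j)^(2H-2)); for H = 1/2, where the leading coefficient vanishes, the exponent
   -2 is used instead. Summation gives the bias, the row sums and the variance. *)

theory Submission
  imports Defs "HOL-Real_Asymp.Real_Asymp"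
begin

section \<open>Stein's equation for the normal law\<close>

text \<open>K is never diagonalised: for exponential f the averaging vector g turns both sides of
  the identity into moments of X against a cosine, which are derivatives of E cos, and the resulting
  integrals over g agree by integration by parts in g. The variance of T is 2 tr K^4, and Schur's
  test bounds tr K^4 by the squared row sum times tr K^2. For H < 3/4, row sums of order
  n^max(2H-1,0) and tr K^2 of order n give sqrt(psi_H(n)). A covariance density |u-v|^(2H-2) would
  not be integrable at the diagonal for H < 1/2. Summation by parts avoids it: e^(-\<theta>t) times
  the integral of e^(\<theta>u) dY_u over [a,t] is the mean of Y_t - Y_max(t-p,a) over an
  exponential p, so that only increments of the covariance occur, for every H in (0,1). The exponent
  -2 at H = 1/2 also keeps the sums of d^b away from b = -1, where a logarithm would appear. At H =
  3/4 the stationary covariance is c d^(-1/2) + O(d^(-3/2)) with c = 3/(8 \<theta>^2); the squares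
  sum to c^2 log n up to a bounded error, and 4 c^2 = 9/(16 \<theta>^4).\<close>

abbreviation (input) std_gauss :: "real measure" where "std_gauss \<equiv> std_normal_distribution"

lemma prob_space_std_gauss: "prob_space std_gauss"
  using real_dist_normal_dist real_distribution_def by blast

lemma measure_std_gauss_UNIV [simp]: "measure std_gauss UNIV = 1"
  using prob_space.prob_space[OF prob_space_std_gauss] by simp

lemma integrable_std_gauss_iff:
  fixes f :: "real \<Rightarrow> real"
  assumes "f \<in> borel_measurable borel"
  shows "integrable std_gauss f \<longleftrightarrow> integrable lborel (\<lambda>x. f x * exp (- x\<^sup>2 / 2))"
proof -
  have "integrable std_gauss f \<longleftrightarrow> integrable lborel (\<lambda>x. std_normal_density x * f x)"
    using assms by (subst integrable_density) auto
  also have "(\<lambda>x. std_normal_density x * f x) = (\<lambda>x. (1 / sqrt (2*pi)) * (f x * exp (- x\<^sup>2 / 2)))"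
    by (auto simp: std_normal_density_def)
  also have "integrable lborel \<dots> \<longleftrightarrow> integrable lborel (\<lambda>x. f x * exp (- x\<^sup>2 / 2))"
    by (subst integrable_mult_left_iff) auto
  finally show ?thesis .
qed

lemma integral_std_gauss_eq:
  fixes f :: "real \<Rightarrow> real"
  assumes "f \<in> borel_measurable borel"
  shows "integral\<^sup>L std_gauss f = (LINT x|lborel. f x * exp (- x\<^sup>2 / 2)) / sqrt (2 * pi)"
proof -
  have "integral\<^sup>L std_gauss f = (LINT x|lborel. std_normal_density x * f x)"
    using assms by (subst integral_density) auto
  also have "(\<lambda>x. std_normal_density x * f x) = (\<lambda>x. (1 / sqrt (2*pi)) * (f x * exp (- x\<^sup>2 / 2)))"
    by (auto simp: std_normal_density_def)
  finally show ?thesis by simp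
qed

lemma abs_integrable_std_gauss: "integrable std_gauss (\<lambda>x. \<bar>x\<bar>)"
  using integrable_abs[OF integrable_std_normal_distribution_moment[of 1]] by simp

lemma integral_abs_std_gauss_le: "(LINT x|std_gauss. \<bar>x\<bar>) \<le> 1"
proof -
  interpret prob_space std_gauss by (rule prob_space_std_gauss)
  have "(LINT x|std_gauss. \<bar>x\<bar>) \<le> (LINT x|std_gauss. (1 + x^2) / 2)"
  proof (rule integral_mono)
    show "integrable std_gauss (\<lambda>x. (1 + x\<^sup>2) / 2)"
      using integrable_std_normal_distribution_moment[of 2] by auto
    show "\<bar>x\<bar> \<le> (1 + x\<^sup>2) / 2" for x :: real
      using sum_squares_bound[of "1::real" "\<bar>x\<bar>"] by simp
  qed (rule abs_integrable_std_gauss)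
  also have "\<dots> = (1 + (LINT x|std_gauss. x^2)) / 2"
    using integrable_std_normal_distribution_moment[of 2]
    by (simp add: prob_space)
  also have "(LINT x|std_gauss. x^2) = 1"
    using std_normal_distribution_even_moments(1)[of 1] by (simp add: fact_2)
  finally show ?thesis by simp
qed

lemma lipschitz_real_le:
  fixes h :: "real \<Rightarrow> real"
  assumes "1-lipschitz_on UNIV h"
  shows "\<bar>h x - h y\<bar> \<le> \<bar>x - y\<bar>"
  using lipschitz_onD[OF assms, of x y] by (simp add: dist_real_def)

lemma lipschitz_real_measurable:
  fixes h :: "real \<Rightarrow> real"
  assumes "1-lipschitz_on UNIV h"
  shows "h \<in> borel_measurable borel"
  by (intro borel_measurable_continuous_onI lipschitz_on_continuous_on[OF assms])

lemma integrable_std_gauss_lipschitz: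
  fixes h :: "real \<Rightarrow> real"
  assumes "1-lipschitz_on UNIV h"
  shows "integrable std_gauss h"
proof -
  interpret prob_space std_gauss by (rule prob_space_std_gauss)
  show ?thesis
  proof (rule Bochner_Integration.integrable_bound)
    show "integrable std_gauss (\<lambda>x. \<bar>h 0\<bar> + \<bar>x\<bar>)"
      using abs_integrable_std_gauss by auto
    show "AE x in std_gauss. norm (h x) \<le> norm (\<bar>h 0\<bar> + \<bar>x\<bar>)"
      using lipschitz_real_le[OF assms, of _ 0] by (auto intro!: AE_I2) (smt (verit, best))
  qed (use lipschitz_real_measurable[OF assms] in simp)
qed

text \<open>Averaging the Lipschitz inequality over a standard normal \<open>y\<close> costs its
  first absolute moment, which is at most 1. The bound controls Stein's solution and, later, the
  case of a variance far from its target.\<close>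

lemma lipschitz_centred_bound:
  fixes h :: "real \<Rightarrow> real"
  assumes h: "1-lipschitz_on UNIV h"
  shows "\<bar>h x - integral\<^sup>L std_gauss h\<bar> \<le> \<bar>x\<bar> + 1"
proof -
  interpret prob_space std_gauss by (rule prob_space_std_gauss)
  have "h x - integral\<^sup>L std_gauss h = (LINT y|std_gauss. h x - h y)"
    using integrable_std_gauss_lipschitz[OF h] by (simp add: prob_space)
  also have "\<bar>\<dots>\<bar> \<le> (LINT y|std_gauss. \<bar>h x - h y\<bar>)"
    by (rule integral_abs_bound)
  also have "\<dots> \<le> (LINT y|std_gauss. \<bar>x\<bar> + \<bar>y\<bar>)"
  proof (rule integral_mono)
    show "\<bar>h x - h y\<bar> \<le> \<bar>x\<bar> + \<bar>y\<bar>" for y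
      using lipschitz_real_le[OF h, of x y] by linarith
  qed (use integrable_std_gauss_lipschitz[OF h] abs_integrable_std_gauss in auto)
  also have "\<dots> = \<bar>x\<bar> + (LINT y|std_gauss. \<bar>y\<bar>)"
    using abs_integrable_std_gauss by (simp add: prob_space)
  finally show ?thesis using integral_abs_std_gauss_le by linarith
qed

text \<open>Cutting the half line at \<open>x - 1\<close> leaves a constant and an integral over a
  compact interval, to which the fundamental theorem of calculus applies.\<close>

lemma lower_integral_has_derivative:
  fixes u :: "real \<Rightarrow> real"
  assumes u: "integrable lborel u" and c: "continuous_on UNIV u"
  shows "((\<lambda>x. LINT y:{..x}|lborel. u y) has_real_derivative u x) (at x)"
proof -
  have si: "set_integrable lborel A u" if "A \<in> sets borel" for A
    using that u unfolding set_integrable_def by (intro integrable_mult_indicator) auto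
  have split: "(LINT y:{..z}|lborel. u y) = (LINT y:{..<x-1}|lborel. u y) + integral {x-1..z} u"
    if "z \<ge> x - 1" for z
  proof -
    have "(LINT y:{..<x-1} \<union> {x-1..z}|lborel. u y) = (LINT y:{..<x-1}|lborel. u y) + (LINT y:{x-1..z}|lborel. u y)"
      by (rule set_integral_Un) (auto intro: si)
    moreover have "{..<x-1} \<union> {x-1..z} = {..z}" using that by auto
    ultimately show ?thesis using set_borel_integral_eq_integral(2)[OF si[of "{x-1..z}"]] by simp
  qed
  have "((\<lambda>z. integral {x-1..z} u) has_real_derivative u x) (at x within {x-1..x+1})"
    by (rule integral_has_real_derivative) (auto intro: continuous_on_subset[OF c])
  then have "((\<lambda>z. integral {x-1..z} u) has_real_derivative u x) (at x)"
    by (simp add: at_within_Icc_at)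
  then have "((\<lambda>z. (LINT y:{..<x-1}|lborel. u y) + integral {x-1..z} u) has_real_derivative u x) (at x)"
    by (rule DERIV_cong[OF DERIV_add[OF DERIV_const]]) simp
  then show ?thesis
    by (rule has_field_derivative_transform_within_open[where S="{x-1<..}"]) (auto simp: split)
qed


section \<open>The lower Gaussian tail and its Mills ratio\<close>

definition gtail :: "real \<Rightarrow> real" where
  "gtail x = (LINT y:{..x}|lborel. exp (- y\<^sup>2 / 2))"

lemma integrable_moment_exp:
  "integrable lborel (\<lambda>y::real. y ^ k * exp (- y\<^sup>2 / 2))"
  using integrable_std_gauss_iff[of "\<lambda>y. y ^ k"] integrable_std_normal_distribution_moment[of k] by simp

lemma set_integrable_moment_exp:
  "A \<in> sets borel \<Longrightarrow> set_integrable lborel A (\<lambda>y::real. y ^ k * exp (- y\<^sup>2 / 2))"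
  unfolding set_integrable_def by (intro integrable_mult_indicator integrable_moment_exp) auto

lemma lower_integral_at_bot:
  fixes u :: "real \<Rightarrow> real"
  assumes u: "integrable lborel u"
  shows "((\<lambda>x. LINT y:{..x}|lborel. u y) \<longlongrightarrow> 0) at_bot"
proof (rule tendsto_at_botI_sequentially)
  fix X :: "nat \<Rightarrow> real" assume X: "filterlim X at_bot sequentially"
  have "(\<lambda>n. LINT y|lborel. indicator {..X n} y *\<^sub>R u y) \<longlonglongrightarrow> (LINT y::real|lborel. (0::real))"
  proof (rule integral_dominated_convergence[where w="\<lambda>y. \<bar>u y\<bar>"])
    show "AE y in lborel. (\<lambda>n. indicator {..X n} y *\<^sub>R u y) \<longlonglongrightarrow> 0"
    proof (rule AE_I2)
      fix y
      have "eventually (\<lambda>n. X n < y) sequentially"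
        using X unfolding filterlim_at_bot_dense by auto
      then show "(\<lambda>n. indicator {..X n} y *\<^sub>R u y) \<longlonglongrightarrow> 0"
        by (intro tendsto_eventually) (auto elim!: eventually_mono)
    qed
  qed (use u in \<open>auto split: split_indicator\<close>)
  then show "(\<lambda>n. LINT y:{..X n}|lborel. u y) \<longlonglongrightarrow> 0"
    by (simp add: set_lebesgue_integral_def)
qed

lemma has_derivative_gauss_exp:
  "((\<lambda>x::real. exp (- x\<^sup>2 / 2)) has_real_derivative - x * exp (- x\<^sup>2 / 2)) (at x)"
  by (auto intro!: derivative_eq_intros)

text \<open>Both sides have the same derivative and vanish at minus infinity.\<close>

lemma lower_integral_linear_exp:
  fixes x :: real
  shows "(LINT y:{..x}|lborel. (- y) * exp (- y\<^sup>2 / 2)) = exp (- x\<^sup>2 / 2)"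
proof -
  let ?D = "\<lambda>x::real. (LINT y:{..x}|lborel. (- y) * exp (- y\<^sup>2 / 2)) - exp (- x\<^sup>2 / 2)"
  have i: "integrable lborel (\<lambda>y::real. (- y) * exp (- y\<^sup>2 / 2))"
    using integrable_moment_exp[of 1] by simp
  have d: "(?D has_real_derivative 0) (at z)" for z
    using DERIV_diff[OF lower_integral_has_derivative[OF i] has_derivative_gauss_exp[of z]]
    by (simp add: continuous_intros)
  obtain c where c: "\<And>z. ?D z = c"
    using has_field_derivative_zero_constant[of UNIV ?D] d by auto
  have "(?D \<longlongrightarrow> 0 - 0) at_bot"
  proof (intro tendsto_diff lower_integral_at_bot i)
    show "((\<lambda>x::real. exp (- x\<^sup>2 / 2)) \<longlongrightarrow> 0) at_bot" by real_asymp
  qed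
  then have "c = 0" using c by (simp add: tendsto_const_iff)
  then show ?thesis using c[of x] by simp
qed

lemma gtail_has_derivative: "(gtail has_real_derivative exp (- x\<^sup>2 / 2)) (at x)"
  unfolding gtail_def using integrable_moment_exp[of 0]
  by (intro lower_integral_has_derivative) (auto intro!: continuous_intros)

text \<open>This is Mills' lower bound for the tail, \<open>gtail\<close> being sqrt(2 pi) times the
  normal distribution function. \<open>?D\<close> is nondecreasing with limit 0 at minus infinity,
  hence nonnegative, and multiplication by \<open>x \<le> 0\<close> reverses the inequality.\<close>

lemma mills_ratio_lower:
  assumes "x \<le> 0"
  shows "x * gtail x + exp (- x\<^sup>2 / 2) \<le> exp (- x\<^sup>2 / 2) / (1 + x\<^sup>2)"
proof -
  let ?D = "\<lambda>x. gtail x + x / (1 + x\<^sup>2) * exp (- x\<^sup>2 / 2)"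
  have nz: "1 + z\<^sup>2 > 0" for z :: real by (simp add: add_pos_nonneg)
  have d: "(?D has_real_derivative (2 / (1 + z\<^sup>2)\<^sup>2) * exp (- z\<^sup>2 / 2)) (at z)" for z
  proof -
    have "(?D has_real_derivative (exp (- z\<^sup>2 / 2) + (((1 + z\<^sup>2) - z * (2 * z)) / (1 + z\<^sup>2)\<^sup>2 * exp (- z\<^sup>2 / 2)
             + z / (1 + z\<^sup>2) * (exp (- z\<^sup>2 / 2) * (- z))))) (at z)"
    proof (intro DERIV_add gtail_has_derivative)
      have "((\<lambda>x. x / (1 + x\<^sup>2)) has_real_derivative ((1 + z\<^sup>2) - z * (2 * z)) / (1 + z\<^sup>2)\<^sup>2) (at z)"
        using nz[of z] by (auto intro!: derivative_eq_intros simp: power2_eq_square)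
      from DERIV_mult[OF this has_derivative_gauss_exp[of z]]
      show "((\<lambda>x. x / (1 + x\<^sup>2) * exp (- x\<^sup>2 / 2)) has_real_derivative ((1 + z\<^sup>2) - z * (2 * z)) / (1 + z\<^sup>2)\<^sup>2 * exp (- z\<^sup>2 / 2)
             + z / (1 + z\<^sup>2) * (exp (- z\<^sup>2 / 2) * (- z))) (at z)"
        by (simp add: algebra_simps)
    qed
    also have "(exp (- z\<^sup>2 / 2) + (((1 + z\<^sup>2) - z * (2 * z)) / (1 + z\<^sup>2)\<^sup>2 * exp (- z\<^sup>2 / 2)
             + z / (1 + z\<^sup>2) * (exp (- z\<^sup>2 / 2) * (- z))))
        = (1 + ((1 + z\<^sup>2) - z * (2 * z)) / (1 + z\<^sup>2)\<^sup>2 - z * z / (1 + z\<^sup>2)) * exp (- z\<^sup>2 / 2)"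
      by (simp add: algebra_simps)
    also have "1 + ((1 + z\<^sup>2) - z * (2 * z)) / (1 + z\<^sup>2)\<^sup>2 - z * z / (1 + z\<^sup>2) = 2 / (1 + z\<^sup>2)\<^sup>2"
      using nz[of z] by (simp add: divide_simps) (simp add: algebra_simps power2_eq_square)
    finally show ?thesis .
  qed
  have mono: "?D a \<le> ?D b" if "a \<le> b" for a b
  proof (rule DERIV_nonneg_imp_nondecreasing[OF that])
    fix z show "\<exists>y. (?D has_real_derivative y) (at z) \<and> 0 \<le> y"
      by (rule exI, rule conjI, rule d) auto
  qed
  have "(?D \<longlongrightarrow> 0 + 0) at_bot"
  proof (rule tendsto_add)
    show "(gtail \<longlongrightarrow> 0) at_bot"
      unfolding gtail_def using lower_integral_at_bot[OF integrable_moment_exp[of 0]] by simp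
    show "((\<lambda>x::real. x / (1 + x\<^sup>2) * exp (- x\<^sup>2 / 2)) \<longlongrightarrow> 0) at_bot" by real_asymp
  qed
  then have "0 \<le> ?D x"
  proof (intro tendsto_upperbound[where F=at_bot and f="?D"])
    show "\<forall>\<^sub>F i in at_bot. ?D i \<le> ?D x"
      using eventually_le_at_bot[of x] by eventually_elim (rule mono)
  qed auto
  then have D0: "x * ?D x \<le> 0" using assms by (simp add: mult_nonpos_nonneg)
  have eq: "x * ?D x = x * gtail x + (x * (x / (1 + x\<^sup>2))) * exp (- x\<^sup>2 / 2)"
    by (simp add: algebra_simps)
  have eq': "x * (x / (1 + x\<^sup>2)) = 1 - 1 / (1 + x\<^sup>2)"
    using nz[of x] by (simp add: field_simps power2_eq_square)
  show ?thesis
    using D0 unfolding eq eq' by (simp add: left_diff_distrib)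
qed

section \<open>The solution of Stein's equation and its derivative\<close>

definition stein_num :: "(real \<Rightarrow> real) \<Rightarrow> real \<Rightarrow> real" where
  "stein_num h x = (LINT y:{..x}|lborel. (h y - integral\<^sup>L std_gauss h) * exp (- y\<^sup>2 / 2))"

lemma stein_integrand_integrable:
  assumes h: "1-lipschitz_on UNIV h"
  shows "integrable lborel (\<lambda>y. (h y - integral\<^sup>L std_gauss h) * exp (- y\<^sup>2 / 2))"
proof -
  interpret prob_space std_gauss by (rule prob_space_std_gauss)
  have "integrable std_gauss (\<lambda>y. h y - integral\<^sup>L std_gauss h)"
    using integrable_std_gauss_lipschitz[OF h] by auto
  then show ?thesis
    using lipschitz_real_measurable[OF h] by (subst (asm) integrable_std_gauss_iff) auto
qed

lemma stein_num_has_derivative: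
  assumes h: "1-lipschitz_on UNIV h"
  shows "(stein_num h has_real_derivative (h x - integral\<^sup>L std_gauss h) * exp (- x\<^sup>2 / 2)) (at x)"
  unfolding stein_num_def
  by (rule lower_integral_has_derivative[OF stein_integrand_integrable[OF h]])
     (auto intro!: continuous_intros lipschitz_on_continuous_on[OF h])

text \<open>Up to the factor e^(-x^2/2) the quantity is the derivative of Stein's solution. Split
  \<open>h y - ?c\<close> into \<open>h y - h x\<close> and \<open>h x - ?c\<close>: the first part
  is at most \<open>W\<close> by the Lipschitz property, the second combines with the free term to
  \<open>(h x - ?c) * W\<close>. The Mills bound \<open>W \<le> ?e x / (1 + x\<^sup>2)\<close> then
  absorbs the coefficient 2|x| + 1.\<close>

lemma stein_bound_nonpos:
  assumes h: "1-lipschitz_on UNIV h" and x: "x \<le> 0"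
  shows "\<bar>x * stein_num h x + (h x - integral\<^sup>L std_gauss h) * exp (- x\<^sup>2 / 2)\<bar> \<le> 2 * exp (- x\<^sup>2 / 2)"
proof -
  let ?c = "integral\<^sup>L std_gauss h" and ?e = "\<lambda>y::real. exp (- y\<^sup>2 / 2)"
  have si: "set_integrable lborel {..x} (\<lambda>y. (h y - ?c) * ?e y)"
    unfolding set_integrable_def by (intro integrable_mult_indicator stein_integrand_integrable h) auto
  have s0: "set_integrable lborel {..x} (\<lambda>y. a * ?e y)" for a
    using set_integrable_moment_exp[of "{..x}" 0] by (simp add: set_integrable_mult_right)
  have s1: "set_integrable lborel {..x} (\<lambda>y. (- y) * ?e y)"
    using set_integrable_mult_right[OF set_integrable_moment_exp[of "{..x}" 1], of "-1"] by simp
  have i0: "(LINT y:{..x}|lborel. a * ?e y) = a * gtail x" for a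
    by (simp add: gtail_def)
  define R where "R = (LINT y:{..x}|lborel. (h y - h x) * ?e y)"
  have sR: "set_integrable lborel {..x} (\<lambda>y. (h y - h x) * ?e y)"
    using set_integral_diff(1)[OF si s0[of "h x - ?c"]] by (simp add: algebra_simps)
  have e1: "stein_num h x = R + (h x - ?c) * gtail x"
    unfolding stein_num_def R_def i0[symmetric]
    by (subst set_integral_add(2)[OF sR s0, symmetric]) (simp add: algebra_simps)
  \<comment> \<open>\<open>W\<close> is also the integral of (x - y) e^(-y^2/2) over y at most x, so
    that one quantity serves both parts.\<close>
  define W where "W = x * gtail x + ?e x"
  have eq: "x * stein_num h x + (h x - ?c) * ?e x = x * R + (h x - ?c) * W"
    unfolding e1 W_def by (simp add: algebra_simps)
  have W_eq: "(LINT y:{..x}|lborel. (x - y) * ?e y) = W"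
    using set_integral_add(2)[OF s0[of x] s1] i0[of x] lower_integral_linear_exp[of x]
    by (simp add: W_def algebra_simps)
  have "\<bar>R\<bar> \<le> (LINT y:{..x}|lborel. \<bar>(h y - h x) * ?e y\<bar>)"
    unfolding R_def using set_integral_norm_bound[OF sR] by simp
  also have "\<dots> \<le> (LINT y:{..x}|lborel. (x - y) * ?e y)"
  proof (rule set_integral_mono)
    show "set_integrable lborel {..x} (\<lambda>y. \<bar>(h y - h x) * ?e y\<bar>)"
      by (rule set_integrable_abs[OF sR])
    show "set_integrable lborel {..x} (\<lambda>y. (x - y) * ?e y)"
      using set_integral_add(1)[OF s0[of x] s1] by (simp add: algebra_simps)
    show "\<bar>(h y - h x) * ?e y\<bar> \<le> (x - y) * ?e y" if "y \<in> {..x}" for y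
      using that lipschitz_real_le[OF h, of y x] by (auto simp: abs_mult)
  qed
  finally have R: "\<bar>R\<bar> \<le> W" unfolding W_eq .
  then have W0: "0 \<le> W" by linarith
  have "\<bar>x * R + (h x - ?c) * W\<bar> \<le> \<bar>x\<bar> * \<bar>R\<bar> + \<bar>h x - ?c\<bar> * \<bar>W\<bar>"
    by (metis abs_mult abs_triangle_ineq)
  also have "\<dots> \<le> \<bar>x\<bar> * W + (\<bar>x\<bar> + 1) * W"
    using R W0 lipschitz_centred_bound[OF h, of x] by (intro add_mono mult_mono) auto
  also have "\<dots> = (2 * \<bar>x\<bar> + 1) * W" by (simp add: algebra_simps)
  also have "\<dots> \<le> (2 * \<bar>x\<bar> + 1) * (?e x / (1 + x\<^sup>2))"
    using mills_ratio_lower[OF x] by (intro mult_left_mono) (auto simp: W_def)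
  also have "\<dots> = ((2 * \<bar>x\<bar> + 1) / (1 + x\<^sup>2)) * ?e x" by simp
  also have "\<dots> \<le> 2 * ?e x"
  proof (rule mult_right_mono)
    have "2 * \<bar>x\<bar> \<le> 1 + x\<^sup>2"
      using sum_squares_bound[of 1 "\<bar>x\<bar>"] by simp
    then have "2 * \<bar>x\<bar> + 1 \<le> 2 * (1 + x\<^sup>2)"
      using zero_le_power2[of x] by argo
    then show "(2 * \<bar>x\<bar> + 1) / (1 + x\<^sup>2) \<le> 2"
      by (simp add: divide_le_eq add_pos_nonneg)
  qed auto
  finally show ?thesis unfolding eq .
qed

text \<open>Since \<open>h\<close> minus its mean integrates to 0 against the normal law, the lower
  integral is minus the upper one, and the substitution y -> -y makes the latter a lower integral
  for the reflected function. This carries the bound from \<open>x \<le> 0\<close> to positive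
  x.\<close>

lemma stein_num_reflect:
  assumes h: "1-lipschitz_on UNIV h"
  shows "stein_num h x = - stein_num (\<lambda>y. h (- y)) (- x)"
    and "integral\<^sup>L std_gauss (\<lambda>y. h (- y)) = integral\<^sup>L std_gauss h"
proof -
  let ?c = "integral\<^sup>L std_gauss h" and ?e = "\<lambda>y::real. exp (- y\<^sup>2 / 2)"
  let ?u = "\<lambda>y. (h y - ?c) * ?e y"
  have [measurable]: "h \<in> borel_measurable borel" by (rule lipschitz_real_measurable[OF h])
  show c: "integral\<^sup>L std_gauss (\<lambda>y. h (- y)) = ?c"
    using lborel_integral_real_affine[of "-1" "\<lambda>y. h y * ?e y" 0]
    by (subst (1 2) integral_std_gauss_eq) auto
  have iu: "integrable lborel ?u" by (rule stein_integrand_integrable[OF h])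
  have si: "set_integrable lborel A ?u" if "A \<in> sets borel" for A
    using that iu unfolding set_integrable_def by (intro integrable_mult_indicator) auto
  interpret prob_space std_gauss by (rule prob_space_std_gauss)
  have "integral\<^sup>L std_gauss (\<lambda>y. h y - ?c) = 0"
    using integrable_std_gauss_lipschitz[OF h] by simp
  then have "(LINT y|lborel. ?u y) = 0"
    by (subst (asm) integral_std_gauss_eq) auto
  moreover have UNIV: "{..x} \<union> {x<..} = UNIV" by auto
  ultimately have "(LINT y:{..x} \<union> {x<..}|lborel. ?u y) = 0"
    by (simp add: set_lebesgue_integral_def UNIV)
  then have "(LINT y:{..x}|lborel. ?u y) = - (LINT y:{x<..}|lborel. ?u y)"
    using set_integral_Un[OF _ si si, of "{..x}" "{x<..}"] by (auto simp: disjoint_iff)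
  also have "(LINT y:{x<..}|lborel. ?u y) = (LINT y|lborel. indicator {x<..} (-y) *\<^sub>R ?u (-y))"
    unfolding set_lebesgue_integral_def
    using lborel_integral_real_affine[of "-1" "\<lambda>y. indicator {x<..} y *\<^sub>R ?u y" 0] by simp
  also have "\<dots> = (LINT y|lborel. indicator {..-x} y *\<^sub>R ((h (-y) - ?c) * ?e y))"
  proof (rule integral_cong_AE)
    show "AE y in lborel. indicator {x<..} (-y) *\<^sub>R ?u (-y) = indicator {..-x} y *\<^sub>R ((h (-y) - ?c) * ?e y)"
      using AE_lborel_singleton[of "-x"] by eventually_elim (auto split: split_indicator)
  qed auto
  finally show "stein_num h x = - stein_num (\<lambda>y. h (- y)) (- x)"
    unfolding stein_num_def c by (simp add: set_lebesgue_integral_def)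
qed

text \<open>The integrating factor e^(-x^2/2) of the equation yields \<open>f\<close>. For positive
  x the derivative is estimated through the reflected function, which is again 1-Lipschitz.
  Continuity of \<open>f'\<close> is read off the equation; polynomial approximation will use
  it.\<close>

theorem stein_solution:
  fixes h :: "real \<Rightarrow> real"
  assumes h: "1-lipschitz_on UNIV h"
  obtains f f' where "\<And>x. (f has_real_derivative f' x) (at x)" "continuous_on UNIV f'"
    "\<And>x. \<bar>f' x\<bar> \<le> 2" "\<And>x. f' x - x * f x = h x - integral\<^sup>L std_gauss h"
proof -
  let ?c = "integral\<^sup>L std_gauss h"
  define f where "f = (\<lambda>x. exp (x\<^sup>2 / 2) * stein_num h x)"
  define f' where "f' = (\<lambda>x. x * f x + (h x - ?c))"
  have ee: "exp (x\<^sup>2 / 2) * exp (- x\<^sup>2 / 2) = 1" for x :: real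
    by (simp flip: exp_add)
  have d: "(f has_real_derivative f' x) (at x)" for x
  proof -
    have "(f has_real_derivative (exp (x\<^sup>2 / 2) * x * stein_num h x
        + exp (x\<^sup>2 / 2) * ((h x - ?c) * exp (- x\<^sup>2 / 2)))) (at x)"
      unfolding f_def by (auto intro!: derivative_eq_intros stein_num_has_derivative[OF h])
    also have "(exp (x\<^sup>2 / 2) * x * stein_num h x
        + exp (x\<^sup>2 / 2) * ((h x - ?c) * exp (- x\<^sup>2 / 2))) = f' x"
      unfolding f'_def f_def using ee[of x] by (simp add: algebra_simps flip: mult.assoc)
    finally show ?thesis .
  qed
  have cont: "continuous_on UNIV f'"
    unfolding f'_def
    by (intro continuous_intros lipschitz_on_continuous_on[OF h] DERIV_continuous_on)
       (use d in blast)
  have f'_eq: "f' x = exp (x\<^sup>2 / 2) * (x * stein_num h x + (h x - ?c) * exp (- x\<^sup>2 / 2))" for x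
    unfolding f'_def f_def using ee[of x] by (simp add: algebra_simps flip: mult.assoc)
  have num: "\<bar>x * stein_num h x + (h x - ?c) * exp (- x\<^sup>2 / 2)\<bar> \<le> 2 * exp (- x\<^sup>2 / 2)" for x
  proof (cases "x \<le> 0")
    case True then show ?thesis by (rule stein_bound_nonpos[OF h])
  next
    case False
    have h': "1-lipschitz_on UNIV (\<lambda>y. h (- y))"
    proof (rule lipschitz_onI)
      fix a b show "dist (h (- a)) (h (- b)) \<le> 1 * dist a b"
        using lipschitz_real_le[OF h, of "-a" "-b"] by (simp add: dist_real_def)
    qed simp
    show ?thesis
      using stein_bound_nonpos[OF h', of "- x"] False stein_num_reflect[OF h] by simp
  qed
  have "\<bar>f' x\<bar> \<le> 2" for x
  proof -
    have "\<bar>f' x\<bar> \<le> exp (x\<^sup>2 / 2) * (2 * exp (- x\<^sup>2 / 2))"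
      unfolding f'_eq abs_mult using num[of x] by (intro mult_mono) auto
    then show ?thesis using ee[of x] by simp
  qed
  then show ?thesis using d cont by (intro that) (auto simp: f'_def)
qed

section \<open>Gaussian vectors\<close>

text \<open>The law is a scaled standard normal law instead of a density, which includes the point
  mass at 0 for \<open>v = 0\<close>; \<open>v\<close> is the variance.\<close>

definition cgauss :: "'a measure \<Rightarrow> real \<Rightarrow> ('a \<Rightarrow> real) \<Rightarrow> bool" where
  "cgauss M v U \<longleftrightarrow> U \<in> borel_measurable M \<and> 0 \<le> v \<and>
     distr M borel U = distr std_gauss borel (\<lambda>x. sqrt v * x)"

lemma cgauss_measurable: "cgauss M v U \<Longrightarrow> U \<in> borel_measurable M"
  and cgauss_nonneg: "cgauss M v U \<Longrightarrow> 0 \<le> v"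
  by (auto simp: cgauss_def)

lemma cgauss_integrable_iff:
  assumes U: "cgauss M v U" and h: "h \<in> borel_measurable borel"
  shows "integrable M (\<lambda>\<omega>. h (U \<omega>) :: real) \<longleftrightarrow> integrable std_gauss (\<lambda>x. h (sqrt v * x))"
proof -
  have "integrable M (\<lambda>\<omega>. h (U \<omega>)) \<longleftrightarrow> integrable (distr M borel U) h"
    using U h by (subst integrable_distr_eq) (auto simp: cgauss_def)
  also have "\<dots> \<longleftrightarrow> integrable (distr std_gauss borel (\<lambda>x. sqrt v * x)) h"
    using U by (simp add: cgauss_def)
  also have "\<dots> \<longleftrightarrow> integrable std_gauss (\<lambda>x. h (sqrt v * x))"
    using h by (subst integrable_distr_eq) auto
  finally show ?thesis .
qed

lemma cgauss_integral:
  assumes U: "cgauss M v U" and h: "h \<in> borel_measurable borel"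
  shows "(LINT \<omega>|M. h (U \<omega>) :: real) = (LINT x|std_gauss. h (sqrt v * x))"
proof -
  have "(LINT \<omega>|M. h (U \<omega>)) = integral\<^sup>L (distr M borel U) h"
    using U h by (subst integral_distr) (auto simp: cgauss_def)
  also have "\<dots> = integral\<^sup>L (distr std_gauss borel (\<lambda>x. sqrt v * x)) h"
    using U by (simp add: cgauss_def)
  also have "\<dots> = (LINT x|std_gauss. h (sqrt v * x))"
    using h by (subst integral_distr) auto
  finally show ?thesis .
qed

lemma integral_cos_std_gauss: "(LINT x|std_gauss. cos (t * x)) = exp (- t\<^sup>2 / 2)"
proof -
  interpret prob_space std_gauss by (rule prob_space_std_gauss)
  have "complex_of_real (exp (- t\<^sup>2 / 2)) = (CLINT x|std_gauss. iexp (t * x))"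
    using char_std_normal_distribution by (metis char_def)
  then have "exp (- t\<^sup>2 / 2) = Re (CLINT x|std_gauss. iexp (t * x))"
    by (metis Re_complex_of_real)
  also have "\<dots> = (LINT x|std_gauss. Re (iexp (t * x)))"
    by (intro integral_Re[symmetric] integrable_iexp) auto
  finally show ?thesis by (simp add: Re_exp)
qed

lemma cgauss_cos:
  assumes "cgauss M v U"
  shows "(LINT \<omega>|M. cos (U \<omega>)) = exp (- v / 2)"
  using cgauss_integral[OF assms, of cos] integral_cos_std_gauss[of "sqrt v"] cgauss_nonneg[OF assms] by simp

lemma cgauss_integrable_power:
  assumes "cgauss M v U"
  shows "integrable M (\<lambda>\<omega>. U \<omega> ^ k)"
  using cgauss_integrable_iff[OF assms, of "\<lambda>x. x ^ k"] integrable_std_normal_distribution_moment[of k]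
  by (simp add: power_mult_distrib)

lemma cgauss_square:
  assumes "cgauss M v U"
  shows "(LINT \<omega>|M. (U \<omega>)\<^sup>2) = v"
  using cgauss_integral[OF assms, of "\<lambda>x. x\<^sup>2"] std_normal_distribution_even_moments(1)[of 1] cgauss_nonneg[OF assms]
  by (simp add: power_mult_distrib fact_2)

lemma cgauss_fourth:
  assumes "cgauss M v U"
  shows "(LINT \<omega>|M. (U \<omega>) ^ 4) = 3 * v\<^sup>2"
proof -
  have "sqrt v ^ 4 = v\<^sup>2"
    using cgauss_nonneg[OF assms] by (simp add: power4_eq_xxxx power2_eq_square)
  then show ?thesis
    using cgauss_integral[OF assms, of "\<lambda>x. x ^ 4"] std_normal_distribution_even_moments(1)[of 2]
    by (simp add: power_mult_distrib fact_numeral)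
qed

lemma cgauss_char:
  assumes "cgauss M v U"
  shows "char (distr M borel U) t = exp (- (t\<^sup>2 * v) / 2)"
proof -
  have "char (distr M borel U) t = char (distr std_gauss borel (\<lambda>x. sqrt v * x)) t"
    using assms by (simp add: cgauss_def)
  also have "\<dots> = char std_gauss (t * sqrt v)"
    unfolding char_def by (subst integral_distr) (auto simp: mult_ac)
  also have "\<dots> = exp (- (t\<^sup>2 * v) / 2)"
    using cgauss_nonneg[OF assms] by (simp add: char_std_normal_distribution power_mult_distrib)
  finally show ?thesis .
qed

lemma cgaussI_char:
  assumes M: "prob_space M" and U: "U \<in> borel_measurable M" and v: "0 \<le> v"
    and char: "\<And>t. char (distr M borel U) t = exp (- (t\<^sup>2 * v) / 2)"
  shows "cgauss M v U"
proof -
  have [simp]: "real_distribution (distr M borel U)"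
    using prob_space.real_distribution_distr[OF M U] .
  have rdN: "real_distribution (distr std_gauss borel (\<lambda>x. sqrt v * x))"
    by (intro prob_space.real_distribution_distr prob_space_std_gauss) auto
  have "char (distr std_gauss borel (\<lambda>x. sqrt v * x)) t = exp (- (t\<^sup>2 * v) / 2)" for t
  proof -
    have "char (distr std_gauss borel (\<lambda>x. sqrt v * x)) t = char std_gauss (t * sqrt v)"
      unfolding char_def by (subst integral_distr) (auto simp: mult_ac)
    then show ?thesis using v by (simp add: char_std_normal_distribution power_mult_distrib)
  qed
  then have "distr M borel U = distr std_gauss borel (\<lambda>x. sqrt v * x)"
    using rdN char by (intro Levy_uniqueness) auto
  then show ?thesis using U v by (simp add: cgauss_def)
qed

text \<open>The characteristic functions converge by dominated convergence on the one hand and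
  through the variances on the other; Levy's uniqueness theorem identifies the law.\<close>

lemma cgauss_limit:
  assumes M: "prob_space M" and U: "\<And>k. cgauss M (v k) (U k)"
    and V: "V \<in> borel_measurable M"
    and lim: "AE \<omega> in M. (\<lambda>k. U k \<omega>) \<longlonglongrightarrow> V \<omega>" and v: "v \<longlonglongrightarrow> w"
  shows "cgauss M w V"
proof (rule cgaussI_char[OF M V])
  interpret prob_space M by fact
  show "0 \<le> w"
    using v by (rule LIMSEQ_le_const) (auto intro: cgauss_nonneg[OF U])
  fix t
  have [measurable]: "U k \<in> borel_measurable M" for k by (rule cgauss_measurable[OF U])
  have "(\<lambda>k. CLINT \<omega>|M. iexp (t * U k \<omega>)) \<longlonglongrightarrow> (CLINT \<omega>|M. iexp (t * V \<omega>))"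
  proof (rule integral_dominated_convergence[where w="\<lambda>_. 1"])
    show "AE \<omega> in M. (\<lambda>k. iexp (t * U k \<omega>)) \<longlonglongrightarrow> iexp (t * V \<omega>)"
      using lim by eventually_elim (intro tendsto_intros)
  qed (use V in auto)
  moreover have "(CLINT \<omega>|M. iexp (t * W \<omega>)) = char (distr M borel W) t" if "W \<in> borel_measurable M" for W
    using that unfolding char_def by (subst integral_distr) auto
  ultimately have "(\<lambda>k. char (distr M borel (U k)) t) \<longlonglongrightarrow> char (distr M borel V) t"
    using V by simp
  moreover have "(\<lambda>k. char (distr M borel (U k)) t) \<longlonglongrightarrow> exp (- (t\<^sup>2 * w) / 2)"
    unfolding cgauss_char[OF U] by (intro tendsto_intros v) auto
  ultimately show "char (distr M borel V) t = exp (- (t\<^sup>2 * w) / 2)"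
    using LIMSEQ_unique by blast
qed

section \<open>Moments of Gaussian vectors with possibly singular covariance\<close>

locale gaussian_vector = prob_space M
  for M :: "'a measure" and I :: "'i set" and K :: "'i \<Rightarrow> 'i \<Rightarrow> real" and X :: "'i \<Rightarrow> 'a \<Rightarrow> real" +
  assumes finI: "finite I"
    and symK: "\<And>i j. i \<in> I \<Longrightarrow> j \<in> I \<Longrightarrow> K i j = K j i"
    and gauss: "\<And>c. cgauss M (\<Sum>i\<in>I. \<Sum>j\<in>I. c i * c j * K i j) (\<lambda>\<omega>. \<Sum>i\<in>I. c i * X i \<omega>)"
begin

definition lin :: "('i \<Rightarrow> real) \<Rightarrow> 'a \<Rightarrow> real" where "lin c \<omega> = (\<Sum>i\<in>I. c i * X i \<omega>)"

definition bf :: "('i \<Rightarrow> real) \<Rightarrow> ('i \<Rightarrow> real) \<Rightarrow> real" where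
  "bf a b = (\<Sum>i\<in>I. \<Sum>j\<in>I. a i * b j * K i j)"

abbreviation dl :: "'i \<Rightarrow> 'i \<Rightarrow> real" where "dl i \<equiv> (\<lambda>k. if k = i then 1 else 0)"

definition Kv :: "('i \<Rightarrow> real) \<Rightarrow> 'i \<Rightarrow> real" where "Kv b i = (\<Sum>j\<in>I. K i j * b j)"

lemma gauss_lin: "cgauss M (bf c c) (lin c)"
  using gauss[of c] unfolding bf_def lin_def .

lemma lin_measurable [measurable]: "lin c \<in> borel_measurable M"
  by (rule cgauss_measurable[OF gauss_lin])

lemma bf_nonneg: "0 \<le> bf c c" by (rule cgauss_nonneg[OF gauss_lin])

lemma bf_sym: "bf a b = bf b a"
  unfolding bf_def by (subst sum.swap) (auto intro!: sum.cong simp: symK mult_ac)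

lemma bf_add: "bf (\<lambda>i. a i + b i) c = bf a c + bf b c"
  by (simp add: bf_def algebra_simps sum.distrib)

lemma bf_scale: "bf (\<lambda>i. r * a i) c = r * bf a c"
  by (simp add: bf_def sum_distrib_left mult_ac)

lemma bf_add2: "bf c (\<lambda>i. a i + b i) = bf c a + bf c b"
  by (metis bf_add bf_sym)

lemma bf_scale2: "bf c (\<lambda>i. r * a i) = r * bf c a"
  by (metis bf_scale bf_sym)

lemma lin_add: "lin (\<lambda>i. a i + b i) \<omega> = lin a \<omega> + lin b \<omega>"
  by (simp add: lin_def algebra_simps sum.distrib)

lemma lin_scale: "lin (\<lambda>i. r * a i) \<omega> = r * lin a \<omega>"
  by (simp add: lin_def sum_distrib_left mult_ac)

lemma lin_dl: "i \<in> I \<Longrightarrow> lin (dl i) = X i"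
  using finI by (auto simp: lin_def fun_eq_iff if_distrib[of "\<lambda>x. x * _"] cong: if_cong)

lemma bf_dl: "i \<in> I \<Longrightarrow> bf (dl i) b = Kv b i"
proof -
  assume i: "i \<in> I"
  have "bf (dl i) b = (\<Sum>k\<in>I. if k = i then (\<Sum>j\<in>I. b j * K i j) else 0)"
    unfolding bf_def by (intro sum.cong) auto
  then show ?thesis using i finI by (simp add: Kv_def mult.commute)
qed

lemma Kv_dl: "j \<in> I \<Longrightarrow> Kv (dl j) i = K i j"
  using finI by (simp add: Kv_def if_distrib[of "\<lambda>x. _ * x"] cong: if_cong)

lemma X_measurable [measurable]: "i \<in> I \<Longrightarrow> X i \<in> borel_measurable M"
  using lin_measurable[of "dl i"] by (simp add: lin_dl)

lemma lin_power_integrable: "integrable M (\<lambda>\<omega>. lin c \<omega> ^ k)"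
  by (rule cgauss_integrable_power[OF gauss_lin])

lemma lin_mult_integrable: "integrable M (\<lambda>\<omega>. lin a \<omega> * lin b \<omega>)"
proof (rule Bochner_Integration.integrable_bound)
  show "integrable M (\<lambda>\<omega>. lin a \<omega> ^ 2 + lin b \<omega> ^ 2)"
    by (intro Bochner_Integration.integrable_add lin_power_integrable)
  show "AE \<omega> in M. norm (lin a \<omega> * lin b \<omega>) \<le> norm ((lin a \<omega>)\<^sup>2 + (lin b \<omega>)\<^sup>2)"
  proof (rule AE_I2)
    fix \<omega>
    have "\<bar>lin a \<omega> * lin b \<omega>\<bar> \<le> (lin a \<omega>)\<^sup>2 + (lin b \<omega>)\<^sup>2"
      using sum_squares_bound[of "\<bar>lin a \<omega>\<bar>" "\<bar>lin b \<omega>\<bar>"] abs_ge_zero[of "lin a \<omega> * lin b \<omega>"]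
      unfolding abs_mult power2_abs by linarith
    then show "norm (lin a \<omega> * lin b \<omega>) \<le> norm ((lin a \<omega>)\<^sup>2 + (lin b \<omega>)\<^sup>2)" by simp
  qed
qed measurable

lemma lin_covariance: "(LINT \<omega>|M. lin a \<omega> * lin b \<omega>) = bf a b"
proof -
  have "bf (\<lambda>i. a i + b i) (\<lambda>i. a i + b i) = (LINT \<omega>|M. (lin a \<omega> + lin b \<omega>)\<^sup>2)"
    using cgauss_square[OF gauss_lin[of "\<lambda>i. a i + b i"]] by (simp add: lin_add)
  also have "\<dots> = (LINT \<omega>|M. (lin a \<omega>)\<^sup>2 + (lin b \<omega>)\<^sup>2 + 2 * (lin a \<omega> * lin b \<omega>))"
    by (simp add: power2_sum mult.assoc)
  also have "\<dots> = bf a a + bf b b + 2 * (LINT \<omega>|M. lin a \<omega> * lin b \<omega>)"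
    using lin_power_integrable lin_mult_integrable cgauss_square[OF gauss_lin] by simp
  finally show ?thesis using bf_sym[of a b] by (simp add: bf_add bf_add2)
qed

text \<open>The value is minus the second derivative at r = 0 of E cos(\<open>lin b\<close> + r
  \<open>lin a\<close>), which equals exp(-(B + 2 r C + r^2 A) / 2). The derivative is taken as a
  limit of symmetric second differences.\<close>

lemma lin_square_cos:
  "(LINT \<omega>|M. (lin a \<omega>)\<^sup>2 * cos (lin b \<omega>)) = (bf a a - (bf a b)\<^sup>2) * exp (- bf b b / 2)"
proof -
  define A where "A = bf a a"
  define B where "B = bf b b"
  define C where "C = bf a b"
  define e :: "nat \<Rightarrow> real" where "e = (\<lambda>n. 1 / real (Suc n))"
  have e0: "e n \<noteq> 0" for n by (simp add: e_def)
  have elim: "e \<longlonglongrightarrow> 0" unfolding e_def by (rule LIMSEQ_Suc[OF lim_1_over_n])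
  have coslin: "(LINT \<omega>|M. cos (lin b \<omega> + r * lin a \<omega>)) = exp (- (B + 2 * r * C + r\<^sup>2 * A) / 2)" for r
  proof -
    have "(LINT \<omega>|M. cos (lin (\<lambda>i. b i + r * a i) \<omega>))
        = exp (- bf (\<lambda>i. b i + r * a i) (\<lambda>i. b i + r * a i) / 2)"
      by (rule cgauss_cos[OF gauss_lin])
    then show ?thesis
      using bf_sym[of b a]
      by (simp add: lin_add lin_scale bf_add bf_add2 bf_scale bf_scale2 A_def B_def C_def power2_eq_square algebra_simps)
  qed
  \<comment> \<open>By the addition theorem this is (2 cos y - cos(y + e x) - cos(y - e x)) / e^2
    with x = \<open>lin a \<omega>\<close> and y = \<open>lin b \<omega>\<close>. In the product
    form the domination by x^2 is visible, since 1 - cos z is at most z^2 / 2.\<close>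
  define s where "s = (\<lambda>n \<omega>. 2 * cos (lin b \<omega>) * ((1 - cos (e n * lin a \<omega>)) / (e n)\<^sup>2))"
  have one_cos: "0 \<le> 1 - cos y" "1 - cos y \<le> y\<^sup>2 / 2" for y :: real
  proof -
    show "0 \<le> 1 - cos y" by simp
    have "(sin (y / 2))\<^sup>2 \<le> (y / 2)\<^sup>2"
      using abs_sin_x_le_abs_x[of "y / 2"] by (simp only: abs_le_square_iff)
    then show "1 - cos y \<le> y\<^sup>2 / 2"
      using cos_double_sin[of "y / 2"] by (simp add: power_divide)
  qed
  have lim1: "(\<lambda>n. LINT \<omega>|M. s n \<omega>) \<longlonglongrightarrow> (LINT \<omega>|M. (lin a \<omega>)\<^sup>2 * cos (lin b \<omega>))"
  proof (rule integral_dominated_convergence[where w="\<lambda>\<omega>. (lin a \<omega>)\<^sup>2"])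
    show "AE \<omega> in M. (\<lambda>n. s n \<omega>) \<longlonglongrightarrow> (lin a \<omega>)\<^sup>2 * cos (lin b \<omega>)"
    proof (rule AE_I2)
      fix \<omega>
      have "((\<lambda>r. (1 - cos (r * y)) / r\<^sup>2) \<longlongrightarrow> y\<^sup>2 / 2) (at 0)" for y :: real by (real_asymp; simp add: power2_eq_square)
      then have "(\<lambda>n. (1 - cos (e n * lin a \<omega>)) / (e n)\<^sup>2) \<longlonglongrightarrow> (lin a \<omega>)\<^sup>2 / 2"
        using elim e0 by (auto simp: tendsto_at_iff_sequentially o_def)
      then have "(\<lambda>n. s n \<omega>) \<longlonglongrightarrow> 2 * cos (lin b \<omega>) * ((lin a \<omega>)\<^sup>2 / 2)"
        unfolding s_def by (rule tendsto_mult_left)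
      then show "(\<lambda>n. s n \<omega>) \<longlonglongrightarrow> (lin a \<omega>)\<^sup>2 * cos (lin b \<omega>)" by (simp add: mult.commute)
    qed
    show "AE \<omega> in M. norm (s n \<omega>) \<le> (lin a \<omega>)\<^sup>2" for n
    proof (rule AE_I2)
      fix \<omega>
      have "(1 - cos (e n * lin a \<omega>)) / (e n)\<^sup>2 \<le> ((e n * lin a \<omega>)\<^sup>2 / 2) / (e n)\<^sup>2"
        by (intro divide_right_mono one_cos) auto
      also have "\<dots> = (lin a \<omega>)\<^sup>2 / 2" using e0[of n] by (simp add: power_mult_distrib)
      finally have "\<bar>2 * cos (lin b \<omega>)\<bar> * \<bar>(1 - cos (e n * lin a \<omega>)) / (e n)\<^sup>2\<bar> \<le> 2 * ((lin a \<omega>)\<^sup>2 / 2)"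
        using one_cos(1) by (intro mult_mono) (auto simp: abs_mult)
      then show "norm (s n \<omega>) \<le> (lin a \<omega>)\<^sup>2" by (simp add: s_def abs_mult)
    qed
    show "integrable M (\<lambda>\<omega>. (lin a \<omega>)\<^sup>2)" by (rule lin_power_integrable)
  qed (auto simp: s_def)
  have cosint: "integrable M (\<lambda>\<omega>. cos (lin b \<omega> + r * lin a \<omega>))" for r
    by (rule integrable_const_bound[where B=1]) auto
  have s_int: "(LINT \<omega>|M. s n \<omega>) = (2 * exp (- B / 2) - exp (- (B + 2 * e n * C + (e n)\<^sup>2 * A) / 2)
      - exp (- (B - 2 * e n * C + (e n)\<^sup>2 * A) / 2)) / (e n)\<^sup>2" for n
  proof -
    have "s n \<omega> = (2 * cos (lin b \<omega> + 0 * lin a \<omega>) - cos (lin b \<omega> + e n * lin a \<omega>)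
        - cos (lin b \<omega> + (- e n) * lin a \<omega>)) / (e n)\<^sup>2" for \<omega>
      by (simp add: s_def cos_add cos_diff algebra_simps)
    then have "(LINT \<omega>|M. s n \<omega>) = (LINT \<omega>|M. (2 * cos (lin b \<omega> + 0 * lin a \<omega>) - cos (lin b \<omega> + e n * lin a \<omega>)
        - cos (lin b \<omega> + (- e n) * lin a \<omega>)) / (e n)\<^sup>2)" by simp
    also have "\<dots> = (2 * (LINT \<omega>|M. cos (lin b \<omega> + 0 * lin a \<omega>)) - (LINT \<omega>|M. cos (lin b \<omega> + e n * lin a \<omega>))
        - (LINT \<omega>|M. cos (lin b \<omega> + (- e n) * lin a \<omega>))) / (e n)\<^sup>2"
      using cosint[of 0] cosint[of "e n"] cosint[of "- e n"] by (simp del: mult_minus_left)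
    also have "\<dots> = (2 * exp (- B / 2) - exp (- (B + 2 * e n * C + (e n)\<^sup>2 * A) / 2)
      - exp (- (B - 2 * e n * C + (e n)\<^sup>2 * A) / 2)) / (e n)\<^sup>2"
      unfolding coslin by simp
    finally show ?thesis .
  qed
  have "((\<lambda>r. (2 * exp (- B / 2) - exp (- (B + 2 * r * C + r\<^sup>2 * A) / 2)
      - exp (- (B - 2 * r * C + r\<^sup>2 * A) / 2)) / r\<^sup>2) \<longlongrightarrow> (A - C\<^sup>2) * exp (- B / 2)) (at 0)"
    by (real_asymp; simp add: field_simps power2_eq_square)
  then have "(\<lambda>n. LINT \<omega>|M. s n \<omega>) \<longlonglongrightarrow> (A - C\<^sup>2) * exp (- B / 2)"
    unfolding s_int using elim e0 by (auto simp: tendsto_at_iff_sequentially o_def)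
  with lim1 show ?thesis unfolding A_def B_def C_def by (rule LIMSEQ_unique)
qed

end

context gaussian_vector begin

text \<open>Polarisation of the identity for squares.\<close>

lemma lin_mult_cos:
  "(LINT \<omega>|M. lin a \<omega> * lin a' \<omega> * cos (lin b \<omega>)) = (bf a a' - bf a b * bf a' b) * exp (- bf b b / 2)"
proof -
  have int: "integrable M (\<lambda>\<omega>. lin c \<omega> * lin d \<omega> * cos (lin b \<omega>))" for c d
    by (rule Bochner_Integration.integrable_bound[OF lin_mult_integrable[of c d]])
       (auto simp: abs_mult intro!: AE_I2 mult_right_le_one_le)
  have "(LINT \<omega>|M. (lin (\<lambda>i. a i + a' i) \<omega>)\<^sup>2 * cos (lin b \<omega>)) =
      (LINT \<omega>|M. lin a \<omega> * lin a \<omega> * cos (lin b \<omega>) + lin a' \<omega> * lin a' \<omega> * cos (lin b \<omega>)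
         + 2 * (lin a \<omega> * lin a' \<omega> * cos (lin b \<omega>)))"
    by (intro Bochner_Integration.integral_cong) (auto simp: lin_add power2_eq_square algebra_simps)
  also have "\<dots> = (LINT \<omega>|M. lin a \<omega> * lin a \<omega> * cos (lin b \<omega>)) + (LINT \<omega>|M. lin a' \<omega> * lin a' \<omega> * cos (lin b \<omega>))
         + 2 * (LINT \<omega>|M. lin a \<omega> * lin a' \<omega> * cos (lin b \<omega>))"
    using int by simp
  finally have "2 * (LINT \<omega>|M. lin a \<omega> * lin a' \<omega> * cos (lin b \<omega>)) =
     (bf (\<lambda>i. a i + a' i) (\<lambda>i. a i + a' i) - (bf (\<lambda>i. a i + a' i) b)\<^sup>2) * exp (- bf b b / 2)
     - (bf a a - (bf a b)\<^sup>2) * exp (- bf b b / 2) - (bf a' a' - (bf a' b)\<^sup>2) * exp (- bf b b / 2)"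
    using lin_square_cos[of a b] lin_square_cos[of a' b] lin_square_cos[of "\<lambda>i. a i + a' i" b]
    by (simp add: power2_eq_square)
  also have "\<dots> = 2 * ((bf a a' - bf a b * bf a' b) * exp (- bf b b / 2))"
    unfolding bf_add bf_add2 bf_sym[of a' a] by (simp add: power2_eq_square algebra_simps)
  finally show ?thesis by simp
qed

lemma X_mult_integrable: "i \<in> I \<Longrightarrow> j \<in> I \<Longrightarrow> integrable M (\<lambda>\<omega>. X i \<omega> * X j \<omega>)"
  using lin_mult_integrable[of "dl i" "dl j"] by (simp add: lin_dl)

lemma X_covariance: "i \<in> I \<Longrightarrow> j \<in> I \<Longrightarrow> (LINT \<omega>|M. X i \<omega> * X j \<omega>) = K i j"
  using lin_covariance[of "dl i" "dl j"] by (simp add: lin_dl bf_dl Kv_dl)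

lemma X_mult_cos:
  "i \<in> I \<Longrightarrow> j \<in> I \<Longrightarrow> (LINT \<omega>|M. X i \<omega> * X j \<omega> * cos (lin b \<omega>)) =
     (K i j - Kv b i * Kv b j) * exp (- bf b b / 2)"
  using lin_mult_cos[of "dl i" "dl j" b] by (simp add: lin_dl bf_dl Kv_dl)

lemma lin_prod4_integrable: "integrable M (\<lambda>\<omega>. lin a \<omega> * lin b \<omega> * (lin c \<omega> * lin d \<omega>))"
proof (rule Bochner_Integration.integrable_bound)
  show "integrable M (\<lambda>\<omega>. lin a \<omega> ^ 4 + lin b \<omega> ^ 4 + lin c \<omega> ^ 4 + lin d \<omega> ^ 4)"
    by (intro Bochner_Integration.integrable_add lin_power_integrable)
  have *: "\<bar>w * x * (y * z)\<bar> \<le> w ^ 4 + x ^ 4 + y ^ 4 + z ^ 4" for w x y z :: real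
  proof -
    have "2 * (\<bar>w * x\<bar> * \<bar>y * z\<bar>) \<le> (w * x)\<^sup>2 + (y * z)\<^sup>2"
      using sum_squares_bound[of "\<bar>w * x\<bar>" "\<bar>y * z\<bar>"] by simp
    moreover have "2 * (w * x)\<^sup>2 \<le> w ^ 4 + x ^ 4" for w x :: real
      using sum_squares_bound[of "w\<^sup>2" "x\<^sup>2"] by (simp add: power_mult_distrib)
    moreover have "0 \<le> w ^ 4 + x ^ 4" for w x :: real by (simp add: zero_le_even_power)
    ultimately show ?thesis unfolding abs_mult[of "w * x"] by (smt (verit))
  qed
  show "AE \<omega> in M. norm (lin a \<omega> * lin b \<omega> * (lin c \<omega> * lin d \<omega>))
      \<le> norm (lin a \<omega> ^ 4 + lin b \<omega> ^ 4 + lin c \<omega> ^ 4 + lin d \<omega> ^ 4)"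
  proof (rule AE_I2)
    fix \<omega>
    show "norm (lin a \<omega> * lin b \<omega> * (lin c \<omega> * lin d \<omega>))
      \<le> norm (lin a \<omega> ^ 4 + lin b \<omega> ^ 4 + lin c \<omega> ^ 4 + lin d \<omega> ^ 4)"
      unfolding real_norm_def by (rule order_trans[OF * abs_ge_self])
  qed
qed measurable

text \<open>Polarisation reduces the mixed moment to fourth moments of single centred Gaussian
  variables, each of which is three times a squared variance.\<close>

lemma isserlis:
  "(LINT \<omega>|M. lin a \<omega> * lin b \<omega> * (lin c \<omega> * lin d \<omega>)) = bf a b * bf c d + bf a c * bf b d + bf a d * bf b c"
proof -
  define L where "L = (\<lambda>p q r \<omega>. lin (\<lambda>i. (a i + p * b i) + (q * c i + r * d i)) \<omega>)"
  have L_eq: "L p q r \<omega> = lin a \<omega> + p * lin b \<omega> + (q * lin c \<omega> + r * lin d \<omega>)" for p q r \<omega>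
    unfolding L_def lin_add lin_scale by simp
  define s where "s = bf a a + bf b b + bf c c + bf d d"
  define V where "V = (\<lambda>p q r. bf (\<lambda>i. (a i + p * b i) + (q * c i + r * d i)) (\<lambda>i. (a i + p * b i) + (q * c i + r * d i)))"
  have V_eq: "V p q r = s + 2 * (p * bf a b + q * bf a c + r * bf a d
      + p * q * bf b c + p * r * bf b d + q * r * bf c d)" if "p * p = 1" "q * q = 1" "r * r = 1" for p q r
  proof -
    have "V p q r = bf a a + (p * p) * bf b b + (q * q) * bf c c + (r * r) * bf d d + 2 * (p * bf a b + q * bf a c + r * bf a d
      + p * q * bf b c + p * r * bf b d + q * r * bf c d)"
    unfolding V_def bf_add bf_add2 bf_scale bf_scale2 bf_sym[of b a] bf_sym[of c a] bf_sym[of d a] bf_sym[of c b]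
      bf_sym[of d b] bf_sym[of d c] by (simp add: algebra_simps)
    then show ?thesis unfolding that s_def by simp
  qed
  \<comment> \<open>The signed sum after insertion of the variances: all terms containing
    \<open>s\<close> cancel and the three pairings remain.\<close>
  have alg: "3 * (s + 2 * (x1 + x2 + x3 + x4 + x5 + x6))\<^sup>2 - 3 * (s + 2 * (- x1 + x2 + x3 - x4 - x5 + x6))\<^sup>2
     - 3 * (s + 2 * (x1 - x2 + x3 - x4 + x5 - x6))\<^sup>2 - 3 * (s + 2 * (x1 + x2 - x3 + x4 - x5 - x6))\<^sup>2
     + 3 * (s + 2 * (- x1 - x2 + x3 + x4 - x5 - x6))\<^sup>2 + 3 * (s + 2 * (- x1 + x2 - x3 - x4 + x5 - x6))\<^sup>2
     + 3 * (s + 2 * (x1 - x2 - x3 - x4 - x5 + x6))\<^sup>2 - 3 * (s + 2 * (- x1 - x2 - x3 + x4 + x5 + x6))\<^sup>2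
     = 192 * (x1 * x6 + x2 * x5 + x3 * x4)" for x1 x2 x3 x4 x5 x6 :: real
    by (simp add: power2_eq_square algebra_simps)
  have int: "integrable M (\<lambda>\<omega>. L p q r \<omega> ^ 4)" for p q r
    unfolding L_def by (rule lin_power_integrable)
  have E: "(LINT \<omega>|M. L p q r \<omega> ^ 4) = 3 * (V p q r)\<^sup>2" for p q r
    unfolding L_def V_def by (rule cgauss_fourth[OF gauss_lin])
  \<comment> \<open>Each of the eight sign patterns p, q, r carries the sign p q r, so that only the
    monomial w x y z survives; 192 is 8 times 4!.\<close>
  have pol: "192 * (w * x * (y * z)) = (w + 1 * x + (1 * y + 1 * z)) ^ 4 - (w + (-1) * x + (1 * y + 1 * z)) ^ 4
     - (w + 1 * x + ((-1) * y + 1 * z)) ^ 4 - (w + 1 * x + (1 * y + (-1) * z)) ^ 4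
     + (w + (-1) * x + ((-1) * y + 1 * z)) ^ 4 + (w + (-1) * x + (1 * y + (-1) * z)) ^ 4
     + (w + 1 * x + ((-1) * y + (-1) * z)) ^ 4 - (w + (-1) * x + ((-1) * y + (-1) * z)) ^ 4" for w x y z :: real
    by algebra
  have "192 * (LINT \<omega>|M. lin a \<omega> * lin b \<omega> * (lin c \<omega> * lin d \<omega>)) =
     (LINT \<omega>|M. 192 * (lin a \<omega> * lin b \<omega> * (lin c \<omega> * lin d \<omega>)))" by simp
  also have "\<dots> = (LINT \<omega>|M. L 1 1 1 \<omega> ^ 4 - L (-1) 1 1 \<omega> ^ 4 - L 1 (-1) 1 \<omega> ^ 4 - L 1 1 (-1) \<omega> ^ 4
     + L (-1) (-1) 1 \<omega> ^ 4 + L (-1) 1 (-1) \<omega> ^ 4 + L 1 (-1) (-1) \<omega> ^ 4 - L (-1) (-1) (-1) \<omega> ^ 4)"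
    unfolding pol L_eq ..
  also have "\<dots> = (LINT \<omega>|M. L 1 1 1 \<omega> ^ 4) - (LINT \<omega>|M. L (-1) 1 1 \<omega> ^ 4) - (LINT \<omega>|M. L 1 (-1) 1 \<omega> ^ 4)
     - (LINT \<omega>|M. L 1 1 (-1) \<omega> ^ 4) + (LINT \<omega>|M. L (-1) (-1) 1 \<omega> ^ 4) + (LINT \<omega>|M. L (-1) 1 (-1) \<omega> ^ 4)
     + (LINT \<omega>|M. L 1 (-1) (-1) \<omega> ^ 4) - (LINT \<omega>|M. L (-1) (-1) (-1) \<omega> ^ 4)"
    using int by simp
  also have "\<dots> = 192 * (bf a b * bf c d + bf a c * bf b d + bf a d * bf b c)"
    using alg[of "bf a b" "bf a c" "bf a d" "bf b c" "bf b d" "bf c d"]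
    by (simp add: E V_eq)
  finally show ?thesis by simp
qed

lemma X_prod4:
  assumes "i \<in> I" "j \<in> I" "k \<in> I" "l \<in> I"
  shows "(LINT \<omega>|M. X i \<omega> * X j \<omega> * (X k \<omega> * X l \<omega>)) = K i j * K k l + K i k * K j l + K i l * K j k"
    and "integrable M (\<lambda>\<omega>. X i \<omega> * X j \<omega> * (X k \<omega> * X l \<omega>))"
  using isserlis[of "dl i" "dl j" "dl k" "dl l"] lin_prod4_integrable[of "dl i" "dl j" "dl k" "dl l"] assms
  by (simp_all add: lin_dl bf_dl Kv_dl)

end

section \<open>Integration by parts in standard Gaussian variables\<close>

lemma std_gauss_integration_by_parts:
  fixes f f' :: "real \<Rightarrow> real"
  assumes d: "\<And>x. (f has_real_derivative f' x) (at x)" and c: "continuous_on UNIV f'"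
    and b: "\<And>x. \<bar>f x\<bar> \<le> C * (1 + x\<^sup>2)" and b': "\<And>x. \<bar>f' x\<bar> \<le> C * (1 + x\<^sup>2)"
  shows "(LINT x|std_gauss. x * f x) = (LINT x|std_gauss. f' x)"
proof -
  interpret prob_space std_gauss by (rule prob_space_std_gauss)
  have cf: "continuous_on UNIV f" using d by (intro DERIV_continuous_on) blast
  have [measurable]: "f \<in> borel_measurable borel" "f' \<in> borel_measurable borel"
    using c cf by (auto intro: borel_measurable_continuous_onI)
  let ?e = "\<lambda>x::real. exp (- x\<^sup>2 / 2)"
  let ?u = "\<lambda>x. (f' x - x * f x) * ?e x"
  have C: "0 \<le> C" using b[of 0] by auto
  have i1: "integrable std_gauss f'"
  proof (rule Bochner_Integration.integrable_bound)
    show "integrable std_gauss (\<lambda>x. C * (1 + x\<^sup>2))"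
      using integrable_std_normal_distribution_moment[of 2] by auto
  qed (use b' C in \<open>auto intro!: AE_I2\<close>)
  have i2: "integrable std_gauss (\<lambda>x. x * f x)"
  proof (rule Bochner_Integration.integrable_bound)
    show "integrable std_gauss (\<lambda>x. C * (1 + 2 * x ^ 2 + x ^ 4))"
      using integrable_std_normal_distribution_moment[of 2] integrable_std_normal_distribution_moment[of 4] by auto
    show "AE x in std_gauss. norm (x * f x) \<le> norm (C * (1 + 2 * x ^ 2 + x ^ 4))"
    proof (rule AE_I2)
      fix x :: real
      have "2 * \<bar>x\<bar> \<le> 1 + x\<^sup>2" using sum_squares_bound[of 1 "\<bar>x\<bar>"] by simp
      then have "\<bar>x\<bar> \<le> 1 + x\<^sup>2" by linarith
      then have "\<bar>x\<bar> * \<bar>f x\<bar> \<le> (1 + x\<^sup>2) * (C * (1 + x\<^sup>2))"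
        using b[of x] C by (intro mult_mono) auto
      also have "\<dots> = C * (1 + 2 * x ^ 2 + x ^ 4)" by algebra
      finally show "norm (x * f x) \<le> norm (C * (1 + 2 * x ^ 2 + x ^ 4))"
        by (simp add: abs_mult C)
    qed
  qed auto
  have iu: "integrable lborel ?u"
    using Bochner_Integration.integrable_diff[OF i1 i2] by (subst (asm) integrable_std_gauss_iff) auto
  \<comment> \<open>\<open>f x * ?e x\<close> is a primitive of \<open>?u\<close>. Its limit 0 at
    minus infinity makes the constant \<open>?D\<close> vanish, and its limit 0 at infinity then
    makes the total integral of \<open>?u\<close> vanish.\<close>
  let ?D = "\<lambda>x. (LINT y:{..x}|lborel. ?u y) - f x * ?e x"
  have "(?D has_real_derivative 0) (at z)" for z
  proof -
    have "((\<lambda>x. f x * ?e x) has_real_derivative ?u z) (at z)"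
      using DERIV_mult[OF d has_derivative_gauss_exp[of z]] by (simp add: algebra_simps)
    moreover have "continuous_on UNIV ?u" by (intro continuous_intros c cf) auto
    ultimately show ?thesis
      using DERIV_diff[OF lower_integral_has_derivative[OF iu]] by fastforce
  qed
  then obtain c where c: "\<And>z. ?D z = c"
    using has_field_derivative_zero_constant[of UNIV ?D] by auto
  have fb: "((\<lambda>x. f x * ?e x) \<longlongrightarrow> 0) F"
    if "((\<lambda>x. (1 + x\<^sup>2) * ?e x) \<longlongrightarrow> 0) F" for F
  proof (rule Lim_null_comparison[OF _ tendsto_mult_right_zero[OF that, of C]])
    have "norm (f x * ?e x) \<le> C * ((1 + x\<^sup>2) * ?e x)" for x
      using mult_right_mono[OF b[of x], of "?e x"] by (simp add: abs_mult mult.assoc)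
    then show "\<forall>\<^sub>F x in F. norm (f x * ?e x) \<le> C * ((1 + x\<^sup>2) * ?e x)" by simp
  qed
  have "((\<lambda>x::real. (1 + x\<^sup>2) * ?e x) \<longlongrightarrow> 0) at_bot" by real_asymp
  note fb_bot = fb[OF this]
  have "((\<lambda>x::real. (1 + x\<^sup>2) * ?e x) \<longlongrightarrow> 0) at_top" by real_asymp
  note fb_top = fb[OF this]
  have "(?D \<longlongrightarrow> 0 - 0) at_bot"
    by (intro tendsto_diff lower_integral_at_bot iu fb_bot)
  then have "c = 0" using c by (simp add: tendsto_const_iff)
  have "((\<lambda>x. LINT y:{..x}|lborel. ?u y) \<longlongrightarrow> (LINT y|lborel. ?u y)) at_top"
    unfolding set_lebesgue_integral_def by (rule tendsto_integral_at_top) (use iu in auto)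
  then have "(?D \<longlongrightarrow> (LINT y|lborel. ?u y) - 0) at_top"
    by (intro tendsto_diff fb_top)
  then have "(LINT y|lborel. ?u y) = 0" using c \<open>c = 0\<close> by (simp add: tendsto_const_iff)
  then have "(LINT x|std_gauss. f' x - x * f x) = 0" by (subst integral_std_gauss_eq) auto
  then show ?thesis using i1 i2 by simp
qed

abbreviation gauss_iid :: "'i set \<Rightarrow> ('i \<Rightarrow> real) measure" where "gauss_iid I \<equiv> Pi\<^sub>M I (\<lambda>_. std_gauss)"

lemma product_sigma_finite_std_gauss: "product_sigma_finite (\<lambda>_::'i. std_gauss)"
proof -
  interpret prob_space std_gauss by (rule prob_space_std_gauss)
  show ?thesis by standard
qed

lemma prob_space_gauss_iid: "prob_space (gauss_iid I)"
  by (intro prob_space_PiM prob_space_std_gauss)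

text \<open>The characteristic functions of independent coordinates multiply, which gives the
  identity matrix as covariance.\<close>

lemma gauss_iid_gaussian_vector:
  fixes I :: "'i set"
  assumes "finite I"
  shows "gaussian_vector (gauss_iid I) I (\<lambda>i j. if i = j then 1 else 0) (\<lambda>i g. g i)"
proof -
  interpret prob_space "gauss_iid I" by (rule prob_space_gauss_iid)
  interpret product_sigma_finite "\<lambda>_::'i. std_gauss" by (rule product_sigma_finite_std_gauss)
  interpret N: prob_space std_gauss by (rule prob_space_std_gauss)
  show ?thesis
  proof (unfold_locales)
    fix c :: "'i \<Rightarrow> real"
    have [measurable]: "(\<lambda>g. \<Sum>i\<in>I. c i * g i) \<in> borel_measurable (gauss_iid I)"
      by (intro borel_measurable_sum borel_measurable_times measurable_const)
         (auto intro: measurable_component_singleton[THEN measurable_compose])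
    have v: "(\<Sum>i\<in>I. \<Sum>j\<in>I. c i * c j * (if i = j then 1 else 0)) = (\<Sum>i\<in>I. (c i)\<^sup>2)"
      using assms by (intro sum.cong) (auto simp: if_distrib[of "\<lambda>x. _ * x"] power2_eq_square cong: if_cong)
    show "cgauss (gauss_iid I) (\<Sum>i\<in>I. \<Sum>j\<in>I. c i * c j * (if i = j then 1 else 0)) (\<lambda>g. \<Sum>i\<in>I. c i * g i)"
      unfolding v
    proof (rule cgaussI_char)
      fix t :: real
      have "char (distr (gauss_iid I) borel (\<lambda>g. \<Sum>i\<in>I. c i * g i)) t = (CLINT g|gauss_iid I. (\<Prod>i\<in>I. iexp (t * c i * g i)))"
        unfolding char_def
        by (subst integral_distr) (auto simp: sum_distrib_left assms mult_ac simp flip: exp_sum)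
      also have "\<dots> = (\<Prod>i\<in>I. CLINT x|std_gauss. iexp (t * c i * x))"
        using assms by (intro product_integral_prod N.integrable_iexp) auto
      also have "\<dots> = (\<Prod>i\<in>I. complex_of_real (exp (- (t * c i)\<^sup>2 / 2)))"
        by (simp only: char_def[symmetric] char_std_normal_distribution)
      also have "\<dots> = exp (- (t\<^sup>2 * (\<Sum>i\<in>I. (c i)\<^sup>2)) / 2)"
        using assms by (simp flip: of_real_prod exp_sum add: power_mult_distrib sum_distrib_left sum_divide_distrib sum_negf)
      finally show "char (distr (gauss_iid I) borel (\<lambda>g. \<Sum>i\<in>I. c i * g i)) t = exp (- (t\<^sup>2 * (\<Sum>i\<in>I. (c i)\<^sup>2)) / 2)" .
    qed (auto intro: sum_nonneg prob_space_axioms)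
  qed (use assms in auto)
qed

section \<open>Quadratic forms of Gaussian vectors\<close>

lemma fubini_bounded:
  fixes h :: "'a \<Rightarrow> real" and \<phi> :: "'a \<times> 'b \<Rightarrow> real"
  assumes M: "prob_space M" and G: "prob_space G" and h: "integrable M h"
    and [measurable]: "\<phi> \<in> borel_measurable (M \<Otimes>\<^sub>M G)" and b: "\<And>p. \<bar>\<phi> p\<bar> \<le> 1"
  shows "(LINT \<omega>|M. h \<omega> * (LINT g|G. \<phi> (\<omega>, g))) = (LINT g|G. LINT \<omega>|M. h \<omega> * \<phi> (\<omega>, g))"
proof -
  interpret M: prob_space M by fact
  interpret G: prob_space G by fact
  interpret pair_sigma_finite M G by standard
  have [measurable]: "h \<in> borel_measurable M" using h by auto
  have *: "\<bar>h \<omega> * \<phi> p\<bar> \<le> \<bar>h \<omega>\<bar>" for \<omega> p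
    using mult_left_mono[OF b[of p], of "\<bar>h \<omega>\<bar>"] by (simp add: abs_mult)
  have "integrable (M \<Otimes>\<^sub>M G) (\<lambda>(\<omega>, g). h \<omega> * \<phi> (\<omega>, g))"
  proof (rule Fubini_integrable)
    show "integrable M (\<lambda>\<omega>. LINT g|G. norm (case (\<omega>, g) of (\<omega>, g) \<Rightarrow> h \<omega> * \<phi> (\<omega>, g)))"
    proof (rule Bochner_Integration.integrable_bound[OF h])
      show "AE \<omega> in M. norm (LINT g|G. norm (case (\<omega>, g) of (\<omega>, g) \<Rightarrow> h \<omega> * \<phi> (\<omega>, g))) \<le> norm (h \<omega>)"
      proof (rule AE_I2)
        fix \<omega> assume \<omega>: "\<omega> \<in> space M"
        have "(LINT g|G. \<bar>h \<omega> * \<phi> (\<omega>, g)\<bar>) \<le> (LINT g|G. \<bar>h \<omega>\<bar>)"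
          by (rule integral_mono) (use * \<omega> in \<open>auto intro!: G.integrable_const_bound[where B="\<bar>h \<omega>\<bar>"]\<close>)
        then show "norm (LINT g|G. norm (case (\<omega>, g) of (\<omega>, g) \<Rightarrow> h \<omega> * \<phi> (\<omega>, g))) \<le> norm (h \<omega>)"
          by (simp add: G.prob_space)
      qed
    qed auto
    show "AE \<omega> in M. integrable G (\<lambda>g. case (\<omega>, g) of (\<omega>, g) \<Rightarrow> h \<omega> * \<phi> (\<omega>, g))"
    proof (rule AE_I2)
      fix \<omega> assume "\<omega> \<in> space M"
      then show "integrable G (\<lambda>g. case (\<omega>, g) of (\<omega>, g) \<Rightarrow> h \<omega> * \<phi> (\<omega>, g))"
        using b by (auto intro!: G.integrable_const_bound[where B=1])
    qed
  qed auto
  then have "(LINT g|G. LINT \<omega>|M. h \<omega> * \<phi> (\<omega>, g)) = (LINT \<omega>|M. LINT g|G. h \<omega> * \<phi> (\<omega>, g))"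
    by (rule Fubini_integral)
  then show ?thesis by simp
qed

lemma gauss_iid_integration_by_parts:
  fixes K :: "'i \<Rightarrow> 'i \<Rightarrow> real" and l :: "'i \<Rightarrow> real"
  assumes I: "finite I" "j \<in> I" and sym: "\<And>i k. i \<in> I \<Longrightarrow> k \<in> I \<Longrightarrow> K i k = K k i"
    and pos: "\<And>g. 0 \<le> (\<Sum>i\<in>I. \<Sum>k\<in>I. g i * g k * K i k)" and s: "0 \<le> s"
  shows "(LINT g|gauss_iid I. g j * (\<Sum>i\<in>I. l i * g i) * exp (- s * (\<Sum>i\<in>I. \<Sum>k\<in>I. g i * g k * K i k)))
    = (LINT g|gauss_iid I. (l j - 2 * s * (\<Sum>i\<in>I. l i * g i) * (\<Sum>k\<in>I. K j k * g k)) * exp (- s * (\<Sum>i\<in>I. \<Sum>k\<in>I. g i * g k * K i k)))"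
    (is "?L = ?R")
    and "integrable (gauss_iid I) (\<lambda>g. g j * (\<Sum>i\<in>I. l i * g i) * exp (- s * (\<Sum>i\<in>I. \<Sum>k\<in>I. g i * g k * K i k)))" (is ?i1)
    and "integrable (gauss_iid I) (\<lambda>g. (l j - 2 * s * (\<Sum>i\<in>I. l i * g i) * (\<Sum>k\<in>I. K j k * g k)) * exp (- s * (\<Sum>i\<in>I. \<Sum>k\<in>I. g i * g k * K i k)))" (is ?i2)
proof -
  define Q where "Q = (\<lambda>g. \<Sum>i\<in>I. \<Sum>k\<in>I. g i * g k * K i k)"
  interpret g: gaussian_vector "gauss_iid I" I "\<lambda>i j. if i = j then 1 else 0" "\<lambda>i g. g i"
    by (rule gauss_iid_gaussian_vector[OF I(1)])
  interpret product_sigma_finite "\<lambda>_::'i. std_gauss" by (rule product_sigma_finite_std_gauss)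
  have [measurable]: "i \<in> I \<Longrightarrow> (\<lambda>g. g i) \<in> borel_measurable (gauss_iid I)" for i by (rule g.X_measurable)
  have lin: "g.lin c = (\<lambda>g. \<Sum>i\<in>I. c i * g i)" for c by (simp add: g.lin_def fun_eq_iff)
  have [measurable]: "Q \<in> borel_measurable (gauss_iid I)" unfolding Q_def by measurable
  have e1: "exp (- s * Q g) \<le> 1" for g using pos[of g] s by (simp add: Q_def)
  have int: "integrable (gauss_iid I) (\<lambda>g. g.lin a g * g.lin b g * exp (- s * Q g))" for a b
    by (rule Bochner_Integration.integrable_bound[OF g.lin_mult_integrable[of a b]])
       (use e1 in \<open>auto simp: abs_mult intro!: AE_I2 mult_right_le_one_le\<close>)
  have int0: "integrable (gauss_iid I) (\<lambda>g. exp (- s * Q g))"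
    by (rule g.integrable_const_bound[where B=1]) (use e1 in auto)
  show i1: ?i1
    using int[of "g.dl j" l] I unfolding g.lin_dl[OF I(2)] unfolding lin Q_def by simp
  have "integrable (gauss_iid I) (\<lambda>g. l j * exp (- s * Q g) - 2 * s * (g.lin l g * g.lin (K j) g * exp (- s * Q g)))"
    by (intro Bochner_Integration.integrable_diff integrable_mult_right int int0)
  then show i2: ?i2 unfolding lin Q_def by (simp add: algebra_simps)
  define J where "J = I - {j}"
  have J: "finite J" "j \<notin> J" and IJ: "I = insert j J" using I by (auto simp: J_def)
  note pi = product_integral_insert[OF J]
  have "?L = (LINT g|gauss_iid J. LINT x|std_gauss. x * ((\<Sum>i\<in>I. l i * (g(j := x)) i) * exp (- s * Q (g(j := x)))))"
    using pi[OF i1[unfolded IJ]] unfolding IJ[symmetric] Q_def by (simp add: mult.assoc del: fun_upd_apply) simp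
  also have "\<dots> = (LINT g|gauss_iid J. LINT x|std_gauss. (l j - 2 * s * (\<Sum>i\<in>I. l i * (g(j := x)) i) * (\<Sum>k\<in>I. K j k * (g(j := x)) k)) * exp (- s * Q (g(j := x))))"
  proof (rule Bochner_Integration.integral_cong[OF refl])
    fix g :: "'i \<Rightarrow> real"
    define c where "c = (\<Sum>i\<in>J. l i * g i)"
    define d where "d = (\<Sum>k\<in>J. K j k * g k)"
    define e where "e = (\<Sum>i\<in>J. \<Sum>k\<in>J. g i * g k * K i k)"
    have up: "(g(j := x)) i = g i" if "i \<in> J" for i x using that J by auto
    have l_eq: "(\<Sum>i\<in>I. l i * (g(j := x)) i) = l j * x + c" for x
      unfolding IJ using J by (simp add: c_def up cong: sum.cong del: fun_upd_apply) simp
    have K_eq: "(\<Sum>k\<in>I. K j k * (g(j := x)) k) = K j j * x + d" for x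
      unfolding IJ using J by (simp add: d_def up cong: sum.cong del: fun_upd_apply) simp
    \<comment> \<open>Symmetry of \<open>K\<close> makes the two cross terms equal, whence the
      factor 2 here and in the derivative.\<close>
    have Q_eq: "Q (g(j := x)) = K j j * x\<^sup>2 + 2 * d * x + e" for x
    proof -
      have *: "Q (g(j := x)) = (x * x * K j j + (\<Sum>k\<in>J. x * g k * K j k)) + (\<Sum>i\<in>J. g i * x * K i j + (\<Sum>k\<in>J. g i * g k * K i k))"
        unfolding Q_def IJ using J by (simp add: up cong: sum.cong del: fun_upd_apply) simp
      have **: "(\<Sum>i\<in>J. g i * x * K i j + (\<Sum>k\<in>J. g i * g k * K i k)) = (\<Sum>i\<in>J. x * g i * K j i) + e"
        unfolding sum.distrib e_def using sym I IJ by (intro arg_cong2[where f="(+)"] sum.cong) auto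
      have ***: "(\<Sum>k\<in>J. x * g k * K j k) = x * d" by (simp add: d_def sum_distrib_left mult_ac)
      show ?thesis unfolding * ** *** by (simp add: power2_eq_square)
    qed
    define E where "E = (\<lambda>x. exp (- s * (K j j * x\<^sup>2 + 2 * d * x + e)))"
    have E: "0 \<le> E x" "E x \<le> 1" for x
      using pos[of "g(j := x)"] s unfolding E_def Q_eq[symmetric] Q_def by auto
    define m where "m = (\<lambda>x::real. max 1 \<bar>x\<bar>)"
    have m: "1 \<le> m x" "m x * m x \<le> 1 + x\<^sup>2" "m x \<le> 1 + x\<^sup>2" for x
    proof -
      show "1 \<le> m x" by (simp add: m_def)
      show *: "m x * m x \<le> 1 + x\<^sup>2" unfolding m_def max_def by (auto simp: power2_eq_square)
      show "m x \<le> 1 + x\<^sup>2" using * mult_right_mono[OF \<open>1 \<le> m x\<close>, of "m x"] \<open>1 \<le> m x\<close> by linarith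
    qed
    have lm: "\<bar>a * x + b\<bar> \<le> (\<bar>a\<bar> + \<bar>b\<bar>) * m x" for a b x
    proof -
      have "\<bar>a * x + b\<bar> \<le> \<bar>a\<bar> * \<bar>x\<bar> + \<bar>b\<bar> * 1" by (metis abs_mult abs_triangle_ineq mult.right_neutral)
      also have "\<dots> \<le> \<bar>a\<bar> * m x + \<bar>b\<bar> * m x" by (intro add_mono mult_left_mono) (auto simp: m_def)
      finally show ?thesis by (simp add: algebra_simps)
    qed
    define C where "C = (\<bar>l j\<bar> + \<bar>c\<bar>) + (2 * s * ((\<bar>l j\<bar> + \<bar>c\<bar>) * (\<bar>K j j\<bar> + \<bar>d\<bar>)))"
    have "(LINT x|std_gauss. x * ((l j * x + c) * E x)) = (LINT x|std_gauss. (l j - 2 * s * (l j * x + c) * (K j j * x + d)) * E x)"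
    proof (rule std_gauss_integration_by_parts[where C=C])
      show "((\<lambda>x. (l j * x + c) * E x) has_real_derivative (l j - 2 * s * (l j * x + c) * (K j j * x + d)) * E x) (at x)" for x
        unfolding E_def by (auto intro!: derivative_eq_intros simp: algebra_simps power2_eq_square)
      show "continuous_on UNIV (\<lambda>x. (l j - 2 * s * (l j * x + c) * (K j j * x + d)) * E x)"
        unfolding E_def by (intro continuous_intros)
      fix x
      have "\<bar>(l j * x + c) * E x\<bar> \<le> \<bar>l j * x + c\<bar> * 1"
        using E[of x] by (simp add: abs_mult mult_left_le)
      also have "\<dots> \<le> (\<bar>l j\<bar> + \<bar>c\<bar>) * (1 + x\<^sup>2)"
        using order_trans[OF lm[of "l j" x c] mult_left_mono[OF m(3)[of x]]] by simp
      also have "\<dots> \<le> C * (1 + x\<^sup>2)" using s unfolding C_def by (intro mult_right_mono) auto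
      finally show "\<bar>(l j * x + c) * E x\<bar> \<le> C * (1 + x\<^sup>2)" .
      have "\<bar>(l j - 2 * s * (l j * x + c) * (K j j * x + d)) * E x\<bar> \<le> \<bar>l j - 2 * s * (l j * x + c) * (K j j * x + d)\<bar> * 1"
        using E[of x] by (simp add: abs_mult mult_left_le)
      also have "\<dots> \<le> \<bar>l j\<bar> + 2 * s * (\<bar>l j * x + c\<bar> * \<bar>K j j * x + d\<bar>)"
        using abs_triangle_ineq4[of "l j" "2 * s * (l j * x + c) * (K j j * x + d)"] s by (simp add: abs_mult mult.assoc)
      also have "\<dots> \<le> (\<bar>l j\<bar> + \<bar>c\<bar>) * (1 + x\<^sup>2) + 2 * s * (((\<bar>l j\<bar> + \<bar>c\<bar>) * m x) * ((\<bar>K j j\<bar> + \<bar>d\<bar>) * m x))"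
      proof (intro add_mono mult_left_mono mult_mono lm)
        show "\<bar>l j\<bar> \<le> (\<bar>l j\<bar> + \<bar>c\<bar>) * (1 + x\<^sup>2)"
          using mult_mono[of "\<bar>l j\<bar>" "\<bar>l j\<bar> + \<bar>c\<bar>" 1 "1 + x\<^sup>2"] by simp
        show "0 \<le> (\<bar>l j\<bar> + \<bar>c\<bar>) * m x" using m(1)[of x] by (intro mult_nonneg_nonneg) auto
      qed (use s in auto)
      also have "\<dots> = (\<bar>l j\<bar> + \<bar>c\<bar>) * (1 + x\<^sup>2) + (2 * s * ((\<bar>l j\<bar> + \<bar>c\<bar>) * (\<bar>K j j\<bar> + \<bar>d\<bar>))) * (m x * m x)"
        by (simp add: mult_ac)
      also have "\<dots> \<le> (\<bar>l j\<bar> + \<bar>c\<bar>) * (1 + x\<^sup>2) + (2 * s * ((\<bar>l j\<bar> + \<bar>c\<bar>) * (\<bar>K j j\<bar> + \<bar>d\<bar>))) * (1 + x\<^sup>2)"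
        using s by (intro add_left_mono mult_left_mono m) auto
      also have "\<dots> = C * (1 + x\<^sup>2)" by (simp add: C_def algebra_simps)
      finally show "\<bar>(l j - 2 * s * (l j * x + c) * (K j j * x + d)) * E x\<bar> \<le> C * (1 + x\<^sup>2)" .
    qed
    then show "(LINT x|std_gauss. x * ((\<Sum>i\<in>I. l i * (g(j := x)) i) * exp (- s * Q (g(j := x)))))
      = (LINT x|std_gauss. (l j - 2 * s * (\<Sum>i\<in>I. l i * (g(j := x)) i) * (\<Sum>k\<in>I. K j k * (g(j := x)) k)) * exp (- s * Q (g(j := x))))"
      unfolding l_eq K_eq Q_eq E_def .
  qed
  also have "\<dots> = ?R"
    using pi[OF i2[unfolded IJ]] unfolding IJ[symmetric] Q_def by simp
  finally show "?L = ?R" .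
qed

section \<open>Stein's identity for the squared norm\<close>

context gaussian_vector begin

text \<open>\<open>sqn\<close> plays the role of Q in Stein's identity and \<open>kform\<close> that
  of T; their expectations are \<open>trK\<close> and \<open>trK2\<close>. By symmetry of
  \<open>K\<close> the sum of squares \<open>trK2\<close> is the trace of K^2, which is also half
  the variance of Q.\<close>

definition sqn :: "'a \<Rightarrow> real" where "sqn \<omega> = (\<Sum>i\<in>I. (X i \<omega>)\<^sup>2)"

definition kform :: "'a \<Rightarrow> real" where "kform \<omega> = (\<Sum>i\<in>I. \<Sum>j\<in>I. K i j * (X i \<omega> * X j \<omega>))"

definition trK :: real where "trK = (\<Sum>i\<in>I. K i i)"

definition trK2 :: real where "trK2 = (\<Sum>i\<in>I. \<Sum>j\<in>I. (K i j)\<^sup>2)"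

lemma sqn_measurable [measurable]: "sqn \<in> borel_measurable M"
  unfolding sqn_def by measurable

lemma kform_measurable [measurable]: "kform \<in> borel_measurable M"
  unfolding kform_def by measurable

lemma sqn_nonneg: "0 \<le> sqn \<omega>" unfolding sqn_def by (intro sum_nonneg) auto

lemma sqn_integrable: "integrable M sqn"
  unfolding sqn_def power2_eq_square by (intro Bochner_Integration.integrable_sum X_mult_integrable)

lemma kform_integrable: "integrable M kform"
  unfolding kform_def by (intro Bochner_Integration.integrable_sum integrable_mult_right X_mult_integrable)

lemma sqn_expectation: "(LINT \<omega>|M. sqn \<omega>) = trK"
  unfolding sqn_def trK_def power2_eq_square
  by (subst Bochner_Integration.integral_sum) (auto simp: X_mult_integrable X_covariance)

lemma kform_expectation: "(LINT \<omega>|M. kform \<omega>) = trK2"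
proof -
  have "(LINT \<omega>|M. kform \<omega>) = (\<Sum>i\<in>I. \<Sum>j\<in>I. K i j * (LINT \<omega>|M. X i \<omega> * X j \<omega>))"
    unfolding kform_def
    by (simp add: Bochner_Integration.integral_sum Bochner_Integration.integrable_sum integrable_mult_right X_mult_integrable)
  then show ?thesis by (simp add: trK2_def X_covariance power2_eq_square)
qed

lemma sqn_square_integrable: "integrable M (\<lambda>\<omega>. (sqn \<omega>)\<^sup>2)"
proof -
  have "(\<lambda>\<omega>. (sqn \<omega>)\<^sup>2) = (\<lambda>\<omega>. \<Sum>i\<in>I. \<Sum>j\<in>I. X i \<omega> * X i \<omega> * (X j \<omega> * X j \<omega>))"
    by (auto simp: sqn_def power2_eq_square sum_product)
  then show ?thesis
    by (simp add: Bochner_Integration.integrable_sum X_prod4)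
qed

text \<open>This is the characteristic function of \<open>g\<close> at the point sqrt(2s) X; the
  factor sqrt(2s) turns the exponent -|c|^2 / 2 into -s |X|^2.\<close>

lemma exp_sqn_eq:
  assumes "0 \<le> s"
  shows "exp (- s * sqn \<omega>) = (LINT g|gauss_iid I. cos (\<Sum>i\<in>I. sqrt (2 * s) * g i * X i \<omega>))"
proof -
  interpret g: gaussian_vector "gauss_iid I" I "\<lambda>i j. if i = j then 1 else 0" "\<lambda>i g. g i"
    by (rule gauss_iid_gaussian_vector[OF finI])
  have "(LINT g|gauss_iid I. cos (g.lin (\<lambda>i. sqrt (2 * s) * X i \<omega>) g)) = exp (- g.bf (\<lambda>i. sqrt (2 * s) * X i \<omega>) (\<lambda>i. sqrt (2 * s) * X i \<omega>) / 2)"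
    by (rule cgauss_cos[OF g.gauss_lin])
  also have "g.bf (\<lambda>i. sqrt (2 * s) * X i \<omega>) (\<lambda>i. sqrt (2 * s) * X i \<omega>) = (\<Sum>i\<in>I. 2 * s * (X i \<omega>)\<^sup>2)"
    unfolding g.bf_def
  proof (rule sum.cong[OF refl])
    fix i assume "i \<in> I"
    then have "(\<Sum>j\<in>I. sqrt (2 * s) * X i \<omega> * (sqrt (2 * s) * X j \<omega>) * (if i = j then 1 else 0))
      = sqrt (2 * s) * X i \<omega> * (sqrt (2 * s) * X i \<omega>)"
      using finI by (simp add: if_distrib[of "\<lambda>x. _ * x"] cong: if_cong)
    also have "\<dots> = 2 * s * (X i \<omega>)\<^sup>2"
      using assms by (simp add: power2_eq_square)
    finally show "(\<Sum>j\<in>I. sqrt (2 * s) * X i \<omega> * (sqrt (2 * s) * X j \<omega>) * (if i = j then 1 else 0)) = 2 * s * (X i \<omega>)\<^sup>2" .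
  qed
  also have "\<dots> = 2 * (s * sqn \<omega>)" by (simp add: sqn_def sum_distrib_left mult.assoc)
  finally show ?thesis by (simp add: g.lin_def mult_ac)
qed

lemma integral_exp_sqn:
  assumes h: "integrable M h" and s: "0 \<le> s"
  shows "(LINT \<omega>|M. h \<omega> * exp (- s * sqn \<omega>)) = (LINT g|gauss_iid I. LINT \<omega>|M. h \<omega> * cos (lin (\<lambda>i. sqrt (2 * s) * g i) \<omega>))"
proof -
  have [measurable]: "(\<lambda>p. snd p i) \<in> borel_measurable (M \<Otimes>\<^sub>M gauss_iid I)" if "i \<in> I" for i
  proof -
    have "(\<lambda>g. g i) \<in> borel_measurable (gauss_iid I)"
      using gaussian_vector.X_measurable[OF gauss_iid_gaussian_vector[OF finI] that] .
    then show ?thesis by (rule measurable_compose[OF measurable_snd])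
  qed
  have "(\<lambda>p. cos (\<Sum>i\<in>I. sqrt (2 * s) * snd p i * X i (fst p))) \<in> borel_measurable (M \<Otimes>\<^sub>M gauss_iid I)"
    by measurable
  from fubini_bounded[OF prob_space_axioms prob_space_gauss_iid h this]
  show ?thesis unfolding exp_sqn_eq[OF s] lin_def by simp
qed

text \<open>Put e(g) = exp(-s <g, K g>). The left side becomes -2s E[|K g|^2 e(g)]. On the right T
  contributes (tr K^2 - 2s <K g, K K g>) e(g), and integration by parts in every coordinate
  identifies its mean with that of <g, K^2 g> e(g) = |K g|^2 e(g).\<close>

lemma laplace_identity:
  assumes s: "0 \<le> s"
  shows "(LINT \<omega>|M. (sqn \<omega> - trK) * exp (- s * sqn \<omega>)) = - 2 * s * (LINT \<omega>|M. kform \<omega> * exp (- s * sqn \<omega>))"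
proof -
  define e where "e = (\<lambda>g. exp (- s * bf g g))"
  define r where "r = sqrt (2 * s)"
  have rr: "r * r = 2 * s" using s by (simp add: r_def)
  interpret g: gaussian_vector "gauss_iid I" I "\<lambda>i j. if i = j then 1 else 0" "\<lambda>i g. g i"
    by (rule gauss_iid_gaussian_vector[OF finI])
  have bfr: "exp (- bf (\<lambda>i. r * g i) (\<lambda>i. r * g i) / 2) = e g" for g
    unfolding bf_scale bf_scale2 e_def using rr by (simp flip: mult.assoc)
  have Kvr: "Kv (\<lambda>i. r * g i) i = r * Kv g i" for g i
    by (simp add: Kv_def sum_distrib_left mult_ac)
  have XX: "(LINT \<omega>|M. X i \<omega> * X j \<omega> * cos (lin (\<lambda>i. r * g i) \<omega>)) = (K i j - 2 * s * Kv g i * Kv g j) * e g"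
    if "i \<in> I" "j \<in> I" for i j g
  proof -
    have "(LINT \<omega>|M. X i \<omega> * X j \<omega> * cos (lin (\<lambda>i. r * g i) \<omega>)) = (K i j - (r * r) * Kv g i * Kv g j) * e g"
      unfolding X_mult_cos[OF that] bfr Kvr by (simp add: mult_ac)
    then show ?thesis by (simp only: rr)
  qed
  have XXi: "integrable M (\<lambda>\<omega>. X i \<omega> * X j \<omega> * cos (lin b \<omega>))" if "i \<in> I" "j \<in> I" for i j b
    by (rule Bochner_Integration.integrable_bound[OF X_mult_integrable[OF that]])
       (use that in \<open>auto simp: abs_mult intro!: AE_I2 mult_right_le_one_le\<close>)
  have ci: "integrable M (\<lambda>\<omega>. cos (lin b \<omega>))" for b
    by (rule integrable_const_bound[where B=1]) auto
  have c: "(LINT \<omega>|M. cos (lin (\<lambda>i. r * g i) \<omega>)) = e g" for g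
    using cgauss_cos[OF gauss_lin[of "\<lambda>i. r * g i"]] unfolding bfr .
  have L: "(LINT \<omega>|M. (sqn \<omega> - trK) * cos (lin (\<lambda>i. r * g i) \<omega>)) = (\<Sum>i\<in>I. - 2 * s * (Kv g i)\<^sup>2) * e g" for g
  proof -
    have "(LINT \<omega>|M. (sqn \<omega> - trK) * cos (lin (\<lambda>i. r * g i) \<omega>)) =
      (LINT \<omega>|M. (\<Sum>i\<in>I. X i \<omega> * X i \<omega> * cos (lin (\<lambda>i. r * g i) \<omega>)) - trK * cos (lin (\<lambda>i. r * g i) \<omega>))"
      by (simp add: sqn_def power2_eq_square left_diff_distrib sum_distrib_right)
    also have "\<dots> = (\<Sum>i\<in>I. (K i i - 2 * s * Kv g i * Kv g i) * e g) - trK * e g"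
      by (subst Bochner_Integration.integral_diff)
         (auto intro!: Bochner_Integration.integrable_sum XXi ci simp: Bochner_Integration.integral_sum XXi XX c)
    also have "\<dots> = (\<Sum>i\<in>I. - 2 * s * (Kv g i)\<^sup>2) * e g"
      by (simp add: trK_def sum_subtractf sum_negf power2_eq_square mult.assoc flip: sum_distrib_right left_diff_distrib)
    finally show ?thesis .
  qed
  have R: "(LINT \<omega>|M. kform \<omega> * cos (lin (\<lambda>i. r * g i) \<omega>)) = (\<Sum>i\<in>I. \<Sum>j\<in>I. K i j * (K i j - 2 * s * Kv g i * Kv g j)) * e g" for g
  proof -
    have "(LINT \<omega>|M. kform \<omega> * cos (lin (\<lambda>i. r * g i) \<omega>)) =
      (LINT \<omega>|M. (\<Sum>i\<in>I. \<Sum>j\<in>I. K i j * (X i \<omega> * X j \<omega> * cos (lin (\<lambda>i. r * g i) \<omega>))))"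
      by (simp add: kform_def sum_distrib_right mult.assoc)
    also have "\<dots> = (\<Sum>i\<in>I. \<Sum>j\<in>I. K i j * (LINT \<omega>|M. X i \<omega> * X j \<omega> * cos (lin (\<lambda>i. r * g i) \<omega>)))"
      by (simp add: Bochner_Integration.integral_sum Bochner_Integration.integrable_sum XXi)
    also have "\<dots> = (\<Sum>i\<in>I. \<Sum>j\<in>I. K i j * (K i j - 2 * s * Kv g i * Kv g j)) * e g"
      unfolding sum_distrib_right by (intro sum.cong refl) (simp only: XX; simp only: mult.assoc)
    finally show ?thesis .
  qed
  have e_eq: "e g = exp (- s * (\<Sum>i\<in>I. \<Sum>k\<in>I. g i * g k * K i k))" for g
    by (simp add: e_def bf_def)
  have pos: "0 \<le> (\<Sum>i\<in>I. \<Sum>k\<in>I. g i * g k * K i k)" for g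
    using bf_nonneg[of g] by (simp add: bf_def)
  \<comment> \<open>\<open>l j\<close> is row j of K^2, so that the linear form in the integration
    by parts is coordinate j of K^2 g and the entries \<open>l j j\<close> sum to tr K^2.\<close>
  define l where "l = (\<lambda>j i. \<Sum>k\<in>I. K j k * K k i)"
  have l_eq: "(\<Sum>i\<in>I. l j i * g i) = Kv (Kv g) j" for j g
    unfolding l_def Kv_def sum_distrib_right sum_distrib_left by (subst sum.swap) (simp add: mult.assoc)
  have ibp: "(LINT g|gauss_iid I. g j * Kv (Kv g) j * e g) = (LINT g|gauss_iid I. (l j j - 2 * s * Kv (Kv g) j * Kv g j) * e g)"
    "integrable (gauss_iid I) (\<lambda>g. g j * Kv (Kv g) j * e g)"
    "integrable (gauss_iid I) (\<lambda>g. (l j j - 2 * s * Kv (Kv g) j * Kv g j) * e g)" if "j \<in> I" for j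
    using gauss_iid_integration_by_parts[OF finI that symK pos s, of "l j"] unfolding e_eq l_eq Kv_def[symmetric] by auto
  have Kvsym: "(\<Sum>j\<in>I. a j * Kv b j) = (\<Sum>j\<in>I. Kv a j * b j)" for a b
    unfolding Kv_def sum_distrib_right sum_distrib_left
    by (subst sum.swap) (auto intro!: sum.cong simp: symK mult_ac)
  have Kvsq: "(\<Sum>j\<in>I. g j * Kv (Kv g) j) = (\<Sum>j\<in>I. (Kv g j)\<^sup>2)" for g
    using Kvsym[of g "Kv g"] by (simp add: power2_eq_square)
  have "(LINT \<omega>|M. kform \<omega> * exp (- s * sqn \<omega>)) =
      (LINT g|gauss_iid I. (\<Sum>i\<in>I. \<Sum>j\<in>I. K i j * (K i j - 2 * s * Kv g i * Kv g j)) * e g)"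
    unfolding integral_exp_sqn[OF kform_integrable s] r_def[symmetric] R ..
  also have "\<dots> = (LINT g|gauss_iid I. (\<Sum>j\<in>I. (l j j - 2 * s * Kv (Kv g) j * Kv g j) * e g))"
  proof (rule Bochner_Integration.integral_cong[OF refl])
    fix g
    have "(\<Sum>i\<in>I. \<Sum>j\<in>I. K i j * (K i j - 2 * s * Kv g i * Kv g j)) = (\<Sum>i\<in>I. l i i - 2 * s * Kv (Kv g) i * Kv g i)"
    proof (rule sum.cong[OF refl])
      fix i assume i: "i \<in> I"
      have "(\<Sum>j\<in>I. K i j * (K i j - 2 * s * Kv g i * Kv g j)) = (\<Sum>j\<in>I. K i j * K j i) - 2 * s * Kv g i * (\<Sum>j\<in>I. K i j * Kv g j)"
        unfolding sum_distrib_left sum_subtractf[symmetric]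
        using i by (intro sum.cong) (auto simp: symK algebra_simps)
      then show "(\<Sum>j\<in>I. K i j * (K i j - 2 * s * Kv g i * Kv g j)) = l i i - 2 * s * Kv (Kv g) i * Kv g i"
        by (simp add: l_def Kv_def[of "Kv g"] mult_ac)
    qed
    then show "(\<Sum>i\<in>I. \<Sum>j\<in>I. K i j * (K i j - 2 * s * Kv g i * Kv g j)) * e g
       = (\<Sum>j\<in>I. (l j j - 2 * s * Kv (Kv g) j * Kv g j) * e g)" by (simp add: sum_distrib_right)
  qed
  also have "\<dots> = (\<Sum>j\<in>I. LINT g|gauss_iid I. g j * Kv (Kv g) j * e g)"
    by (simp add: Bochner_Integration.integral_sum ibp)
  also have "\<dots> = (LINT g|gauss_iid I. (\<Sum>j\<in>I. g j * Kv (Kv g) j) * e g)"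
    by (simp add: Bochner_Integration.integral_sum ibp sum_distrib_right)
  also have "\<dots> = (LINT g|gauss_iid I. (\<Sum>j\<in>I. (Kv g j)\<^sup>2) * e g)"
    unfolding Kvsq ..
  finally have T: "(LINT \<omega>|M. kform \<omega> * exp (- s * sqn \<omega>)) = (LINT g|gauss_iid I. (\<Sum>j\<in>I. (Kv g j)\<^sup>2) * e g)" .
  have i0: "integrable M (\<lambda>\<omega>. sqn \<omega> - trK)" using sqn_integrable by auto
  have "(LINT \<omega>|M. (sqn \<omega> - trK) * exp (- s * sqn \<omega>)) = (LINT g|gauss_iid I. (\<Sum>i\<in>I. - 2 * s * (Kv g i)\<^sup>2) * e g)"
    unfolding integral_exp_sqn[OF i0 s] r_def[symmetric] L ..
  also have "\<dots> = (LINT g|gauss_iid I. - 2 * s * ((\<Sum>i\<in>I. (Kv g i)\<^sup>2) * e g))"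
    by (simp add: sum_distrib_left sum_distrib_right mult.assoc)
  also have "\<dots> = - 2 * s * (LINT g|gauss_iid I. (\<Sum>i\<in>I. (Kv g i)\<^sup>2) * e g)" by simp
  finally show ?thesis unfolding T .
qed

end

text \<open>A function of \<open>q\<close> is written as a function of \<open>y = exp (- q / m)\<close> on \<open>[0, 1]\<close>; by Weierstrass,
  approximating its derivative by polynomials in \<open>y\<close> reduces the identity to exponentials of \<open>q\<close>.\<close>

lemma (in prob_space) laplace_extension_bounded:
  fixes Q V T :: "'a \<Rightarrow> real"
  assumes Q: "Q \<in> borel_measurable M" "\<And>\<omega>. 0 \<le> Q \<omega>"
    and V: "integrable M V" "(LINT \<omega>|M. V \<omega>) = 0" and T: "integrable M T"
    and lap: "\<And>s. 0 \<le> s \<Longrightarrow> (LINT \<omega>|M. V \<omega> * exp (- s * Q \<omega>)) = - 2 * s * (LINT \<omega>|M. T \<omega> * exp (- s * Q \<omega>))"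
    and f: "\<And>x. (f has_real_derivative f' x) (at x)" "continuous_on UNIV f'" and m: "0 < m"
  shows "(LINT \<omega>|M. V \<omega> * f (m * (1 - exp (- Q \<omega> / m))))
     = 2 * (LINT \<omega>|M. T \<omega> * (f' (m * (1 - exp (- Q \<omega> / m))) * exp (- Q \<omega> / m)))"
proof -
  define Y where "Y = (\<lambda>\<omega>. exp (- Q \<omega> / m))"
  have Y: "0 \<le> Y \<omega>" "Y \<omega> \<le> 1" for \<omega> using Q(2)[of \<omega>] m by (auto simp: Y_def)
  have [measurable]: "Q \<in> borel_measurable M" "V \<in> borel_measurable M" "T \<in> borel_measurable M"
    using Q V T by auto
  have [measurable]: "Y \<in> borel_measurable M" unfolding Y_def by measurable
  have cf: "continuous_on UNIV f" using f(1) by (intro DERIV_continuous_on) blast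
  have [measurable]: "f \<in> borel_measurable borel" "f' \<in> borel_measurable borel"
    using cf f(2) by (auto intro: borel_measurable_continuous_onI)
  have bint: "integrable M (\<lambda>\<omega>. h \<omega> * \<phi> (Y \<omega>))"
    if h: "integrable M h" and c: "continuous_on {0..1} \<phi>" and [measurable]: "\<phi> \<in> borel_measurable borel"
    for h and \<phi> :: "real \<Rightarrow> real"
  proof -
    have "bounded (\<phi> ` {0..1})" using c by (intro compact_imp_bounded compact_continuous_image) auto
    then obtain B where "\<forall>y\<in>{0..1}. \<bar>\<phi> y\<bar> \<le> B" by (auto simp: bounded_iff)
    then have B: "\<And>y. y \<in> {0..1} \<Longrightarrow> \<bar>\<phi> y\<bar> \<le> B" by blast
    have [measurable]: "h \<in> borel_measurable M" using h by auto
    show ?thesis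
    proof (rule Bochner_Integration.integrable_bound)
      show "integrable M (\<lambda>\<omega>. B * h \<omega>)" using h by auto
      show "AE \<omega> in M. norm (h \<omega> * \<phi> (Y \<omega>)) \<le> norm (B * h \<omega>)"
      proof (rule AE_I2)
        fix \<omega>
        have "\<bar>\<phi> (Y \<omega>)\<bar> \<le> \<bar>B\<bar>" using B[of "Y \<omega>"] Y[of \<omega>] by auto
        then show "norm (h \<omega> * \<phi> (Y \<omega>)) \<le> norm (B * h \<omega>)"
          by (simp add: abs_mult mult.commute[of "\<bar>B\<bar>"] mult_left_mono)
      qed
    qed measurable
  qed
  define F where "F = (\<lambda>y. f (m * (1 - y)))"
  define F' where "F' = (\<lambda>y. - m * f' (m * (1 - y)))"
  have F: "(F has_real_derivative F' y) (at y)" for y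
  proof -
    have "((\<lambda>y. f (m * (1 - y))) has_real_derivative f' (m * (1 - y)) * (- m)) (at y)"
      by (rule DERIV_chain2[OF f(1)]) (auto intro!: derivative_eq_intros)
    then show ?thesis by (simp add: F_def F'_def mult.commute)
  qed
  have cF': "continuous_on A F'" for A
    unfolding F'_def by (intro continuous_intros continuous_on_compose2[OF f(2)]) auto
  have cF: "continuous_on A F" for A
    unfolding F_def by (intro continuous_intros continuous_on_compose2[OF cf]) auto
  have [measurable]: "F \<in> borel_measurable borel" "F' \<in> borel_measurable borel"
    using cF cF' by (auto intro: borel_measurable_continuous_onI)
  define D where "D = \<bar>(LINT \<omega>|M. V \<omega> * F (Y \<omega>)) - 2 * (LINT \<omega>|M. T \<omega> * (- (1 / m) * F' (Y \<omega>) * Y \<omega>))\<bar>"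
  define c0 where "c0 = (LINT \<omega>|M. \<bar>V \<omega>\<bar>) + 2 / m * (LINT \<omega>|M. \<bar>T \<omega>\<bar>)"
  have c0: "0 \<le> c0" using m by (auto simp: c0_def)
  have "D \<le> \<epsilon> * c0" if \<epsilon>: "\<epsilon> > 0" for \<epsilon>
  proof -
    obtain p where "real_polynomial_function p" and p: "\<And>y. y \<in> {0..1} \<Longrightarrow> \<bar>F' y - p y\<bar> < \<epsilon>"
      using Stone_Weierstrass_real_polynomial_function[of "{0..1::real}" F' \<epsilon>] cF' \<epsilon> by auto
    then obtain a n where p_eq: "p = (\<lambda>y. \<Sum>i\<le>n. a i * y ^ i)"
      using real_polynomial_function_iff_sum by auto
    define P where "P = (\<lambda>y::real. \<Sum>i\<le>n. a i / real (Suc i) * y ^ Suc i)"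
    have P: "(P has_real_derivative p y) (at y)" for y
    proof -
      have "((\<lambda>y. a i / real (Suc i) * y ^ Suc i) has_real_derivative a i * y ^ i) (at y)" for i
        using DERIV_cmult[OF DERIV_pow[of "Suc i" y], of "a i / real (Suc i)"]
        by (simp del: of_nat_Suc power_Suc)
      then show ?thesis unfolding P_def p_eq by (intro DERIV_sum) auto
    qed
    have cP: "continuous_on A P" and cp: "continuous_on A p" for A
      unfolding P_def p_eq by (intro continuous_intros)+
    have [measurable]: "P \<in> borel_measurable borel" "p \<in> borel_measurable borel"
      using cP cp by (auto intro: borel_measurable_continuous_onI)
    \<comment> \<open>Only the derivatives of \<open>F\<close> and \<open>P\<close> are known to be
      close. As \<open>V\<close> has mean 0, the constant \<open>\<delta> 1\<close> may be
      subtracted, and the mean value theorem on [0, 1] bounds the rest by \<epsilon>.\<close>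
    define \<delta> where "\<delta> = (\<lambda>y. F y - P y)"
    have \<delta>: "\<bar>\<delta> y - \<delta> 1\<bar> \<le> \<epsilon>" if "y \<in> {0..1}" for y
    proof -
      have "norm (\<delta> y - \<delta> 1) \<le> \<epsilon> * norm (y - 1)"
      proof (rule field_differentiable_bound[where S="{0..1}" and f'="\<lambda>y. F' y - p y"])
        fix z :: real assume z: "z \<in> {0..1}"
        show "(\<delta> has_field_derivative F' z - p z) (at z within {0..1})"
          unfolding \<delta>_def by (rule has_field_derivative_at_within[OF DERIV_diff[OF F P]])
        show "norm (F' z - p z) \<le> \<epsilon>" using p[OF z] by simp
      qed (use that in auto)
      also have "\<dots> \<le> \<epsilon> * 1" using that \<epsilon> by (intro mult_left_mono) auto
      finally show ?thesis by simp
    qed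
    \<comment> \<open>Y^k is exp(-(k/m) Q), so \<open>lap\<close> with s = k/m treats each monomial,
      and the factor k cancels the denominator in the primitive \<open>P\<close>.\<close>
    have VP: "(LINT \<omega>|M. V \<omega> * P (Y \<omega>)) = 2 * (LINT \<omega>|M. T \<omega> * (- (1 / m) * p (Y \<omega>) * Y \<omega>))"
    proof -
      have Yp: "Y \<omega> ^ k = exp (- (real k / m) * Q \<omega>)" for k \<omega>
        unfolding Y_def exp_of_nat_mult[symmetric] by (simp add: field_simps)
      have lapY: "(LINT \<omega>|M. V \<omega> * Y \<omega> ^ k) = - 2 * (real k / m) * (LINT \<omega>|M. T \<omega> * Y \<omega> ^ k)" for k
        unfolding Yp by (rule lap) (use m in simp)
      have iY: "integrable M (\<lambda>\<omega>. h \<omega> * Y \<omega> ^ k)" if "integrable M h" for h k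
        by (rule bint[OF that, of "\<lambda>y. y ^ k"]) (auto intro!: continuous_intros)
      have "(LINT \<omega>|M. V \<omega> * P (Y \<omega>)) = (LINT \<omega>|M. (\<Sum>i\<le>n. a i / real (Suc i) * (V \<omega> * Y \<omega> ^ Suc i)))"
        by (simp add: P_def sum_distrib_left mult_ac del: power_Suc of_nat_Suc)
      also have "\<dots> = (\<Sum>i\<le>n. a i / real (Suc i) * (LINT \<omega>|M. V \<omega> * Y \<omega> ^ Suc i))"
        by (simp add: Bochner_Integration.integral_sum iY V(1) del: power_Suc of_nat_Suc)
      also have "\<dots> = (\<Sum>i\<le>n. a i / real (Suc i) * (- 2 * (real (Suc i) / m) * (LINT \<omega>|M. T \<omega> * Y \<omega> ^ Suc i)))"
        unfolding lapY ..
      also have "\<dots> = 2 * (\<Sum>i\<le>n. (- (1 / m) * a i) * (LINT \<omega>|M. T \<omega> * Y \<omega> ^ Suc i))"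
        unfolding sum_distrib_left by (intro sum.cong refl) (simp del: power_Suc of_nat_Suc)
      also have "\<dots> = 2 * (LINT \<omega>|M. (\<Sum>i\<le>n. (- (1 / m) * a i) * (T \<omega> * Y \<omega> ^ Suc i)))"
        by (subst Bochner_Integration.integral_sum) (intro integrable_mult_right iY T, simp del: power_Suc)
      also have "(\<lambda>\<omega>. \<Sum>i\<le>n. (- (1 / m) * a i) * (T \<omega> * Y \<omega> ^ Suc i)) = (\<lambda>\<omega>. T \<omega> * (- (1 / m) * p (Y \<omega>) * Y \<omega>))"
        by (simp add: p_eq sum_distrib_left sum_distrib_right mult_ac)
      finally show ?thesis .
    qed
    have iVF: "integrable M (\<lambda>\<omega>. V \<omega> * F (Y \<omega>))" and iVP: "integrable M (\<lambda>\<omega>. V \<omega> * P (Y \<omega>))"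
      by (rule bint[OF V(1) cF], measurable) (rule bint[OF V(1) cP], measurable)
    have iTF: "integrable M (\<lambda>\<omega>. T \<omega> * (- (1 / m) * F' (Y \<omega>) * Y \<omega>))"
      by (rule bint[OF T, of "\<lambda>y. - (1 / m) * F' y * y"]) (use cF' m in \<open>auto intro!: continuous_intros\<close>)
    have iTp: "integrable M (\<lambda>\<omega>. T \<omega> * (- (1 / m) * p (Y \<omega>) * Y \<omega>))"
      by (rule bint[OF T, of "\<lambda>y. - (1 / m) * p y * y"]) (use cp m in \<open>auto intro!: continuous_intros\<close>)
    have "(LINT \<omega>|M. V \<omega> * F (Y \<omega>)) - 2 * (LINT \<omega>|M. T \<omega> * (- (1 / m) * F' (Y \<omega>) * Y \<omega>))
      = (LINT \<omega>|M. V \<omega> * F (Y \<omega>)) - (LINT \<omega>|M. V \<omega> * P (Y \<omega>)) - \<delta> 1 * (LINT \<omega>|M. V \<omega>)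
       - 2 * ((LINT \<omega>|M. T \<omega> * (- (1 / m) * F' (Y \<omega>) * Y \<omega>)) - (LINT \<omega>|M. T \<omega> * (- (1 / m) * p (Y \<omega>) * Y \<omega>)))"
      using V(2) VP by simp
    also have "\<dots> = (LINT \<omega>|M. V \<omega> * F (Y \<omega>) - V \<omega> * P (Y \<omega>) - \<delta> 1 * V \<omega>)
       - 2 * (LINT \<omega>|M. T \<omega> * (- (1 / m) * F' (Y \<omega>) * Y \<omega>) - T \<omega> * (- (1 / m) * p (Y \<omega>) * Y \<omega>))"
      using iVF iVP V(1) iTF iTp by simp
    finally have "D \<le> \<bar>LINT \<omega>|M. V \<omega> * F (Y \<omega>) - V \<omega> * P (Y \<omega>) - \<delta> 1 * V \<omega>\<bar>
       + 2 * \<bar>LINT \<omega>|M. T \<omega> * (- (1 / m) * F' (Y \<omega>) * Y \<omega>) - T \<omega> * (- (1 / m) * p (Y \<omega>) * Y \<omega>)\<bar>"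
      unfolding D_def by linarith
    also have "\<bar>LINT \<omega>|M. V \<omega> * F (Y \<omega>) - V \<omega> * P (Y \<omega>) - \<delta> 1 * V \<omega>\<bar> \<le> (LINT \<omega>|M. \<epsilon> * \<bar>V \<omega>\<bar>)"
    proof (rule order_trans[OF integral_abs_bound], rule integral_mono)
      fix \<omega>
      have "\<bar>V \<omega> * F (Y \<omega>) - V \<omega> * P (Y \<omega>) - \<delta> 1 * V \<omega>\<bar> = \<bar>V \<omega>\<bar> * \<bar>\<delta> (Y \<omega>) - \<delta> 1\<bar>"
        by (simp add: \<delta>_def abs_mult[symmetric] algebra_simps)
      also have "\<dots> \<le> \<bar>V \<omega>\<bar> * \<epsilon>" using \<delta>[of "Y \<omega>"] Y[of \<omega>] by (intro mult_left_mono) auto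
      finally show "\<bar>V \<omega> * F (Y \<omega>) - V \<omega> * P (Y \<omega>) - \<delta> 1 * V \<omega>\<bar> \<le> \<epsilon> * \<bar>V \<omega>\<bar>" by (simp add: mult.commute)
    qed (use iVF iVP V in auto)
    also have "\<bar>LINT \<omega>|M. T \<omega> * (- (1 / m) * F' (Y \<omega>) * Y \<omega>) - T \<omega> * (- (1 / m) * p (Y \<omega>) * Y \<omega>)\<bar> \<le> (LINT \<omega>|M. (\<epsilon> / m) * \<bar>T \<omega>\<bar>)"
    proof (rule order_trans[OF integral_abs_bound], rule integral_mono)
      fix \<omega>
      have "\<bar>T \<omega> * (- (1 / m) * F' (Y \<omega>) * Y \<omega>) - T \<omega> * (- (1 / m) * p (Y \<omega>) * Y \<omega>)\<bar>
         = \<bar>T \<omega>\<bar> * (1 / m) * (\<bar>F' (Y \<omega>) - p (Y \<omega>)\<bar> * Y \<omega>)"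
      proof -
        have "T \<omega> * (- (1 / m) * F' (Y \<omega>) * Y \<omega>) - T \<omega> * (- (1 / m) * p (Y \<omega>) * Y \<omega>)
          = - (T \<omega> * (1 / m) * ((F' (Y \<omega>) - p (Y \<omega>)) * Y \<omega>))" by (simp add: algebra_simps)
        then show ?thesis using m Y(1)[of \<omega>] by (simp add: abs_mult)
      qed
      also have "\<dots> \<le> \<bar>T \<omega>\<bar> * (1 / m) * (\<epsilon> * 1)"
        using p[of "Y \<omega>"] Y[of \<omega>] m by (intro mult_left_mono mult_mono) auto
      finally show "\<bar>T \<omega> * (- (1 / m) * F' (Y \<omega>) * Y \<omega>) - T \<omega> * (- (1 / m) * p (Y \<omega>) * Y \<omega>)\<bar> \<le> (\<epsilon> / m) * \<bar>T \<omega>\<bar>"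
        by (simp add: mult_ac)
    qed (use iTF iTp T in auto)
    finally show ?thesis by (simp add: c0_def algebra_simps)
  qed
  then have "D \<le> 0"
  proof -
    assume *: "\<And>\<epsilon>. \<epsilon> > 0 \<Longrightarrow> D \<le> \<epsilon> * c0"
    show "D \<le> 0"
    proof (rule field_le_epsilon)
      fix e :: real assume "0 < e"
      then have "D \<le> e / (c0 + 1) * c0" using c0 by (intro *) auto
      also have "\<dots> \<le> e" using c0 \<open>0 < e\<close> by (simp add: field_simps)
      finally show "D \<le> 0 + e" by simp
    qed
  qed
  then have "(LINT \<omega>|M. V \<omega> * F (Y \<omega>)) = 2 * (LINT \<omega>|M. T \<omega> * (- (1 / m) * F' (Y \<omega>) * Y \<omega>))"
    unfolding D_def by simp
  then show ?thesis using m unfolding F_def F'_def Y_def by simp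
qed

text \<open>Let m tend to infinity in the bounded version. The argument m (1 - exp(-q/m)) tends to q
  without exceeding it, so \<open>f\<close> stays below |f 0| + C q, and integrability of
  \<open>V * Q\<close> supplies the dominating function.\<close>

lemma (in prob_space) laplace_extension:
  fixes Q V T :: "'a \<Rightarrow> real"
  assumes Q: "Q \<in> borel_measurable M" "\<And>\<omega>. 0 \<le> Q \<omega>"
    and V: "integrable M V" "(LINT \<omega>|M. V \<omega>) = 0" and T: "integrable M T"
    and VQ: "integrable M (\<lambda>\<omega>. V \<omega> * Q \<omega>)"
    and lap: "\<And>s. 0 \<le> s \<Longrightarrow> (LINT \<omega>|M. V \<omega> * exp (- s * Q \<omega>)) = - 2 * s * (LINT \<omega>|M. T \<omega> * exp (- s * Q \<omega>))"
    and f: "\<And>x. (f has_real_derivative f' x) (at x)" "continuous_on UNIV f'" and b: "\<And>x. \<bar>f' x\<bar> \<le> C"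
  shows "(LINT \<omega>|M. V \<omega> * f (Q \<omega>)) = 2 * (LINT \<omega>|M. T \<omega> * f' (Q \<omega>))"
    and "integrable M (\<lambda>\<omega>. V \<omega> * f (Q \<omega>))" and "integrable M (\<lambda>\<omega>. T \<omega> * f' (Q \<omega>))"
proof -
  have [measurable]: "Q \<in> borel_measurable M" "V \<in> borel_measurable M" "T \<in> borel_measurable M"
    using Q V T by auto
  have cf: "continuous_on UNIV f" using f(1) by (intro DERIV_continuous_on) blast
  have [measurable]: "f \<in> borel_measurable borel" "f' \<in> borel_measurable borel"
    using cf f(2) by (auto intro: borel_measurable_continuous_onI)
  have C: "0 \<le> C" using b[of 0] by auto
  have fb: "\<bar>f x\<bar> \<le> \<bar>f 0\<bar> + C * q" if "0 \<le> x" "x \<le> q" for x q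
  proof -
    have "norm (f x - f 0) \<le> C * norm (x - 0)"
      using b by (intro field_differentiable_bound[where S=UNIV and f'=f']) (auto intro: has_field_derivative_at_within f)
    moreover have "C * x \<le> C * q" using that C by (intro mult_left_mono) auto
    ultimately show ?thesis using that by auto
  qed
  define \<eta> where "\<eta> = (\<lambda>n q. real (Suc n) * (1 - exp (- q / real (Suc n))))"
  have \<eta>: "0 \<le> \<eta> n q" "\<eta> n q \<le> q" if "0 \<le> q" for n q
  proof -
    show "0 \<le> \<eta> n q" using that by (simp add: \<eta>_def)
    have "1 - exp (- q / real (Suc n)) \<le> q / real (Suc n)"
      using exp_ge_add_one_self[of "- q / real (Suc n)"] by simp
    then have "\<eta> n q \<le> real (Suc n) * (q / real (Suc n))" unfolding \<eta>_def by (intro mult_left_mono) auto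
    then show "\<eta> n q \<le> q" by simp
  qed
  have \<eta>_lim: "(\<lambda>n. \<eta> n q) \<longlonglongrightarrow> q" for q
  proof -
    have "((\<lambda>x. x * (1 - exp (- q / x))) \<longlongrightarrow> q) at_top" by real_asymp
    then have "(\<lambda>n. real n * (1 - exp (- q / real n))) \<longlonglongrightarrow> q"
      by (rule filterlim_compose[OF _ filterlim_real_sequentially])
    then show ?thesis unfolding \<eta>_def by (rule LIMSEQ_Suc)
  qed
  have e_lim: "(\<lambda>n. exp (- q / real (Suc n))) \<longlonglongrightarrow> 1" for q
  proof -
    have "((\<lambda>x. exp (- q / x)) \<longlongrightarrow> 1) at_top" by real_asymp
    then have "(\<lambda>n. exp (- q / real n)) \<longlonglongrightarrow> 1"
      by (rule filterlim_compose[OF _ filterlim_real_sequentially])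
    then show ?thesis by (rule LIMSEQ_Suc)
  qed

  have eq: "(LINT \<omega>|M. V \<omega> * f (\<eta> n (Q \<omega>))) = 2 * (LINT \<omega>|M. T \<omega> * (f' (\<eta> n (Q \<omega>)) * exp (- Q \<omega> / real (Suc n))))" for n
    unfolding \<eta>_def by (rule laplace_extension_bounded[OF Q V T lap f]) auto
  have [measurable]: "\<eta> n \<in> borel_measurable borel" for n unfolding \<eta>_def by measurable
  have w: "integrable M (\<lambda>\<omega>. \<bar>f 0\<bar> * \<bar>V \<omega>\<bar> + C * \<bar>V \<omega> * Q \<omega>\<bar>)" using V VQ by auto
  have dom: "\<bar>V \<omega> * f x\<bar> \<le> \<bar>f 0\<bar> * \<bar>V \<omega>\<bar> + C * \<bar>V \<omega> * Q \<omega>\<bar>" if "0 \<le> x" "x \<le> Q \<omega>" for x \<omega>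
    using mult_left_mono[OF fb[OF that], of "\<bar>V \<omega>\<bar>"] Q(2)[of \<omega>] by (simp add: abs_mult algebra_simps)
  have l1: "(\<lambda>n. LINT \<omega>|M. V \<omega> * f (\<eta> n (Q \<omega>))) \<longlonglongrightarrow> (LINT \<omega>|M. V \<omega> * f (Q \<omega>))"
  proof (rule integral_dominated_convergence[OF _ _ w])
    show "AE \<omega> in M. (\<lambda>n. V \<omega> * f (\<eta> n (Q \<omega>))) \<longlonglongrightarrow> V \<omega> * f (Q \<omega>)"
      by (intro AE_I2 tendsto_mult_left continuous_on_tendsto_compose[OF cf \<eta>_lim]) auto
    show "AE \<omega> in M. norm (V \<omega> * f (\<eta> n (Q \<omega>))) \<le> \<bar>f 0\<bar> * \<bar>V \<omega>\<bar> + C * \<bar>V \<omega> * Q \<omega>\<bar>" for n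
      using dom \<eta> Q(2) by (intro AE_I2) simp
  qed measurable
  have l2: "(\<lambda>n. LINT \<omega>|M. T \<omega> * (f' (\<eta> n (Q \<omega>)) * exp (- Q \<omega> / real (Suc n)))) \<longlonglongrightarrow> (LINT \<omega>|M. T \<omega> * (f' (Q \<omega>) * 1))"
  proof (rule integral_dominated_convergence[where w="\<lambda>\<omega>. C * \<bar>T \<omega>\<bar>"])
    show "AE \<omega> in M. (\<lambda>n. T \<omega> * (f' (\<eta> n (Q \<omega>)) * exp (- Q \<omega> / real (Suc n)))) \<longlonglongrightarrow> T \<omega> * (f' (Q \<omega>) * 1)"
      by (intro AE_I2 tendsto_mult_left tendsto_mult e_lim continuous_on_tendsto_compose[OF f(2) \<eta>_lim]) auto
    show "AE \<omega> in M. norm (T \<omega> * (f' (\<eta> n (Q \<omega>)) * exp (- Q \<omega> / real (Suc n)))) \<le> C * \<bar>T \<omega>\<bar>" for n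
    proof (rule AE_I2)
      fix \<omega>
      have "\<bar>T \<omega>\<bar> * (\<bar>f' (\<eta> n (Q \<omega>))\<bar> * exp (- Q \<omega> / real (Suc n))) \<le> \<bar>T \<omega>\<bar> * (C * 1)"
        using b Q(2)[of \<omega>] C by (intro mult_left_mono mult_mono) auto
      then show "norm (T \<omega> * (f' (\<eta> n (Q \<omega>)) * exp (- Q \<omega> / real (Suc n)))) \<le> C * \<bar>T \<omega>\<bar>"
        by (simp add: abs_mult mult.commute)
    qed
  qed (use T in auto)
  have "(\<lambda>n. LINT \<omega>|M. V \<omega> * f (\<eta> n (Q \<omega>))) \<longlonglongrightarrow> 2 * (LINT \<omega>|M. T \<omega> * (f' (Q \<omega>) * 1))"
    unfolding eq by (intro tendsto_mult_left l2)
  then show "(LINT \<omega>|M. V \<omega> * f (Q \<omega>)) = 2 * (LINT \<omega>|M. T \<omega> * f' (Q \<omega>))"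
    using LIMSEQ_unique[OF l1] by simp
  show "integrable M (\<lambda>\<omega>. V \<omega> * f (Q \<omega>))"
    by (rule Bochner_Integration.integrable_bound[OF w])
       (use dom[OF Q(2) order_refl] in \<open>auto intro!: AE_I2 intro: order_trans[OF _ abs_ge_self]\<close>)
  show "integrable M (\<lambda>\<omega>. T \<omega> * f' (Q \<omega>))"
  proof (rule Bochner_Integration.integrable_bound)
    show "integrable M (\<lambda>\<omega>. C * \<bar>T \<omega>\<bar>)" using T by auto
    show "AE \<omega> in M. norm (T \<omega> * f' (Q \<omega>)) \<le> norm (C * \<bar>T \<omega>\<bar>)"
      using mult_right_mono[OF b abs_ge_zero] C by (intro AE_I2) (simp add: abs_mult mult.commute[of "\<bar>T _\<bar>"])
  qed measurable
qed

context gaussian_vector begin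

text \<open>Of the three pairings in Isserlis' formula one gives the squared mean; the other two
  agree by symmetry of \<open>K\<close> and give each the sum of the squared entries of K^2, that is
  tr K^4.\<close>

lemma kform_square_integrable: "integrable M (\<lambda>\<omega>. (kform \<omega>)\<^sup>2)"
  and kform_second_moment: "(LINT \<omega>|M. (kform \<omega>)\<^sup>2) = trK2\<^sup>2 + 2 * (\<Sum>i\<in>I. \<Sum>j\<in>I. (\<Sum>k\<in>I. K i k * K k j)\<^sup>2)"
proof -
  have eq: "(\<lambda>\<omega>. (kform \<omega>)\<^sup>2) = (\<lambda>\<omega>. \<Sum>i\<in>I. \<Sum>j\<in>I. \<Sum>k\<in>I. \<Sum>l\<in>I. K i j * K k l * (X i \<omega> * X j \<omega> * (X k \<omega> * X l \<omega>)))"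
  proof
    fix \<omega>
    have "(kform \<omega>)\<^sup>2 = (\<Sum>i\<in>I. \<Sum>j\<in>I. K i j * (X i \<omega> * X j \<omega>)) * kform \<omega>"
      by (simp add: power2_eq_square kform_def)
    also have "\<dots> = (\<Sum>i\<in>I. \<Sum>j\<in>I. K i j * (X i \<omega> * X j \<omega>) * kform \<omega>)"
      by (simp add: sum_distrib_right)
    also have "\<dots> = (\<Sum>i\<in>I. \<Sum>j\<in>I. \<Sum>k\<in>I. \<Sum>l\<in>I. K i j * (X i \<omega> * X j \<omega>) * (K k l * (X k \<omega> * X l \<omega>)))"
      by (simp add: kform_def sum_distrib_left)
    finally show "(kform \<omega>)\<^sup>2 = (\<Sum>i\<in>I. \<Sum>j\<in>I. \<Sum>k\<in>I. \<Sum>l\<in>I. K i j * K k l * (X i \<omega> * X j \<omega> * (X k \<omega> * X l \<omega>)))"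
      by (simp add: mult_ac)
  qed
  show "integrable M (\<lambda>\<omega>. (kform \<omega>)\<^sup>2)"
    unfolding eq by (intro Bochner_Integration.integrable_sum integrable_mult_right X_prod4)
  have "(LINT \<omega>|M. (kform \<omega>)\<^sup>2) = (\<Sum>i\<in>I. \<Sum>j\<in>I. \<Sum>k\<in>I. \<Sum>l\<in>I. K i j * K k l * (LINT \<omega>|M. X i \<omega> * X j \<omega> * (X k \<omega> * X l \<omega>)))"
    unfolding eq
    by (simp add: Bochner_Integration.integral_sum Bochner_Integration.integrable_sum integrable_mult_right X_prod4(2))
  also have "\<dots> = (\<Sum>i\<in>I. \<Sum>j\<in>I. \<Sum>k\<in>I. \<Sum>l\<in>I. K i j * K k l * (K i j * K k l + K i k * K j l + K i l * K j k))"
    by (intro sum.cong refl arg_cong2[where f="(*)"] X_prod4(1))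
  also have "\<dots> = (\<Sum>i\<in>I. \<Sum>j\<in>I. \<Sum>k\<in>I. \<Sum>l\<in>I. (K i j)\<^sup>2 * (K k l)\<^sup>2)
      + (\<Sum>i\<in>I. \<Sum>j\<in>I. \<Sum>k\<in>I. \<Sum>l\<in>I. K i j * K k l * (K i k * K j l))
      + (\<Sum>i\<in>I. \<Sum>j\<in>I. \<Sum>k\<in>I. \<Sum>l\<in>I. K i j * K k l * (K i l * K j k))"
    by (simp add: sum.distrib[symmetric] power2_eq_square algebra_simps)
  also have "(\<Sum>i\<in>I. \<Sum>j\<in>I. \<Sum>k\<in>I. \<Sum>l\<in>I. (K i j)\<^sup>2 * (K k l)\<^sup>2) = trK2\<^sup>2"
  proof -
    have "(\<Sum>i\<in>I. \<Sum>j\<in>I. \<Sum>k\<in>I. \<Sum>l\<in>I. (K i j)\<^sup>2 * (K k l)\<^sup>2) = (\<Sum>i\<in>I. \<Sum>j\<in>I. (K i j)\<^sup>2 * trK2)"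
      by (simp add: trK2_def sum_distrib_left)
    also have "\<dots> = trK2 * trK2"
      unfolding sum_distrib_right[symmetric] trK2_def ..
    finally show ?thesis by (simp add: power2_eq_square)
  qed
  also have "(\<Sum>i\<in>I. \<Sum>j\<in>I. \<Sum>k\<in>I. \<Sum>l\<in>I. K i j * K k l * (K i l * K j k)) =
      (\<Sum>i\<in>I. \<Sum>j\<in>I. \<Sum>k\<in>I. \<Sum>l\<in>I. K i j * K k l * (K i k * K j l))"
    by (rule sum.cong[OF refl], rule sum.cong[OF refl], subst sum.swap, intro sum.cong refl) (simp add: symK mult_ac)
  also have "(\<Sum>i\<in>I. \<Sum>j\<in>I. \<Sum>k\<in>I. \<Sum>l\<in>I. K i j * K k l * (K i k * K j l)) = (\<Sum>i\<in>I. \<Sum>l\<in>I. (\<Sum>k\<in>I. K i k * K k l)\<^sup>2)"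
  proof (rule sum.cong[OF refl])
    fix i assume i: "i \<in> I"
    have "(\<Sum>j\<in>I. \<Sum>k\<in>I. \<Sum>l\<in>I. K i j * K k l * (K i k * K j l)) = (\<Sum>j\<in>I. \<Sum>l\<in>I. \<Sum>k\<in>I. K i j * K k l * (K i k * K j l))"
      by (intro sum.cong refl sum.swap)
    also have "\<dots> = (\<Sum>l\<in>I. \<Sum>j\<in>I. \<Sum>k\<in>I. K i j * K k l * (K i k * K j l))"
      by (rule sum.swap)
    also have "\<dots> = (\<Sum>l\<in>I. (\<Sum>k\<in>I. K i k * K k l)\<^sup>2)"
      by (simp add: power2_eq_square sum_product mult_ac)
    finally show "(\<Sum>j\<in>I. \<Sum>k\<in>I. \<Sum>l\<in>I. K i j * K k l * (K i k * K j l)) = (\<Sum>l\<in>I. (\<Sum>k\<in>I. K i k * K k l)\<^sup>2)" .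
  qed
  finally show "(LINT \<omega>|M. (kform \<omega>)\<^sup>2) = trK2\<^sup>2 + 2 * (\<Sum>i\<in>I. \<Sum>j\<in>I. (\<Sum>k\<in>I. K i k * K k j)\<^sup>2)"
    by simp
qed

text \<open>Schur's test. Cauchy-Schwarz with the weight |K i k| bounds an entry of K^2; one factor
  \<open>L\<close> is the total weight, the other arises by symmetry when the weight is summed over
  \<open>i\<close>.\<close>

lemma schur_square_sum:
  assumes L: "\<And>i. i \<in> I \<Longrightarrow> (\<Sum>j\<in>I. \<bar>K i j\<bar>) \<le> L" and L0: "0 \<le> L"
  shows "(\<Sum>i\<in>I. \<Sum>j\<in>I. (\<Sum>k\<in>I. K i k * K k j)\<^sup>2) \<le> L\<^sup>2 * trK2"
proof -
  have cs: "(\<Sum>k\<in>I. K i k * K k j)\<^sup>2 \<le> L * (\<Sum>k\<in>I. \<bar>K i k\<bar> * (K k j)\<^sup>2)" if i: "i \<in> I" for i j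
  proof -
    have "(\<Sum>k\<in>I. K i k * K k j)\<^sup>2 \<le> (\<Sum>k\<in>I. \<bar>K i k * K k j\<bar>)\<^sup>2"
      using sum_abs[of "\<lambda>k. K i k * K k j" I] by (intro power2_le_iff_abs_le[THEN iffD2]) (auto intro: sum_nonneg)
    also have "(\<Sum>k\<in>I. \<bar>K i k * K k j\<bar>) = (\<Sum>k\<in>I. sqrt \<bar>K i k\<bar> * (sqrt \<bar>K i k\<bar> * \<bar>K k j\<bar>))"
      by (intro sum.cong refl) (simp add: abs_mult flip: mult.assoc)
    also have "(\<dots>)\<^sup>2 \<le> (\<Sum>k\<in>I. (sqrt \<bar>K i k\<bar>)\<^sup>2) * (\<Sum>k\<in>I. (sqrt \<bar>K i k\<bar> * \<bar>K k j\<bar>)\<^sup>2)"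
      by (rule Cauchy_Schwarz_ineq_sum)
    also have "\<dots> = (\<Sum>k\<in>I. \<bar>K i k\<bar>) * (\<Sum>k\<in>I. \<bar>K i k\<bar> * (K k j)\<^sup>2)"
      by (simp add: power_mult_distrib)
    also have "\<dots> \<le> L * (\<Sum>k\<in>I. \<bar>K i k\<bar> * (K k j)\<^sup>2)"
      by (intro mult_right_mono L i sum_nonneg) auto
    finally show ?thesis .
  qed
  have "(\<Sum>i\<in>I. \<Sum>j\<in>I. (\<Sum>k\<in>I. K i k * K k j)\<^sup>2) \<le> (\<Sum>i\<in>I. \<Sum>j\<in>I. L * (\<Sum>k\<in>I. \<bar>K i k\<bar> * (K k j)\<^sup>2))"
    by (intro sum_mono cs)
  also have "\<dots> = L * (\<Sum>i\<in>I. \<Sum>j\<in>I. \<Sum>k\<in>I. \<bar>K i k\<bar> * (K k j)\<^sup>2)"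
    by (simp add: sum_distrib_left)
  also have "(\<Sum>i\<in>I. \<Sum>j\<in>I. \<Sum>k\<in>I. \<bar>K i k\<bar> * (K k j)\<^sup>2) = (\<Sum>i\<in>I. \<Sum>k\<in>I. \<Sum>j\<in>I. \<bar>K i k\<bar> * (K k j)\<^sup>2)"
    by (intro sum.cong refl sum.swap)
  also have "\<dots> = (\<Sum>k\<in>I. \<Sum>i\<in>I. \<Sum>j\<in>I. \<bar>K i k\<bar> * (K k j)\<^sup>2)"
    by (rule sum.swap)
  also have "\<dots> = (\<Sum>k\<in>I. (\<Sum>i\<in>I. \<bar>K k i\<bar>) * (\<Sum>j\<in>I. (K k j)\<^sup>2))"
    by (intro sum.cong refl) (simp add: sum_product symK)
  also have "L * \<dots> \<le> L * (\<Sum>k\<in>I. L * (\<Sum>j\<in>I. (K k j)\<^sup>2))"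
    by (intro mult_left_mono L0 sum_mono mult_right_mono L sum_nonneg) auto
  also have "\<dots> = L\<^sup>2 * trK2"
    by (simp add: trK2_def sum_distrib_left power2_eq_square mult.assoc)
  finally show ?thesis .
qed

text \<open>For the standardised statistic F, E[F f(F)] = E[T f'(F)] / tr K^2. Stein's equation
  turns the difference of expectations into E[R f'(F)] with R = 1 - T / tr K^2, which has mean 0 and
  second moment at most 2 L^2 / tr K^2.\<close>

theorem stein_bound:
  assumes L: "\<And>i. i \<in> I \<Longrightarrow> (\<Sum>j\<in>I. \<bar>K i j\<bar>) \<le> L" and L0: "0 \<le> L" and tr: "trK2 > 0"
    and h: "1-lipschitz_on UNIV h"
  shows "\<bar>(LINT \<omega>|M. h ((sqn \<omega> - trK) / sqrt (2 * trK2))) - integral\<^sup>L std_gauss h\<bar> \<le> 4 * L / sqrt trK2"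
proof -
  define s where "s = sqrt (2 * trK2)"
  have s: "s > 0" "s * s = 2 * trK2" using tr by (auto simp: s_def)
  obtain f f' where f: "\<And>x. (f has_real_derivative f' x) (at x)" "continuous_on UNIV f'"
    "\<And>x. \<bar>f' x\<bar> \<le> 2" "\<And>x. f' x - x * f x = h x - integral\<^sup>L std_gauss h"
    using stein_solution[OF h] by blast
  define F where "F = (\<lambda>\<omega>. (sqn \<omega> - trK) / s)"
  have [measurable]: "F \<in> borel_measurable M" unfolding F_def by measurable
  have [measurable]: "h \<in> borel_measurable borel" "f' \<in> borel_measurable borel"
    using lipschitz_real_measurable[OF h] f(2) by (auto intro: borel_measurable_continuous_onI)
  have V: "integrable M (\<lambda>\<omega>. sqn \<omega> - trK)" "(LINT \<omega>|M. sqn \<omega> - trK) = 0"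
    using sqn_integrable sqn_expectation by (auto simp: prob_space)
  have VQ: "integrable M (\<lambda>\<omega>. (sqn \<omega> - trK) * sqn \<omega>)"
    using Bochner_Integration.integrable_diff[OF sqn_square_integrable integrable_mult_right[OF sqn_integrable, of trK]]
    by (simp add: power2_eq_square left_diff_distrib)
  have d: "((\<lambda>q. f ((q - trK) / s)) has_real_derivative f' ((q - trK) / s) * (1 / s)) (at q)" for q
    by (rule DERIV_chain2[OF f(1)]) (use s(1) in \<open>auto intro!: derivative_eq_intros\<close>)
  have c: "continuous_on UNIV (\<lambda>q. f' ((q - trK) / s) * (1 / s))"
    by (intro continuous_intros continuous_on_compose2[OF f(2)]) (use s in auto)
  have b: "\<bar>f' ((q - trK) / s) * (1 / s)\<bar> \<le> 2 / s" for q
    using f(3)[of "(q - trK) / s"] s by (simp add: abs_mult divide_right_mono)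
  note ext = laplace_extension[OF sqn_measurable sqn_nonneg V kform_integrable VQ laplace_identity d c b]
  have "(LINT \<omega>|M. F \<omega> * f (F \<omega>)) = (LINT \<omega>|M. (sqn \<omega> - trK) * f (F \<omega>)) / s"
    by (simp add: F_def)
  also have "\<dots> = (2 * (LINT \<omega>|M. kform \<omega> * (f' (F \<omega>) * (1 / s)))) / s"
    using ext(1) by (simp add: F_def)
  also have "\<dots> = (LINT \<omega>|M. kform \<omega> * f' (F \<omega>)) * (2 / (s * s))" by simp
  also have "\<dots> = (LINT \<omega>|M. kform \<omega> / trK2 * f' (F \<omega>))" using tr unfolding s(2) by simp
  finally have Ff: "(LINT \<omega>|M. F \<omega> * f (F \<omega>)) = (LINT \<omega>|M. kform \<omega> / trK2 * f' (F \<omega>))" .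
  have i1: "integrable M (\<lambda>\<omega>. F \<omega> * f (F \<omega>))"
    using ext(2) s unfolding F_def by (simp add: divide_inverse mult_ac)
  have i2: "integrable M (\<lambda>\<omega>. f' (F \<omega>))"
    by (rule integrable_const_bound[where B=2]) (use f(3) in auto)
  have i3: "integrable M (\<lambda>\<omega>. kform \<omega> / trK2 * f' (F \<omega>))"
    using ext(3) s tr unfolding F_def by (simp add: divide_inverse mult_ac)
  have hF: "h (F \<omega>) = (f' (F \<omega>) - F \<omega> * f (F \<omega>)) + integral\<^sup>L std_gauss h" for \<omega>
    using f(4)[of "F \<omega>"] by simp
  define R where "R = (\<lambda>\<omega>. 1 - kform \<omega> / trK2)"
  have [measurable]: "R \<in> borel_measurable M" unfolding R_def by measurable
  have iR: "integrable M R" using kform_integrable by (simp add: R_def)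
  have R1: "(LINT \<omega>|M. R \<omega>) = 0"
    using kform_integrable kform_expectation tr by (simp add: R_def prob_space)
  have R2_eq: "(\<lambda>\<omega>. (R \<omega>)\<^sup>2) = (\<lambda>\<omega>. 1 - 2 / trK2 * kform \<omega> + (kform \<omega>)\<^sup>2 / trK2\<^sup>2)"
    using tr by (auto simp: R_def power2_diff power_divide fun_eq_iff)
  have iR2: "integrable M (\<lambda>\<omega>. (R \<omega>)\<^sup>2)"
    unfolding R2_eq using kform_integrable kform_square_integrable by simp
  have "(LINT \<omega>|M. (R \<omega>)\<^sup>2) = 1 - 2 / trK2 * trK2 + (LINT \<omega>|M. (kform \<omega>)\<^sup>2) / trK2\<^sup>2"
    unfolding R2_eq using kform_integrable kform_square_integrable kform_expectation by (simp add: prob_space)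
  also have "\<dots> = 2 * (\<Sum>i\<in>I. \<Sum>j\<in>I. (\<Sum>k\<in>I. K i k * K k j)\<^sup>2) / trK2\<^sup>2"
    unfolding kform_second_moment using tr by (simp add: field_simps)
  also have "\<dots> \<le> 2 * (L\<^sup>2 * trK2) / trK2\<^sup>2"
    by (intro divide_right_mono mult_left_mono schur_square_sum L L0) auto
  \<comment> \<open>Rounding 2 up to 4 makes the bound a square; together with |f'| at most 2 this
    is the origin of the factor 4.\<close>
  also have "\<dots> \<le> (2 * L / sqrt trK2)\<^sup>2"
    using tr by (simp add: power_divide power_mult_distrib power2_eq_square field_simps)
  finally have R2: "(LINT \<omega>|M. (R \<omega>)\<^sup>2) \<le> (2 * L / sqrt trK2)\<^sup>2" .
  have "(LINT \<omega>|M. \<bar>R \<omega>\<bar>)\<^sup>2 \<le> (LINT \<omega>|M. (R \<omega>)\<^sup>2)"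
    using variance_eq[of "\<lambda>\<omega>. \<bar>R \<omega>\<bar>"] variance_positive[of "\<lambda>\<omega>. \<bar>R \<omega>\<bar>"] iR iR2 by simp
  then have "(LINT \<omega>|M. \<bar>R \<omega>\<bar>)\<^sup>2 \<le> (2 * L / sqrt trK2)\<^sup>2"
    using R2 by linarith
  then have absR: "(LINT \<omega>|M. \<bar>R \<omega>\<bar>) \<le> 2 * L / sqrt trK2"
    by (rule power2_le_imp_le) (use L0 tr in auto)
  have "(LINT \<omega>|M. h (F \<omega>)) - integral\<^sup>L std_gauss h = (LINT \<omega>|M. f' (F \<omega>)) - (LINT \<omega>|M. F \<omega> * f (F \<omega>))"
    unfolding hF using i1 i2 by (simp add: prob_space)
  also have "\<dots> = (LINT \<omega>|M. R \<omega> * f' (F \<omega>))"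
    unfolding Ff R_def left_diff_distrib using i2 i3 by simp
  also have "\<bar>\<dots>\<bar> \<le> (LINT \<omega>|M. \<bar>R \<omega>\<bar> * 2)"
  proof (rule order_trans[OF integral_abs_bound], rule integral_mono)
    show "integrable M (\<lambda>\<omega>. \<bar>R \<omega> * f' (F \<omega>)\<bar>)"
      unfolding R_def left_diff_distrib using i2 i3 by simp
    show "\<bar>R \<omega> * f' (F \<omega>)\<bar> \<le> \<bar>R \<omega>\<bar> * 2" for \<omega>
      unfolding abs_mult using f(3) by (intro mult_left_mono) auto
  qed (use iR in auto)
  also have "\<dots> \<le> 4 * L / sqrt trK2"
    using absR by simp
  finally show ?thesis by (simp add: F_def s_def)
qed

end

section \<open>Gaussian processes and Young sums\<close>

lemma normal_law_eq_distr:
  assumes "0 \<le> s"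
  shows "normal_law m s = distr std_gauss borel (\<lambda>x. m + s * x)"
proof (cases "s = 0")
  case True
  then show ?thesis
    using prob_space.distr_const[OF prob_space_std_gauss, of m borel] by (simp add: normal_law_def)
next
  case False
  interpret prob_space std_gauss by (rule prob_space_std_gauss)
  have "distributed std_gauss lborel (\<lambda>x. x) std_normal_density"
    by (auto simp: distributed_def intro!: distr_id2)
  from normal_density_affine[OF this, of s m] False assms
  have "distributed std_gauss lborel (\<lambda>x. m + s * x) (normal_density m s)" by simp
  then have "distr std_gauss lborel (\<lambda>x. m + s * x) = density lborel (normal_density m s)"
    by (rule distributed_distr_eq_density)
  moreover have "distr std_gauss lborel (\<lambda>x. m + s * x) = distr std_gauss borel (\<lambda>x. m + s * x)"
    by (rule distr_cong) auto
  ultimately show ?thesis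
    using False by (simp add: normal_law_def)
qed

section \<open>The linear span of a Gaussian process\<close>

definition lcomb :: "(real \<Rightarrow> 'a \<Rightarrow> real) \<Rightarrow> real set \<Rightarrow> ('a \<Rightarrow> real) set" where
  "lcomb Y T = {U. \<exists>F c. finite F \<and> F \<subseteq> T \<and> U = (\<lambda>\<omega>. \<Sum>t\<in>F. c t * Y t \<omega>)}"

lemma lcomb_single: "t \<in> T \<Longrightarrow> Y t \<in> lcomb Y T"
  unfolding lcomb_def by (intro CollectI exI[of _ "{t}"] exI[of _ "\<lambda>_. 1"]) auto

lemma lcomb_scale: "U \<in> lcomb Y T \<Longrightarrow> (\<lambda>\<omega>. r * U \<omega>) \<in> lcomb Y T"
  unfolding lcomb_def
proof clarify
  fix F c assume "finite F" "F \<subseteq> T"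
  then show "\<exists>F' c'. finite F' \<and> F' \<subseteq> T \<and> (\<lambda>\<omega>. r * (\<Sum>t\<in>F. c t * Y t \<omega>)) = (\<lambda>\<omega>. \<Sum>t\<in>F'. c' t * Y t \<omega>)"
    by (intro exI[of _ F] exI[of _ "\<lambda>t. r * c t"]) (auto simp: sum_distrib_left mult.assoc)
qed

lemma lcomb_add:
  assumes "U \<in> lcomb Y T" "V \<in> lcomb Y T"
  shows "(\<lambda>\<omega>. U \<omega> + V \<omega>) \<in> lcomb Y T"
proof -
  obtain F c where F: "finite F" "F \<subseteq> T" "U = (\<lambda>\<omega>. \<Sum>t\<in>F. c t * Y t \<omega>)"
    using assms(1) by (auto simp: lcomb_def)
  obtain G d where G: "finite G" "G \<subseteq> T" "V = (\<lambda>\<omega>. \<Sum>t\<in>G. d t * Y t \<omega>)"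
    using assms(2) by (auto simp: lcomb_def)
  have "U \<omega> + V \<omega> = (\<Sum>t\<in>F \<union> G. ((if t \<in> F then c t else 0) + (if t \<in> G then d t else 0)) * Y t \<omega>)" for \<omega>
  proof -
    have "U \<omega> = (\<Sum>t\<in>F \<union> G. (if t \<in> F then c t else 0) * Y t \<omega>)"
      unfolding F(3) using F(1) G(1) by (intro sum.mono_neutral_cong_left) auto
    moreover have "V \<omega> = (\<Sum>t\<in>F \<union> G. (if t \<in> G then d t else 0) * Y t \<omega>)"
      unfolding G(3) using F(1) G(1) by (intro sum.mono_neutral_cong_left) auto
    ultimately show ?thesis by (simp add: sum.distrib distrib_right)
  qed
  then show ?thesis using F G unfolding lcomb_def
    by (intro CollectI exI[of _ "F \<union> G"] exI[of _ "\<lambda>t. (if t \<in> F then c t else 0) + (if t \<in> G then d t else 0)"]) auto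
qed

lemma lcomb_sum:
  assumes "finite A" "\<And>a. a \<in> A \<Longrightarrow> U a \<in> lcomb Y T"
  shows "(\<lambda>\<omega>. \<Sum>a\<in>A. U a \<omega>) \<in> lcomb Y T"
  using assms
proof (induction A rule: finite_induct)
  case empty
  show ?case unfolding lcomb_def by (intro CollectI exI[of _ "{}"]) auto
next
  case (insert a A)
  then show ?case using lcomb_add[of "U a" Y T "\<lambda>\<omega>. \<Sum>a\<in>A. U a \<omega>"] by simp
qed

lemma lcomb_diff:
  assumes "U \<in> lcomb Y T" "V \<in> lcomb Y T"
  shows "(\<lambda>\<omega>. U \<omega> - V \<omega>) \<in> lcomb Y T"
  using lcomb_add[OF assms(1) lcomb_scale[OF assms(2), of "-1"]] by simp

locale centred_gaussian = prob_space M for M :: "'a measure" +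
  fixes T :: "real set" and R :: "real \<Rightarrow> real \<Rightarrow> real" and Y :: "real \<Rightarrow> 'a \<Rightarrow> real"
  assumes ccg: "continuous_centred_gaussian M T R Y"
begin

lemma Y_measurable [measurable]: "t \<in> T \<Longrightarrow> Y t \<in> borel_measurable M"
  using ccg by (auto simp: continuous_centred_gaussian_def gaussian_process_def)

lemma lcomb_law:
  assumes "U \<in> lcomb Y T"
  obtains m s where "0 \<le> s" "distr M borel U = distr std_gauss borel (\<lambda>x. m + s * x)" "U \<in> borel_measurable M"
proof -
  obtain F c where F: "finite F" "F \<subseteq> T" "U = (\<lambda>\<omega>. \<Sum>t\<in>F. c t * Y t \<omega>)"
    using assms by (auto simp: lcomb_def)
  then have "\<exists>m s. s \<ge> 0 \<and> distr M borel U = normal_law m s"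
    using ccg unfolding continuous_centred_gaussian_def gaussian_process_def by blast
  moreover have "U \<in> borel_measurable M"
    unfolding F(3) using F(2) by (intro borel_measurable_sum borel_measurable_times) auto
  ultimately show ?thesis using that normal_law_eq_distr by metis
qed

lemma lcomb_integrable_power:
  assumes "U \<in> lcomb Y T"
  shows "integrable M (\<lambda>\<omega>. (U \<omega>) ^ k)" and "U \<in> borel_measurable M"
proof -
  obtain m s where *: "0 \<le> s" "distr M borel U = distr std_gauss borel (\<lambda>x. m + s * x)" and [measurable]: "U \<in> borel_measurable M"
    using lcomb_law[OF assms] by blast
  interpret N: prob_space std_gauss by (rule prob_space_std_gauss)
  have "integrable std_gauss (\<lambda>x. (m + s * x) ^ k)"
    unfolding binomial_ring power_mult_distrib
    by (intro Bochner_Integration.integrable_sum integrable_mult_right integrable_mult_left integrable_std_normal_distribution_moment)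
  then have "integrable (distr std_gauss borel (\<lambda>x. m + s * x)) (\<lambda>x. x ^ k)"
    by (subst integrable_distr_eq) auto
  then have "integrable (distr M borel U) (\<lambda>x. x ^ k)" by (simp add: *)
  then show "integrable M (\<lambda>\<omega>. (U \<omega>) ^ k)" by (subst (asm) integrable_distr_eq) auto
  show "U \<in> borel_measurable M" by fact
qed

lemma lcomb_mean:
  assumes "U \<in> lcomb Y T"
  shows "(LINT \<omega>|M. U \<omega>) = 0"
proof -
  obtain F c where F: "finite F" "F \<subseteq> T" "U = (\<lambda>\<omega>. \<Sum>t\<in>F. c t * Y t \<omega>)"
    using assms by (auto simp: lcomb_def)
  have "integrable M (Y t)" if "t \<in> T" for t
    using lcomb_integrable_power(1)[OF lcomb_single[OF that], of 1] by simp
  moreover have "(LINT \<omega>|M. Y t \<omega>) = 0" if "t \<in> T" for t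
    using ccg that by (auto simp: continuous_centred_gaussian_def)
  ultimately show ?thesis unfolding F(3) using F(2)
    by (subst Bochner_Integration.integral_sum) (auto intro!: sum.neutral)
qed

text \<open>The definition of a Gaussian process leaves the parameters of each combination open:
  centring forces the mean 0, and the second moment then fixes the scale.\<close>

lemma lcomb_cgauss:
  assumes "U \<in> lcomb Y T"
  shows "cgauss M (LINT \<omega>|M. (U \<omega>)\<^sup>2) U"
proof -
  obtain m s where *: "0 \<le> s" "distr M borel U = distr std_gauss borel (\<lambda>x. m + s * x)" and [measurable]: "U \<in> borel_measurable M"
    using lcomb_law[OF assms] by blast
  interpret N: prob_space std_gauss by (rule prob_space_std_gauss)
  have "0 = (LINT x|distr M borel U. x)"
    using lcomb_mean[OF assms] by (subst integral_distr) auto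
  also have "\<dots> = (LINT x|std_gauss. m + s * x)"
    unfolding *(2) by (subst integral_distr) auto
  also have "\<dots> = m"
    using integrable_std_normal_distribution_moment[of 1] integral_std_normal_distribution_moment_odd[of 1]
    by simp
  finally have m: "m = 0" by simp
  have c: "cgauss M (s\<^sup>2) U"
    using * m by (simp add: cgauss_def)
  show ?thesis using c unfolding cgauss_square[OF c] .
qed

lemma lcomb_mult_integrable:
  assumes "U \<in> lcomb Y T" "V \<in> lcomb Y T"
  shows "integrable M (\<lambda>\<omega>. U \<omega> * V \<omega>)"
proof -
  have "integrable M (\<lambda>\<omega>. ((U \<omega> + V \<omega>) ^ 2 - U \<omega> ^ 2 - V \<omega> ^ 2) / 2)"
    using lcomb_integrable_power(1)[OF lcomb_add[OF assms], of 2]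
      lcomb_integrable_power(1)[OF assms(1), of 2] lcomb_integrable_power(1)[OF assms(2), of 2] by simp
  also have "(\<lambda>\<omega>. ((U \<omega> + V \<omega>) ^ 2 - U \<omega> ^ 2 - V \<omega> ^ 2) / 2) = (\<lambda>\<omega>. U \<omega> * V \<omega>)"
    by (auto simp: power2_eq_square algebra_simps)
  finally show ?thesis .
qed

lemma lcomb_gaussian_vector:
  assumes I: "finite I" and U: "\<And>i. i \<in> I \<Longrightarrow> U i \<in> lcomb Y T"
  shows "gaussian_vector M I (\<lambda>i j. LINT \<omega>|M. U i \<omega> * U j \<omega>) U"
proof unfold_locales
  fix c
  have *: "(\<lambda>\<omega>. \<Sum>i\<in>I. c i * U i \<omega>) \<in> lcomb Y T"
    by (intro lcomb_sum I lcomb_scale U)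
  have "(LINT \<omega>|M. (\<Sum>i\<in>I. c i * U i \<omega>)\<^sup>2) = (LINT \<omega>|M. (\<Sum>i\<in>I. \<Sum>j\<in>I. c i * c j * (U i \<omega> * U j \<omega>)))"
    by (simp add: power2_eq_square sum_product mult_ac)
  also have "\<dots> = (\<Sum>i\<in>I. \<Sum>j\<in>I. c i * c j * (LINT \<omega>|M. U i \<omega> * U j \<omega>))"
    using lcomb_mult_integrable[OF U U]
    by (simp add: Bochner_Integration.integral_sum Bochner_Integration.integrable_sum)
  finally show "cgauss M (\<Sum>i\<in>I. \<Sum>j\<in>I. c i * c j * (LINT \<omega>|M. U i \<omega> * U j \<omega>)) (\<lambda>\<omega>. \<Sum>i\<in>I. c i * U i \<omega>)"
    using lcomb_cgauss[OF *] by simp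
qed (use I in \<open>auto simp: mult.commute\<close>)

end

text \<open>The covariance of the limit is read off the limiting characteristic function, so that
  almost sure convergence together with convergence of the covariances suffices.\<close>

lemma gaussian_vector_limit:
  assumes G: "\<And>m::nat. gaussian_vector M I (K m) (X m)"
    and V: "\<And>i. i \<in> I \<Longrightarrow> V i \<in> borel_measurable M"
    and lim: "\<And>i. i \<in> I \<Longrightarrow> AE \<omega> in M. (\<lambda>m. X m i \<omega>) \<longlonglongrightarrow> V i \<omega>"
    and K: "\<And>i j. i \<in> I \<Longrightarrow> j \<in> I \<Longrightarrow> (\<lambda>m. K m i j) \<longlonglongrightarrow> L i j"
  shows "gaussian_vector M I L V"
proof -
  interpret G: gaussian_vector M I "K 0" "X 0" by (rule G)
  show ?thesis
  proof unfold_locales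
    fix c
    show "cgauss M (\<Sum>i\<in>I. \<Sum>j\<in>I. c i * c j * L i j) (\<lambda>\<omega>. \<Sum>i\<in>I. c i * V i \<omega>)"
    proof (rule cgauss_limit[OF G.prob_space_axioms gaussian_vector.gauss[OF G, of c]])
      have "AE \<omega> in M. \<forall>i\<in>I. (\<lambda>m. X m i \<omega>) \<longlonglongrightarrow> V i \<omega>"
        using G.finI lim by (intro AE_finite_allI) auto
      then show "AE \<omega> in M. (\<lambda>m. \<Sum>i\<in>I. c i * X m i \<omega>) \<longlonglongrightarrow> (\<Sum>i\<in>I. c i * V i \<omega>)"
        by eventually_elim (auto intro!: tendsto_sum tendsto_mult_left)
      show "(\<lambda>\<omega>. \<Sum>i\<in>I. c i * V i \<omega>) \<in> borel_measurable M"
        using V by (intro borel_measurable_sum borel_measurable_times) auto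
      show "(\<lambda>m. \<Sum>i\<in>I. \<Sum>j\<in>I. c i * c j * K m i j) \<longlonglongrightarrow> (\<Sum>i\<in>I. \<Sum>j\<in>I. c i * c j * L i j)"
        by (intro tendsto_sum tendsto_mult_left K)
    qed
  next
    fix i j assume ij: "i \<in> I" "j \<in> I"
    have "(\<lambda>m. K m i j) = (\<lambda>m. K m j i)"
      using gaussian_vector.symK[OF G ij] by auto
    then show "L i j = L j i" using K[OF ij] K[OF ij(2,1)] LIMSEQ_unique by metis
  qed (rule G.finI)
qed

section \<open>Riemann-Stieltjes sums on uniform grids\<close>

definition grid :: "nat \<Rightarrow> real \<Rightarrow> real \<Rightarrow> nat \<Rightarrow> real" where
  "grid n a t l = a + real l * (t - a) / real n"

lemma grid_simps: "grid n a t 0 = a" "n > 0 \<Longrightarrow> grid n a t n = t"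
  by (auto simp: grid_def)

lemma grid_mono: "a \<le> t \<Longrightarrow> l \<le> l' \<Longrightarrow> grid n a t l \<le> grid n a t l'"
  unfolding grid_def by (intro add_left_mono divide_right_mono mult_right_mono) auto

lemma grid_bounds: "a \<le> t \<Longrightarrow> l \<le> n \<Longrightarrow> n > 0 \<Longrightarrow> grid n a t l \<in> {a..t}"
  using grid_mono[of a t 0 l n] grid_mono[of a t l n n] by (simp add: grid_simps)

lemma grid_Suc: "grid n a t (Suc l) = grid n a t l + (t - a) / real n"
  by (simp add: grid_def add_divide_distrib distrib_right)

text \<open>The cells of the uniform grid, tagged at their left ends, form a tagged division of mesh
  (b - a)/n, which is fine for a constant gauge once n is large. The limit over all divisions thus
  becomes a limit along one sequence of measurable functions of the path.\<close>

lemma young_grid_limit: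
  assumes Y: "has_young_integral f g a b J" and ab: "a < b"
  shows "(\<lambda>n. \<Sum>l<n. f (grid n a b l) * (g (grid n a b (Suc l)) - g (grid n a b l))) \<longlonglongrightarrow> J"
proof (rule LIMSEQ_I)
  fix e :: real assume "0 < e"
  then obtain d where d: "d > 0" and D: "\<And>D. D tagged_division_of {a..b} \<Longrightarrow> (\<lambda>x. ball x d) fine D \<Longrightarrow>
     \<bar>(\<Sum>(x, K)\<in>D. f x * (g (Sup K) - g (Inf K))) - J\<bar> < e"
    using Y[unfolded has_young_integral_def, rule_format, OF \<open>0 < e\<close>] by blast
  obtain N where N: "(b - a) / d < real N" using reals_Archimedean2 by blast
  show "\<exists>no. \<forall>n\<ge>no. norm ((\<Sum>l<n. f (grid n a b l) * (g (grid n a b (Suc l)) - g (grid n a b l))) - J) < e"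
  proof (intro exI allI impI)
    fix n assume n: "n \<ge> Suc N"
    then have n0: "n > 0" by simp
    have "(b - a) / d < real n" using N n by linarith
    then have mesh: "(b - a) / real n < d" using d n0 by (simp add: field_simps)
    let ?x = "grid n a b"
    define D where "D = (\<lambda>l. (?x l, {?x l..?x (Suc l)})) ` {..<n}"
    have lt: "?x l < ?x (Suc l)" for l using ab n0 by (simp add: grid_Suc)
    have mono: "?x l \<le> ?x l'" if "l \<le> l'" for l l' by (rule grid_mono) (use that ab in auto)
    have inj: "inj_on (\<lambda>l. (?x l, {?x l..?x (Suc l)})) {..<n}"
    proof (rule inj_onI)
      have "strict_mono ?x" by (rule strict_monoI_Suc) (rule lt)
      fix l l' assume "(?x l, {?x l..?x (Suc l)}) = (?x l', {?x l'..?x (Suc l')})"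
      then have "?x l = ?x l'" by (simp only: prod.inject)
      then show "l = l'" using strict_mono_eq[OF \<open>strict_mono ?x\<close>] by blast
    qed
    have "D tagged_division_of {a..b}"
      unfolding tagged_division_of
    proof (intro conjI allI impI)
      show "finite D" by (simp add: D_def)
    next
      fix x K assume "(x, K) \<in> D"
      then obtain l where l: "l < n" "x = ?x l" "K = {?x l..?x (Suc l)}" by (auto simp: D_def)
      show "x \<in> K" using lt[of l] l by auto
      show "K \<subseteq> {a..b}"
        using grid_bounds[of a b l n] grid_bounds[of a b "Suc l" n] l ab by auto
      show "\<exists>a b. K = cbox a b" using l by auto
    next
      fix x1 K1 x2 K2 assume *: "(x1, K1) \<in> D \<and> (x2, K2) \<in> D \<and> (x1, K1) \<noteq> (x2, K2)"
      then obtain l1 l2 where l: "K1 = {?x l1..?x (Suc l1)}" "K2 = {?x l2..?x (Suc l2)}" "l1 \<noteq> l2"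
        by (auto simp: D_def)
      then have "Suc l1 \<le> l2 \<or> Suc l2 \<le> l1" by auto
      then have "?x (Suc l1) \<le> ?x l2 \<or> ?x (Suc l2) \<le> ?x l1" using mono by blast
      then show "interior K1 \<inter> interior K2 = {}" using l by auto
    next
      show "\<Union>{K. \<exists>x. (x, K) \<in> D} = {a..b}"
      proof (intro equalityI subsetI)
        fix y assume "y \<in> \<Union>{K. \<exists>x. (x, K) \<in> D}"
        then obtain l where "l < n" "y \<in> {?x l..?x (Suc l)}" by (auto simp: D_def)
        then show "y \<in> {a..b}"
          using grid_bounds[of a b l n] grid_bounds[of a b "Suc l" n] ab by auto
      next
        fix y assume y: "y \<in> {a..b}"
        have "\<exists>l<n. y \<in> {?x l..?x (Suc l)}"
        \<comment> \<open>Rounding down finds the cell of y except at y = b, where the index would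
          be \<open>n\<close>; this point belongs to the last cell.\<close>
        proof (cases "y = b")
          case True
          then show ?thesis using lt[of "n - 1"] n0 by (intro exI[of _ "n - 1"]) (auto simp: grid_simps)
        next
          case False
          define l where "l = nat \<lfloor>(y - a) * real n / (b - a)\<rfloor>"
          have pos: "0 \<le> (y - a) * real n / (b - a)" using y ab by auto
          have "real l \<le> (y - a) * real n / (b - a)" "(y - a) * real n / (b - a) < real l + 1"
            using pos unfolding l_def by linarith+
          then have 1: "real l * (b - a) / real n \<le> y - a" "y - a < (real l + 1) * (b - a) / real n"
            using ab n0 by (auto simp: field_simps)
          have "(y - a) * real n / (b - a) < real n" using y ab False n0 by (simp add: field_simps)
          then have "l < n" using pos unfolding l_def by linarith
          then show ?thesis using 1 by (intro exI[of _ l]) (auto simp: grid_def add.commute)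
        qed
        then obtain l where "l < n" "y \<in> {?x l..?x (Suc l)}" by blast
        moreover from this have "(?x l, {?x l..?x (Suc l)}) \<in> D" by (auto simp: D_def)
        ultimately show "y \<in> \<Union>{K. \<exists>x. (x, K) \<in> D}" by blast
      qed
    qed
    moreover have "(\<lambda>x. ball x d) fine D"
      unfolding fine_def D_def using mesh lt by (auto simp: grid_Suc dist_real_def)
    ultimately have "\<bar>(\<Sum>(x, K)\<in>D. f x * (g (Sup K) - g (Inf K))) - J\<bar> < e" by (rule D)
    also have "(\<Sum>(x, K)\<in>D. f x * (g (Sup K) - g (Inf K))) = (\<Sum>l<n. f (?x l) * (g (?x (Suc l)) - g (?x l)))"
      unfolding D_def using inj lt by (subst sum.reindex) (auto simp: less_imp_le)
    finally show "norm ((\<Sum>l<n. f (?x l) * (g (?x (Suc l)) - g (?x l))) - J) < e" by simp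
  qed
qed

section \<open>Young sums as expectations over an exponential variable\<close>

abbreviation expo :: "real \<Rightarrow> real measure" where "expo \<theta> \<equiv> density lborel (exponential_density \<theta>)"

lemma prob_space_expo: "0 < \<theta> \<Longrightarrow> prob_space (expo \<theta>)"
  by (rule prob_space_exponential_density)

lemma AE_expo_pos: "0 < \<theta> \<Longrightarrow> AE p in expo \<theta>. 0 < p"
proof -
  assume "0 < \<theta>"
  have "AE p in lborel. p \<noteq> (0::real)" by (rule AE_lborel_singleton)
  then have "AE p in lborel. 0 < ennreal (exponential_density \<theta> p) \<longrightarrow> 0 < p"
    by eventually_elim (auto simp: exponential_density_def split: if_splits)
  then show ?thesis by (simp add: AE_density)
qed

lemma measure_expo_atMost: "0 < \<theta> \<Longrightarrow> measure (expo \<theta>) {..v} = (if 0 \<le> v then 1 - exp (- \<theta> * v) else 0)"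
  unfolding measure_def by (subst emeasure_erlang_density) (auto simp: erlang_CDF_0)

lemma measure_expo_Ioc:
  assumes "0 < \<theta>" "0 \<le> u" "u \<le> v"
  shows "measure (expo \<theta>) {u<..v} = exp (- \<theta> * u) - exp (- \<theta> * v)"
proof -
  interpret prob_space "expo \<theta>" by (rule prob_space_expo[OF assms(1)])
  have "{u<..v} = {..v} - {..u}" by auto
  then have "measure (expo \<theta>) {u<..v} = measure (expo \<theta>) {..v} - measure (expo \<theta>) {..u}"
    using assms by (subst finite_measure_Diff[symmetric]) auto
  then show ?thesis using assms by (simp add: measure_expo_atMost)
qed

lemma measure_expo_Ioi:
  assumes "0 < \<theta>" "0 \<le> u"
  shows "measure (expo \<theta>) {u<..} = exp (- \<theta> * u)"
proof -
  interpret prob_space "expo \<theta>" by (rule prob_space_expo[OF assms(1)])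
  have "measure (expo \<theta>) {u<..} = 1 - measure (expo \<theta>) {..u}"
    using prob_compl[of "{..u}"] by (simp add: Compl_eq_Diff_UNIV[symmetric])
  then show ?thesis using assms by (simp add: measure_expo_atMost)
qed

text \<open>The prefactor e^(-\<theta>t) of the Ornstein-Uhlenbeck integral is kept inside the
  exponent: the weight at a grid point x is then the probability that an exponential variable
  exceeds t - x.\<close>

definition young_sum :: "real \<Rightarrow> nat \<Rightarrow> real \<Rightarrow> real \<Rightarrow> (real \<Rightarrow> real) \<Rightarrow> real" where
  "young_sum \<theta> n a t g = (\<Sum>l<n. exp (\<theta> * (grid n a t l - t)) * (g (grid n a t (Suc l)) - g (grid n a t l)))"

text \<open>The integrand produced by summation by parts. If t - p lies in the cell from x_l
  (included) to x_(l+1) (excluded), the value is g(t) - g(x_(l+1)); if t - p < a, it is g(t) - g(a).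
  It approximates g(t) - g(max(t - p, a)).\<close>

definition young_step :: "nat \<Rightarrow> real \<Rightarrow> real \<Rightarrow> (real \<Rightarrow> real) \<Rightarrow> real \<Rightarrow> real" where
  "young_step n a t g p = (\<Sum>l<n. indicator {t - grid n a t (Suc l)<..t - grid n a t l} p * (g t - g (grid n a t (Suc l))))
     + indicator {t - a<..} p * (g t - g a)"

lemma young_step_measurable [measurable]: "young_step n a t g \<in> borel_measurable borel"
  unfolding young_step_def by measurable

text \<open>Summation by parts: the increment of the weights over a cell is the probability that t -
  p falls into that cell, and the first weight is the probability of p > t - a.\<close>

lemma young_sum_eq_integral:
  assumes \<theta>: "0 < \<theta>" and at: "a \<le> t" and n: "0 < n"
  shows "young_sum \<theta> n a t g = (LINT p|expo \<theta>. young_step n a t g p)"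
proof -
  interpret prob_space "expo \<theta>" by (rule prob_space_expo[OF \<theta>])
  let ?x = "grid n a t" and ?w = "\<lambda>l. exp (\<theta> * (grid n a t l - t))"
  have b: "?x l \<in> {a..t}" if "l \<le> n" for l using grid_bounds[OF at that n] .
  have "(LINT p|expo \<theta>. young_step n a t g p) = (\<Sum>l<n. measure (expo \<theta>) {t - ?x (Suc l)<..t - ?x l} * (g t - g (?x (Suc l))))
      + measure (expo \<theta>) {t - a<..} * (g t - g a)"
  proof -
    have i: "integrable (expo \<theta>) (\<lambda>p. indicator {u<..v} p * c)" "integrable (expo \<theta>) (\<lambda>p. indicator {u<..} p * c)"
      for u v c :: real
      by (intro integrable_mult_left integrable_real_indicator; simp add: emeasure_eq_measure)+
    have I: "(LINT p|expo \<theta>. indicator {u<..v} p * c) = measure (expo \<theta>) {u<..v} * c"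
      "(LINT p|expo \<theta>. indicator {u<..} p * c) = measure (expo \<theta>) {u<..} * c" for u v c :: real
      by simp_all
    show ?thesis
      unfolding young_step_def Bochner_Integration.integral_add[OF Bochner_Integration.integrable_sum[OF i(1)] i(2)]
        Bochner_Integration.integral_sum[OF i(1)] I ..
  qed
  also have "\<dots> = (\<Sum>l<n. (?w (Suc l) - ?w l) * (g t - g (?x (Suc l)))) + ?w 0 * (g t - g a)"
  proof (intro arg_cong2[where f="(+)"] sum.cong refl arg_cong2[where f="(*)"])
    fix l assume "l \<in> {..<n}"
    then show "measure (expo \<theta>) {t - ?x (Suc l)<..t - ?x l} = ?w (Suc l) - ?w l"
      using b[of l] b[of "Suc l"] grid_mono[OF at, of l "Suc l" n] \<theta>
      by (subst measure_expo_Ioc) (auto simp: algebra_simps)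
  next
    show "measure (expo \<theta>) {t - a<..} = ?w 0"
      using at \<theta> by (subst measure_expo_Ioi) (auto simp: grid_simps algebra_simps)
  qed
  also have "\<dots> = young_sum \<theta> n a t g"
  proof -
    have tel: "(\<Sum>l<n. ?w (Suc l) - ?w l) = ?w n - ?w 0" by (rule sum_lessThan_telescope)
    have tel2: "(\<Sum>l<n. ?w (Suc l) * g (?x (Suc l)) - ?w l * g (?x l)) = ?w n * g (?x n) - ?w 0 * g (?x 0)"
      by (rule sum_lessThan_telescope)
    have "(\<Sum>l<n. (?w (Suc l) - ?w l) * (g t - g (?x (Suc l)))) =
       (\<Sum>l<n. (?w (Suc l) - ?w l) * g t - ((?w (Suc l) * g (?x (Suc l)) - ?w l * g (?x l)) - ?w l * (g (?x (Suc l)) - g (?x l))))"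
      by (intro sum.cong refl) (simp add: algebra_simps)
    also have "\<dots> = (?w n - ?w 0) * g t - ((?w n * g (?x n) - ?w 0 * g (?x 0)) - young_sum \<theta> n a t g)"
      unfolding sum_subtractf sum_distrib_right[symmetric] young_sum_def using tel tel2 by (simp add: sum_subtractf)
    finally show ?thesis using n by (simp add: grid_simps algebra_simps)
  qed
  finally show ?thesis by simp
qed

text \<open>The point \<open>u\<close> is t - p rounded up to the grid, or \<open>a\<close>. It is
  chosen before \<open>g\<close>, which admits functions varying with the mesh.\<close>

lemma young_step_value:
  assumes at: "a < t" and n: "0 < n" and p: "0 < p"
  obtains u where "u \<in> {a..t}" "\<bar>u - max (t - p) a\<bar> \<le> (t - a) / real n" "\<And>g. young_step n a t g p = g t - g u"
proof (cases "t - a < p")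
  case True
  have "young_step n a t g p = g t - g a" for g
  proof -
    have "indicator {t - grid n a t (Suc l)<..t - grid n a t l} p = (0::real)" if "l < n" for l
      using grid_bounds[of a t l n] that at n True by auto
    then show ?thesis using True by (simp add: young_step_def)
  qed
  then show ?thesis using True at by (intro that[of a]) auto
next
  case False
  let ?x = "grid n a t"
  \<comment> \<open>\<open>r\<close> is the position of t - p counted in cells from
    \<open>a\<close>; \<open>p > 0\<close> keeps it below \<open>n\<close>, so that its floor is the
    index of a cell.\<close>
  define r where "r = (t - p - a) * real n / (t - a)"
  define l where "l = nat \<lfloor>r\<rfloor>"
  have r0: "0 \<le> r" unfolding r_def using at False by (intro divide_nonneg_pos mult_nonneg_nonneg) auto
  have "(t - p - a) * real n < (t - a) * real n" using p n by (intro mult_strict_right_mono) auto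
  then have "r < real n" using at by (simp add: r_def divide_less_eq mult.commute)
  note r = r0 this
  have l: "real l \<le> r" "r < real l + 1" "l < n" using r unfolding l_def by linarith+
  have rx: "t - p = a + r * (t - a) / real n" using at n by (simp add: r_def field_simps)
  have x1: "?x l \<le> t - p"
    unfolding rx grid_def using l at n by (intro add_left_mono divide_right_mono mult_right_mono) auto
  have x2: "t - p < ?x (Suc l)"
    unfolding rx grid_def using l at n by (intro add_strict_left_mono divide_strict_right_mono mult_strict_right_mono) auto
  have "young_step n a t g p = g t - g (?x (Suc l))" for g
  proof -
    have ind: "indicator {t - ?x (Suc l')<..t - ?x l'} p = (if l' = l then 1 else (0::real))" for l'
    proof (cases "l' = l")
      case True then show ?thesis using x1 x2 by (auto split: split_indicator)
    next
      case False
      then have "Suc l \<le> l' \<or> Suc l' \<le> l" by auto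
      then have "?x (Suc l) \<le> ?x l' \<or> ?x (Suc l') \<le> ?x l" using grid_mono[of a t _ _ n] at by (meson less_imp_le)
      then show ?thesis using False x1 x2 by (auto split: split_indicator)
    qed
    have "(\<Sum>l'<n. indicator {t - ?x (Suc l')<..t - ?x l'} p * (g t - g (?x (Suc l')))) = g t - g (?x (Suc l))"
      unfolding ind using l(3) by (simp add: if_distrib[of "\<lambda>x. x * _"] cong: if_cong)
    moreover have "\<not> t - a < p" by fact
    ultimately show ?thesis by (simp add: young_step_def)
  qed
  moreover have "?x (Suc l) \<in> {a..t}" using grid_bounds[of a t "Suc l" n] l at n by auto
  moreover have "\<bar>?x (Suc l) - max (t - p) a\<bar> \<le> (t - a) / real n"
    using x1 x2 False unfolding grid_Suc by (auto simp: max_def)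
  ultimately show ?thesis by (intro that[of "?x (Suc l)"])
qed

lemma young_step_bound:
  assumes at: "a < t" and n: "0 < n" and \<theta>: "0 < \<theta>" and B: "\<And>u. u \<in> {a..t} \<Longrightarrow> \<bar>g u\<bar> \<le> B"
  shows "AE p in expo \<theta>. norm (young_step n a t g p) \<le> 2 * B"
  using AE_expo_pos[OF \<theta>]
proof eventually_elim
  fix p :: real assume "0 < p"
  then obtain u where "u \<in> {a..t}" "young_step n a t g p = g t - g u"
    using young_step_value[OF at n] by metis
  then show "norm (young_step n a t g p) \<le> 2 * B"
    using B[of u] B[of t] at by auto
qed

lemma young_sum_bound:
  assumes at: "a < t" and n: "0 < n" and \<theta>: "0 < \<theta>" and B: "\<And>u. u \<in> {a..t} \<Longrightarrow> \<bar>g u\<bar> \<le> B"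
  shows "\<bar>young_sum \<theta> n a t g\<bar> \<le> 2 * B"
proof -
  interpret prob_space "expo \<theta>" by (rule prob_space_expo[OF \<theta>])
  have AE: "AE p in expo \<theta>. norm (young_step n a t g p) \<le> 2 * B" by (rule young_step_bound[OF assms])
  have i: "integrable (expo \<theta>) (young_step n a t g)"
    by (rule integrable_const_bound[OF AE]) auto
  have "\<bar>LINT p|expo \<theta>. young_step n a t g p\<bar> \<le> (LINT p|expo \<theta>. \<bar>young_step n a t g p\<bar>)" by (rule integral_abs_bound)
  also have "\<dots> \<le> (LINT p|expo \<theta>. 2 * B)"
    by (rule integral_mono_AE) (use AE i in auto)
  finally show ?thesis using young_sum_eq_integral[OF \<theta> less_imp_le[OF at] n] prob_space by simp
qed

text \<open>Each rounded point converges to max(t - p, a), and dominated convergence finishes. The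
  functions \<open>G k\<close> may vary with the mesh: in the two-parameter case they are themselves
  Young sums, and \<open>L\<close> expresses their continuous convergence.\<close>

lemma young_sum_limit:
  assumes \<theta>: "0 < \<theta>" and at: "a < t"
    and B: "\<And>k u. u \<in> {a..t} \<Longrightarrow> \<bar>G k u\<bar> \<le> B"
    and L: "\<And>u us. (\<And>k. us k \<in> {a..t}) \<Longrightarrow> us \<longlonglongrightarrow> u \<Longrightarrow> (\<lambda>k. G k (us k)) \<longlonglongrightarrow> L u"
    and [measurable]: "(\<lambda>p. L (max (t - p) a)) \<in> borel_measurable borel"
  shows "(\<lambda>k. young_sum \<theta> (Suc k) a t (G k)) \<longlonglongrightarrow> (LINT p|expo \<theta>. L t - L (max (t - p) a))"
proof -
  interpret prob_space "expo \<theta>" by (rule prob_space_expo[OF \<theta>])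
  have "(\<lambda>k. LINT p|expo \<theta>. young_step (Suc k) a t (G k) p) \<longlonglongrightarrow> (LINT p|expo \<theta>. L t - L (max (t - p) a))"
  proof (rule integral_dominated_convergence[where w="\<lambda>_. 2 * B"])
    show "AE p in expo \<theta>. norm (young_step (Suc k) a t (G k) p) \<le> 2 * B" for k
      by (rule young_step_bound[OF at _ \<theta> B]) auto
    show "AE p in expo \<theta>. (\<lambda>k. young_step (Suc k) a t (G k) p) \<longlonglongrightarrow> L t - L (max (t - p) a)"
      using AE_expo_pos[OF \<theta>]
    proof eventually_elim
      fix p :: real assume p: "0 < p"
      have "\<exists>u. u \<in> {a..t} \<and> \<bar>u - max (t - p) a\<bar> \<le> (t - a) / real (Suc k) \<and> (\<forall>g. young_step (Suc k) a t g p = g t - g u)" for k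
        using young_step_value[OF at _ p, of "Suc k"] by (metis zero_less_Suc)
      then obtain u where u: "\<And>k. u k \<in> {a..t}" "\<And>k. \<bar>u k - max (t - p) a\<bar> \<le> (t - a) / real (Suc k)"
        "\<And>k g. young_step (Suc k) a t g p = g t - g (u k)" by metis
      have "(\<lambda>k. (t - a) / real (Suc k)) \<longlonglongrightarrow> 0"
        by (rule LIMSEQ_Suc) (rule lim_const_over_n)
      then have "(\<lambda>k. u k - max (t - p) a) \<longlonglongrightarrow> 0"
        by (rule Lim_null_comparison[rotated]) (use u(2) in \<open>auto intro: always_eventually\<close>)
      then have "u \<longlonglongrightarrow> max (t - p) a" by (simp add: LIM_zero_iff)
      then have "(\<lambda>k. G k (u k)) \<longlonglongrightarrow> L (max (t - p) a)" by (intro L u)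
      moreover have "(\<lambda>k. G k t) \<longlonglongrightarrow> L t" by (intro L) (use at in auto)
      ultimately show "(\<lambda>k. young_step (Suc k) a t (G k) p) \<longlonglongrightarrow> L t - L (max (t - p) a)"
        unfolding u(3) by (intro tendsto_diff)
    qed
  qed auto
  then show ?thesis using young_sum_eq_integral[OF \<theta> less_imp_le[OF at]] by simp
qed

text \<open>For a process Y with covariance \<open>R\<close>, this is the covariance of
  E_p[Y_t - Y_max(t-p,a)] and E_q[Y_s - Y_max(s-q,a)], where p and q are independent exponential
  variables: the covariance of the Ornstein-Uhlenbeck integrals over [a,t] and [a,s].\<close>

definition ou_cov :: "real \<Rightarrow> (real \<Rightarrow> real \<Rightarrow> real) \<Rightarrow> real \<Rightarrow> real \<Rightarrow> real \<Rightarrow> real" where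
  "ou_cov \<theta> R a t s = (LINT p|expo \<theta>. (LINT q|expo \<theta>. R t s - R t (max (s - q) a))
      - (LINT q|expo \<theta>. R (max (t - p) a) s - R (max (t - p) a) (max (s - q) a)))"

text \<open>The inner sum converges continuously in the first argument of \<open>R\<close>, by the
  one-parameter limit along \<open>R (us k)\<close>, so the outer sum is another instance of that
  limit. Compactness of the rectangle provides the bounds.\<close>

lemma young_sum_iterated_limit:
  assumes \<theta>: "0 < \<theta>" and at: "a < t" "a < s"
    and c: "continuous_on ({a..} \<times> {a..}) (\<lambda>(u, v). R u v)"
    and [measurable]: "(\<lambda>(u, v). R u v) \<in> borel_measurable (borel \<Otimes>\<^sub>M borel)"
  shows "(\<lambda>k. young_sum \<theta> (Suc k) a t (\<lambda>u. young_sum \<theta> (Suc k) a s (R u))) \<longlonglongrightarrow> ou_cov \<theta> R a t s"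
proof -
  interpret prob_space "expo \<theta>" by (rule prob_space_expo[OF \<theta>])
  have "compact ((\<lambda>(u, v). R u v) ` ({a..t} \<times> {a..s}))"
    by (intro compact_continuous_image continuous_on_subset[OF c] compact_Times) auto
  then obtain B where "\<forall>z\<in>(\<lambda>(u, v). R u v) ` ({a..t} \<times> {a..s}). norm z \<le> B"
    using compact_imp_bounded bounded_iff by blast
  then have B: "\<bar>R u v\<bar> \<le> B" if "u \<in> {a..t}" "v \<in> {a..s}" for u v using that by force
  have Rlim: "(\<lambda>k. R (us k) (vs k)) \<longlonglongrightarrow> R u v"
    if "\<And>k. us k \<in> {a..t}" "us \<longlonglongrightarrow> u" "\<And>k. vs k \<in> {a..s}" "vs \<longlonglongrightarrow> v" for us vs u v
  proof -
    have uv: "(u, v) \<in> {a..} \<times> {a..}"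
      using Lim_in_closed_set[OF closed_atLeast _ _ that(2), of a] Lim_in_closed_set[OF closed_atLeast _ _ that(4), of a] that
      by (auto simp: always_eventually)
    have "(\<lambda>k. (\<lambda>(u, v). R u v) (us k, vs k)) \<longlonglongrightarrow> (\<lambda>(u, v). R u v) (u, v)"
      by (rule continuous_on_tendsto_compose[OF c tendsto_Pair[OF that(2,4)] uv]) (use that in \<open>auto intro!: always_eventually\<close>)
    then show ?thesis by simp
  qed
  define G where "G = (\<lambda>u. LINT q|expo \<theta>. R u s - R u (max (s - q) a))"
  have [measurable]: "G \<in> borel_measurable borel" unfolding G_def by measurable
  have inner: "(\<lambda>k. young_sum \<theta> (Suc k) a s (R (us k))) \<longlonglongrightarrow> G u"
    if "\<And>k. us k \<in> {a..t}" "us \<longlonglongrightarrow> u" for us u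
    unfolding G_def by (rule young_sum_limit[OF \<theta> at(2), where B=B]) (use B Rlim that in auto)
  have "(\<lambda>k. young_sum \<theta> (Suc k) a t (\<lambda>u. young_sum \<theta> (Suc k) a s (R u))) \<longlonglongrightarrow> (LINT p|expo \<theta>. G t - G (max (t - p) a))"
    by (rule young_sum_limit[OF \<theta> at(1), where B="2 * B"]) (use inner young_sum_bound[OF at(2) _ \<theta> B] in auto)
  then show ?thesis by (simp add: ou_cov_def G_def)
qed

context centred_gaussian begin

lemma young_sum_lcomb:
  assumes "a \<le> t" "{a..t} \<subseteq> T"
  shows "(\<lambda>\<omega>. young_sum \<theta> n a t (\<lambda>u. Y u \<omega>)) \<in> lcomb Y T"
  unfolding young_sum_def
proof (intro lcomb_sum lcomb_scale lcomb_diff lcomb_single)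
  fix l assume "l \<in> {..<n}"
  then show "grid n a t (Suc l) \<in> T" "grid n a t l \<in> T"
    using grid_bounds[OF assms(1), of "Suc l" n] grid_bounds[OF assms(1), of l n] assms(2) by auto
qed auto

lemma young_sum_covariance:
  assumes "a \<le> t" "{a..t} \<subseteq> T" "a' \<le> s" "{a'..s} \<subseteq> T"
  shows "(LINT \<omega>|M. young_sum \<theta> n a t (\<lambda>u. Y u \<omega>) * young_sum \<theta> n' a' s (\<lambda>u. Y u \<omega>)) = young_sum \<theta> n a t (\<lambda>u. young_sum \<theta> n' a' s (R u))"
proof -
  let ?x = "grid n a t" and ?y = "grid n' a' s"
  have x: "?x l \<in> T" if "l \<le> n" "0 < n" for l using grid_bounds[OF assms(1) that] assms(2) by auto
  have y: "?y l \<in> T" if "l \<le> n'" "0 < n'" for l using grid_bounds[OF assms(3) that] assms(4) by auto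
  have R: "(LINT \<omega>|M. Y u \<omega> * Y v \<omega>) = R u v" if "u \<in> T" "v \<in> T" for u v
    using ccg that by (auto simp: continuous_centred_gaussian_def)
  have i: "integrable M (\<lambda>\<omega>. Y u \<omega> * Y v \<omega>)" if "u \<in> T" "v \<in> T" for u v
    using that by (intro lcomb_mult_integrable lcomb_single)
  have ii: "integrable M (\<lambda>\<omega>. (Y u \<omega> - Y u' \<omega>) * (Y v \<omega> - Y v' \<omega>))" if "u \<in> T" "v \<in> T" "u' \<in> T" "v' \<in> T" for u v u' v'
    using that by (intro lcomb_mult_integrable lcomb_diff lcomb_single)
  have E: "(LINT \<omega>|M. (Y u \<omega> - Y u' \<omega>) * (Y v \<omega> - Y v' \<omega>)) = R u v - R u v' - (R u' v - R u' v')"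
    if "u \<in> T" "v \<in> T" "u' \<in> T" "v' \<in> T" for u v u' v'
  proof -
    have "(LINT \<omega>|M. (Y u \<omega> - Y u' \<omega>) * (Y v \<omega> - Y v' \<omega>)) = (LINT \<omega>|M. Y u \<omega> * Y v \<omega> - Y u \<omega> * Y v' \<omega> - (Y u' \<omega> * Y v \<omega> - Y u' \<omega> * Y v' \<omega>))"
      by (intro Bochner_Integration.integral_cong) (auto simp: algebra_simps)
    then show ?thesis using that i by (simp add: R)
  qed
  have "(LINT \<omega>|M. young_sum \<theta> n a t (\<lambda>u. Y u \<omega>) * young_sum \<theta> n' a' s (\<lambda>u. Y u \<omega>)) =
    (LINT \<omega>|M. (\<Sum>l<n. \<Sum>m<n'. (exp (\<theta> * (?x l - t)) * exp (\<theta> * (?y m - s))) *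
       ((Y (?x (Suc l)) \<omega> - Y (?x l) \<omega>) * (Y (?y (Suc m)) \<omega> - Y (?y m) \<omega>))))"
    unfolding young_sum_def sum_product by (simp add: mult_ac)
  also have "\<dots> = (\<Sum>l<n. \<Sum>m<n'. (exp (\<theta> * (?x l - t)) * exp (\<theta> * (?y m - s))) *
       (LINT \<omega>|M. (Y (?x (Suc l)) \<omega> - Y (?x l) \<omega>) * (Y (?y (Suc m)) \<omega> - Y (?y m) \<omega>)))"
    using ii x y
    by (subst Bochner_Integration.integral_sum, intro Bochner_Integration.integrable_sum integrable_mult_right ii)
       (auto intro!: sum.cong simp: Bochner_Integration.integral_sum)
  also have "\<dots> = (\<Sum>l<n. \<Sum>m<n'. (exp (\<theta> * (?x l - t)) * exp (\<theta> * (?y m - s))) *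
       (R (?x (Suc l)) (?y (Suc m)) - R (?x (Suc l)) (?y m) - (R (?x l) (?y (Suc m)) - R (?x l) (?y m))))"
    using x y by (intro sum.cong refl arg_cong2[where f="(*)"] E) auto
  also have "\<dots> = young_sum \<theta> n a t (\<lambda>u. young_sum \<theta> n' a' s (R u))"
    unfolding young_sum_def sum_subtractf[symmetric] sum_distrib_left by (intro sum.cong refl) (simp add: algebra_simps)
  finally show ?thesis .
qed

text \<open>At a fixed mesh the Young sums lie in the linear span of the process, hence form a
  Gaussian vector, and their covariance is a double Young sum of \<open>R\<close>. Both converge as
  the mesh shrinks.\<close>

lemma young_OU_gaussian_vector:
  assumes \<theta>: "0 < \<theta>" and I: "finite I" "\<And>t. t \<in> I \<Longrightarrow> a < t" and T: "{a..} \<subseteq> T"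
    and c: "continuous_on ({a..} \<times> {a..}) (\<lambda>(u, v). R u v)"
    and R: "(\<lambda>(u, v). R u v) \<in> borel_measurable (borel \<Otimes>\<^sub>M borel)"
    and X: "\<And>t. t \<in> I \<Longrightarrow> X t \<in> borel_measurable M"
    and lim: "\<And>t. t \<in> I \<Longrightarrow> AE \<omega> in M. (\<lambda>k. young_sum \<theta> (Suc k) a t (\<lambda>u. Y u \<omega>)) \<longlonglongrightarrow> X t \<omega>"
  shows "gaussian_vector M I (ou_cov \<theta> R a) X"
proof (rule gaussian_vector_limit[where X="\<lambda>k t \<omega>. young_sum \<theta> (Suc k) a t (\<lambda>u. Y u \<omega>)"])
  have T': "{a..t} \<subseteq> T" for t using T by auto
  show "gaussian_vector M I (\<lambda>t s. LINT \<omega>|M. young_sum \<theta> (Suc k) a t (\<lambda>u. Y u \<omega>) * young_sum \<theta> (Suc k) a s (\<lambda>u. Y u \<omega>))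
     (\<lambda>t \<omega>. young_sum \<theta> (Suc k) a t (\<lambda>u. Y u \<omega>))" for k
    using I T' by (intro lcomb_gaussian_vector young_sum_lcomb) (auto simp: less_imp_le)
  fix t s assume ts: "t \<in> I" "s \<in> I"
  have "(\<lambda>k. LINT \<omega>|M. young_sum \<theta> (Suc k) a t (\<lambda>u. Y u \<omega>) * young_sum \<theta> (Suc k) a s (\<lambda>u. Y u \<omega>))
     = (\<lambda>k. young_sum \<theta> (Suc k) a t (\<lambda>u. young_sum \<theta> (Suc k) a s (R u)))"
    using I(2)[OF ts(1)] I(2)[OF ts(2)] T' by (intro ext young_sum_covariance) auto
  then show "(\<lambda>k. LINT \<omega>|M. young_sum \<theta> (Suc k) a t (\<lambda>u. Y u \<omega>) * young_sum \<theta> (Suc k) a s (\<lambda>u. Y u \<omega>)) \<longlonglongrightarrow> ou_cov \<theta> R a t s"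
    using young_sum_iterated_limit[OF \<theta> I(2)[OF ts(1)] I(2)[OF ts(2)] c R] by simp
qed (use X lim in auto)

end

lemma young_young_sum_limit:
  assumes "has_young_integral (\<lambda>s. exp (\<theta> * s)) g a t J" "a < t"
  shows "(\<lambda>k. young_sum \<theta> (Suc k) a t g) \<longlonglongrightarrow> exp (- \<theta> * t) * J"
proof -
  have "young_sum \<theta> n a t g = exp (- \<theta> * t) * (\<Sum>l<n. exp (\<theta> * grid n a t l) * (g (grid n a t (Suc l)) - g (grid n a t l)))" for n
    unfolding young_sum_def sum_distrib_left
    by (intro sum.cong refl) (simp add: right_diff_distrib exp_diff exp_minus field_simps)
  then have "(\<lambda>n. young_sum \<theta> n a t g) \<longlonglongrightarrow> exp (- \<theta> * t) * J"
    using tendsto_mult_left[OF young_grid_limit[OF assms]] by simp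
  then show ?thesis by (rule LIMSEQ_Suc)
qed

section \<open>Asymptotics of the covariances\<close>

definition abs_pow :: "real \<Rightarrow> real \<Rightarrow> real" where "abs_pow H x = \<bar>x\<bar> powr (2 * H)"

definition mixed_diff :: "real \<Rightarrow> real \<Rightarrow> real \<Rightarrow> real \<Rightarrow> real" where
  "mixed_diff H x \<alpha> \<beta> = abs_pow H (x + \<alpha> + \<beta>) - abs_pow H (x + \<alpha>) - abs_pow H (x + \<beta>) + abs_pow H x"

lemma abs_pow_measurable [measurable]: "abs_pow H \<in> borel_measurable borel"
  unfolding abs_pow_def by measurable

lemma abs_pow_nonneg: "0 \<le> abs_pow H x" by (simp add: abs_pow_def)

lemma abs_pow_even: "abs_pow H (- x) = abs_pow H x" by (simp add: abs_pow_def)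

lemma abs_pow_le_square:
  assumes "0 < H" "H < 1" "\<bar>x\<bar> \<le> y" "1 \<le> y"
  shows "abs_pow H x \<le> y\<^sup>2"
proof -
  have "abs_pow H x \<le> y powr (2 * H)" unfolding abs_pow_def using assms by (intro powr_mono2) auto
  also have "\<dots> \<le> y powr 2" using assms by (intro powr_mono) auto
  finally show ?thesis using assms by simp
qed

text \<open>If w = |\<alpha>| + |\<beta>| is at most x/2, all arguments lie in [x/2, 3x/2], where
  the third derivative of y^(2H) is O(x^(2H-3)), and three mean value estimates bound the remainder.
  Otherwise every term is O(w^2), and inserting (2w/x)^3, which is at least 1, buys the factor
  x^(-3); hence the fifth power.\<close>

lemma mixed_diff_expansion:
  assumes H: "0 < H" "H < 1"
  obtains C where "0 \<le> C" "\<And>x \<alpha> \<beta>. 1 \<le> x \<Longrightarrow>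
    \<bar>mixed_diff H x \<alpha> \<beta> - \<alpha> * \<beta> * (2 * H * (2 * H - 1) * x powr (2 * H - 2))\<bar> \<le> C * (1 + \<bar>\<alpha>\<bar> + \<bar>\<beta>\<bar>) ^ 5 * x powr (2 * H - 3)"
proof -
  define a where "a = 2 * H"
  have a: "0 < a" "a < 2" using H by (auto simp: a_def)
  define g1 where "g1 = (\<lambda>y::real. a * y powr (a - 1))"
  define g2 where "g2 = (\<lambda>y::real. a * (a - 1) * y powr (a - 2))"
  define g3 where "g3 = (\<lambda>y::real. a * (a - 1) * (a - 2) * y powr (a - 3))"
  have d0: "((\<lambda>y. y powr a) has_real_derivative g1 y) (at y)" if "y > 0" for y
    using that unfolding g1_def by (auto intro!: derivative_eq_intros)
  have d1: "(g1 has_real_derivative g2 y) (at y)" if "y > 0" for y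
    unfolding g1_def g2_def using that by (auto intro!: derivative_eq_intros simp: diff_diff_eq)
  have d2: "(g2 has_real_derivative g3 y) (at y)" if "y > 0" for y
    unfolding g2_def g3_def using that by (auto intro!: derivative_eq_intros simp: diff_diff_eq)
  \<comment> \<open>The exponent a - 3 is negative, so |g3| on [x/2, 3x/2] is largest at the left
    end; after removal of x^(a-3) the factor (1/2)^(a-3) remains.\<close>
  define c3 where "c3 = \<bar>a * (a - 1) * (a - 2)\<bar> * (1/2) powr (a - 3)"
  have c3: "0 \<le> c3" by (simp add: c3_def)
  show thesis
  \<comment> \<open>\<open>c3\<close> serves the Taylor regime; 304 = 38 * 2^3 serves the crude
    one.\<close>
  proof (rule that[of "c3 + 304"])
    fix x \<alpha> \<beta> :: real assume x: "1 \<le> x"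
    define w where "w = \<bar>\<alpha>\<bar> + \<bar>\<beta>\<bar>"
    have w: "0 \<le> w" by (simp add: w_def)
    have g2x: "2 * H * (2 * H - 1) * x powr (2 * H - 2) = g2 x" by (simp add: g2_def a_def)
    have weight: "w ^ 5 \<le> (1 + w) ^ 5" using w by (intro power_mono) auto
    show "\<bar>mixed_diff H x \<alpha> \<beta> - \<alpha> * \<beta> * (2 * H * (2 * H - 1) * x powr (2 * H - 2))\<bar> \<le> (c3 + 304) * (1 + \<bar>\<alpha>\<bar> + \<bar>\<beta>\<bar>) ^ 5 * x powr (2 * H - 3)"
    proof (cases "w \<le> x / 2")
      case True
      let ?S = "{x / 2..3 * x / 2}"
      have pos: "y > 0" if "y \<in> ?S" for y using that x by auto
      define c where "c = c3 * x powr (a - 3)"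
      have c: "0 \<le> c" using c3 by (simp add: c_def)
      have g3b: "\<bar>g3 y\<bar> \<le> c" if "y \<in> ?S" for y
      proof -
        have "y powr (a - 3) \<le> (1/2 * x) powr (a - 3)" using that x a by (intro powr_mono2') auto
        also have "\<dots> = (1/2) powr (a - 3) * x powr (a - 3)" using x by (subst powr_mult) auto
        finally have "\<bar>a * (a - 1) * (a - 2)\<bar> * y powr (a - 3) \<le> \<bar>a * (a - 1) * (a - 2)\<bar> * ((1/2) powr (a - 3) * x powr (a - 3))"
          by (intro mult_left_mono) auto
        then show ?thesis by (simp add: g3_def c_def c3_def abs_mult mult.assoc)
      qed
      have g2d: "\<bar>g2 y - g2 x\<bar> \<le> c * w" if "y \<in> ?S" "\<bar>y - x\<bar> \<le> w" for y
      proof -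
        have "norm (g2 y - g2 x) \<le> c * norm (y - x)"
        proof (rule field_differentiable_bound[where S="?S" and f'=g3])
          show "(g2 has_real_derivative g3 z) (at z within ?S)" if "z \<in> ?S" for z
            by (rule has_field_derivative_at_within[OF d2[OF pos[OF that]]])
        qed (use g3b that x in auto)
        also have "\<dots> \<le> c * w" using c that by (intro mult_left_mono) auto
        finally show ?thesis by simp
      qed
      have g1d: "\<bar>g1 (x + \<tau> + \<beta>) - g1 (x + \<tau>) - \<beta> * g2 x\<bar> \<le> c * w * \<bar>\<beta>\<bar>" if \<tau>: "\<bar>\<tau>\<bar> \<le> \<bar>\<alpha>\<bar>" for \<tau>
      proof -
        let ?f = "\<lambda>\<sigma>. g1 (x + \<tau> + \<sigma>) - \<sigma> * g2 x"
        have "norm (?f \<beta> - ?f 0) \<le> (c * w) * norm (\<beta> - 0)"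
        proof (rule field_differentiable_bound[where S="{-\<bar>\<beta>\<bar>..\<bar>\<beta>\<bar>}" and f'="\<lambda>\<sigma>. g2 (x + \<tau> + \<sigma>) - g2 x"])
          fix \<sigma> assume "\<sigma> \<in> {-\<bar>\<beta>\<bar>..\<bar>\<beta>\<bar>}"
          then have \<sigma>: "\<bar>\<tau>\<bar> + \<bar>\<sigma>\<bar> \<le> w" using \<tau> by (auto simp: w_def)
          have "-\<bar>\<tau>\<bar> \<le> \<tau>" "-\<bar>\<sigma>\<bar> \<le> \<sigma>" "\<tau> \<le> \<bar>\<tau>\<bar>" "\<sigma> \<le> \<bar>\<sigma>\<bar>" by auto
          then have S: "x + \<tau> + \<sigma> \<in> ?S" using True \<sigma> unfolding atLeastAtMost_iff by linarith
          have "((\<lambda>\<sigma>. g1 (x + \<tau> + \<sigma>)) has_real_derivative g2 (x + \<tau> + \<sigma>) * 1) (at \<sigma>)"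
            by (rule DERIV_chain2[where f=g1 and g="\<lambda>\<sigma>. x + \<tau> + \<sigma>", OF d1[OF pos[OF S]]]) (auto intro!: derivative_eq_intros)
          from DERIV_diff[OF this DERIV_cmult_right[OF DERIV_ident[of "at \<sigma>"], of "g2 x"]]
          show "(?f has_real_derivative g2 (x + \<tau> + \<sigma>) - g2 x) (at \<sigma> within {-\<bar>\<beta>\<bar>..\<bar>\<beta>\<bar>})"
            by (auto intro: has_field_derivative_at_within)
          show "norm (g2 (x + \<tau> + \<sigma>) - g2 x) \<le> c * w"
            using g2d[OF S] \<sigma> by simp
        qed auto
        then show ?thesis by simp
      qed
      \<comment> \<open>\<open>h \<alpha> - h 0\<close> is the mixed difference minus its bilinear
        leading term, and \<open>g1d\<close> bounds the derivative of \<open>h\<close>.\<close>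
      define h where "h = (\<lambda>\<tau>. (x + \<tau> + \<beta>) powr a - (x + \<tau>) powr a - \<tau> * (\<beta> * g2 x))"
      have "norm (h \<alpha> - h 0) \<le> (c * w * \<bar>\<beta>\<bar>) * norm (\<alpha> - 0)"
      proof (rule field_differentiable_bound[where S="{-\<bar>\<alpha>\<bar>..\<bar>\<alpha>\<bar>}" and f'="\<lambda>\<tau>. g1 (x + \<tau> + \<beta>) - g1 (x + \<tau>) - \<beta> * g2 x"])
        fix \<tau> assume "\<tau> \<in> {-\<bar>\<alpha>\<bar>..\<bar>\<alpha>\<bar>}"
        then have \<tau>: "\<bar>\<tau>\<bar> \<le> \<bar>\<alpha>\<bar>" by auto
        have "-\<bar>\<tau>\<bar> \<le> \<tau>" "-\<bar>\<beta>\<bar> \<le> \<beta>" by auto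
        then have S: "x + \<tau> + \<beta> > 0" "x + \<tau> > 0" using True x \<tau> unfolding w_def by linarith+
        have "((\<lambda>\<tau>. (x + \<tau> + \<beta>) powr a) has_real_derivative g1 (x + \<tau> + \<beta>) * 1) (at \<tau>)"
          by (rule DERIV_chain2[where f="\<lambda>y. y powr a" and g="\<lambda>\<tau>. x + \<tau> + \<beta>", OF d0[OF S(1)]]) (auto intro!: derivative_eq_intros)
        note D1 = this
        have "((\<lambda>\<tau>. (x + \<tau>) powr a) has_real_derivative g1 (x + \<tau>) * 1) (at \<tau>)"
          by (rule DERIV_chain2[where f="\<lambda>y. y powr a" and g="\<lambda>\<tau>. x + \<tau>", OF d0[OF S(2)]]) (auto intro!: derivative_eq_intros)
        from DERIV_diff[OF DERIV_diff[OF D1 this] DERIV_cmult_right[OF DERIV_ident, of "\<beta> * g2 x"]]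
        show "(h has_real_derivative g1 (x + \<tau> + \<beta>) - g1 (x + \<tau>) - \<beta> * g2 x) (at \<tau> within {-\<bar>\<alpha>\<bar>..\<bar>\<alpha>\<bar>})"
          unfolding h_def by (auto intro: has_field_derivative_at_within)
        show "norm (g1 (x + \<tau> + \<beta>) - g1 (x + \<tau>) - \<beta> * g2 x) \<le> c * w * \<bar>\<beta>\<bar>" using g1d[OF \<tau>] by simp
      qed auto
      moreover have "mixed_diff H x \<alpha> \<beta> - \<alpha> * \<beta> * g2 x = h \<alpha> - h 0"
      proof -
        have "-\<bar>\<alpha>\<bar> \<le> \<alpha>" "-\<bar>\<beta>\<bar> \<le> \<beta>" by auto
        then have "x + \<alpha> + \<beta> > 0" "x + \<alpha> > 0" "x + \<beta> > 0" using True x unfolding w_def by linarith+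
        then show ?thesis using x by (simp add: mixed_diff_def abs_pow_def h_def a_def)
      qed
      ultimately have "\<bar>mixed_diff H x \<alpha> \<beta> - \<alpha> * \<beta> * g2 x\<bar> \<le> c * w * \<bar>\<beta>\<bar> * \<bar>\<alpha>\<bar>" by simp
      also have "\<dots> \<le> c * w * w * w" using c w by (intro mult_mono) (auto simp: w_def)
      also have "\<dots> = c * w ^ 3" by (simp add: power3_eq_cube)
      also have "\<dots> \<le> c * (1 + w) ^ 5"
      proof (rule mult_left_mono[OF _ c])
        have "w ^ 3 \<le> (1 + w) ^ 3" using w by (intro power_mono) auto
        also have "\<dots> \<le> (1 + w) ^ 5" using w by (intro power_increasing) auto
        finally show "w ^ 3 \<le> (1 + w) ^ 5" .
      qed
      also have "\<dots> \<le> (c3 + 304) * (1 + w) ^ 5 * x powr (a - 3)"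
        using mult_right_mono[of c3 "c3 + 304" "(1 + w) ^ 5 * x powr (a - 3)"] w unfolding c_def by (simp add: mult_ac)
      finally show ?thesis unfolding g2x by (simp add: w_def a_def add.assoc)
    next
      case False
      then have xw: "x < 2 * w" "1 / 2 < w" using x by auto
      have ap: "abs_pow H y \<le> (3 * w)\<^sup>2" if "\<bar>y\<bar> \<le> x + w" for y
        by (rule abs_pow_le_square[OF H]) (use that xw in auto)
      have "abs_pow H (x + \<alpha> + \<beta>) \<le> (3 * w)\<^sup>2" "abs_pow H (x + \<alpha>) \<le> (3 * w)\<^sup>2" "abs_pow H (x + \<beta>) \<le> (3 * w)\<^sup>2" "abs_pow H x \<le> (3 * w)\<^sup>2"
        using x unfolding w_def by (intro ap[unfolded w_def]; linarith)+
      then have s: "\<bar>mixed_diff H x \<alpha> \<beta>\<bar> \<le> 18 * w\<^sup>2"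
        using abs_pow_nonneg[of H "x + \<alpha> + \<beta>"] abs_pow_nonneg[of H "x + \<alpha>"] abs_pow_nonneg[of H "x + \<beta>"] abs_pow_nonneg[of H x]
        unfolding mixed_diff_def power_mult_distrib by (simp add: abs_le_iff)
      have "\<bar>g2 x\<bar> \<le> 2"
      proof -
        have "x powr (a - 2) \<le> x powr 0" using x a by (intro powr_mono) auto
        then have "\<bar>a\<bar> * \<bar>a - 1\<bar> * x powr (a - 2) \<le> 2 * 1 * 1" using a x by (intro mult_mono) auto
        then show ?thesis by (simp add: g2_def abs_mult)
      qed
      then have "\<bar>\<alpha>\<bar> * \<bar>\<beta>\<bar> * \<bar>g2 x\<bar> \<le> w * w * 2" using w by (intro mult_mono) (auto simp: w_def)
      then have "\<bar>mixed_diff H x \<alpha> \<beta> - \<alpha> * \<beta> * g2 x\<bar> \<le> 38 * w\<^sup>2"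
        using s abs_triangle_ineq4[of "mixed_diff H x \<alpha> \<beta>" "\<alpha> * \<beta> * g2 x"] zero_le_power2[of w]
        unfolding abs_mult power2_eq_square by linarith
      also have "\<dots> \<le> 38 * w\<^sup>2 * (2 * w / x) ^ 3"
      proof -
        have "1 \<le> (2 * w / x) ^ 3" using xw x by (intro one_le_power) (auto simp: field_simps)
        then show ?thesis by (simp add: mult_le_cancel_left1)
      qed
      also have "\<dots> = 304 * w ^ 5 * (1 / x ^ 3)"
        by (simp add: power_divide power_mult_distrib eval_nat_numeral)
      also have "1 / x ^ 3 = x powr (- 3)"
        using x by (simp add: powr_minus_divide)
      also have "304 * w ^ 5 * x powr (- 3) \<le> (c3 + 304) * (1 + w) ^ 5 * x powr (a - 3)"
        using weight w c3 x a by (intro mult_mono powr_mono) auto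
      finally show ?thesis unfolding g2x by (simp add: w_def a_def add.assoc)
    qed
  qed (use c3 in auto)
qed

text \<open>At H = 1/2 the value 2H - 2 = -1 would make the sums of d^b grow logarithmically; -2 is
  the remainder exponent 2H - 3 at this point.\<close>

definition decay_exp :: "real \<Rightarrow> real" where "decay_exp H = (if H = 1 / 2 then - 2 else 2 * H - 2)"

lemma decay_exp_neg: "H < 1 \<Longrightarrow> decay_exp H < 0" by (simp add: decay_exp_def)

lemma mixed_diff_bound:
  assumes H: "0 < H" "H < 1"
  obtains C where "0 \<le> C" "\<And>x \<alpha> \<beta>. 1 \<le> x \<Longrightarrow> \<bar>mixed_diff H x \<alpha> \<beta>\<bar> \<le> C * (1 + \<bar>\<alpha>\<bar> + \<bar>\<beta>\<bar>) ^ 5 * x powr decay_exp H"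
proof -
  obtain C where C: "0 \<le> C" "\<And>x \<alpha> \<beta>. 1 \<le> x \<Longrightarrow>
    \<bar>mixed_diff H x \<alpha> \<beta> - \<alpha> * \<beta> * (2 * H * (2 * H - 1) * x powr (2 * H - 2))\<bar> \<le> C * (1 + \<bar>\<alpha>\<bar> + \<bar>\<beta>\<bar>) ^ 5 * x powr (2 * H - 3)"
    using mixed_diff_expansion[OF H] by blast
  show thesis
  proof (rule that[of "C + 2"])
    fix x \<alpha> \<beta> :: real assume x: "1 \<le> x"
    define w where "w = \<bar>\<alpha>\<bar> + \<bar>\<beta>\<bar>"
    have w: "0 \<le> w" by (simp add: w_def)
    \<comment> \<open>Both exponents are -2 at H = 1/2; elsewhere they differ by 1.\<close>
    have 1: "x powr (2 * H - 3) \<le> x powr decay_exp H" using x H by (intro powr_mono) (auto simp: decay_exp_def)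
    have 2: "\<bar>\<alpha> * \<beta> * (2 * H * (2 * H - 1) * x powr (2 * H - 2))\<bar> \<le> 2 * (1 + w) ^ 5 * x powr decay_exp H"
    proof (cases "H = 1 / 2")
      case True show ?thesis unfolding True using w by simp
    next
      case False
      have "\<bar>\<alpha>\<bar> * \<bar>\<beta>\<bar> \<le> (1 + w) * (1 + w)" using w by (intro mult_mono) (auto simp: w_def)
      also have "\<dots> = (1 + w) ^ 2" by (simp add: power2_eq_square)
      also have "\<dots> \<le> (1 + w) ^ 5" using w by (intro power_increasing) auto
      finally have 3: "\<bar>\<alpha>\<bar> * \<bar>\<beta>\<bar> \<le> (1 + w) ^ 5" .
      have "\<bar>\<alpha>\<bar> * \<bar>\<beta>\<bar> * ((\<bar>2 * H\<bar> * \<bar>2 * H - 1\<bar>) * x powr (2 * H - 2)) \<le> (1 + w) ^ 5 * ((2 * 1) * x powr (2 * H - 2))"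
        using H w by (intro mult_mono mult_right_mono 3) auto
      moreover have "\<bar>\<alpha> * \<beta> * (2 * H * (2 * H - 1) * x powr (2 * H - 2))\<bar>
         = \<bar>\<alpha>\<bar> * \<bar>\<beta>\<bar> * ((\<bar>2 * H\<bar> * \<bar>2 * H - 1\<bar>) * x powr (2 * H - 2))"
        unfolding abs_mult by simp
      moreover have "decay_exp H = 2 * H - 2" using False by (simp add: decay_exp_def)
      ultimately show ?thesis by (simp only: mult_1_right mult_ac)
    qed
    have "C * (1 + \<bar>\<alpha>\<bar> + \<bar>\<beta>\<bar>) ^ 5 * x powr (2 * H - 3) \<le> C * (1 + w) ^ 5 * x powr decay_exp H"
      using C(1) w 1 by (intro mult_mono) (auto simp: w_def add.assoc)
    then have "\<bar>mixed_diff H x \<alpha> \<beta>\<bar> \<le> C * (1 + w) ^ 5 * x powr decay_exp H + 2 * (1 + w) ^ 5 * x powr decay_exp H"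
      using C(2)[OF x, of \<alpha> \<beta>] 2 by linarith
    then show "\<bar>mixed_diff H x \<alpha> \<beta>\<bar> \<le> (C + 2) * (1 + \<bar>\<alpha>\<bar> + \<bar>\<beta>\<bar>) ^ 5 * x powr decay_exp H"
      by (simp add: w_def algebra_simps)
  qed (use C in auto)
qed

section \<open>Expectations over two independent exponential variables\<close>

abbreviation expo2 :: "real \<Rightarrow> (real \<times> real) measure" where "expo2 \<theta> \<equiv> expo \<theta> \<Otimes>\<^sub>M expo \<theta>"

lemma pair_sigma_finite_expo: "0 < \<theta> \<Longrightarrow> pair_sigma_finite (expo \<theta>) (expo \<theta>)"
  using prob_space_expo by (auto simp: pair_sigma_finite_def intro: prob_space_imp_sigma_finite)

lemma expo_distributed: "0 < \<theta> \<Longrightarrow> distributed (expo \<theta>) lborel (\<lambda>p. p) (exponential_density \<theta>)"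
  by (auto simp: distributed_def intro!: distr_id2)

lemma expo_power_integrable:
  assumes "0 < \<theta>"
  shows "integrable (expo \<theta>) (\<lambda>p. p ^ k)"
  using prob_space.erlang_ith_moment_integrable[OF prob_space_expo[OF assms] assms expo_distributed[OF assms]] .

lemma expo_poly_integrable:
  assumes "0 < \<theta>"
  shows "integrable (expo \<theta>) (\<lambda>p. (1 + p) ^ k)"
  unfolding binomial_ring
  using expo_power_integrable[OF assms] by (auto intro!: Bochner_Integration.integrable_sum)

lemma expo_mean: "0 < \<theta> \<Longrightarrow> (LINT p|expo \<theta>. p) = 1 / \<theta>"
  using prob_space.exponential_distributed_expectation[OF prob_space_expo _ expo_distributed] by auto

lemma sets_expo2 [measurable_cong]: "sets (expo2 \<theta>) = sets (borel \<Otimes>\<^sub>M borel)"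
  by (intro sets_pair_measure_cong) auto

lemma expo2_product:
  assumes \<theta>: "0 < \<theta>" and u: "integrable (expo \<theta>) u" and v: "integrable (expo \<theta>) v"
  shows "integrable (expo2 \<theta>) (\<lambda>(p, q). u p * v q :: real)"
    and "(LINT z|expo2 \<theta>. (case z of (p, q) \<Rightarrow> u p * v q)) = (LINT p|expo \<theta>. u p) * (LINT q|expo \<theta>. v q)"
proof -
  interpret pair_sigma_finite "expo \<theta>" "expo \<theta>" by (rule pair_sigma_finite_expo[OF \<theta>])
  have [measurable]: "u \<in> borel_measurable (expo \<theta>)" "v \<in> borel_measurable (expo \<theta>)" using u v by auto
  show *: "integrable (expo2 \<theta>) (\<lambda>(p, q). u p * v q)"
    by (rule Fubini_integrable) (use u v in \<open>auto simp: abs_mult\<close>)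
  show "(LINT z|expo2 \<theta>. (case z of (p, q) \<Rightarrow> u p * v q)) = (LINT p|expo \<theta>. u p) * (LINT q|expo \<theta>. v q)"
    using integral_fst[OF *] u v by simp
qed

text \<open>The product dominates (1 + p + q)^5 for positive p and q, while its integral factorises
  over the two exponential laws.\<close>

definition weight :: "real \<times> real \<Rightarrow> real" where "weight z = (1 + fst z) ^ 5 * (1 + snd z) ^ 5"

definition weight_mass :: "real \<Rightarrow> real" where "weight_mass \<theta> = (LINT z|expo2 \<theta>. weight z)"

lemma weight_integrable: "0 < \<theta> \<Longrightarrow> integrable (expo2 \<theta>) weight"
  using expo2_product(1)[OF _ expo_poly_integrable expo_poly_integrable, of \<theta> 5 5]
  by (simp add: weight_def[abs_def] case_prod_unfold)

lemma AE_expo2_pos: 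
  assumes \<theta>: "0 < \<theta>" shows "AE z in expo2 \<theta>. 0 < fst z \<and> 0 < snd z"
proof -
  interpret pair_sigma_finite "expo \<theta>" "expo \<theta>" by (rule pair_sigma_finite_expo[OF \<theta>])
  show ?thesis
  proof (rule AE_pair_measure)
    show "{z \<in> space (expo2 \<theta>). 0 < fst z \<and> 0 < snd z} \<in> sets (expo2 \<theta>)" by measurable
    show "AE p in expo \<theta>. AE q in expo \<theta>. 0 < fst (p, q) \<and> 0 < snd (p, q)"
      using AE_expo_pos[OF \<theta>] by eventually_elim (use AE_expo_pos[OF \<theta>] in auto)
  qed
qed

lemma weight_mass_nonneg: "0 < \<theta> \<Longrightarrow> 0 \<le> weight_mass \<theta>"
  unfolding weight_mass_def
proof (rule integral_nonneg_AE)
  assume "0 < \<theta>"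
  from AE_expo2_pos[OF this] show "AE z in expo2 \<theta>. 0 \<le> weight z"
    by eventually_elim (simp add: weight_def)
qed

lemma expo2_bounded:
  fixes f :: "real \<times> real \<Rightarrow> real"
  assumes \<theta>: "0 < \<theta>" and [measurable]: "f \<in> borel_measurable (borel \<Otimes>\<^sub>M borel)"
    and b: "\<And>p q. 0 < p \<Longrightarrow> 0 < q \<Longrightarrow> \<bar>f (p, q)\<bar> \<le> C * weight (p, q)"
  shows "integrable (expo2 \<theta>) f" and "\<bar>LINT z|expo2 \<theta>. f z\<bar> \<le> C * weight_mass \<theta>"
proof -
  have AE: "AE z in expo2 \<theta>. \<bar>f z\<bar> \<le> C * weight z"
    using AE_expo2_pos[OF \<theta>] by eventually_elim (use b in auto)
  have w: "integrable (expo2 \<theta>) (\<lambda>z. C * weight z)" using weight_integrable[OF \<theta>] by auto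
  show i: "integrable (expo2 \<theta>) f"
    by (rule Bochner_Integration.integrable_bound[OF w]) (use AE in \<open>auto elim!: eventually_mono\<close>)
  have "\<bar>LINT z|expo2 \<theta>. f z\<bar> \<le> (LINT z|expo2 \<theta>. \<bar>f z\<bar>)" by (rule integral_abs_bound)
  also have "\<dots> \<le> (LINT z|expo2 \<theta>. C * weight z)" by (rule integral_mono_AE) (use i w AE in auto)
  finally show "\<bar>LINT z|expo2 \<theta>. f z\<bar> \<le> C * weight_mass \<theta>" by (simp add: weight_mass_def)
qed

lemma quad_le_weight:
  assumes "0 < p" "0 < q" "0 \<le> c" "0 \<le> x" "x \<le> 1 + c + p + q"
  shows "x\<^sup>2 \<le> (1 + c)\<^sup>2 * weight (p, q)"
proof -
  have "x \<le> (1 + c) * ((1 + p) * (1 + q))"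
  proof -
    have "0 \<le> p * q" "0 \<le> c * (p + q + p * q)" using assms by auto
    moreover have "(1 + c) * ((1 + p) * (1 + q)) = 1 + c + p + q + p * q + c * (p + q + p * q)"
      by (simp add: algebra_simps)
    ultimately show ?thesis using assms(5) by linarith
  qed
  then have "x\<^sup>2 \<le> ((1 + c) * ((1 + p) * (1 + q)))\<^sup>2" using assms by (intro power_mono) auto
  also have "\<dots> = (1 + c)\<^sup>2 * ((1 + p) ^ 2 * (1 + q) ^ 2)" by (simp add: power_mult_distrib)
  also have "\<dots> \<le> (1 + c)\<^sup>2 * ((1 + p) ^ 5 * (1 + q) ^ 5)"
    using assms by (intro mult_left_mono mult_mono power_increasing) auto
  finally show ?thesis by (simp add: weight_def)
qed

text \<open>Quadratic growth of \<open>R\<close> makes the double integral absolutely convergent, so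
  that the iterated integrals merge into one over the product law. The pointwise bound is free of
  \<open>a\<close>, which later permits the limit of \<open>a\<close> to minus infinity.\<close>

lemma ou_cov_eq:
  assumes \<theta>: "0 < \<theta>" and at: "a \<le> t" "a \<le> s" and c: "0 \<le> c"
    and [measurable]: "(\<lambda>(u, v). R u v) \<in> borel_measurable (borel \<Otimes>\<^sub>M borel)"
    and b: "\<And>u v. a \<le> u \<Longrightarrow> a \<le> v \<Longrightarrow> \<bar>R u v\<bar> \<le> c * (1 + \<bar>u\<bar> + \<bar>v\<bar>)\<^sup>2"
  shows "ou_cov \<theta> R a t s = (LINT z|expo2 \<theta>. (case z of (p, q) \<Rightarrow>
     R t s - R t (max (s - q) a) - (R (max (t - p) a) s - R (max (t - p) a) (max (s - q) a))))" (is "_ = integral\<^sup>L _ ?f")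
    and "\<And>p q. 0 < p \<Longrightarrow> 0 < q \<Longrightarrow>
     \<bar>R t s - R t (max (s - q) a) - (R (max (t - p) a) s - R (max (t - p) a) (max (s - q) a))\<bar> \<le> (4 * c * (1 + \<bar>t\<bar> + \<bar>s\<bar>)\<^sup>2) * weight (p, q)"
proof -
  interpret pair_sigma_finite "expo \<theta>" "expo \<theta>" by (rule pair_sigma_finite_expo[OF \<theta>])
  have Rb: "\<bar>R u v\<bar> \<le> (c * (1 + \<bar>t\<bar> + \<bar>s\<bar>)\<^sup>2) * weight (p, q)"
    if "0 < p" "0 < q" "a \<le> u" "a \<le> v" "\<bar>u\<bar> \<le> \<bar>t\<bar> + p" "\<bar>v\<bar> \<le> \<bar>s\<bar> + q" for p q u v
  proof -
    have "\<bar>R u v\<bar> \<le> c * (1 + \<bar>u\<bar> + \<bar>v\<bar>)\<^sup>2" by (rule b[OF that(3,4)])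
    also have "\<dots> \<le> c * ((1 + (\<bar>t\<bar> + \<bar>s\<bar>))\<^sup>2 * weight (p, q))"
      using that by (intro mult_left_mono c quad_le_weight) auto
    finally show ?thesis by (simp add: add.assoc mult.assoc)
  qed
  \<comment> \<open>As \<open>a \<le> t\<close>, the truncated point lies between t - p and t, so
    its size is controlled without reference to \<open>a\<close>.\<close>
  have mx: "a \<le> max (t - p) a" "\<bar>max (t - p) a\<bar> \<le> \<bar>t\<bar> + p" "a \<le> max (s - q) a" "\<bar>max (s - q) a\<bar> \<le> \<bar>s\<bar> + q"
    "\<bar>t\<bar> \<le> \<bar>t\<bar> + p" "\<bar>s\<bar> \<le> \<bar>s\<bar> + q" if "0 < p" "0 < q" for p q
    using that at by auto
  show fb: "\<bar>R t s - R t (max (s - q) a) - (R (max (t - p) a) s - R (max (t - p) a) (max (s - q) a))\<bar> \<le> (4 * c * (1 + \<bar>t\<bar> + \<bar>s\<bar>)\<^sup>2) * weight (p, q)"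
    if p: "0 < p" "0 < q" for p q
    using Rb[OF p at mx(5)[OF p] mx(6)[OF p]] Rb[OF p at(1) mx(3)[OF p] mx(5)[OF p] mx(4)[OF p]]
      Rb[OF p mx(1)[OF p] at(2) mx(2)[OF p] mx(6)[OF p]] Rb[OF p mx(1)[OF p] mx(3)[OF p] mx(2)[OF p] mx(4)[OF p]]
    by argo
  have fm: "?f \<in> borel_measurable (borel \<Otimes>\<^sub>M borel)" by measurable
  have i: "integrable (expo2 \<theta>) ?f" by (rule expo2_bounded(1)[OF \<theta> fm]) (use fb in auto)
  have sec: "integrable (expo \<theta>) (\<lambda>q. R u s - R u (max (s - q) a))" if "a \<le> u" for u
  proof (rule Bochner_Integration.integrable_bound)
    let ?K = "2 * c * (2 + \<bar>u\<bar> + \<bar>s\<bar>)\<^sup>2"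
    show "integrable (expo \<theta>) (\<lambda>q. ?K * (1 + q) ^ 2)"
      using expo_poly_integrable[OF \<theta>] by auto
    show "AE q in expo \<theta>. norm (R u s - R u (max (s - q) a)) \<le> norm (?K * (1 + q) ^ 2)"
      using AE_expo_pos[OF \<theta>]
    proof eventually_elim
      fix q :: real assume q: "0 < q"
      have "\<bar>R u v\<bar> \<le> c * ((2 + \<bar>u\<bar> + \<bar>s\<bar>) * (1 + q))\<^sup>2" if "a \<le> v" "\<bar>v\<bar> \<le> \<bar>s\<bar> + q" for v
      proof -
        have "0 \<le> q * \<bar>u\<bar>" "0 \<le> q * \<bar>s\<bar>" using q by auto
        moreover have "(2 + \<bar>u\<bar> + \<bar>s\<bar>) * (1 + q) = 2 + \<bar>u\<bar> + \<bar>s\<bar> + 2 * q + q * \<bar>u\<bar> + q * \<bar>s\<bar>"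
          by (simp add: algebra_simps)
        ultimately have "1 + \<bar>u\<bar> + \<bar>v\<bar> \<le> (2 + \<bar>u\<bar> + \<bar>s\<bar>) * (1 + q)"
          using that(2) q by linarith
        then have "c * (1 + \<bar>u\<bar> + \<bar>v\<bar>)\<^sup>2 \<le> c * ((2 + \<bar>u\<bar> + \<bar>s\<bar>) * (1 + q))\<^sup>2"
          using c by (intro mult_left_mono power_mono) auto
        then show ?thesis using b[OF \<open>a \<le> u\<close> that(1)] by linarith
      qed
      note Rq = this
      have "\<bar>max (s - q) a\<bar> \<le> \<bar>s\<bar> + q" using q at by (auto simp: max_def)
      then have "\<bar>R u (max (s - q) a)\<bar> \<le> c * ((2 + \<bar>u\<bar> + \<bar>s\<bar>) * (1 + q))\<^sup>2" by (intro Rq) auto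
      moreover have "\<bar>R u s\<bar> \<le> c * ((2 + \<bar>u\<bar> + \<bar>s\<bar>) * (1 + q))\<^sup>2" using q at by (intro Rq) auto
      ultimately have "\<bar>R u s - R u (max (s - q) a)\<bar> \<le> 2 * (c * ((2 + \<bar>u\<bar> + \<bar>s\<bar>) * (1 + q))\<^sup>2)"
        using abs_triangle_ineq4[of "R u s" "R u (max (s - q) a)"] by linarith
      also have "\<dots> = ?K * (1 + q) ^ 2" by (simp add: power_mult_distrib)
      finally show "norm (R u s - R u (max (s - q) a)) \<le> norm (?K * (1 + q) ^ 2)" by simp
    qed
  qed measurable
  have "ou_cov \<theta> R a t s = (LINT p|expo \<theta>. LINT q|expo \<theta>. R t s - R t (max (s - q) a) - (R (max (t - p) a) s - R (max (t - p) a) (max (s - q) a)))"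
    unfolding ou_cov_def
    by (rule Bochner_Integration.integral_cong[OF refl], rule Bochner_Integration.integral_diff[symmetric])
       (rule sec[OF at(1)], rule sec, simp)
  also have "\<dots> = integral\<^sup>L (expo2 \<theta>) ?f" using integral_fst[OF i] by simp
  finally show "ou_cov \<theta> R a t s = integral\<^sup>L (expo2 \<theta>) ?f" .
qed

section \<open>Covariances of the sub-fractional and the stationary process\<close>

definition subfbm_cov :: "real \<Rightarrow> real \<Rightarrow> real \<Rightarrow> real" where
  "subfbm_cov H t s = t powr (2 * H) + s powr (2 * H) - 1 / 2 * ((t + s) powr (2 * H) + \<bar>t - s\<bar> powr (2 * H))"

definition fbm_cov :: "real \<Rightarrow> real \<Rightarrow> real \<Rightarrow> real" where
  "fbm_cov H t s = 1 / 2 * (\<bar>t\<bar> powr (2 * H) + \<bar>s\<bar> powr (2 * H) - \<bar>t - s\<bar> powr (2 * H))"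

definition stat_diff :: "real \<Rightarrow> real \<Rightarrow> real \<times> real \<Rightarrow> real" where
  "stat_diff H k z = (case z of (p, q) \<Rightarrow> abs_pow H k - abs_pow H (k - p) - abs_pow H (k + q) + abs_pow H (k - p + q))"

text \<open>In a mixed difference of the fractional covariance the terms in one argument cancel and
  only -|t - s|^(2H) / 2 contributes. The result is the covariance of Z at lag
  \<open>k\<close>.\<close>

definition stationary_cov :: "real \<Rightarrow> real \<Rightarrow> real \<Rightarrow> real" where
  "stationary_cov \<theta> H k = - (1 / 2) * (LINT z|expo2 \<theta>. stat_diff H k z)"

lemma stat_diff_measurable [measurable]: "stat_diff H k \<in> borel_measurable (borel \<Otimes>\<^sub>M borel)"
  unfolding stat_diff_def[abs_def] by measurable

lemma subfbm_cov_measurable [measurable]: "(\<lambda>(u, v). subfbm_cov H u v) \<in> borel_measurable (borel \<Otimes>\<^sub>M borel)"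
  unfolding subfbm_cov_def by measurable

lemma fbm_cov_measurable [measurable]: "(\<lambda>(u, v). fbm_cov H u v) \<in> borel_measurable (borel \<Otimes>\<^sub>M borel)"
  unfolding fbm_cov_def by measurable

lemma abs_pow_continuous: "0 < H \<Longrightarrow> continuous_on UNIV (abs_pow H)"
  unfolding abs_pow_def[abs_def] by (rule continuous_on_powr') (auto intro!: continuous_intros)

lemma subfbm_cov_abs_pow: "0 \<le> u \<Longrightarrow> 0 \<le> v \<Longrightarrow> subfbm_cov H u v = abs_pow H u + abs_pow H v - 1 / 2 * (abs_pow H (u + v) + abs_pow H (u - v))"
  by (simp add: subfbm_cov_def abs_pow_def)

lemma fbm_cov_abs_pow: "fbm_cov H u v = 1 / 2 * (abs_pow H u + abs_pow H v - abs_pow H (u - v))"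
  by (simp add: fbm_cov_def abs_pow_def)

lemma subfbm_cov_continuous:
  assumes "0 < H" shows "continuous_on ({0..} \<times> {0..}) (\<lambda>(u, v). subfbm_cov H u v)"
proof -
  have "continuous_on ({0..} \<times> {0..}) (\<lambda>z::real \<times> real. abs_pow H (fst z) + abs_pow H (snd z) - 1 / 2 * (abs_pow H (fst z + snd z) + abs_pow H (fst z - snd z)))"
    by (intro continuous_intros continuous_on_compose2[OF abs_pow_continuous[OF assms]]) auto
  then show ?thesis
    by (rule continuous_on_eq) (auto simp: subfbm_cov_abs_pow)
qed

lemma fbm_cov_continuous:
  assumes "0 < H" shows "continuous_on A (\<lambda>(u, v). fbm_cov H u v)"
  unfolding fbm_cov_abs_pow case_prod_unfold
  by (intro continuous_intros continuous_on_compose2[OF abs_pow_continuous[OF assms]]) auto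

lemma subfbm_cov_bound:
  assumes H: "0 < H" "H < 1" and "0 \<le> u" "0 \<le> v"
  shows "\<bar>subfbm_cov H u v\<bar> \<le> 3 * (1 + \<bar>u\<bar> + \<bar>v\<bar>)\<^sup>2"
proof -
  define B where "B = (1 + \<bar>u\<bar> + \<bar>v\<bar>)\<^sup>2"
  have "abs_pow H u \<le> B" "abs_pow H v \<le> B"
     "abs_pow H (u + v) \<le> B" "abs_pow H (u - v) \<le> B"
    unfolding B_def by (intro abs_pow_le_square H; linarith)+
  then show ?thesis unfolding B_def[symmetric] using abs_pow_nonneg[of H u] abs_pow_nonneg[of H v] abs_pow_nonneg[of H "u + v"] abs_pow_nonneg[of H "u - v"]
    unfolding subfbm_cov_abs_pow[OF assms(3,4)] by argo
qed

lemma fbm_cov_bound: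
  assumes H: "0 < H" "H < 1"
  shows "\<bar>fbm_cov H u v\<bar> \<le> 3 * (1 + \<bar>u\<bar> + \<bar>v\<bar>)\<^sup>2"
proof -
  define B where "B = (1 + \<bar>u\<bar> + \<bar>v\<bar>)\<^sup>2"
  have "abs_pow H u \<le> B" "abs_pow H v \<le> B"
     "abs_pow H (u - v) \<le> B"
    unfolding B_def by (intro abs_pow_le_square H; linarith)+
  then show ?thesis unfolding B_def[symmetric] using abs_pow_nonneg[of H u] abs_pow_nonneg[of H v] abs_pow_nonneg[of H "u - v"]
    unfolding fbm_cov_abs_pow by argo
qed

text \<open>For fixed (p, q) the truncation at \<open>a m\<close> is eventually inactive and the
  integrand equals its limit; the bound free of \<open>a\<close> dominates.\<close>

lemma ou_cov_fbm_cov_limit: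
  assumes \<theta>: "0 < \<theta>" and H: "0 < H" "H < 1" and a: "filterlim a at_bot sequentially"
    and at: "\<And>m::nat. a m \<le> t" "\<And>m. a m \<le> s"
  shows "(\<lambda>m. ou_cov \<theta> (fbm_cov H) (a m) t s) \<longlonglongrightarrow> stationary_cov \<theta> H (t - s)"
proof -
  define f where "f = (\<lambda>m (p, q). fbm_cov H t s - fbm_cov H t (max (s - q) (a m)) - (fbm_cov H (max (t - p) (a m)) s - fbm_cov H (max (t - p) (a m)) (max (s - q) (a m))))"
  define C where "C = 4 * 3 * (1 + \<bar>t\<bar> + \<bar>s\<bar>)\<^sup>2"
  have eq: "ou_cov \<theta> (fbm_cov H) (a m) t s = (LINT z|expo2 \<theta>. f m z)" for m
    unfolding f_def by (rule ou_cov_eq(1)[OF \<theta> at(1,2), where c=3]) (use fbm_cov_bound[OF H] in auto)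
  have b: "\<bar>f m (p, q)\<bar> \<le> C * weight (p, q)" if "0 < p" "0 < q" for m p q
    unfolding f_def C_def prod.case
    by (rule ou_cov_eq(2)[OF \<theta> at(1,2)[of m], where c=3 and R="fbm_cov H"]) (use fbm_cov_bound[OF H] that in auto)
  have "(\<lambda>m. LINT z|expo2 \<theta>. f m z) \<longlonglongrightarrow> (LINT z|expo2 \<theta>. - (1 / 2) * stat_diff H (t - s) z)"
  proof (rule integral_dominated_convergence[where w="\<lambda>z. C * weight z"])
    show "integrable (expo2 \<theta>) (\<lambda>z. C * weight z)" using weight_integrable[OF \<theta>] by auto
    show "AE z in expo2 \<theta>. norm (f m z) \<le> C * weight z" for m
      using AE_expo2_pos[OF \<theta>] by eventually_elim (use b in auto)
    show "AE z in expo2 \<theta>. (\<lambda>m. f m z) \<longlonglongrightarrow> - (1 / 2) * stat_diff H (t - s) z"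
    proof (rule AE_I2)
      fix z :: "real \<times> real"
      obtain p q where z: "z = (p, q)" by force
      have "eventually (\<lambda>m. a m \<le> t - p \<and> a m \<le> s - q) sequentially"
        using a unfolding filterlim_at_bot by (intro eventually_conj) auto
      then have "eventually (\<lambda>m. f m z = - (1 / 2) * stat_diff H (t - s) z) sequentially"
      proof eventually_elim
        fix m assume m: "a m \<le> t - p \<and> a m \<le> s - q"
        have e: "abs_pow H (t - (s - q)) = abs_pow H (t - s + q)" "abs_pow H (t - p - s) = abs_pow H (t - s - p)"
          "abs_pow H (t - p - (s - q)) = abs_pow H (t - s - p + q)"
          by (intro arg_cong[where f="abs_pow H"]; simp)+
        show "f m z = - (1 / 2) * stat_diff H (t - s) z"
          using m unfolding f_def z prod.case stat_diff_def fbm_cov_abs_pow e by (simp add: max_absorb1 e) argo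
      qed
      then show "(\<lambda>m. f m z) \<longlonglongrightarrow> - (1 / 2) * stat_diff H (t - s) z" by (rule tendsto_eventually)
    qed
  qed (unfold f_def, measurable)
  then show ?thesis unfolding eq stationary_cov_def by simp
qed

definition sub_OU_cov :: "real \<Rightarrow> real \<Rightarrow> real \<Rightarrow> real \<Rightarrow> real" where "sub_OU_cov \<theta> H t s = ou_cov \<theta> (subfbm_cov H) 0 t s"

text \<open>Since max(t - p, 0) = t - min p t, the mixed difference of the sub-fractional
  covariance, multiplied by -2, splits into a truncated stationary part at lag t - s and a part
  based at t + s.\<close>

definition sub_diff :: "real \<Rightarrow> real \<Rightarrow> real \<Rightarrow> real \<times> real \<Rightarrow> real" where
  "sub_diff H t s z = (case z of (p, q) \<Rightarrow> stat_diff H (t - s) (min p t, min q s) + mixed_diff H (t + s) (- min p t) (- min q s))"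

lemma sub_diff_measurable [measurable]: "sub_diff H t s \<in> borel_measurable (borel \<Otimes>\<^sub>M borel)"
  unfolding sub_diff_def[abs_def] mixed_diff_def stat_diff_def by measurable

lemma sub_OU_cov_eq:
  assumes \<theta>: "0 < \<theta>" and H: "0 < H" "H < 1" and t: "0 \<le> t" "0 \<le> s"
  shows "sub_OU_cov \<theta> H t s = - (1 / 2) * (LINT z|expo2 \<theta>. sub_diff H t s z)" and "integrable (expo2 \<theta>) (sub_diff H t s)"
proof -
  define f where "f = (\<lambda>(p, q). subfbm_cov H t s - subfbm_cov H t (max (s - q) 0) - (subfbm_cov H (max (t - p) 0) s - subfbm_cov H (max (t - p) 0) (max (s - q) 0)))"
  have f: "f z = - (1 / 2) * sub_diff H t s z" for z
  proof -
    obtain p q where z: "z = (p, q)" by force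
    have mx: "max (t - p) 0 = t - min p t" "max (s - q) 0 = s - min q s" by auto
    have e: "abs_pow H (t - (s - q')) = abs_pow H (t - s + q')" "abs_pow H (t - p' - s) = abs_pow H (t - s - p')"
      "abs_pow H (t - p' - (s - q')) = abs_pow H (t - s - p' + q')" "abs_pow H (t + (s - q')) = abs_pow H (t + s + - q')"
      "abs_pow H (t - p' + s) = abs_pow H (t + s + - p')" "abs_pow H (t - p' + (s - q')) = abs_pow H (t + s + - p' + - q')" for p' q'
      by (intro arg_cong[where f="abs_pow H"]; simp)+
    have nn: "0 \<le> t - min p t" "0 \<le> s - min q s" by auto
    show ?thesis
      unfolding f_def z prod.case sub_diff_def stat_diff_def mixed_diff_def mx
      unfolding subfbm_cov_abs_pow[OF t] subfbm_cov_abs_pow[OF t(1) nn(2)] subfbm_cov_abs_pow[OF nn(1) t(2)] subfbm_cov_abs_pow[OF nn] e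
      by (simp add: field_simps)
  qed
  have fm: "f \<in> borel_measurable (borel \<Otimes>\<^sub>M borel)" unfolding f_def by measurable
  have b: "\<bar>f (p, q)\<bar> \<le> (4 * 3 * (1 + \<bar>t\<bar> + \<bar>s\<bar>)\<^sup>2) * weight (p, q)" if "0 < p" "0 < q" for p q
    unfolding f_def prod.case
    by (rule ou_cov_eq(2)[OF \<theta> t, where c=3 and R="subfbm_cov H"]) (use subfbm_cov_bound[OF H] that in auto)
  have "integrable (expo2 \<theta>) f" by (rule expo2_bounded(1)[OF \<theta> fm b])
  then have "integrable (expo2 \<theta>) (\<lambda>z. - 2 * f z)" by auto
  then show "integrable (expo2 \<theta>) (sub_diff H t s)" by (simp add: f)
  have "sub_OU_cov \<theta> H t s = (LINT z|expo2 \<theta>. f z)"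
    unfolding sub_OU_cov_def f_def by (rule ou_cov_eq(1)[OF \<theta> t, where c=3]) (use subfbm_cov_bound[OF H] in auto)
  then show "sub_OU_cov \<theta> H t s = - (1 / 2) * (LINT z|expo2 \<theta>. sub_diff H t s z)" by (simp add: f)
qed

lemma stat_diff_mixed_diff: "stat_diff H k (p, q) = mixed_diff H k (- p) q"
  by (simp add: stat_diff_def mixed_diff_def)

lemma weight_ge:
  assumes "0 < p" "0 < q" "0 \<le> x" "x \<le> 1 + p + q"
  shows "x ^ 5 \<le> weight (p, q)"
proof -
  have "x \<le> (1 + p) * (1 + q)"
    using assms mult_nonneg_nonneg[of p q] by (simp add: algebra_simps; linarith)
  then have "x ^ 5 \<le> ((1 + p) * (1 + q)) ^ 5" using assms by (intro power_mono) auto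
  then show ?thesis by (simp add: weight_def power_mult_distrib)
qed

lemma stat_diff_integrable:
  assumes \<theta>: "0 < \<theta>" and H: "0 < H" "H < 1"
  shows "integrable (expo2 \<theta>) (stat_diff H k)"
proof (rule expo2_bounded(1)[OF \<theta> stat_diff_measurable])
  fix p q :: real assume p: "0 < p" "0 < q"
  define B where "B = (1 + \<bar>k\<bar> + p + q)\<^sup>2"
  have "abs_pow H k \<le> B" "abs_pow H (k - p) \<le> B" "abs_pow H (k + q) \<le> B" "abs_pow H (k - p + q) \<le> B"
    unfolding B_def by (intro abs_pow_le_square H; use p in linarith)+
  then have "\<bar>stat_diff H k (p, q)\<bar> \<le> 4 * B"
    using abs_pow_nonneg[of H k] abs_pow_nonneg[of H "k - p"] abs_pow_nonneg[of H "k + q"] abs_pow_nonneg[of H "k - p + q"]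
    unfolding stat_diff_def prod.case by argo
  also have "\<dots> \<le> 4 * ((1 + \<bar>k\<bar>)\<^sup>2 * weight (p, q))"
    unfolding B_def using p by (intro mult_left_mono quad_le_weight) auto
  finally show "\<bar>stat_diff H k (p, q)\<bar> \<le> (4 * (1 + \<bar>k\<bar>)\<^sup>2) * weight (p, q)" by simp
qed

lemma stationary_cov_bound:
  assumes \<theta>: "0 < \<theta>" and H: "0 < H" "H < 1"
  obtains C where "0 \<le> C" "\<And>k. 1 \<le> k \<Longrightarrow> \<bar>stationary_cov \<theta> H k\<bar> \<le> C * k powr decay_exp H"
proof -
  obtain C where C: "0 \<le> C" "\<And>x \<alpha> \<beta>. 1 \<le> x \<Longrightarrow> \<bar>mixed_diff H x \<alpha> \<beta>\<bar> \<le> C * (1 + \<bar>\<alpha>\<bar> + \<bar>\<beta>\<bar>) ^ 5 * x powr decay_exp H"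
    using mixed_diff_bound[OF H] by blast
  show thesis
  proof (rule that[of "C * weight_mass \<theta>"])
    fix k :: real assume k: "1 \<le> k"
    have "\<bar>LINT z|expo2 \<theta>. stat_diff H k z\<bar> \<le> (C * k powr decay_exp H) * weight_mass \<theta>"
    proof (rule expo2_bounded(2)[OF \<theta> stat_diff_measurable])
      fix p q :: real assume p: "0 < p" "0 < q"
      have "\<bar>stat_diff H k (p, q)\<bar> \<le> C * (1 + \<bar>- p\<bar> + \<bar>q\<bar>) ^ 5 * k powr decay_exp H" unfolding stat_diff_mixed_diff by (rule C(2)[OF k])
      also have "\<dots> \<le> C * weight (p, q) * k powr decay_exp H"
        using p C(1) by (intro mult_right_mono mult_left_mono weight_ge) auto
      finally show "\<bar>stat_diff H k (p, q)\<bar> \<le> C * k powr decay_exp H * weight (p, q)" by (simp add: mult_ac)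
    qed
    moreover have "0 \<le> (C * k powr decay_exp H) * weight_mass \<theta>" using C(1) weight_mass_nonneg[OF \<theta>] by auto
    ultimately show "\<bar>stationary_cov \<theta> H k\<bar> \<le> C * weight_mass \<theta> * k powr decay_exp H"
      by (simp add: stationary_cov_def abs_mult mult_ac)
  qed (use C(1) weight_mass_nonneg[OF \<theta>] in auto)
qed

text \<open>The mixed difference has the leading term -p q 2H(2H-1) k^(2H-2). With E[p q] =
  1/\<theta>^2 and the prefactor -1/2 it gives the coefficient H(2H-1)/\<theta>^2.\<close>

lemma stationary_cov_asymptotic:
  assumes \<theta>: "0 < \<theta>" and H: "0 < H" "H < 1"
  obtains C where "0 \<le> C" "\<And>k. 1 \<le> k \<Longrightarrow>
     \<bar>stationary_cov \<theta> H k - H * (2 * H - 1) / \<theta>\<^sup>2 * k powr (2 * H - 2)\<bar> \<le> C * k powr (2 * H - 3)"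
proof -
  obtain C where C: "0 \<le> C" "\<And>x \<alpha> \<beta>. 1 \<le> x \<Longrightarrow>
    \<bar>mixed_diff H x \<alpha> \<beta> - \<alpha> * \<beta> * (2 * H * (2 * H - 1) * x powr (2 * H - 2))\<bar> \<le> C * (1 + \<bar>\<alpha>\<bar> + \<bar>\<beta>\<bar>) ^ 5 * x powr (2 * H - 3)"
    using mixed_diff_expansion[OF H] by blast
  have pq: "integrable (expo2 \<theta>) (\<lambda>(p, q). p * q)" "(LINT z|expo2 \<theta>. (case z of (p, q) \<Rightarrow> p * q)) = 1 / \<theta>\<^sup>2"
    using expo2_product[OF \<theta>, of "\<lambda>p. p" "\<lambda>p. p"] expo_power_integrable[OF \<theta>, of 1] expo_mean[OF \<theta>] by (auto simp: power2_eq_square)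
  show thesis
  proof (rule that[of "C * weight_mass \<theta>"])
    fix k :: real assume k: "1 \<le> k"
    define L where "L = 2 * H * (2 * H - 1) * k powr (2 * H - 2)"
    have "\<bar>LINT z|expo2 \<theta>. (stat_diff H k z + L * (case z of (p, q) \<Rightarrow> p * q))\<bar> \<le> (C * k powr (2 * H - 3)) * weight_mass \<theta>"
    proof (rule expo2_bounded(2)[OF \<theta>])
      fix p q :: real assume p: "0 < p" "0 < q"
      have "\<bar>stat_diff H k (p, q) + L * (case (p, q) of (p, q) \<Rightarrow> p * q)\<bar> = \<bar>mixed_diff H k (- p) q - (- p) * q * L\<bar>"
        unfolding stat_diff_mixed_diff by (simp add: mult_ac)
      also have "\<dots> \<le> C * (1 + \<bar>- p\<bar> + \<bar>q\<bar>) ^ 5 * k powr (2 * H - 3)" unfolding L_def by (rule C(2)[OF k])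
      also have "\<dots> \<le> C * weight (p, q) * k powr (2 * H - 3)"
        using p C(1) by (intro mult_right_mono mult_left_mono weight_ge) auto
      finally show "\<bar>stat_diff H k (p, q) + L * (case (p, q) of (p, q) \<Rightarrow> p * q)\<bar> \<le> C * k powr (2 * H - 3) * weight (p, q)" by (simp add: mult_ac)
    qed measurable
    moreover have "(LINT z|expo2 \<theta>. (stat_diff H k z + L * (case z of (p, q) \<Rightarrow> p * q))) = (LINT z|expo2 \<theta>. stat_diff H k z) + L * (1 / \<theta>\<^sup>2)"
      using stat_diff_integrable[OF \<theta> H] pq by simp
    moreover have "stationary_cov \<theta> H k - H * (2 * H - 1) / \<theta>\<^sup>2 * k powr (2 * H - 2) = - (1 / 2) * ((LINT z|expo2 \<theta>. stat_diff H k z) + L * (1 / \<theta>\<^sup>2))"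
      by (simp add: stationary_cov_def L_def field_simps)
    moreover have "0 \<le> (C * k powr (2 * H - 3)) * weight_mass \<theta>" using C(1) weight_mass_nonneg[OF \<theta>] by auto
    ultimately show "\<bar>stationary_cov \<theta> H k - H * (2 * H - 1) / \<theta>\<^sup>2 * k powr (2 * H - 2)\<bar> \<le> C * weight_mass \<theta> * k powr (2 * H - 3)"
      by (simp add: abs_mult mult_ac)
  qed (use C(1) weight_mass_nonneg[OF \<theta>] in auto)
qed

text \<open>The rate is that of the later time \<open>s\<close>, however small \<open>t\<close> is.
  The part based at t + s decays by itself. If only p is truncated, evenness of |x| turns the change
  of the stationary part into a mixed difference based at \<open>s\<close>; if q > s, the weight
  absorbs the required power of s.\<close>

lemma sub_OU_cov_stationary_cov_bound:
  assumes \<theta>: "0 < \<theta>" and H: "0 < H" "H < 1"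
  obtains C where "0 \<le> C" "\<And>t s. 1 \<le> t \<Longrightarrow> t \<le> s \<Longrightarrow> \<bar>sub_OU_cov \<theta> H t s - stationary_cov \<theta> H (t - s)\<bar> \<le> C * s powr decay_exp H"
proof -
  obtain C where C: "0 \<le> C" "\<And>x \<alpha> \<beta>. 1 \<le> x \<Longrightarrow> \<bar>mixed_diff H x \<alpha> \<beta>\<bar> \<le> C * (1 + \<bar>\<alpha>\<bar> + \<bar>\<beta>\<bar>) ^ 5 * x powr decay_exp H"
    using mixed_diff_bound[OF H] by blast
  show thesis
  proof (rule that[of "(2 * C + 32) * weight_mass \<theta>"])
    fix t s :: real assume ts: "1 \<le> t" "t \<le> s"
    then have s1: "1 \<le> s" by simp
    have "\<bar>LINT z|expo2 \<theta>. (sub_diff H t s z - stat_diff H (t - s) z)\<bar> \<le> ((2 * C + 32) * s powr decay_exp H) * weight_mass \<theta>"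
    proof (rule expo2_bounded(2)[OF \<theta>])
      fix p q :: real assume p: "0 < p" "0 < q"
      let ?E = "stat_diff H (t - s) (min p t, min q s) - stat_diff H (t - s) (p, q)"
      have S1: "\<bar>mixed_diff H (t + s) (- min p t) (- min q s)\<bar> \<le> C * weight (p, q) * s powr decay_exp H"
      proof -
        have "\<bar>mixed_diff H (t + s) (- min p t) (- min q s)\<bar> \<le> C * (1 + \<bar>- min p t\<bar> + \<bar>- min q s\<bar>) ^ 5 * (t + s) powr decay_exp H"
          by (rule C(2)) (use ts in auto)
        also have "\<dots> \<le> C * weight (p, q) * s powr decay_exp H"
          using p C(1) ts decay_exp_neg[OF H(2)] by (intro mult_mono mult_left_mono weight_ge powr_mono2') (auto simp: weight_def)
        finally show ?thesis .
      qed
      have S2: "\<bar>?E\<bar> \<le> (C + 32) * weight (p, q) * s powr decay_exp H"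
      proof (cases "q \<le> s")
        case q: True
        show ?thesis
        proof (cases "p \<le> t")
          case True
          then show ?thesis using q C(1) p by (simp add: weight_def)
        next
          case False
          \<comment> \<open>Replacing p by t gives t - s - t = -s. By evenness the four terms left
            over are the values at s, s - q, s + (p - t) and s + (p - t) - q, a mixed difference at
            \<open>s\<close> with increments p - t and -q.\<close>
          have ev: "abs_pow H (t - s - t) = abs_pow H s" "abs_pow H (t - s - t + q) = abs_pow H (s - q)"
            "abs_pow H (t - s - p) = abs_pow H (s + (p - t))" "abs_pow H (t - s - p + q) = abs_pow H (s + (p - t) + - q)"
            using abs_pow_even[of H "t - s - t"] abs_pow_even[of H "t - s - t + q"] abs_pow_even[of H "t - s - p"] abs_pow_even[of H "t - s - p + q"]
            by (simp_all add: algebra_simps)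
          have "?E = - mixed_diff H s (p - t) (- q)"
          proof -
            have m: "min p t = t" "min q s = q" using False q by auto
            show ?thesis unfolding stat_diff_def prod.case mixed_diff_def m ev by simp
          qed
          then have "\<bar>?E\<bar> \<le> C * (1 + \<bar>p - t\<bar> + \<bar>- q\<bar>) ^ 5 * s powr decay_exp H" using C(2)[OF s1, of "p - t" "- q"] by simp
          also have "\<dots> \<le> (C + 32) * weight (p, q) * s powr decay_exp H"
            using p C(1) ts False by (intro mult_right_mono mult_mono weight_ge) auto
          finally show ?thesis .
        qed
      next
        case False
        define W where "W = 1 + p + q"
        define B where "B = (2 * W)\<^sup>2"
        have W: "1 \<le> W" using p by (simp add: W_def)
        have ap: "abs_pow H y \<le> B" if "\<bar>y\<bar> \<le> s + p + q" for y
          unfolding B_def by (rule abs_pow_le_square[OF H]) (use that p False W in \<open>auto simp: W_def\<close>)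
        have "abs_pow H (t - s) \<le> B" "abs_pow H (t - s - min p t) \<le> B" "abs_pow H (t - s + min q s) \<le> B" "abs_pow H (t - s - min p t + min q s) \<le> B"
          "abs_pow H (t - s - p) \<le> B" "abs_pow H (t - s + q) \<le> B" "abs_pow H (t - s - p + q) \<le> B"
          by (intro ap; use p ts in \<open>auto simp: min_def abs_le_iff\<close>)+
        then have "\<bar>stat_diff H (t - s) (min p t, min q s)\<bar> \<le> 2 * B" "\<bar>stat_diff H (t - s) (p, q)\<bar> \<le> 2 * B"
          using abs_pow_nonneg[of H "t - s"] abs_pow_nonneg[of H "t - s - min p t"] abs_pow_nonneg[of H "t - s + min q s"]
            abs_pow_nonneg[of H "t - s - min p t + min q s"] abs_pow_nonneg[of H "t - s - p"] abs_pow_nonneg[of H "t - s + q"]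
            abs_pow_nonneg[of H "t - s - p + q"]
          unfolding stat_diff_def prod.case by (argo, argo)
        then have "\<bar>?E\<bar> \<le> 4 * B" using abs_triangle_ineq4[of "stat_diff H (t - s) (min p t, min q s)" "stat_diff H (t - s) (p, q)"] by linarith
        also have "\<dots> = 16 * W ^ 2" by (simp add: B_def power_mult_distrib)
        \<comment> \<open>q > s forces W > s, so the inserted factor is at least 1; it supplies
          s^(-3), which is below the required power of s.\<close>
        also have "\<dots> \<le> 16 * W ^ 2 * (W / s) ^ 3"
        proof -
          have "1 \<le> (W / s) ^ 3" using False s1 p by (intro one_le_power) (auto simp: W_def)
          then show ?thesis using W by (simp add: mult_le_cancel_left1)
        qed
        also have "\<dots> = 16 * W ^ 5 * (1 / s ^ 3)" by (simp add: power_divide eval_nat_numeral)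
        also have "1 / s ^ 3 = s powr (- 3)" using s1 by (simp add: powr_minus_divide)
        also have "16 * W ^ 5 * s powr (- 3) \<le> (C + 32) * weight (p, q) * s powr decay_exp H"
          using p C(1) s1 H by (intro mult_mono weight_ge powr_mono) (auto simp: W_def decay_exp_def weight_def)
        finally show ?thesis .
      qed
      have "sub_diff H t s (p, q) - stat_diff H (t - s) (p, q) = ?E + mixed_diff H (t + s) (- min p t) (- min q s)"
        by (simp add: sub_diff_def)
      then have "\<bar>sub_diff H t s (p, q) - stat_diff H (t - s) (p, q)\<bar> \<le> (C + 32) * weight (p, q) * s powr decay_exp H + C * weight (p, q) * s powr decay_exp H"
        using S1 S2 by linarith
      then show "\<bar>sub_diff H t s (p, q) - stat_diff H (t - s) (p, q)\<bar> \<le> (2 * C + 32) * s powr decay_exp H * weight (p, q)"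
        by (simp add: algebra_simps)
    qed measurable
    moreover have "sub_OU_cov \<theta> H t s - stationary_cov \<theta> H (t - s) = - (1 / 2) * (LINT z|expo2 \<theta>. (sub_diff H t s z - stat_diff H (t - s) z))"
      using sub_OU_cov_eq[OF \<theta> H, of t s] stat_diff_integrable[OF \<theta> H] ts by (simp add: stationary_cov_def diff_divide_distrib)
    moreover have "0 \<le> ((2 * C + 32) * s powr decay_exp H) * weight_mass \<theta>" using C(1) weight_mass_nonneg[OF \<theta>] by auto
    ultimately show "\<bar>sub_OU_cov \<theta> H t s - stationary_cov \<theta> H (t - s)\<bar> \<le> (2 * C + 32) * weight_mass \<theta> * s powr decay_exp H"
      by (simp add: abs_mult mult_ac)
  qed (use C(1) weight_mass_nonneg[OF \<theta>] in auto)
qed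

section \<open>The stationary variance\<close>

lemma nn_integral_expo:
  assumes "0 < \<theta>" and [measurable]: "f \<in> borel_measurable borel"
  shows "(\<integral>\<^sup>+p. f p \<partial>expo \<theta>) = (\<integral>\<^sup>+p. ennreal (exponential_density \<theta> p) * f p \<partial>lborel)"
  by (subst nn_integral_density) auto

lemma expo_laplace:
  assumes \<theta>: "0 < \<theta>"
  shows "(\<integral>\<^sup>+p. ennreal (exp (- \<theta> * p)) \<partial>expo \<theta>) = ennreal (1 / 2)"
proof -
  interpret E2: prob_space "expo (2 * \<theta>)" by (rule prob_space_expo) (use \<theta> in auto)
  have "(\<integral>\<^sup>+p. ennreal (exp (- \<theta> * p)) \<partial>expo \<theta>) = (\<integral>\<^sup>+p. ennreal (exponential_density \<theta> p) * ennreal (exp (- \<theta> * p)) \<partial>lborel)"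
    by (rule nn_integral_expo[OF \<theta>]) simp
  also have "\<dots> = (\<integral>\<^sup>+p. ennreal (1 / 2) * ennreal (exponential_density (2 * \<theta>) p) \<partial>lborel)"
  proof (rule nn_integral_cong)
    fix p
    have "exp (- p * \<theta>) * exp (- \<theta> * p) = exp (- p * (2 * \<theta>))" by (simp flip: exp_add)
    then have e: "exponential_density \<theta> p * exp (- \<theta> * p) = 1 / 2 * exponential_density (2 * \<theta>) p"
      by (auto simp: exponential_density_def)
    have "ennreal (exponential_density \<theta> p) * ennreal (exp (- \<theta> * p)) = ennreal (exponential_density \<theta> p * exp (- \<theta> * p))"
      by (rule ennreal_mult[symmetric]) (use \<theta> in \<open>auto simp: exponential_density_def\<close>)
    also have "\<dots> = ennreal (1 / 2) * ennreal (exponential_density (2 * \<theta>) p)"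
      unfolding e by (rule ennreal_mult) (use \<theta> in \<open>auto simp: exponential_density_def\<close>)
    finally show "ennreal (exponential_density \<theta> p) * ennreal (exp (- \<theta> * p)) = ennreal (1 / 2) * ennreal (exponential_density (2 * \<theta>) p)" .
  qed
  also have "\<dots> = ennreal (1 / 2) * (\<integral>\<^sup>+p. ennreal (exponential_density (2 * \<theta>) p) \<partial>lborel)"
    by (rule nn_integral_cmult) auto
  also have "(\<integral>\<^sup>+p. ennreal (exponential_density (2 * \<theta>) p) \<partial>lborel) = emeasure (expo (2 * \<theta>)) (space (expo (2 * \<theta>)))"
    by (subst emeasure_density) auto
  also have "\<dots> = 1" by (rule E2.emeasure_space_1)
  finally show ?thesis by simp
qed

text \<open>Substitution x = \<theta> p in the Gamma integral.\<close>

lemma expo_abs_pow_nn: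
  assumes \<theta>: "0 < \<theta>" and H: "0 < H"
  shows "(\<integral>\<^sup>+p. ennreal (abs_pow H p) \<partial>expo \<theta>) = ennreal (Gamma (2 * H + 1) / \<theta> powr (2 * H))"
proof -
  have "ennreal (Gamma (2 * H + 1)) = (\<integral>\<^sup>+x. ennreal (indicator {0..} x * x powr (2 * H) / exp x) \<partial>lborel)"
    using Gamma_conv_nn_integral_real[of "2 * H + 1"] H by simp
  also have "\<dots> = ennreal \<theta> * (\<integral>\<^sup>+x. ennreal (indicator {0..} (0 + \<theta> * x) * (0 + \<theta> * x) powr (2 * H) / exp (0 + \<theta> * x)) \<partial>lborel)"
    using \<theta> by (subst nn_integral_real_affine[where c=\<theta> and t=0]) auto
  also have "\<dots> = ennreal \<theta> * (\<integral>\<^sup>+x. ennreal (\<theta> powr (2 * H) / \<theta>) * (ennreal (exponential_density \<theta> x) * ennreal (abs_pow H x)) \<partial>lborel)"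
  proof (intro arg_cong2[where f="(*)"] refl nn_integral_cong)
    fix x
    show "ennreal (indicator {0..} (0 + \<theta> * x) * (0 + \<theta> * x) powr (2 * H) / exp (0 + \<theta> * x)) = ennreal (\<theta> powr (2 * H) / \<theta>) * (ennreal (exponential_density \<theta> x) * ennreal (abs_pow H x))"
    proof (cases "x < 0")
      case True
      then have "\<not> 0 \<le> \<theta> * x" using \<theta> by (simp add: zero_le_mult_iff)
      then show ?thesis using True by (simp add: exponential_density_def)
    next
      case False
      then show ?thesis using \<theta>
        by (simp add: exponential_density_def abs_pow_def ennreal_mult[symmetric] powr_mult exp_minus field_simps)
    qed
  qed
  also have "\<dots> = ennreal \<theta> * (ennreal (\<theta> powr (2 * H) / \<theta>) * (\<integral>\<^sup>+p. ennreal (abs_pow H p) \<partial>expo \<theta>))"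
    using \<theta> by (subst nn_integral_cmult) (auto simp: nn_integral_expo)
  also have "\<dots> = ennreal (\<theta> powr (2 * H)) * (\<integral>\<^sup>+p. ennreal (abs_pow H p) \<partial>expo \<theta>)"
    using \<theta> by (simp add: ennreal_mult[symmetric] mult.assoc[symmetric])
  finally have "ennreal (1 / \<theta> powr (2 * H)) * ennreal (Gamma (2 * H + 1)) =
     ennreal (1 / \<theta> powr (2 * H)) * ennreal (\<theta> powr (2 * H)) * (\<integral>\<^sup>+p. ennreal (abs_pow H p) \<partial>expo \<theta>)"
    by (simp add: mult.assoc)
  also have "ennreal (1 / \<theta> powr (2 * H)) * ennreal (\<theta> powr (2 * H)) = 1"
    using \<theta> by (simp add: ennreal_mult[symmetric])
  finally show ?thesis using \<theta> H by (simp add: ennreal_mult[symmetric] Gamma_real_nonneg)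
qed

text \<open>By lack of memory, q - p given q > p is again exponential, so |q - p| has the law of p.
  The half q \<ge> p contributes E[exp(-\<theta> p)] = 1/2 of the moment, and the other half follows
  by symmetry.\<close>

lemma expo2_abs_pow_diff_nn:
  assumes \<theta>: "0 < \<theta>" and H: "0 < H"
  shows "(\<integral>\<^sup>+z. ennreal (abs_pow H (snd z - fst z)) \<partial>expo2 \<theta>) = (\<integral>\<^sup>+p. ennreal (abs_pow H p) \<partial>expo \<theta>)"
proof -
  interpret pair_sigma_finite "expo \<theta>" "expo \<theta>" by (rule pair_sigma_finite_expo[OF \<theta>])
  interpret E: prob_space "expo \<theta>" by (rule prob_space_expo[OF \<theta>])
  define N where "N = (\<integral>\<^sup>+p. ennreal (abs_pow H p) \<partial>expo \<theta>)"
  define up where "up = (\<lambda>p q. indicator {0..} (q - p) * ennreal (abs_pow H (q - p)))"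
  have [measurable]: "(\<lambda>(p, q). up p q) \<in> borel_measurable (borel \<Otimes>\<^sub>M borel)"
    unfolding up_def by measurable
  have inner: "(\<integral>\<^sup>+q. up p q \<partial>expo \<theta>) = ennreal (exp (- \<theta> * p)) * N" if p: "0 < p" for p
  proof -
    have "(\<integral>\<^sup>+q. up p q \<partial>expo \<theta>) = (\<integral>\<^sup>+q. ennreal (exponential_density \<theta> q) * up p q \<partial>lborel)"
      by (rule nn_integral_expo[OF \<theta>]) (simp add: up_def)
    also have "\<dots> = (\<integral>\<^sup>+r. ennreal (exponential_density \<theta> (p + 1 * r)) * up p (p + 1 * r) \<partial>lborel)"
      by (subst nn_integral_real_affine[where c=1 and t=p]) (auto simp: up_def)
    also have "\<dots> = (\<integral>\<^sup>+r. ennreal (exp (- \<theta> * p)) * (ennreal (exponential_density \<theta> r) * ennreal (abs_pow H r)) \<partial>lborel)"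
    proof (rule nn_integral_cong)
      fix r
      show "ennreal (exponential_density \<theta> (p + 1 * r)) * up p (p + 1 * r) = ennreal (exp (- \<theta> * p)) * (ennreal (exponential_density \<theta> r) * ennreal (abs_pow H r))"
      proof (cases "r < 0")
        case True then show ?thesis by (simp add: up_def exponential_density_def)
      next
        case False
        have "exp (- (p + r) * \<theta>) = exp (- \<theta> * p) * exp (- r * \<theta>)" by (simp add: algebra_simps flip: exp_add)
        then show ?thesis using False p \<theta> abs_pow_nonneg[of H r]
          by (simp add: up_def exponential_density_def ennreal_mult[symmetric] mult_ac)
      qed
    qed
    also have "\<dots> = ennreal (exp (- \<theta> * p)) * N"
      unfolding N_def by (subst nn_integral_cmult) (auto simp: nn_integral_expo[OF \<theta>])
    finally show ?thesis .
  qed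
  have half: "(\<integral>\<^sup>+p. \<integral>\<^sup>+q. up p q \<partial>expo \<theta> \<partial>expo \<theta>) = ennreal (1 / 2) * N"
  proof -
    have "(\<integral>\<^sup>+p. \<integral>\<^sup>+q. up p q \<partial>expo \<theta> \<partial>expo \<theta>) = (\<integral>\<^sup>+p. ennreal (exp (- \<theta> * p)) * N \<partial>expo \<theta>)"
      using AE_expo_pos[OF \<theta>] by (intro nn_integral_cong_AE) (auto elim!: eventually_mono simp: inner)
    also have "\<dots> = ennreal (1 / 2) * N"
      by (subst nn_integral_multc) (auto simp: expo_laplace[OF \<theta>, simplified])
    finally show ?thesis .
  qed
  have "(\<integral>\<^sup>+z. ennreal (abs_pow H (snd z - fst z)) \<partial>expo2 \<theta>) = (\<integral>\<^sup>+p. \<integral>\<^sup>+q. ennreal (abs_pow H (q - p)) \<partial>expo \<theta> \<partial>expo \<theta>)"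
    by (subst M1.nn_integral_fst[symmetric]) auto
  also have "\<dots> = (\<integral>\<^sup>+p. \<integral>\<^sup>+q. up p q + up q p \<partial>expo \<theta> \<partial>expo \<theta>)"
  proof (intro nn_integral_cong)
    fix p q :: real
    show "ennreal (abs_pow H (q - p)) = up p q + up q p"
    \<comment> \<open>The diagonal belongs to both halves; the integrand vanishes there.\<close>
    proof (cases "q = p")
      case True then show ?thesis using H by (simp add: up_def abs_pow_def)
    next
      case False
      then show ?thesis using abs_pow_even[of H "q - p"] by (auto simp: up_def split: split_indicator)
    qed
  qed
  also have "\<dots> = (\<integral>\<^sup>+p. \<integral>\<^sup>+q. up p q \<partial>expo \<theta> \<partial>expo \<theta>) + (\<integral>\<^sup>+p. \<integral>\<^sup>+q. up q p \<partial>expo \<theta> \<partial>expo \<theta>)"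
    by (simp add: nn_integral_add)
  also have "(\<integral>\<^sup>+p. \<integral>\<^sup>+q. up q p \<partial>expo \<theta> \<partial>expo \<theta>) = (\<integral>\<^sup>+p. \<integral>\<^sup>+q. up p q \<partial>expo \<theta> \<partial>expo \<theta>)"
    by (rule Fubini') simp
  finally have e: "(\<integral>\<^sup>+z. ennreal (abs_pow H (snd z - fst z)) \<partial>expo2 \<theta>) = ennreal (1 / 2) * N + ennreal (1 / 2) * N"
    unfolding half .
  have h: "ennreal (1 / 2) + ennreal (1 / 2) = 1"
    by (subst ennreal_plus[symmetric]) auto
  show ?thesis unfolding e distrib_right[symmetric] h N_def by simp
qed

text \<open>At lag 0 the difference is |q - p|^(2H) - p^(2H) - q^(2H), and all three terms have the
  same mean \<open>mA\<close>. Hence the value is \<open>mA / 2\<close>, where the functional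
  equation of Gamma applies.\<close>

lemma stationary_cov_0:
  assumes \<theta>: "0 < \<theta>" and H: "0 < H" "H < 1"
  shows "stationary_cov \<theta> H 0 = f_lim H \<theta>"
proof -
  define mA where "mA = Gamma (2 * H + 1) / \<theta> powr (2 * H)"
  have mA0: "0 \<le> mA" using H by (simp add: mA_def Gamma_real_nonneg)
  interpret E: prob_space "expo \<theta>" by (rule prob_space_expo[OF \<theta>])
  have iA: "integrable (expo \<theta>) (abs_pow H)"
    by (rule integrableI_nonneg) (use expo_abs_pow_nn[OF \<theta> H(1)] abs_pow_nonneg in auto)
  have A: "(LINT p|expo \<theta>. abs_pow H p) = mA"
    using expo_abs_pow_nn[OF \<theta> H(1)] mA0 abs_pow_nonneg by (subst integral_eq_nn_integral) (auto simp: mA_def)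
  have c1: "integrable (expo2 \<theta>) (\<lambda>(p, q). abs_pow H p * 1)" "(LINT z|expo2 \<theta>. (case z of (p, q) \<Rightarrow> abs_pow H p * 1)) = mA"
    using expo2_product[OF \<theta> iA, of "\<lambda>_. 1"] A E.prob_space by auto
  have c2: "integrable (expo2 \<theta>) (\<lambda>(p, q). 1 * abs_pow H q)" "(LINT z|expo2 \<theta>. (case z of (p, q) \<Rightarrow> 1 * abs_pow H q)) = mA"
    using expo2_product[OF \<theta> _ iA, of "\<lambda>_. 1"] A E.prob_space by auto
  have nn: "(\<integral>\<^sup>+z. ennreal (abs_pow H (snd z - fst z)) \<partial>expo2 \<theta>) = ennreal mA"
    using expo2_abs_pow_diff_nn[OF \<theta> H(1)] expo_abs_pow_nn[OF \<theta> H(1)] by (simp add: mA_def)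
  have m3: "(\<lambda>z. abs_pow H (snd z - fst z)) \<in> borel_measurable (expo2 \<theta>)" by measurable
  have c3: "integrable (expo2 \<theta>) (\<lambda>z. abs_pow H (snd z - fst z))"
    by (rule integrableI_nonneg[OF m3]) (use nn abs_pow_nonneg in auto)
  have c3': "(LINT z|expo2 \<theta>. abs_pow H (snd z - fst z)) = mA"
    using nn mA0 abs_pow_nonneg by (subst integral_eq_nn_integral[OF m3]) auto
  have "stat_diff H 0 = (\<lambda>z. abs_pow H (snd z - fst z) - (case z of (p, q) \<Rightarrow> abs_pow H p * 1) - (case z of (p, q) \<Rightarrow> 1 * abs_pow H q))"
  proof
    fix z :: "real \<times> real"
    have "abs_pow H 0 = 0" by (simp add: abs_pow_def)
    then show "stat_diff H 0 z = abs_pow H (snd z - fst z) - (case z of (p, q) \<Rightarrow> abs_pow H p * 1) - (case z of (p, q) \<Rightarrow> 1 * abs_pow H q)"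
      using abs_pow_even[of H "fst z"] by (simp add: stat_diff_def case_prod_unfold)
  qed
  then have "(LINT z|expo2 \<theta>. stat_diff H 0 z) = mA - mA - mA"
    using c1 c2 c3 c3' by simp
  then have "stationary_cov \<theta> H 0 = mA / 2" by (simp add: stationary_cov_def)
  also have "\<dots> = f_lim H \<theta>"
  proof -
    have "2 * H \<notin> \<int>\<^sub>\<le>\<^sub>0" using H by (auto dest: nonpos_Ints_nonpos)
    then show ?thesis using Gamma_plus1[of "2 * H"] by (simp add: mA_def f_lim_def)
  qed
  finally show ?thesis .
qed

section \<open>Sums of decaying covariances\<close>

text \<open>Comparison of a term with the integral of y^e over [x, x + 1]. The quotient form holds
  for either sign of e + 1 and thus covers both growing sums and convergent tails.\<close>

lemma powr_telescope_step:
  fixes x e :: real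
  assumes x: "1 \<le> x" and e: "e < 0" "e \<noteq> - 1"
  shows "(x + 1) powr e \<le> ((x + 1) powr (e + 1) - x powr (e + 1)) / (e + 1)"
proof -
  have "\<exists>z>x. z < x + 1 \<and> (x + 1) powr (e + 1) - x powr (e + 1) = (x + 1 - x) * ((e + 1) * z powr e)"
  proof (rule MVT2)
    show "((\<lambda>x. x powr (e + 1)) has_real_derivative (e + 1) * y powr e) (at y)" if "x \<le> y" for y
      using that x by (auto intro!: derivative_eq_intros)
  qed simp
  then obtain z where z: "x < z" "z < x + 1" "(x + 1) powr (e + 1) - x powr (e + 1) = (e + 1) * z powr e" by auto
  have "(x + 1) powr e \<le> z powr e" using z x e by (intro powr_mono2') auto
  also have "\<dots> = ((x + 1) powr (e + 1) - x powr (e + 1)) / (e + 1)" using z(3) e by simp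
  finally show ?thesis .
qed

lemma sum_powr_segment:
  fixes e :: real
  assumes m: "1 \<le> m" "m \<le> n" and e: "e < 0" "e \<noteq> - 1"
  shows "(\<Sum>d\<in>{m<..n}. real d powr e) \<le> (real n powr (e + 1) - real m powr (e + 1)) / (e + 1)"
  using m(2)
proof (induction n rule: dec_induct)
  case base then show ?case by simp
next
  case (step n)
  have "{m<..Suc n} = insert (Suc n) {m<..n}" using step by auto
  then have "(\<Sum>d\<in>{m<..Suc n}. real d powr e) = real (Suc n) powr e + (\<Sum>d\<in>{m<..n}. real d powr e)" by simp
  also have "\<dots> \<le> (real (Suc n) powr (e + 1) - real n powr (e + 1)) / (e + 1) + (real n powr (e + 1) - real m powr (e + 1)) / (e + 1)"
    using powr_telescope_step[OF _ e, of "real n"] step m by (intro add_mono) (auto simp: add.commute)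
  also have "\<dots> = (real (Suc n) powr (e + 1) - real m powr (e + 1)) / (e + 1)"
    by (simp add: add_divide_distrib[symmetric])
  finally show ?case .
qed

text \<open>The growth exponent of the partial sums of d^b when b differs from -1: either n^(b+1) or
  bounded.\<close>

definition growth_exp :: "real \<Rightarrow> real" where "growth_exp b = max (b + 1) 0"

lemma sum_powr_bound:
  fixes b :: real
  assumes b: "b < 0" "b \<noteq> - 1"
  obtains C where "0 \<le> C" "\<And>n. 1 \<le> n \<Longrightarrow> (\<Sum>d=1..n. real d powr b) \<le> C * real n powr growth_exp b"
proof (rule that[of "1 + 1 / \<bar>b + 1\<bar>"])
  fix n :: nat assume n: "1 \<le> n"
  have "{1..n} = insert 1 {1<..n}" using n by auto
  then have "(\<Sum>d=1..n. real d powr b) = 1 + (\<Sum>d\<in>{1<..n}. real d powr b)" by simp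
  also have "\<dots> \<le> 1 + (real n powr (b + 1) - 1) / (b + 1)"
    using sum_powr_segment[OF _ n b] by simp
  also have "\<dots> \<le> 1 + real n powr growth_exp b / \<bar>b + 1\<bar>"
  proof (cases "b + 1 > 0")
    case True then show ?thesis by (simp add: growth_exp_def divide_right_mono)
  next
    case False
    then have neg: "b + 1 < 0" using b by auto
    have "(real n powr (b + 1) - 1) / (b + 1) = (1 - real n powr (b + 1)) / \<bar>b + 1\<bar>"
    proof -
      have a: "\<bar>b + 1\<bar> = - (b + 1)" using neg by simp
      show ?thesis unfolding a by (subst minus_divide_divide[symmetric]) (simp only: minus_diff_eq)
    qed
    also have "\<dots> \<le> 1 / \<bar>b + 1\<bar>" by (intro divide_right_mono) auto
    finally show ?thesis using neg n by (simp add: growth_exp_def)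
  qed
  also have "\<dots> \<le> real n powr growth_exp b + real n powr growth_exp b / \<bar>b + 1\<bar>"
    using n by (intro add_right_mono ge_one_powr_ge_zero) (auto simp: growth_exp_def)
  finally show "(\<Sum>d=1..n. real d powr b) \<le> (1 + 1 / \<bar>b + 1\<bar>) * real n powr growth_exp b"
    by (simp add: distrib_right)
qed auto

lemma sum_powr_tail:
  fixes e :: real
  assumes e: "e < - 1" and n: "1 \<le> n" "n \<le> k"
  shows "(\<Sum>d\<in>{n<..k}. real d powr e) \<le> real n powr (e + 1) / (- (e + 1))"
proof -
  have "(\<Sum>d\<in>{n<..k}. real d powr e) \<le> (real k powr (e + 1) - real n powr (e + 1)) / (e + 1)"
    using e by (intro sum_powr_segment n) auto
  also have "\<dots> = (real n powr (e + 1) - real k powr (e + 1)) / (- (e + 1))"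
    by (subst minus_divide_divide[symmetric]) (simp only: minus_diff_eq)
  also have "\<dots> \<le> real n powr (e + 1) / (- (e + 1))"
    using e by (intro divide_right_mono) auto
  finally show ?thesis .
qed

text \<open>Enlarging the square adds one row and one column, each contributing every positive lag
  once, and one diagonal entry. On the right this raises each coefficient n - d by 1.\<close>

lemma stationary_double_sum:
  fixes h :: "nat \<Rightarrow> real"
  shows "(\<Sum>i=1..n. \<Sum>j=1..n. h (if i \<le> j then j - i else i - j)) = real n * h 0 + 2 * (\<Sum>d=1..n. real (n - d) * h d)"
proof (induction n)
  case 0 then show ?case by simp
next
  case (Suc n)
  let ?h = "\<lambda>i j. h (if i \<le> j then j - i else i - j)"
  have s1: "(\<Sum>i=1..n. ?h i (Suc n)) = (\<Sum>d=1..n. h d)"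
  proof -
    have "(\<Sum>i=1..n. ?h i (Suc n)) = (\<Sum>i=1..n. h (Suc n - i))" by (intro sum.cong) auto
    also have "\<dots> = (\<Sum>d=1..n. h d)"
      by (rule sum.reindex_bij_witness[of _ "\<lambda>d. Suc n - d" "\<lambda>d. Suc n - d"]) auto
    finally show ?thesis .
  qed
  have s2: "(\<Sum>j=1..n. ?h (Suc n) j) = (\<Sum>d=1..n. h d)"
  proof -
    have "(\<Sum>j=1..n. ?h (Suc n) j) = (\<Sum>i=1..n. h (Suc n - i))" by (intro sum.cong) auto
    also have "\<dots> = (\<Sum>d=1..n. h d)"
      by (rule sum.reindex_bij_witness[of _ "\<lambda>d. Suc n - d" "\<lambda>d. Suc n - d"]) auto
    finally show ?thesis .
  qed
  have "(\<Sum>i=1..Suc n. \<Sum>j=1..Suc n. ?h i j) = (\<Sum>i=1..n. \<Sum>j=1..n. ?h i j) + (\<Sum>i=1..n. ?h i (Suc n)) + (\<Sum>j=1..n. ?h (Suc n) j) + h 0"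
    by (simp add: sum.distrib)
  also have "\<dots> = real (Suc n) * h 0 + 2 * ((\<Sum>d=1..n. real (n - d) * h d) + (\<Sum>d=1..n. h d))"
    unfolding Suc s1 s2 by (simp add: algebra_simps)
  also have "(\<Sum>d=1..n. real (n - d) * h d) + (\<Sum>d=1..n. h d) = (\<Sum>d=1..n. real (Suc n - d) * h d)"
    unfolding sum.distrib[symmetric] by (intro sum.cong) (auto simp: Suc_diff_le distrib_right)
  also have "\<dots> = (\<Sum>d=1..Suc n. real (Suc n - d) * h d)" by simp
  finally show ?case .
qed

text \<open>By symmetry twice the half i \<le> j is an upper bound, the diagonal being counted
  twice. For fixed j the lags contribute at most one power sum, and the remaining factor j^b
  contributes another.\<close>

lemma double_sum_max_bound:
  fixes b :: real
  shows "(\<Sum>i=1..n. \<Sum>j=1..n. real (max i j) powr b * real (1 + (if i \<le> j then j - i else i - j)) powr b)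
    \<le> 2 * (\<Sum>d=1..n. real d powr b)\<^sup>2"
proof -
  let ?f = "\<lambda>i j::nat. real (max i j) powr b * real (1 + (if i \<le> j then j - i else i - j)) powr b"
  let ?S = "\<Sum>d=1..n. real d powr b"
  have "(\<Sum>i=1..n. \<Sum>j=1..n. ?f i j) \<le> (\<Sum>i=1..n. \<Sum>j=1..n. (if i \<le> j then ?f i j else 0) + (if j \<le> i then ?f i j else 0))"
    by (intro sum_mono) auto
  also have "\<dots> = (\<Sum>i=1..n. \<Sum>j=1..n. (if i \<le> j then ?f i j else 0)) + (\<Sum>i=1..n. \<Sum>j=1..n. (if j \<le> i then ?f i j else 0))"
    by (simp add: sum.distrib)
  also have "(\<Sum>i=1..n. \<Sum>j=1..n. (if j \<le> i then ?f i j else 0)) = (\<Sum>j=1..n. \<Sum>i=1..n. (if j \<le> i then ?f i j else 0))"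
    by (rule sum.swap)
  also have "\<dots> = (\<Sum>i=1..n. \<Sum>j=1..n. (if i \<le> j then ?f i j else 0))"
    by (intro sum.cong refl) (auto simp: max.commute)
  finally have 1: "(\<Sum>i=1..n. \<Sum>j=1..n. ?f i j) \<le> 2 * (\<Sum>i=1..n. \<Sum>j=1..n. (if i \<le> j then ?f i j else 0))" by simp
  have "(\<Sum>i=1..n. \<Sum>j=1..n. (if i \<le> j then ?f i j else 0)) = (\<Sum>j=1..n. \<Sum>i=1..n. (if i \<le> j then ?f i j else 0))"
    by (rule sum.swap)
  also have "\<dots> \<le> (\<Sum>j=1..n. real j powr b * ?S)"
  proof (rule sum_mono)
    fix j assume j: "j \<in> {1..n}"
    have "(\<Sum>i=1..n. (if i \<le> j then ?f i j else 0)) = (\<Sum>i=1..j. real j powr b * real (Suc j - i) powr b)"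
      using j by (intro sum.mono_neutral_cong_right) (auto simp: max_def Suc_diff_le)
    also have "\<dots> = real j powr b * (\<Sum>i=1..j. real (Suc j - i) powr b)" by (simp add: sum_distrib_left)
    also have "(\<Sum>i=1..j. real (Suc j - i) powr b) = (\<Sum>d=1..j. real d powr b)"
      by (rule sum.reindex_bij_witness[of _ "\<lambda>d. Suc j - d" "\<lambda>d. Suc j - d"]) auto
    also have "real j powr b * \<dots> \<le> real j powr b * ?S"
      using j by (intro mult_left_mono sum_mono2) auto
    finally show "(\<Sum>i=1..n. (if i \<le> j then ?f i j else 0)) \<le> real j powr b * ?S" .
  qed
  also have "\<dots> = ?S\<^sup>2" by (simp add: sum_distrib_right power2_eq_square)
  finally show ?thesis using 1 by simp
qed

lemma harm_le_ln: "1 \<le> n \<Longrightarrow> harm n \<le> ln (real n) + (1::real)"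
proof (induction n rule: dec_induct)
  case base then show ?case by (simp add: harm_def)
next
  case (step n)
  have "ln (real n / real (Suc n)) \<le> real n / real (Suc n) - 1" using step by (intro ln_le_minus_one) auto
  also have "\<dots> = - 1 / real (Suc n)" by (simp add: field_simps)
  finally have "ln (real n) + 1 / real (Suc n) \<le> ln (real (Suc n))" using step by (simp add: ln_div)
  then show ?case using step.IH by (simp add: harm_Suc divide_inverse)
qed

text \<open>\<open>\<kappa>\<close> is the covariance matrix of the observations and \<open>r\<close> the stationary covariance it is
  close to.\<close>

locale covariance_decay =
  fixes \<kappa> :: "nat \<Rightarrow> nat \<Rightarrow> real" and r :: "nat \<Rightarrow> real" and b C :: real
  assumes b: "b < 0" "b \<noteq> - 1" and C: "0 \<le> C"
    and r_decay: "\<And>d. 1 \<le> d \<Longrightarrow> \<bar>r d\<bar> \<le> C * real d powr b"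
    and \<kappa>_close: "\<And>i j. 1 \<le> i \<Longrightarrow> 1 \<le> j \<Longrightarrow> \<bar>\<kappa> i j - r (if i \<le> j then j - i else i - j)\<bar> \<le> C * real (max i j) powr b"
begin

abbreviation ds :: "nat \<Rightarrow> nat \<Rightarrow> nat" where "ds i j \<equiv> (if i \<le> j then j - i else i - j)"

text \<open>\<open>2 powr (- b)\<close> pays for the passage from d to 1 + d when d \<ge> 1, and |r
  0| covers lag 0. The shift is essential there, because \<open>0 powr b\<close> is 0.\<close>

definition Cr :: real where "Cr = \<bar>r 0\<bar> + C * 2 powr (- b)"

lemma Cr: "0 \<le> Cr" using C by (simp add: Cr_def)

lemma r_bound: "\<bar>r d\<bar> \<le> Cr * real (1 + d) powr b"
proof (cases "d = 0")
  case True then show ?thesis using C by (simp add: Cr_def)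
next
  case False
  then have d: "1 \<le> d" by simp
  have "real d powr b = 2 powr (- b) * (2 * real d) powr b"
    by (simp add: powr_mult powr_minus)
  also have "\<dots> \<le> 2 powr (- b) * real (1 + d) powr b"
    using d b by (intro mult_left_mono powr_mono2') auto
  finally have "C * real d powr b \<le> C * (2 powr (- b) * real (1 + d) powr b)" using C by (intro mult_left_mono) auto
  then have "\<bar>r d\<bar> \<le> C * 2 powr (- b) * real (1 + d) powr b" using r_decay[OF d] by simp
  also have "\<dots> \<le> Cr * real (1 + d) powr b" by (intro mult_right_mono) (auto simp: Cr_def)
  finally show ?thesis .
qed

lemma \<kappa>_bound:
  assumes "1 \<le> i" "1 \<le> j"
  shows "\<bar>\<kappa> i j\<bar> \<le> (C + Cr) * real (1 + ds i j) powr b"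
proof -
  have "real (max i j) powr b \<le> real (1 + ds i j) powr b"
    using assms b by (intro powr_mono2') auto
  then have "C * real (max i j) powr b \<le> C * real (1 + ds i j) powr b" using C by (intro mult_left_mono) auto
  then show ?thesis using \<kappa>_close[OF assms] r_bound[of "ds i j"] by (simp only: distrib_right) linarith
qed

text \<open>This controls the bias: the trace is the expectation of the sum of squares, and n
  \<open>r 0\<close> its stationary value.\<close>

lemma trace_bound:
  obtains B where "0 \<le> B" "\<And>n. 1 \<le> n \<Longrightarrow> \<bar>(\<Sum>i=1..n. \<kappa> i i) - real n * r 0\<bar> \<le> B * real n powr growth_exp b"
proof -
  obtain S where S: "0 \<le> S" "\<And>n. 1 \<le> n \<Longrightarrow> (\<Sum>d=1..n. real d powr b) \<le> S * real n powr growth_exp b"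
    using sum_powr_bound[OF b] by blast
  show thesis
  proof (rule that[of "C * S"])
    fix n :: nat assume n: "1 \<le> n"
    have "(\<Sum>i=1..n. \<kappa> i i) - real n * r 0 = (\<Sum>i=1..n. \<kappa> i i - r 0)" by (simp add: sum_subtractf)
    also have "\<bar>\<dots>\<bar> \<le> (\<Sum>i=1..n. \<bar>\<kappa> i i - r 0\<bar>)" by (rule sum_abs)
    also have "\<dots> \<le> (\<Sum>i=1..n. C * real i powr b)"
      by (intro sum_mono) (use \<kappa>_close in \<open>fastforce\<close>)
    also have "\<dots> \<le> C * (S * real n powr growth_exp b)"
      unfolding sum_distrib_left[symmetric] using C S(2)[OF n] by (intro mult_left_mono) auto
    finally show "\<bar>(\<Sum>i=1..n. \<kappa> i i) - real n * r 0\<bar> \<le> C * S * real n powr growth_exp b" by simp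
  qed (use C S in auto)
qed

text \<open>Entries on either side of the diagonal contribute at most one sum of d^b each. The bound
  becomes \<open>L\<close> in Stein's estimate.\<close>

lemma row_sum_bound:
  obtains B where "0 \<le> B" "\<And>n i. 1 \<le> i \<Longrightarrow> i \<le> n \<Longrightarrow> (\<Sum>j=1..n. \<bar>\<kappa> i j\<bar>) \<le> B * real n powr growth_exp b"
proof -
  obtain S where S: "0 \<le> S" "\<And>n. 1 \<le> n \<Longrightarrow> (\<Sum>d=1..n. real d powr b) \<le> S * real n powr growth_exp b"
    using sum_powr_bound[OF b] by blast
  show thesis
  proof (rule that[of "(C + Cr) * (2 * S)"])
    fix n i :: nat assume i: "1 \<le> i" "i \<le> n"
    have "(\<Sum>j=1..n. real (1 + ds i j) powr b) \<le> (\<Sum>j=1..n. (if i \<le> j then real (Suc j - i) powr b else 0) + (if j \<le> i then real (Suc i - j) powr b else 0))"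
      by (intro sum_mono) (auto simp: Suc_diff_le)
    also have "\<dots> = (\<Sum>j=1..n. (if i \<le> j then real (Suc j - i) powr b else 0)) + (\<Sum>j=1..n. (if j \<le> i then real (Suc i - j) powr b else 0))"
      by (rule sum.distrib)
    also have "(\<Sum>j=1..n. (if i \<le> j then real (Suc j - i) powr b else 0)) = (\<Sum>j=i..n. real (Suc j - i) powr b)"
      using i by (intro sum.mono_neutral_cong_right) auto
    also have "\<dots> = (\<Sum>d=1..Suc n - i. real d powr b)"
      using i by (intro sum.reindex_bij_witness[of _ "\<lambda>d. d + i - 1" "\<lambda>j. Suc j - i"]) auto
    also have "\<dots> \<le> (\<Sum>d=1..n. real d powr b)" using i by (intro sum_mono2) auto
    also have "(\<Sum>j=1..n. (if j \<le> i then real (Suc i - j) powr b else 0)) = (\<Sum>j=1..i. real (Suc i - j) powr b)"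
      using i by (intro sum.mono_neutral_cong_right) auto
    also have "\<dots> = (\<Sum>d=1..i. real d powr b)"
      by (rule sum.reindex_bij_witness[of _ "\<lambda>d. Suc i - d" "\<lambda>d. Suc i - d"]) auto
    also have "\<dots> \<le> (\<Sum>d=1..n. real d powr b)" using i by (intro sum_mono2) auto
    finally have *: "(\<Sum>j=1..n. real (1 + ds i j) powr b) \<le> 2 * (S * real n powr growth_exp b)" using S(2)[of n] i by linarith
    have "(\<Sum>j=1..n. \<bar>\<kappa> i j\<bar>) \<le> (\<Sum>j=1..n. (C + Cr) * real (1 + ds i j) powr b)"
      using i by (intro sum_mono \<kappa>_bound) auto
    also have "\<dots> \<le> (C + Cr) * (2 * (S * real n powr growth_exp b))"
      unfolding sum_distrib_left[symmetric] using C Cr * by (intro mult_left_mono) auto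
    finally show "(\<Sum>j=1..n. \<bar>\<kappa> i j\<bar>) \<le> (C + Cr) * (2 * S) * real n powr growth_exp b" by simp
  qed (use C Cr S in auto)
qed

text \<open>A difference of squares factors into a closeness term of order max(i, j)^b and a sum of
  size (1 + |i - j|)^b; the double sum of these products is at most a squared power sum.\<close>

lemma square_sum_close:
  obtains B where "0 \<le> B" "\<And>n. 1 \<le> n \<Longrightarrow>
    \<bar>(\<Sum>i=1..n. \<Sum>j=1..n. (\<kappa> i j)\<^sup>2) - (real n * (r 0)\<^sup>2 + 2 * (\<Sum>d=1..n. real (n - d) * (r d)\<^sup>2))\<bar> \<le> B * real n powr (2 * growth_exp b)"
proof -
  obtain S where S: "0 \<le> S" "\<And>n. 1 \<le> n \<Longrightarrow> (\<Sum>d=1..n. real d powr b) \<le> S * real n powr growth_exp b"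
    using sum_powr_bound[OF b] by blast
  show thesis
  proof (rule that[of "C * (C + 2 * Cr) * (2 * S\<^sup>2)"])
    fix n :: nat assume n: "1 \<le> n"
    have "\<bar>(\<Sum>i=1..n. \<Sum>j=1..n. (\<kappa> i j)\<^sup>2) - (\<Sum>i=1..n. \<Sum>j=1..n. (r (ds i j))\<^sup>2)\<bar>
      = \<bar>\<Sum>i=1..n. \<Sum>j=1..n. ((\<kappa> i j)\<^sup>2 - (r (ds i j))\<^sup>2)\<bar>" by (simp add: sum_subtractf)
    also have "\<dots> \<le> (\<Sum>i=1..n. \<Sum>j=1..n. \<bar>(\<kappa> i j)\<^sup>2 - (r (ds i j))\<^sup>2\<bar>)"
      by (rule order_trans[OF sum_abs]) (intro sum_mono sum_abs)
    also have "\<dots> \<le> (\<Sum>i=1..n. \<Sum>j=1..n. C * (C + 2 * Cr) * (real (max i j) powr b * real (1 + ds i j) powr b))"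
    proof (intro sum_mono)
      fix i j assume ij: "i \<in> {1..n}" "j \<in> {1..n}"
      then have ij': "1 \<le> i" "1 \<le> j" by auto
      have "\<bar>(\<kappa> i j)\<^sup>2 - (r (ds i j))\<^sup>2\<bar> = \<bar>\<kappa> i j - r (ds i j)\<bar> * \<bar>\<kappa> i j + r (ds i j)\<bar>"
        unfolding abs_mult[symmetric] by (simp add: power2_eq_square algebra_simps)
      also have "\<dots> \<le> (C * real (max i j) powr b) * ((C + Cr) * real (1 + ds i j) powr b + Cr * real (1 + ds i j) powr b)"
        using \<kappa>_bound[OF ij'] r_bound[of "ds i j"] C
        by (intro mult_mono \<kappa>_close ij' order_trans[OF abs_triangle_ineq] add_mono) auto
      also have "\<dots> = C * (C + 2 * Cr) * (real (max i j) powr b * real (1 + ds i j) powr b)" by (simp add: algebra_simps)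
      finally show "\<bar>(\<kappa> i j)\<^sup>2 - (r (ds i j))\<^sup>2\<bar> \<le> C * (C + 2 * Cr) * (real (max i j) powr b * real (1 + ds i j) powr b)" .
    qed
    also have "\<dots> \<le> C * (C + 2 * Cr) * (2 * (\<Sum>d=1..n. real d powr b)\<^sup>2)"
      unfolding sum_distrib_left[symmetric] using C Cr by (intro mult_left_mono double_sum_max_bound) auto
    also have "\<dots> \<le> C * (C + 2 * Cr) * (2 * (S * real n powr growth_exp b)\<^sup>2)"
      using C Cr S(2)[OF n] by (intro mult_left_mono power_mono sum_nonneg) auto
    also have "(S * real n powr growth_exp b)\<^sup>2 = S\<^sup>2 * real n powr (2 * growth_exp b)"
      using n by (simp add: power_mult_distrib power2_eq_square powr_add[symmetric])
    finally show "\<bar>(\<Sum>i=1..n. \<Sum>j=1..n. (\<kappa> i j)\<^sup>2) - (real n * (r 0)\<^sup>2 + 2 * (\<Sum>d=1..n. real (n - d) * (r d)\<^sup>2))\<bar>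
       \<le> C * (C + 2 * Cr) * (2 * S\<^sup>2) * real n powr (2 * growth_exp b)"
      unfolding stationary_double_sum[of "\<lambda>d. (r d)\<^sup>2" n] by simp
  qed (use C Cr S in auto)
qed

text \<open>This is the correction for replacing the weights n - d by n. One factor d^(1+b) is at
  most n to the growth exponent, and the other factor d^b is summed.\<close>

lemma weighted_square_sum:
  obtains B where "0 \<le> B" "\<And>n. 1 \<le> n \<Longrightarrow> (\<Sum>d=1..n. real d * (r d)\<^sup>2) \<le> B * real n powr (2 * growth_exp b)"
proof -
  obtain S where S: "0 \<le> S" "\<And>n. 1 \<le> n \<Longrightarrow> (\<Sum>d=1..n. real d powr b) \<le> S * real n powr growth_exp b"
    using sum_powr_bound[OF b] by blast
  show thesis
  proof (rule that[of "C\<^sup>2 * S"])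
    fix n :: nat assume n: "1 \<le> n"
    have "(\<Sum>d=1..n. real d * (r d)\<^sup>2) \<le> (\<Sum>d=1..n. C\<^sup>2 * real n powr growth_exp b * real d powr b)"
    proof (rule sum_mono)
      fix d assume d: "d \<in> {1..n}"
      have "(r d)\<^sup>2 \<le> (C * real d powr b)\<^sup>2" using r_decay[of d] d by (simp add: abs_le_square_iff[symmetric])
      then have "real d * (r d)\<^sup>2 \<le> real d * (C * real d powr b)\<^sup>2" by (intro mult_left_mono) auto
      also have "\<dots> = C\<^sup>2 * (real d powr (1 + b) * real d powr b)"
        using d by (simp add: power_mult_distrib power2_eq_square powr_add)
      also have "\<dots> \<le> C\<^sup>2 * (real n powr growth_exp b * real d powr b)"
      proof (intro mult_left_mono mult_right_mono)
        have "real d powr (1 + b) \<le> real d powr growth_exp b" using d by (intro powr_mono) (auto simp: growth_exp_def)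
        also have "\<dots> \<le> real n powr growth_exp b" using d by (intro powr_mono2) (auto simp: growth_exp_def)
        finally show "real d powr (1 + b) \<le> real n powr growth_exp b" .
      qed auto
      finally show "real d * (r d)\<^sup>2 \<le> C\<^sup>2 * real n powr growth_exp b * real d powr b" by simp
    qed
    also have "\<dots> \<le> C\<^sup>2 * real n powr growth_exp b * (S * real n powr growth_exp b)"
      unfolding sum_distrib_left[symmetric] using S(2)[OF n] by (intro mult_left_mono) auto
    also have "\<dots> = C\<^sup>2 * S * real n powr (2 * growth_exp b)"
      using n by (simp add: powr_add[symmetric] mult_ac)
    finally show "(\<Sum>d=1..n. real d * (r d)\<^sup>2) \<le> C\<^sup>2 * S * real n powr (2 * growth_exp b)" .
  qed (use S in auto)
qed

text \<open>The factor 4 is 2 times 2, as each positive lag stands for d and -d; below the critical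
  exponent this is the asymptotic variance.\<close>

definition limvar :: real where "limvar = 2 * (r 0)\<^sup>2 + 4 * (\<Sum>d. (r (Suc d))\<^sup>2)"

lemma r_square_bound: "1 \<le> d \<Longrightarrow> (r d)\<^sup>2 \<le> C\<^sup>2 * real d powr (2 * b)"
proof -
  assume d: "1 \<le> d"
  have "(r d)\<^sup>2 \<le> (C * real d powr b)\<^sup>2" using r_decay[of d] d by (simp add: abs_le_square_iff[symmetric])
  also have "\<dots> = C\<^sup>2 * real d powr (2 * b)"
    using d by (simp add: power_mult_distrib power2_eq_square powr_add[symmetric])
  finally show ?thesis .
qed

lemma r_square_summable:
  assumes "b < - 1 / 2"
  shows "summable (\<lambda>d. (r (Suc d))\<^sup>2)"
proof (rule summable_comparison_test)
  have "summable (\<lambda>d. real d powr (2 * b))" using assms by (simp add: summable_real_powr_iff)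
  then have "summable (\<lambda>d. real (Suc d) powr (2 * b))" by (subst summable_Suc_iff)
  then show "summable (\<lambda>d. C\<^sup>2 * real (Suc d) powr (2 * b))" by (rule summable_mult)
  show "\<exists>N. \<forall>d\<ge>N. norm ((r (Suc d))\<^sup>2) \<le> C\<^sup>2 * real (Suc d) powr (2 * b)"
    using r_square_bound[of "Suc _"] by auto
qed

lemma sum_Suc_shift: "(\<Sum>d=1..n. f d) = (\<Sum>d<n. f (Suc d) :: real)"
  by (rule sum.reindex_bij_witness[of _ Suc "\<lambda>d. d - 1"]) auto

lemma stationary_part: "1 \<le> n \<Longrightarrow> 2 / real n * (real n * (r 0)\<^sup>2 + 2 * (\<Sum>d=1..n. real (n - d) * (r d)\<^sup>2))
   = 2 * (r 0)\<^sup>2 + 4 * (\<Sum>d=1..n. (r d)\<^sup>2) - 4 / real n * (\<Sum>d=1..n. real d * (r d)\<^sup>2)"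
proof -
  assume n: "1 \<le> n"
  have "(\<Sum>d=1..n. real (n - d) * (r d)\<^sup>2) = real n * (\<Sum>d=1..n. (r d)\<^sup>2) - (\<Sum>d=1..n. real d * (r d)\<^sup>2)"
    unfolding sum_distrib_left sum_subtractf[symmetric]
    by (intro sum.cong) (auto simp: of_nat_diff algebra_simps)
  then show ?thesis using n by (simp add: field_simps)
qed

text \<open>Three errors occur: the departure from stationarity, the weights n - d instead of n, and
  the tail of the variance series. Each is at most a multiple of \<open>q\<close>.\<close>

lemma variance_rate:
  assumes b2: "b < - 1 / 2"
  obtains B where "0 \<le> B" "\<And>n. 1 \<le> n \<Longrightarrow>
    \<bar>2 / real n * (\<Sum>i=1..n. \<Sum>j=1..n. (\<kappa> i j)\<^sup>2) - limvar\<bar> \<le> B * real n powr (growth_exp b - 1 / 2)"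
proof -
  obtain B1 where B1: "0 \<le> B1" "\<And>n. 1 \<le> n \<Longrightarrow>
    \<bar>(\<Sum>i=1..n. \<Sum>j=1..n. (\<kappa> i j)\<^sup>2) - (real n * (r 0)\<^sup>2 + 2 * (\<Sum>d=1..n. real (n - d) * (r d)\<^sup>2))\<bar> \<le> B1 * real n powr (2 * growth_exp b)"
    using square_sum_close by blast
  obtain B2 where B2: "0 \<le> B2" "\<And>n. 1 \<le> n \<Longrightarrow> (\<Sum>d=1..n. real d * (r d)\<^sup>2) \<le> B2 * real n powr (2 * growth_exp b)"
    using weighted_square_sum by blast
  define B3 where "B3 = C\<^sup>2 / (- (2 * b + 1))"
  have B3: "0 \<le> B3" using b2 by (simp add: B3_def divide_nonneg_pos)
  show thesis
  proof (rule that[of "2 * B1 + 4 * B2 + 4 * B3"])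
    fix n :: nat assume n: "1 \<le> n"
    define K where "K = (\<Sum>i=1..n. \<Sum>j=1..n. (\<kappa> i j)\<^sup>2)"
    define L where "L = real n * (r 0)\<^sup>2 + 2 * (\<Sum>d=1..n. real (n - d) * (r d)\<^sup>2)"
    define W where "W = (\<Sum>d=1..n. real d * (r d)\<^sup>2)"
    define q where "q = real n powr (growth_exp b - 1 / 2)"
    have g: "0 \<le> growth_exp b" "growth_exp b \<le> 1 / 2" "b + 1 \<le> growth_exp b" using b2 by (auto simp: growth_exp_def max_def)
    have nq: "real n powr (2 * growth_exp b) / real n \<le> q"
    proof -
      have "real n powr (2 * growth_exp b) / real n = real n powr (2 * growth_exp b - 1)" using n by (simp add: powr_diff)
      \<comment> \<open>2g - 1 \<le> g - 1/2 is the same as g \<le> 1/2 for the growth exponent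
        g.\<close>
      also have "\<dots> \<le> q" unfolding q_def using n g by (intro powr_mono) auto
      finally show ?thesis .
    qed
    have tail: "(\<Sum>d. (r (Suc d))\<^sup>2) - (\<Sum>d=1..n. (r d)\<^sup>2) \<le> B3 * q" "0 \<le> (\<Sum>d. (r (Suc d))\<^sup>2) - (\<Sum>d=1..n. (r d)\<^sup>2)"
    proof -
      have "(\<Sum>d<k. (r (Suc d))\<^sup>2) \<le> (\<Sum>d=1..n. (r d)\<^sup>2) + B3 * q" if k: "n \<le> k" for k
      proof -
        have "(\<Sum>d<k. (r (Suc d))\<^sup>2) = (\<Sum>d\<in>{1..n} \<union> {n<..k}. (r d)\<^sup>2)"
          unfolding sum_Suc_shift[of "\<lambda>d. (r d)\<^sup>2" k, symmetric] using k n by (intro sum.cong) auto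
        also have "\<dots> = (\<Sum>d=1..n. (r d)\<^sup>2) + (\<Sum>d\<in>{n<..k}. (r d)\<^sup>2)"
          by (rule sum.union_disjoint) auto
        also have "(\<Sum>d\<in>{n<..k}. (r d)\<^sup>2) \<le> (\<Sum>d\<in>{n<..k}. C\<^sup>2 * real d powr (2 * b))"
          using n by (intro sum_mono r_square_bound) auto
        also have "\<dots> \<le> C\<^sup>2 * (real n powr (2 * b + 1) / (- (2 * b + 1)))"
          unfolding sum_distrib_left[symmetric] using b2 n k by (intro mult_left_mono sum_powr_tail) auto
        also have "\<dots> = B3 * real n powr (2 * b + 1)" by (simp add: B3_def)
        \<comment> \<open>2b + 1 = (b + 1) + b, where b + 1 is at most the growth exponent and b is
          below -1/2.\<close>
        also have "\<dots> \<le> B3 * q"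
          unfolding q_def using B3 n g by (intro mult_left_mono powr_mono) auto
        finally show ?thesis by simp
      qed
      then have "\<exists>N. \<forall>k\<ge>N. (\<Sum>d<k. (r (Suc d))\<^sup>2) \<le> (\<Sum>d=1..n. (r d)\<^sup>2) + B3 * q" by blast
      from LIMSEQ_le_const2[OF summable_LIMSEQ[OF r_square_summable[OF b2]] this]
      show "(\<Sum>d. (r (Suc d))\<^sup>2) - (\<Sum>d=1..n. (r d)\<^sup>2) \<le> B3 * q" by simp
      show "0 \<le> (\<Sum>d. (r (Suc d))\<^sup>2) - (\<Sum>d=1..n. (r d)\<^sup>2)"
        unfolding sum_Suc_shift[of "\<lambda>d. (r d)\<^sup>2"] using sum_le_suminf[OF r_square_summable[OF b2], of "{..<n}"] by simp
    qed
    have 1: "\<bar>2 / real n * (K - L)\<bar> \<le> 2 * B1 * q"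
    proof -
      have "\<bar>2 / real n * (K - L)\<bar> = 2 / real n * \<bar>K - L\<bar>" by (subst abs_mult) simp
      also have "\<dots> \<le> 2 / real n * (B1 * real n powr (2 * growth_exp b))"
        using B1(2)[OF n] unfolding K_def L_def by (intro mult_left_mono) auto
      also have "\<dots> = 2 * B1 * (real n powr (2 * growth_exp b) / real n)" by simp
      also have "\<dots> \<le> 2 * B1 * q" using B1(1) nq by (intro mult_left_mono) auto
      finally show ?thesis .
    qed
    have W: "0 \<le> 4 / real n * W" "4 / real n * W \<le> 4 * B2 * q"
    proof -
      show "0 \<le> 4 / real n * W" unfolding W_def by (intro mult_nonneg_nonneg sum_nonneg) auto
      have "4 / real n * W \<le> 4 / real n * (B2 * real n powr (2 * growth_exp b))"
        using B2(2)[OF n] unfolding W_def by (intro mult_left_mono) auto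
      also have "\<dots> = 4 * B2 * (real n powr (2 * growth_exp b) / real n)" by simp
      also have "\<dots> \<le> 4 * B2 * q" using B2(1) nq by (intro mult_left_mono) auto
      finally show "4 / real n * W \<le> 4 * B2 * q" .
    qed
    have "2 / real n * K - limvar = 2 / real n * (K - L) + (2 / real n * L - limvar)" by (simp add: right_diff_distrib)
    also have "2 / real n * L - limvar = - 4 * ((\<Sum>d. (r (Suc d))\<^sup>2) - (\<Sum>d=1..n. (r d)\<^sup>2)) - 4 / real n * W"
      unfolding L_def W_def stationary_part[OF n] limvar_def by simp
    finally have "2 / real n * K - limvar = 2 / real n * (K - L) + (- 4 * ((\<Sum>d. (r (Suc d))\<^sup>2) - (\<Sum>d=1..n. (r d)\<^sup>2)) - 4 / real n * W)" .
    moreover have "\<bar>u + (- 4 * w - z)\<bar> \<le> x + y + 4 * v"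
      if "\<bar>u\<bar> \<le> x" "0 \<le> z" "z \<le> y" "w \<le> v" "0 \<le> w" for u v w x y z :: real
      using that by linarith
    note this[OF 1 W tail]
    ultimately have "\<bar>2 / real n * K - limvar\<bar> \<le> 2 * B1 * q + 4 * B2 * q + 4 * (B3 * q)" by simp
    then show "\<bar>2 / real n * (\<Sum>i=1..n. \<Sum>j=1..n. (\<kappa> i j)\<^sup>2) - limvar\<bar> \<le> (2 * B1 + 4 * B2 + 4 * B3) * real n powr (growth_exp b - 1 / 2)"
      by (simp add: K_def q_def algebra_simps)
  qed (use B1 B2 B3 in auto)
qed

text \<open>The square of \<open>r d\<close> differs from c^2 / d by O(d^(-2)), since r - c x is
  O(d^(-3/2)) and r + c x is O(d^(-1/2)) for x = d^(-1/2). The harmonic sum produces the logarithm;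
  the remaining errors stay bounded because the growth exponent is 1/2.\<close>

lemma variance_rate_critical:
  assumes bh: "b = - 1 / 2" and c: "0 \<le> D" "\<And>d. 1 \<le> d \<Longrightarrow> \<bar>r d - c * real d powr (- 1 / 2)\<bar> \<le> D * real d powr (- 3 / 2)"
  obtains B where "0 \<le> B" "\<And>n. 1 \<le> n \<Longrightarrow>
    \<bar>2 / real n * (\<Sum>i=1..n. \<Sum>j=1..n. (\<kappa> i j)\<^sup>2) - 4 * c\<^sup>2 * ln (real n)\<bar> \<le> B"
proof -
  have g: "growth_exp b = 1 / 2" by (simp add: growth_exp_def bh)
  obtain B1 where B1: "0 \<le> B1" "\<And>n. 1 \<le> n \<Longrightarrow>
    \<bar>(\<Sum>i=1..n. \<Sum>j=1..n. (\<kappa> i j)\<^sup>2) - (real n * (r 0)\<^sup>2 + 2 * (\<Sum>d=1..n. real (n - d) * (r d)\<^sup>2))\<bar> \<le> B1 * real n powr (2 * growth_exp b)"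
    using square_sum_close by blast
  obtain B2 where B2: "0 \<le> B2" "\<And>n. 1 \<le> n \<Longrightarrow> (\<Sum>d=1..n. real d * (r d)\<^sup>2) \<le> B2 * real n powr (2 * growth_exp b)"
    using weighted_square_sum by blast
  obtain S where S: "0 \<le> S" "\<And>n. 1 \<le> n \<Longrightarrow> (\<Sum>d=1..n. real d powr (- 2)) \<le> S * real n powr growth_exp (- 2)"
    using sum_powr_bound[of "-2"] by auto
  define E where "E = D * (C + \<bar>c\<bar>)"
  have E: "0 \<le> E" using c C by (simp add: E_def)
  show thesis
  proof (rule that[of "2 * B1 + 2 * (r 0)\<^sup>2 + 4 * (E * S + c\<^sup>2) + 4 * B2"])
    fix n :: nat assume n: "1 \<le> n"
    define K where "K = (\<Sum>i=1..n. \<Sum>j=1..n. (\<kappa> i j)\<^sup>2)"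
    define L where "L = real n * (r 0)\<^sup>2 + 2 * (\<Sum>d=1..n. real (n - d) * (r d)\<^sup>2)"
    define W where "W = (\<Sum>d=1..n. real d * (r d)\<^sup>2)"
    have 1: "\<bar>2 / real n * (K - L)\<bar> \<le> 2 * B1"
    proof -
      have "\<bar>2 / real n * (K - L)\<bar> = 2 / real n * \<bar>K - L\<bar>" by (subst abs_mult) simp
      also have "\<dots> \<le> 2 / real n * (B1 * real n)"
        using B1(2)[OF n] unfolding K_def L_def g by (intro mult_left_mono) auto
      finally show ?thesis using n by simp
    qed
    have W: "0 \<le> 4 / real n * W" "4 / real n * W \<le> 4 * B2"
    proof -
      show "0 \<le> 4 / real n * W" unfolding W_def by (intro mult_nonneg_nonneg sum_nonneg) auto
      have "4 / real n * W \<le> 4 / real n * (B2 * real n)"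
        using B2(2)[OF n] unfolding W_def g by (intro mult_left_mono) auto
      then show "4 / real n * W \<le> 4 * B2" using n by simp
    qed
    have sq: "\<bar>(\<Sum>d=1..n. (r d)\<^sup>2) - c\<^sup>2 * harm n\<bar> \<le> E * S"
    proof -
      have "(\<Sum>d=1..n. (r d)\<^sup>2) - c\<^sup>2 * harm n = (\<Sum>d=1..n. (r d)\<^sup>2 - c\<^sup>2 / real d)"
        by (simp add: harm_def sum_subtractf sum_distrib_left divide_inverse)
      also have "\<bar>\<dots>\<bar> \<le> (\<Sum>d=1..n. \<bar>(r d)\<^sup>2 - c\<^sup>2 / real d\<bar>)" by (rule sum_abs)
      also have "\<dots> \<le> (\<Sum>d=1..n. E * real d powr (- 2))"
      proof (rule sum_mono)
        fix d assume "d \<in> {1..n}"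
        then have d: "1 \<le> d" by simp
        define x where "x = real d powr (- 1 / 2)"
        have xx: "x * x = 1 / real d" using d by (simp add: x_def powr_add[symmetric] powr_minus_divide)
        have "(r d)\<^sup>2 - c\<^sup>2 / real d = (r d - c * x) * (r d + c * x)"
          using xx by (simp add: algebra_simps power2_eq_square)
        then have "\<bar>(r d)\<^sup>2 - c\<^sup>2 / real d\<bar> = \<bar>r d - c * x\<bar> * \<bar>r d + c * x\<bar>" by (simp add: abs_mult)
        also have "\<dots> \<le> (D * real d powr (- 3 / 2)) * ((C + \<bar>c\<bar>) * x)"
        proof (rule mult_mono)
          show "\<bar>r d - c * x\<bar> \<le> D * real d powr (- 3 / 2)" using c(2)[OF d] by (simp add: x_def)
          have "\<bar>c * x\<bar> = \<bar>c\<bar> * x" by (simp add: abs_mult x_def)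
          then show "\<bar>r d + c * x\<bar> \<le> (C + \<bar>c\<bar>) * x"
            using r_decay[OF d] abs_triangle_ineq[of "r d" "c * x"] unfolding bh by (simp add: x_def distrib_right)
        qed (use c in auto)
        also have "\<dots> = E * (real d powr (- 3 / 2) * x)" by (simp add: E_def)
        also have "real d powr (- 3 / 2) * x = real d powr (- 2)" by (simp add: x_def powr_add[symmetric])
        finally show "\<bar>(r d)\<^sup>2 - c\<^sup>2 / real d\<bar> \<le> E * real d powr (- 2)" .
      qed
      also have "\<dots> \<le> E * S"
        unfolding sum_distrib_left[symmetric] using S(2)[OF n] E n by (intro mult_left_mono) (auto simp: growth_exp_def)
      finally show ?thesis .
    qed
    have h: "ln (real n) \<le> harm n" "harm n \<le> ln (real n) + 1"
    proof -
      have "ln (real n) \<le> ln (real n + 1)" using n by simp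
      also have "\<dots> \<le> harm n" using ln_le_harm[of n] by (simp add: add.commute)
      finally show "ln (real n) \<le> harm n" .
      show "harm n \<le> ln (real n) + 1" using n by (rule harm_le_ln)
    qed
    have "\<bar>c\<^sup>2 * harm n - c\<^sup>2 * ln (real n)\<bar> \<le> c\<^sup>2 * 1"
      unfolding right_diff_distrib[symmetric] abs_mult using h by (intro mult_mono) auto
    then have sq2: "\<bar>(\<Sum>d=1..n. (r d)\<^sup>2) - c\<^sup>2 * ln (real n)\<bar> \<le> E * S + c\<^sup>2" using sq by linarith
    have "2 / real n * K - 4 * c\<^sup>2 * ln (real n) = 2 / real n * (K - L) + (2 / real n * L - 4 * c\<^sup>2 * ln (real n))"
      by (simp add: right_diff_distrib)
    also have "2 / real n * L - 4 * c\<^sup>2 * ln (real n) = 2 * (r 0)\<^sup>2 + 4 * ((\<Sum>d=1..n. (r d)\<^sup>2) - c\<^sup>2 * ln (real n)) - 4 / real n * W"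
      unfolding L_def W_def stationary_part[OF n] by simp
    finally have eq: "2 / real n * K - 4 * c\<^sup>2 * ln (real n) = 2 / real n * (K - L)
       + (2 * (r 0)\<^sup>2 + 4 * ((\<Sum>d=1..n. (r d)\<^sup>2) - c\<^sup>2 * ln (real n)) - 4 / real n * W)" .
    have "\<bar>u + (2 * v + 4 * w - z)\<bar> \<le> 2 * B1 + 2 * v + 4 * X + 4 * B2"
      if "\<bar>u\<bar> \<le> 2 * B1" "0 \<le> v" "\<bar>w\<bar> \<le> X" "0 \<le> z" "z \<le> 4 * B2" for u v w z X :: real
      using that by linarith
    from this[OF 1 zero_le_power2[of "r 0"] sq2 W]
    show "\<bar>2 / real n * (\<Sum>i=1..n. \<Sum>j=1..n. (\<kappa> i j)\<^sup>2) - 4 * c\<^sup>2 * ln (real n)\<bar> \<le> 2 * B1 + 2 * (r 0)\<^sup>2 + 4 * (E * S + c\<^sup>2) + 4 * B2"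
      unfolding K_def[symmetric] eq .
  qed (use B1 B2 E S in auto)
qed

end

section \<open>Rates and weak convergence\<close>

context gaussian_vector begin

lemma sqn_variance: "(LINT \<omega>|M. (sqn \<omega> - trK)\<^sup>2) = 2 * trK2" "integrable M (\<lambda>\<omega>. (sqn \<omega> - trK)\<^sup>2)"
proof -
  have eq: "(\<lambda>\<omega>. (sqn \<omega>)\<^sup>2) = (\<lambda>\<omega>. \<Sum>i\<in>I. \<Sum>j\<in>I. X i \<omega> * X i \<omega> * (X j \<omega> * X j \<omega>))"
    by (auto simp: sqn_def power2_eq_square sum_product)
  have "(LINT \<omega>|M. (sqn \<omega>)\<^sup>2) = (\<Sum>i\<in>I. \<Sum>j\<in>I. (LINT \<omega>|M. X i \<omega> * X i \<omega> * (X j \<omega> * X j \<omega>)))"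
    unfolding eq by (simp add: Bochner_Integration.integral_sum Bochner_Integration.integrable_sum X_prod4(2))
  also have "\<dots> = (\<Sum>i\<in>I. \<Sum>j\<in>I. K i i * K j j + 2 * (K i j)\<^sup>2)"
    by (intro sum.cong refl) (subst X_prod4(1), auto simp: power2_eq_square)
  also have "\<dots> = trK\<^sup>2 + 2 * trK2"
  proof -
    have "trK\<^sup>2 = (\<Sum>i\<in>I. \<Sum>j\<in>I. K i i * K j j)"
      unfolding trK_def power2_eq_square by (rule sum_product)
    then show ?thesis by (simp add: trK2_def sum.distrib sum_distrib_left)
  qed
  finally have E2: "(LINT \<omega>|M. (sqn \<omega>)\<^sup>2) = trK\<^sup>2 + 2 * trK2" .
  have e: "(\<lambda>\<omega>. (sqn \<omega> - trK)\<^sup>2) = (\<lambda>\<omega>. (sqn \<omega>)\<^sup>2 - 2 * trK * sqn \<omega> + trK\<^sup>2)"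
    by (auto simp: power2_diff)
  show "integrable M (\<lambda>\<omega>. (sqn \<omega> - trK)\<^sup>2)"
    unfolding e using sqn_integrable sqn_square_integrable by simp
  show "(LINT \<omega>|M. (sqn \<omega> - trK)\<^sup>2) = 2 * trK2"
    unfolding e using sqn_integrable sqn_square_integrable sqn_expectation E2
    by (simp add: prob_space power2_eq_square)
qed

lemma trK2_nonneg: "0 \<le> trK2" unfolding trK2_def by (intro sum_nonneg) auto

lemma sqn_abs_deviation: "(LINT \<omega>|M. \<bar>sqn \<omega> - trK\<bar>) \<le> sqrt (2 * trK2)"
proof (rule power2_le_imp_le)
  have "integrable M (\<lambda>\<omega>. \<bar>sqn \<omega> - trK\<bar>)" using sqn_integrable by auto
  then show "(LINT \<omega>|M. \<bar>sqn \<omega> - trK\<bar>)\<^sup>2 \<le> (sqrt (2 * trK2))\<^sup>2"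
    using variance_eq[of "\<lambda>\<omega>. \<bar>sqn \<omega> - trK\<bar>"] variance_positive[of "\<lambda>\<omega>. \<bar>sqn \<omega> - trK\<bar>"] sqn_variance trK2_nonneg
    by simp
qed (use trK2_nonneg in simp)

text \<open>When the variance is far from its target the claim is trivial, because then \<open>\<epsilon>\<close> is
  bounded below; this also covers a degenerate vector.\<close>

lemma wasserstein_bound:
  assumes L: "\<And>i. i \<in> I \<Longrightarrow> (\<Sum>j\<in>I. \<bar>K i j\<bar>) \<le> L" and L0: "0 \<le> L" and s: "0 < s"
    and e1: "\<bar>2 * trK2 / s\<^sup>2 - 1\<bar> \<le> \<epsilon>" and e2: "\<bar>trK - m\<bar> / s \<le> \<epsilon>" and e3: "12 * L / s \<le> \<epsilon>"
    and h: "1-lipschitz_on UNIV h"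
  shows "\<bar>(LINT \<omega>|M. h ((sqn \<omega> - m) / s)) - integral\<^sup>L std_gauss h\<bar> \<le> 3 * \<epsilon>"
proof -
  interpret N: prob_space std_gauss by (rule prob_space_std_gauss)
  \<comment> \<open>The ratio of the actual standard deviation of the statistic to the target
    \<open>s\<close>. The proof splits at a = 1/2.\<close>
  define a where "a = sqrt (2 * trK2) / s"
  have a0: "0 \<le> a" using s trK2_nonneg by (simp add: a_def)
  have a2: "a\<^sup>2 = 2 * trK2 / s\<^sup>2" using trK2_nonneg by (simp add: a_def power_divide)
  have \<epsilon>: "0 \<le> \<epsilon>" using e1 by linarith
  have [measurable]: "h \<in> borel_measurable borel" by (rule lipschitz_real_measurable[OF h])
  let ?W = "\<lambda>\<omega>. (sqn \<omega> - m) / s"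
  have dev: "integrable M (\<lambda>\<omega>. \<bar>sqn \<omega> - trK\<bar>)" using sqn_integrable by auto
  have lip_int: "integrable M (\<lambda>\<omega>. h ((sqn \<omega> - c) / d))" if "0 < d" for c d
  proof (rule Bochner_Integration.integrable_bound)
    show "integrable M (\<lambda>\<omega>. \<bar>h 0\<bar> + \<bar>(sqn \<omega> - c) / d\<bar>)" using sqn_integrable by auto
    show "AE \<omega> in M. norm (h ((sqn \<omega> - c) / d)) \<le> norm (\<bar>h 0\<bar> + \<bar>(sqn \<omega> - c) / d\<bar>)"
    proof (rule AE_I2)
      fix \<omega> show "norm (h ((sqn \<omega> - c) / d)) \<le> norm (\<bar>h 0\<bar> + \<bar>(sqn \<omega> - c) / d\<bar>)"
        using lipschitz_real_le[OF h, of "(sqn \<omega> - c) / d" 0] by simp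
    qed
  qed measurable
  show ?thesis
  proof (cases "1 / 4 \<le> a\<^sup>2")
    case True
    then have apos: "0 < a" using a0 by (cases "a = 0") auto
    have tr: "0 < trK2" using True s trK2_nonneg unfolding a2 by (cases "trK2 = 0") auto
    define u where "u = sqrt (2 * trK2)"
    have u: "0 < u" "a = u / s" using tr by (auto simp: u_def a_def)
    let ?F = "\<lambda>\<omega>. (sqn \<omega> - trK) / u"
    have st: "\<bar>(LINT \<omega>|M. h (?F \<omega>)) - integral\<^sup>L std_gauss h\<bar> \<le> 4 * L / sqrt trK2"
      using stein_bound[OF L L0 tr h] by (simp add: u_def)
    \<comment> \<open>The comparison of \<open>s\<close> with 3 \<open>sqrt trK2\<close> turns the
      factor 4 of Stein's bound into the 12 of the hypothesis.\<close>
    have "s\<^sup>2 \<le> 8 * trK2" using True s unfolding a2 by (simp add: field_simps)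
    also have "\<dots> \<le> (3 * sqrt trK2)\<^sup>2" using trK2_nonneg by (simp add: power_mult_distrib)
    finally have "s \<le> 3 * sqrt trK2" by (rule power2_le_imp_le) (use tr in simp)
    then have "L * s \<le> L * (3 * sqrt trK2)" using L0 by (intro mult_left_mono) auto
    then have "4 * L / sqrt trK2 \<le> 12 * L / s" using s tr by (simp add: field_simps)
    then have 1: "\<bar>(LINT \<omega>|M. h (?F \<omega>)) - integral\<^sup>L std_gauss h\<bar> \<le> \<epsilon>" using st e3 by linarith
    \<comment> \<open>As a + 1 is at least 1, closeness of the variances yields closeness of the
      standard deviations without loss.\<close>
    have "\<bar>a - 1\<bar> * 1 \<le> \<bar>a - 1\<bar> * \<bar>a + 1\<bar>" using a0 by (intro mult_left_mono) auto
    also have "\<dots> = \<bar>a\<^sup>2 - 1\<bar>" unfolding abs_mult[symmetric] by (simp add: power2_eq_square algebra_simps)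
    finally have "\<bar>a - 1\<bar> \<le> \<bar>a\<^sup>2 - 1\<bar>" by simp
    also have "\<dots> \<le> \<epsilon>" unfolding a2 by (rule e1)
    finally have a1: "\<bar>a - 1\<bar> \<le> \<epsilon>" .
    have "(LINT \<omega>|M. h (?W \<omega>)) - (LINT \<omega>|M. h (?F \<omega>)) = (LINT \<omega>|M. h (?W \<omega>) - h (?F \<omega>))"
      using lip_int[OF s] lip_int[OF u(1)] by simp
    also have "\<bar>\<dots>\<bar> \<le> (LINT \<omega>|M. \<bar>a - 1\<bar> / u * \<bar>sqn \<omega> - trK\<bar> + \<bar>trK - m\<bar> / s)"
    proof (rule order_trans[OF integral_abs_bound], rule integral_mono)
      fix \<omega>
      have W: "?W \<omega> - ?F \<omega> = (a - 1) / u * (sqn \<omega> - trK) + (trK - m) / s"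
        unfolding u(2) using u(1) s by (simp add: field_simps)
      have "\<bar>h (?W \<omega>) - h (?F \<omega>)\<bar> \<le> \<bar>?W \<omega> - ?F \<omega>\<bar>" by (rule lipschitz_real_le[OF h])
      also have "\<dots> \<le> \<bar>(a - 1) / u * (sqn \<omega> - trK)\<bar> + \<bar>(trK - m) / s\<bar>" unfolding W by (rule abs_triangle_ineq)
      also have "\<dots> = \<bar>a - 1\<bar> / u * \<bar>sqn \<omega> - trK\<bar> + \<bar>trK - m\<bar> / s" using u s by (simp add: abs_mult)
      finally show "\<bar>h (?W \<omega>) - h (?F \<omega>)\<bar> \<le> \<bar>a - 1\<bar> / u * \<bar>sqn \<omega> - trK\<bar> + \<bar>trK - m\<bar> / s" .
    qed (use lip_int[OF s] lip_int[OF u(1)] dev in auto)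
    also have "\<dots> = \<bar>a - 1\<bar> / u * (LINT \<omega>|M. \<bar>sqn \<omega> - trK\<bar>) + \<bar>trK - m\<bar> / s"
      using dev by (simp add: prob_space)
    also have "\<dots> \<le> \<bar>a - 1\<bar> / u * u + \<bar>trK - m\<bar> / s"
      using sqn_abs_deviation u by (intro add_right_mono mult_left_mono) (auto simp: u_def)
    also have "\<dots> \<le> \<epsilon> + \<epsilon>" using u a1 e2 by simp
    finally show ?thesis using 1 by linarith
  next
    case False
    \<comment> \<open>The first-moment bound a + \<epsilon> + 1 with a at most 1/2 is now below 3
      \<epsilon>, so a crude comparison suffices.\<close>
    then have big: "3 / 4 \<le> \<epsilon>" using e1 unfolding a2 by linarith
    have "a \<le> 1 / 2" by (rule power2_le_imp_le) (use False in \<open>auto simp: power_divide\<close>)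
    have "(LINT \<omega>|M. h (?W \<omega>)) - integral\<^sup>L std_gauss h = (LINT \<omega>|M. h (?W \<omega>) - integral\<^sup>L std_gauss h)"
      using lip_int[OF s] by (simp add: prob_space)
    also have "\<bar>\<dots>\<bar> \<le> (LINT \<omega>|M. (1 / s * \<bar>sqn \<omega> - trK\<bar> + \<bar>trK - m\<bar> / s) + 1)"
    proof (rule order_trans[OF integral_abs_bound], rule integral_mono)
      fix \<omega>
      have 1: "\<bar>h (?W \<omega>) - integral\<^sup>L std_gauss h\<bar> \<le> \<bar>?W \<omega>\<bar> + 1" by (rule lipschitz_centred_bound[OF h])
      have "?W \<omega> = (sqn \<omega> - trK) / s + (trK - m) / s" using s by (simp add: field_simps)
      then have "\<bar>?W \<omega>\<bar> \<le> \<bar>(sqn \<omega> - trK) / s\<bar> + \<bar>(trK - m) / s\<bar>" by (metis abs_triangle_ineq)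
      also have "\<dots> = 1 / s * \<bar>sqn \<omega> - trK\<bar> + \<bar>trK - m\<bar> / s" using s by simp
      finally show "\<bar>h (?W \<omega>) - integral\<^sup>L std_gauss h\<bar> \<le> (1 / s * \<bar>sqn \<omega> - trK\<bar> + \<bar>trK - m\<bar> / s) + 1" using 1 by linarith
    qed (use lip_int[OF s] dev in auto)
    also have "\<dots> = 1 / s * (LINT \<omega>|M. \<bar>sqn \<omega> - trK\<bar>) + \<bar>trK - m\<bar> / s + 1"
      using dev by (simp add: prob_space)
    also have "\<dots> \<le> 1 / s * sqrt (2 * trK2) + \<bar>trK - m\<bar> / s + 1"
      using sqn_abs_deviation s by (intro add_right_mono mult_left_mono) auto
    also have "\<dots> = a + \<bar>trK - m\<bar> / s + 1" by (simp add: a_def)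
    also have "\<dots> \<le> 3 * \<epsilon>" using \<open>a \<le> 1 / 2\<close> e2 big by linarith
    finally show ?thesis .
  qed
qed

end

section \<open>Wasserstein bounds and convergence in law\<close>

lemma gaussian_vector_reindex:
  assumes G: "gaussian_vector M (f ` J) K X" and f: "inj_on f J" "finite J"
  shows "gaussian_vector M J (\<lambda>i j. K (f i) (f j)) (\<lambda>i. X (f i))"
proof -
  interpret gaussian_vector M "f ` J" K X by (rule G)
  show ?thesis
  proof unfold_locales
    fix c :: "'c \<Rightarrow> real"
    let ?d = "\<lambda>t. c (the_inv_into J f t)"
    have d: "?d (f i) = c i" if "i \<in> J" for i using f that by (simp add: the_inv_into_f_f)
    have "(\<Sum>i\<in>f ` J. \<Sum>j\<in>f ` J. ?d i * ?d j * K i j) = (\<Sum>i\<in>J. \<Sum>j\<in>J. c i * c j * K (f i) (f j))"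
      using f by (simp add: sum.reindex d)
    moreover have "(\<lambda>\<omega>. \<Sum>i\<in>f ` J. ?d i * X i \<omega>) = (\<lambda>\<omega>. \<Sum>i\<in>J. c i * X (f i) \<omega>)"
      using f by (simp add: sum.reindex d)
    ultimately show "cgauss M (\<Sum>i\<in>J. \<Sum>j\<in>J. c i * c j * K (f i) (f j)) (\<lambda>\<omega>. \<Sum>i\<in>J. c i * X (f i) \<omega>)"
      using gauss[of ?d] by simp
  qed (use f symK in auto)
qed

lemma wasserstein_distI:
  assumes M: "prob_space M" and [measurable]: "W \<in> borel_measurable M"
    and b: "\<And>h. 1-lipschitz_on UNIV h \<Longrightarrow> \<bar>(LINT \<omega>|M. h (W \<omega>)) - integral\<^sup>L std_gauss h\<bar> \<le> e"
  shows "wasserstein_dist (distr M borel W) std_gauss \<le> ennreal e"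
  unfolding wasserstein_dist_def
proof (rule SUP_least)
  fix h :: "real \<Rightarrow> real" assume "h \<in> {f. 1-lipschitz_on UNIV f}"
  then have h: "1-lipschitz_on UNIV h" by simp
  have [measurable]: "h \<in> borel_measurable borel" by (rule lipschitz_real_measurable[OF h])
  have "integral\<^sup>L (distr M borel W) h = (LINT \<omega>|M. h (W \<omega>))" by (rule integral_distr) auto
  then show "ennreal \<bar>integral\<^sup>L (distr M borel W) h - integral\<^sup>L std_gauss h\<bar> \<le> ennreal e"
    using b[OF h] by (intro ennreal_leI) simp
qed

lemma lipschitz_scaled:
  fixes g :: "real \<Rightarrow> real"
  assumes g: "\<And>x y. \<bar>g x - g y\<bar> \<le> \<bar>x - y\<bar>" and u: "u \<noteq> 0"
  shows "1-lipschitz_on UNIV (\<lambda>x. g (u * x) / \<bar>u\<bar>)"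
proof (rule lipschitz_onI)
  fix x y :: real
  have "\<bar>g (u * x) - g (u * y)\<bar> \<le> \<bar>u\<bar> * \<bar>x - y\<bar>" using g[of "u * x" "u * y"] by (simp add: right_diff_distrib[symmetric] abs_mult)
  then have "\<bar>g (u * x) - g (u * y)\<bar> / \<bar>u\<bar> \<le> \<bar>x - y\<bar>" using u by (simp add: divide_le_eq mult.commute)
  then show "dist (g (u * x) / \<bar>u\<bar>) (g (u * y) / \<bar>u\<bar>) \<le> 1 * dist x y"
    by (simp add: dist_real_def diff_divide_distrib[symmetric])
qed simp

lemma abs_cos_diff: "\<bar>cos x - cos y\<bar> \<le> \<bar>x - y\<bar>" for x y :: real
  using field_differentiable_bound[of UNIV cos "\<lambda>x. - sin x" 1 x y] by (auto intro: derivative_eq_intros)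

lemma abs_sin_diff: "\<bar>sin x - sin y\<bar> \<le> \<bar>x - y\<bar>" for x y :: real
  using field_differentiable_bound[of UNIV sin "\<lambda>x. cos x" 1 x y] by (auto intro: derivative_eq_intros)

text \<open>cos(u x) and sin(u x) become 1-Lipschitz after division by |u|, so the bound gives
  pointwise convergence of the characteristic functions, and Levy's continuity theorem applies. The
  factor \<open>s\<close> restores the scale removed by standardisation.\<close>

lemma wasserstein_imp_weak_conv:
  fixes W :: "nat \<Rightarrow> 'a \<Rightarrow> real" and e :: "nat \<Rightarrow> real"
  assumes M: "prob_space M" and W[measurable]: "\<And>n. W n \<in> borel_measurable M" and s: "0 < s"
    and b: "\<And>n h. 1 < n \<Longrightarrow> 1-lipschitz_on UNIV h \<Longrightarrow> \<bar>(LINT \<omega>|M. h (W n \<omega>)) - integral\<^sup>L std_gauss h\<bar> \<le> e n"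
    and e: "e \<longlonglongrightarrow> 0"
  shows "weak_conv_m (\<lambda>n. distr M borel (\<lambda>\<omega>. s * W n \<omega>)) (density lborel (normal_density 0 s))"
proof -
  interpret M: prob_space M by fact
  interpret N: prob_space std_gauss by (rule prob_space_std_gauss)
  have D: "density lborel (normal_density 0 s) = distr std_gauss borel (\<lambda>x. s * x)"
    using normal_law_eq_distr[of s 0] s by (simp add: normal_law_def)
  have lim: "(\<lambda>n. LINT \<omega>|M. g (u * W n \<omega>)) \<longlonglongrightarrow> (LINT x|std_gauss. g (u * x))"
    if g: "\<And>x y. \<bar>g x - g y\<bar> \<le> \<bar>x - y\<bar>" for g :: "real \<Rightarrow> real" and u
  proof (cases "u = 0")
    case True then show ?thesis by (simp add: M.prob_space)
  next
    case False
    have "\<bar>(LINT \<omega>|M. g (u * W n \<omega>)) - (LINT x|std_gauss. g (u * x))\<bar> \<le> \<bar>u\<bar> * e n" if n: "1 < n" for n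
    proof -
      have "\<bar>(LINT \<omega>|M. g (u * W n \<omega>) / \<bar>u\<bar>) - (LINT x|std_gauss. g (u * x) / \<bar>u\<bar>)\<bar> \<le> e n"
        by (rule b[OF n lipschitz_scaled[OF g False]])
      then have "\<bar>(LINT \<omega>|M. g (u * W n \<omega>)) - (LINT x|std_gauss. g (u * x))\<bar> / \<bar>u\<bar> \<le> e n"
        by (simp add: diff_divide_distrib[symmetric])
      then show ?thesis using False by (simp add: divide_le_eq mult.commute)
    qed
    then have "eventually (\<lambda>n. norm ((LINT \<omega>|M. g (u * W n \<omega>)) - (LINT x|std_gauss. g (u * x))) \<le> \<bar>u\<bar> * e n) sequentially"
      by (intro eventually_sequentiallyI[of 2]) auto
    then have "(\<lambda>n. (LINT \<omega>|M. g (u * W n \<omega>)) - (LINT x|std_gauss. g (u * x))) \<longlonglongrightarrow> 0"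
      by (rule Lim_null_comparison) (use tendsto_mult_right_zero[OF e] in simp)
    then show ?thesis by (simp add: LIM_zero_iff)
  qed
  have char: "char (distr P borel V) t = complex_of_real (LINT \<omega>|P. cos (t * V \<omega>)) + \<i> * complex_of_real (LINT \<omega>|P. sin (t * V \<omega>))"
    if P: "prob_space P" and V[measurable]: "V \<in> borel_measurable P" for P :: "'c measure" and V t
  proof -
    interpret P: prob_space P by fact
    have i: "integrable P (\<lambda>\<omega>. cos (t * V \<omega>))" "integrable P (\<lambda>\<omega>. sin (t * V \<omega>))"
      by (rule P.integrable_const_bound[where B=1]; simp)+
    have "char (distr P borel V) t = (CLINT \<omega>|P. iexp (t * V \<omega>))"
      unfolding char_def by (rule integral_distr) auto
    also have "(\<lambda>\<omega>. iexp (t * V \<omega>)) = (\<lambda>\<omega>. complex_of_real (cos (t * V \<omega>)) + \<i> * complex_of_real (sin (t * V \<omega>)))"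
      by (auto simp: exp_Euler cos_of_real sin_of_real simp del: of_real_mult)
    also have "(CLINT \<omega>|P. complex_of_real (cos (t * V \<omega>)) + \<i> * complex_of_real (sin (t * V \<omega>)))
       = complex_of_real (LINT \<omega>|P. cos (t * V \<omega>)) + \<i> * complex_of_real (LINT \<omega>|P. sin (t * V \<omega>))"
      using i by (simp add: integrable_of_real)
    finally show ?thesis .
  qed
  show ?thesis
    unfolding D
  proof (rule levy_continuity)
    show "real_distribution (distr M borel (\<lambda>\<omega>. s * W n \<omega>))" for n by (rule M.real_distribution_distr) auto
    show "real_distribution (distr std_gauss borel (\<lambda>x. s * x))" by (rule N.real_distribution_distr) auto
    show "(\<lambda>n. char (distr M borel (\<lambda>\<omega>. s * W n \<omega>)) t) \<longlonglongrightarrow> char (distr std_gauss borel (\<lambda>x. s * x)) t" for t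
      using lim[OF abs_cos_diff, of "t * s"] lim[OF abs_sin_diff, of "t * s"]
      by (auto simp: char[OF M] char[OF prob_space_std_gauss] mult.assoc intro!: tendsto_intros)
  qed
qed

section \<open>The two Ornstein-Uhlenbeck processes as Gaussian vectors\<close>

lemma sub_fractional_OU_gaussian_vector:
  assumes H: "0 < H" "H < 1" and \<theta>: "0 < \<theta>"
    and S: "sub_fractional_BM M H S" and X: "sub_fractional_OU M \<theta> S X"
  shows "gaussian_vector M {1..n} (\<lambda>i j. sub_OU_cov \<theta> H (real i) (real j)) (\<lambda>i. X (real i))"
proof (rule gaussian_vector_reindex[where f=real and K="sub_OU_cov \<theta> H" and X=X])
  have ccg: "continuous_centred_gaussian M {0..} (subfbm_cov H) S"
    using S by (simp add: sub_fractional_BM_def subfbm_cov_def[abs_def])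
  interpret prob_space M using ccg by (simp add: continuous_centred_gaussian_def)
  interpret centred_gaussian M "{0..}" "subfbm_cov H" S by unfold_locales (rule ccg)
  have "gaussian_vector M (real ` {1..n}) (ou_cov \<theta> (subfbm_cov H) 0) X"
  proof (rule young_OU_gaussian_vector[OF \<theta>])
    show "continuous_on ({0..} \<times> {0..}) (\<lambda>(u, v). subfbm_cov H u v)" by (rule subfbm_cov_continuous[OF H(1)])
    show "(\<lambda>(u, v). subfbm_cov H u v) \<in> borel_measurable (borel \<Otimes>\<^sub>M borel)" by (rule subfbm_cov_measurable)
    fix t assume t: "t \<in> real ` {1..n}"
    then show t0: "0 < t" by auto
    show "X t \<in> borel_measurable M" using X t0 by (simp add: sub_fractional_OU_def)
    have "AE \<omega> in M. \<exists>I. has_young_integral (\<lambda>s. exp (\<theta> * s)) (\<lambda>s. S s \<omega>) 0 t I \<and> X t \<omega> = exp (- \<theta> * t) * I"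
      using X t0 by (simp add: sub_fractional_OU_def)
    then show "AE \<omega> in M. (\<lambda>k. young_sum \<theta> (Suc k) 0 t (\<lambda>u. S u \<omega>)) \<longlonglongrightarrow> X t \<omega>"
    proof eventually_elim
      fix \<omega> assume "\<exists>I. has_young_integral (\<lambda>s. exp (\<theta> * s)) (\<lambda>s. S s \<omega>) 0 t I \<and> X t \<omega> = exp (- \<theta> * t) * I"
      then show "(\<lambda>k. young_sum \<theta> (Suc k) 0 t (\<lambda>u. S u \<omega>)) \<longlonglongrightarrow> X t \<omega>"
        using young_young_sum_limit[OF _ t0] by auto
    qed
  qed auto
  then show "gaussian_vector M (real ` {1..n}) (sub_OU_cov \<theta> H) X" by (simp add: sub_OU_cov_def[abs_def])
qed auto

text \<open>Two limits in succession: the mesh tends to 0 on [a_m, t], then a_m tends to minus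
  infinity. The Gaussian property and the covariance pass through both.\<close>

lemma stationary_OU_gaussian_vector:
  assumes H: "0 < H" "H < 1" and \<theta>: "0 < \<theta>" and I: "finite I"
    and B: "two_sided_fractional_BM P H B" and Z: "stationary_fractional_OU P \<theta> B Z"
  shows "gaussian_vector P I (\<lambda>t s. stationary_cov \<theta> H (t - s)) Z"
proof -
  have ccg: "continuous_centred_gaussian P UNIV (fbm_cov H) B"
    using B by (simp add: two_sided_fractional_BM_def fbm_cov_def[abs_def])
  interpret prob_space P using ccg by (simp add: continuous_centred_gaussian_def)
  interpret centred_gaussian P UNIV "fbm_cov H" B by unfold_locales (rule ccg)
  \<comment> \<open>Common starting points, strictly below every time in \<open>I\<close>.\<close>
  define a where "a = (\<lambda>m::nat. Min (insert 0 I) - 1 - real m)"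
  have at: "a m < t" if "t \<in> I" for m t
  proof -
    have "Min (insert 0 I) \<le> t" using I that by (intro Min_le) auto
    then show ?thesis by (simp add: a_def)
  qed
  have abot: "filterlim a at_bot sequentially"
    unfolding a_def by real_asymp
  \<comment> \<open>The values of the Young integrals come from an existential statement for each
    \<omega>, without measurability. Limits of Young sums are measurable and agree with the
    integrals almost surely.\<close>
  define V where "V = (\<lambda>m t \<omega>. lim (\<lambda>k. young_sum \<theta> (Suc k) (a m) t (\<lambda>u. B u \<omega>)))"
  have young: "AE \<omega> in P. \<exists>J. (\<forall>m. (\<lambda>k. young_sum \<theta> (Suc k) (a m) t (\<lambda>u. B u \<omega>)) \<longlonglongrightarrow> exp (- \<theta> * t) * J (a m))
      \<and> (\<lambda>m. exp (- \<theta> * t) * J (a m)) \<longlonglongrightarrow> Z t \<omega>" if t: "t \<in> I" for t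
  proof -
    have "AE \<omega> in P. \<exists>I. has_young_integral_from_minus_infinity (\<lambda>u. exp (\<theta> * u)) (\<lambda>u. B u \<omega>) t I \<and> Z t \<omega> = exp (- \<theta> * t) * I"
      using Z by (simp add: stationary_fractional_OU_def)
    then show ?thesis
    proof eventually_elim
      fix \<omega> assume "\<exists>I. has_young_integral_from_minus_infinity (\<lambda>u. exp (\<theta> * u)) (\<lambda>u. B u \<omega>) t I \<and> Z t \<omega> = exp (- \<theta> * t) * I"
      then obtain L J where J: "\<And>x. x \<le> t \<Longrightarrow> has_young_integral (\<lambda>u. exp (\<theta> * u)) (\<lambda>u. B u \<omega>) x t (J x)"
        "(J \<longlongrightarrow> L) at_bot" "Z t \<omega> = exp (- \<theta> * t) * L"
        unfolding has_young_integral_from_minus_infinity_def by blast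
      have "(\<lambda>k. young_sum \<theta> (Suc k) (a m) t (\<lambda>u. B u \<omega>)) \<longlonglongrightarrow> exp (- \<theta> * t) * J (a m)" for m
        using at[OF t, of m] by (intro young_young_sum_limit J) auto
      moreover have "(\<lambda>m. exp (- \<theta> * t) * J (a m)) \<longlonglongrightarrow> Z t \<omega>"
        unfolding J(3) by (intro tendsto_mult_left filterlim_compose[OF J(2) abot])
      ultimately show "\<exists>J. (\<forall>m. (\<lambda>k. young_sum \<theta> (Suc k) (a m) t (\<lambda>u. B u \<omega>)) \<longlonglongrightarrow> exp (- \<theta> * t) * J (a m))
         \<and> (\<lambda>m. exp (- \<theta> * t) * J (a m)) \<longlonglongrightarrow> Z t \<omega>" by blast
    qed
  qed
  show ?thesis
  proof (rule gaussian_vector_limit[where X=V and K="\<lambda>m. ou_cov \<theta> (fbm_cov H) (a m)"])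
    show "gaussian_vector P I (ou_cov \<theta> (fbm_cov H) (a m)) (V m)" for m
    proof (rule young_OU_gaussian_vector[OF \<theta> I])
      show "continuous_on ({a m..} \<times> {a m..}) (\<lambda>(u, v). fbm_cov H u v)" by (rule fbm_cov_continuous[OF H(1)])
      show "(\<lambda>(u, v). fbm_cov H u v) \<in> borel_measurable (borel \<Otimes>\<^sub>M borel)" by (rule fbm_cov_measurable)
      fix t assume t: "t \<in> I"
      show "a m < t" by (rule at[OF t])
      have "(\<lambda>\<omega>. young_sum \<theta> (Suc k) (a m) t (\<lambda>u. B u \<omega>)) \<in> borel_measurable P" for k
        using at[OF t, of m] by (intro lcomb_integrable_power(2) young_sum_lcomb) auto
      then show "V m t \<in> borel_measurable P"
        unfolding V_def by (rule borel_measurable_lim_metric)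
      show "AE \<omega> in P. (\<lambda>k. young_sum \<theta> (Suc k) (a m) t (\<lambda>u. B u \<omega>)) \<longlonglongrightarrow> V m t \<omega>"
        using young[OF t]
      proof eventually_elim
        fix \<omega> assume "\<exists>J. (\<forall>m. (\<lambda>k. young_sum \<theta> (Suc k) (a m) t (\<lambda>u. B u \<omega>)) \<longlonglongrightarrow> exp (- \<theta> * t) * J (a m))
         \<and> (\<lambda>m. exp (- \<theta> * t) * J (a m)) \<longlonglongrightarrow> Z t \<omega>"
        then have "convergent (\<lambda>k. young_sum \<theta> (Suc k) (a m) t (\<lambda>u. B u \<omega>))" unfolding convergent_def by blast
        then show "(\<lambda>k. young_sum \<theta> (Suc k) (a m) t (\<lambda>u. B u \<omega>)) \<longlonglongrightarrow> V m t \<omega>"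
          unfolding V_def by (simp add: convergent_LIMSEQ_iff)
      qed
    qed auto
    fix t assume t: "t \<in> I"
    show "Z t \<in> borel_measurable P" using Z by (simp add: stationary_fractional_OU_def)
    show "AE \<omega> in P. (\<lambda>m. V m t \<omega>) \<longlonglongrightarrow> Z t \<omega>"
      using young[OF t]
    proof eventually_elim
      fix \<omega> assume "\<exists>J. (\<forall>m. (\<lambda>k. young_sum \<theta> (Suc k) (a m) t (\<lambda>u. B u \<omega>)) \<longlonglongrightarrow> exp (- \<theta> * t) * J (a m))
         \<and> (\<lambda>m. exp (- \<theta> * t) * J (a m)) \<longlonglongrightarrow> Z t \<omega>"
      then obtain J where J: "\<And>m. (\<lambda>k. young_sum \<theta> (Suc k) (a m) t (\<lambda>u. B u \<omega>)) \<longlonglongrightarrow> exp (- \<theta> * t) * J (a m)"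
         "(\<lambda>m. exp (- \<theta> * t) * J (a m)) \<longlonglongrightarrow> Z t \<omega>" by blast
      have "V m t \<omega> = exp (- \<theta> * t) * J (a m)" for m unfolding V_def by (rule limI[OF J(1)])
      then show "(\<lambda>m. V m t \<omega>) \<longlonglongrightarrow> Z t \<omega>" using J(2) by simp
    qed
  next
    fix t s assume "t \<in> I" "s \<in> I"
    then show "(\<lambda>m. ou_cov \<theta> (fbm_cov H) (a m) t s) \<longlonglongrightarrow> stationary_cov \<theta> H (t - s)"
      using at by (intro ou_cov_fbm_cov_limit[OF \<theta> H abot]) (auto intro: less_imp_le)
  qed
qed

text \<open>Both facts come from the Gaussian vector with two times: its covariance is the lag
  function, whose evenness is the symmetry of the covariance matrix.\<close>

lemma
  assumes H: "0 < H" "H < 1" and \<theta>: "0 < \<theta>"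
    and B: "two_sided_fractional_BM P H B" and Z: "stationary_fractional_OU P \<theta> B Z"
  shows rho_eq_stationary_cov: "rho P Z k = stationary_cov \<theta> H (real_of_int k)"
    and stationary_cov_even: "stationary_cov \<theta> H (- x) = stationary_cov \<theta> H x"
proof -
  interpret gaussian_vector P "{real_of_int k, 0}" "\<lambda>t s. stationary_cov \<theta> H (t - s)" Z
    by (rule stationary_OU_gaussian_vector[OF H \<theta> _ B Z]) simp
  show "rho P Z k = stationary_cov \<theta> H (real_of_int k)"
    unfolding rho_def using X_covariance[of "real_of_int k" 0] by simp
  interpret x: gaussian_vector P "{x, 0}" "\<lambda>t s. stationary_cov \<theta> H (t - s)" Z
    by (rule stationary_OU_gaussian_vector[OF H \<theta> _ B Z]) simp
  show "stationary_cov \<theta> H (- x) = stationary_cov \<theta> H x" using x.symK[of 0 x] by simp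
qed

lemma infsum_nonzero_int:
  fixes h :: "int \<Rightarrow> real"
  assumes even: "\<And>i. h (- i) = h i" and nn: "\<And>i. 0 \<le> h i" and s: "summable (\<lambda>d. h (int (Suc d)))"
  shows "(\<Sum>\<^sub>\<infinity>i\<in>UNIV - {0}. h i) = 2 * (\<Sum>d. h (int (Suc d)))"
proof -
  let ?S = "\<Sum>d. h (int (Suc d))"
  have 0: "((\<lambda>d. h (int (Suc d))) has_sum ?S) UNIV"
    using s nn by (intro norm_summable_imp_has_sum) (auto intro: summable_sums)
  have "inj (\<lambda>d. int (Suc d))" "inj (\<lambda>d. - int (Suc d))" by (auto intro!: injI)
  then have "(h has_sum ?S) (range (\<lambda>d. int (Suc d)))" "(h has_sum ?S) (range (\<lambda>d. - int (Suc d)))"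
    using 0 by (auto simp: has_sum_reindex o_def even simp del: of_nat_Suc)
  moreover have "range (\<lambda>d. int (Suc d)) \<inter> range (\<lambda>d. - int (Suc d)) = {}" by auto
  ultimately have "(h has_sum (?S + ?S)) (range (\<lambda>d. int (Suc d)) \<union> range (\<lambda>d. - int (Suc d)))"
    by (rule has_sum_Un_disjoint)
  also have "range (\<lambda>d. int (Suc d)) \<union> range (\<lambda>d. - int (Suc d)) = UNIV - {0}"
  proof (intro equalityI subsetI)
    fix i :: int assume "i \<in> UNIV - {0}"
    then have "i = int (Suc (nat (i - 1))) \<or> i = - int (Suc (nat (- i - 1)))" by auto
    then show "i \<in> range (\<lambda>d. int (Suc d)) \<union> range (\<lambda>d. - int (Suc d))" by blast
  qed auto
  finally show ?thesis by (simp add: infsumI)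
qed

lemma f_hat_eq:
  assumes "1 \<le> n"
  shows "f_hat X n \<omega> - c = ((\<Sum>i=1..n. (X (real i) \<omega>)\<^sup>2) - real n * c) / real n"
  using assms by (simp add: f_hat_def diff_divide_distrib)

lemma f_hat_measurable:
  assumes "\<And>i. 1 \<le> i \<Longrightarrow> X (real i) \<in> borel_measurable M"
  shows "f_hat X n \<in> borel_measurable M"
  unfolding f_hat_def[abs_def] using assms by (intro borel_measurable_times borel_measurable_sum borel_measurable_power) auto

text \<open>Reconciles the two cases of \<open>psi\<close>, split at H = 1/2, with the single
  exponent from the covariance sums. At H = 1/2 the exponent -2 has growth 0, which matches (4H -
  3)/2 = -1/2.\<close>

lemma sqrt_psi:
  assumes "1 \<le> n" "H < 1"
  shows "sqrt (psi H n) = real n powr (growth_exp (decay_exp H) - 1 / 2)"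
proof -
  have p: "sqrt (real n powr x) = real n powr (x / 2)" for x
    by (simp add: powr_half_sqrt_powr)
  show ?thesis
  proof (cases "H < 1 / 2")
    case True
    have "psi H n = real n powr (- 1)" using True assms by (simp add: psi_def powr_minus_divide)
    then show ?thesis using True p[of "-1"] by (simp add: growth_exp_def decay_exp_def)
  next
    case False
    then have eq: "growth_exp (decay_exp H) - 1 / 2 = (4 * H - 3) / 2"
      by (auto simp: growth_exp_def decay_exp_def field_simps)
    show ?thesis unfolding eq using False by (simp add: psi_def p)
  qed
qed

text \<open>The covariance estimate is available for ordered times; symmetry of the covariance
  matrix and evenness of the lag function extend it to all pairs.\<close>

lemma OU_covariance_decay:
  assumes H: "0 < H" "H < 1" and \<theta>: "0 < \<theta>"
    and S: "sub_fractional_BM M H S" and X: "sub_fractional_OU M \<theta> S X"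
    and even: "\<And>x. stationary_cov \<theta> H (- x) = stationary_cov \<theta> H x"
  shows "\<exists>C. covariance_decay (\<lambda>i j. sub_OU_cov \<theta> H (real i) (real j)) (\<lambda>d. stationary_cov \<theta> H (real d)) (decay_exp H) C"
proof -
  obtain C1 where C1: "0 \<le> C1" "\<And>k. 1 \<le> k \<Longrightarrow> \<bar>stationary_cov \<theta> H k\<bar> \<le> C1 * k powr decay_exp H"
    using stationary_cov_bound[OF \<theta> H] by blast
  obtain C2 where C2: "0 \<le> C2" "\<And>t s. 1 \<le> t \<Longrightarrow> t \<le> s \<Longrightarrow> \<bar>sub_OU_cov \<theta> H t s - stationary_cov \<theta> H (t - s)\<bar> \<le> C2 * s powr decay_exp H"
    using sub_OU_cov_stationary_cov_bound[OF \<theta> H] by blast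
  have sym: "sub_OU_cov \<theta> H (real i) (real j) = sub_OU_cov \<theta> H (real j) (real i)" if "1 \<le> i" "1 \<le> j" for i j
  proof -
    interpret gaussian_vector M "{1..max i j}" "\<lambda>i j. sub_OU_cov \<theta> H (real i) (real j)" "\<lambda>i. X (real i)"
      by (rule sub_fractional_OU_gaussian_vector[OF H \<theta> S X])
    show ?thesis using that by (intro symK) auto
  qed
  have "covariance_decay (\<lambda>i j. sub_OU_cov \<theta> H (real i) (real j)) (\<lambda>d. stationary_cov \<theta> H (real d)) (decay_exp H) (C1 + C2)"
  proof
    show "decay_exp H < 0" "decay_exp H \<noteq> - 1" using H by (auto simp: decay_exp_def)
    show "0 \<le> C1 + C2" using C1 C2 by simp
    fix d :: nat assume d: "1 \<le> d"
    have "\<bar>stationary_cov \<theta> H (real d)\<bar> \<le> C1 * real d powr decay_exp H" using d by (intro C1) auto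
    also have "\<dots> \<le> (C1 + C2) * real d powr decay_exp H" using C2 by (intro mult_right_mono) auto
    finally show "\<bar>stationary_cov \<theta> H (real d)\<bar> \<le> (C1 + C2) * real d powr decay_exp H" .
  next
    fix i j :: nat assume ij: "1 \<le> i" "1 \<le> j"
    have main: "\<bar>sub_OU_cov \<theta> H (real i) (real j) - stationary_cov \<theta> H (real (j - i))\<bar> \<le> (C1 + C2) * real j powr decay_exp H"
      if "1 \<le> i" "i \<le> j" for i j :: nat
    proof -
      have e: "stationary_cov \<theta> H (real i - real j) = stationary_cov \<theta> H (real (j - i))"
        using even[of "real (j - i)"] that by (simp add: of_nat_diff)
      have "\<bar>sub_OU_cov \<theta> H (real i) (real j) - stationary_cov \<theta> H (real i - real j)\<bar> \<le> C2 * real j powr decay_exp H"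
        using that by (intro C2) auto
      also have "\<dots> \<le> (C1 + C2) * real j powr decay_exp H" using C1 by (intro mult_right_mono) auto
      finally show ?thesis unfolding e .
    qed
    show "\<bar>sub_OU_cov \<theta> H (real i) (real j) - stationary_cov \<theta> H (real (if i \<le> j then j - i else i - j))\<bar> \<le> (C1 + C2) * real (max i j) powr decay_exp H"
    proof (cases "i \<le> j")
      case True then show ?thesis using main[of i j] ij by (simp add: max_def)
    next
      case False then show ?thesis using main[of j i] sym[OF ij] ij by (simp add: max_def)
    qed
  qed
  then show ?thesis ..
qed

section \<open>The subcritical and the critical rate\<close>

context
  fixes H \<theta> \<sigma> :: real
    and M :: "'a measure" and S X :: "real \<Rightarrow> 'a \<Rightarrow> real"
    and P :: "'b measure" and B Z :: "real \<Rightarrow> 'b \<Rightarrow> real"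
  assumes H: "0 < H" "H < 1"
    and \<theta>: "0 < \<theta>"
    and S: "sub_fractional_BM M H S"
    and X: "sub_fractional_OU M \<theta> S X"
    and B: "two_sided_fractional_BM P H B"
    and Z: "stationary_fractional_OU P \<theta> B Z"
    and \<sigma>: "\<sigma> = sigma_H H \<theta> (rho P Z)"
begin

abbreviation kap :: "nat \<Rightarrow> nat \<Rightarrow> real" where "kap \<equiv> \<lambda>i j. sub_OU_cov \<theta> H (real i) (real j)"

text \<open>\<open>s\<close> normalises the sum of squares, whereas the estimator is that sum
  divided by n; hence the factor n / s.\<close>

lemma OU_wasserstein:
  assumes n: "1 \<le> n" and s: "0 < s"
    and rows: "\<And>i. 1 \<le> i \<Longrightarrow> i \<le> n \<Longrightarrow> (\<Sum>j=1..n. \<bar>kap i j\<bar>) \<le> L" and L0: "0 \<le> L"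
    and e1: "\<bar>2 * (\<Sum>i=1..n. \<Sum>j=1..n. (kap i j)\<^sup>2) / s\<^sup>2 - 1\<bar> \<le> \<epsilon>"
    and e2: "\<bar>(\<Sum>i=1..n. kap i i) - real n * f_lim H \<theta>\<bar> / s \<le> \<epsilon>" and e3: "12 * L / s \<le> \<epsilon>"
    and h: "1-lipschitz_on UNIV h"
  shows "\<bar>(LINT \<omega>|M. h (real n / s * (f_hat X n \<omega> - f_lim H \<theta>))) - integral\<^sup>L std_gauss h\<bar> \<le> 3 * \<epsilon>"
proof -
  interpret gaussian_vector M "{1..n}" kap "\<lambda>i. X (real i)"
    by (rule sub_fractional_OU_gaussian_vector[OF H \<theta> S X])
  have eq: "real n / s * (f_hat X n \<omega> - f_lim H \<theta>) = (sqn \<omega> - real n * f_lim H \<theta>) / s" for \<omega>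
    unfolding f_hat_eq[OF n] sqn_def using n by simp
  show ?thesis
    unfolding eq
  proof (rule wasserstein_bound[OF _ L0 s _ _ e3 h])
    show "\<bar>2 * trK2 / s\<^sup>2 - 1\<bar> \<le> \<epsilon>" unfolding trK2_def by (rule e1)
    show "\<bar>trK - real n * f_lim H \<theta>\<bar> / s \<le> \<epsilon>" unfolding trK_def by (rule e2)
  qed (use rows in auto)
qed

lemma W_measurable: "(\<lambda>\<omega>. c * (f_hat X n \<omega> - d)) \<in> borel_measurable M"
proof -
  have [measurable]: "f_hat X n \<in> borel_measurable M"
    by (rule f_hat_measurable) (use X in \<open>simp add: sub_fractional_OU_def\<close>)
  show ?thesis by measurable
qed

lemma f_lim_pos: "0 < f_lim H \<theta>"
  using H \<theta> by (simp add: f_lim_def)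

lemma subcritical_rate:
  assumes H34: "H < 3 / 4"
  obtains D where "0 < D" "0 < \<sigma>" "\<And>n h. 1 \<le> n \<Longrightarrow> 1-lipschitz_on UNIV h \<Longrightarrow>
    \<bar>(LINT \<omega>|M. h (sqrt (real n) / \<sigma> * (f_hat X n \<omega> - f_lim H \<theta>))) - integral\<^sup>L std_gauss h\<bar>
      \<le> D * real n powr (growth_exp (decay_exp H) - 1 / 2)"
proof -
  note rho = rho_eq_stationary_cov[OF H \<theta> B Z] and even = stationary_cov_even[OF H \<theta> B Z]
  obtain C where "covariance_decay kap (\<lambda>d. stationary_cov \<theta> H (real d)) (decay_exp H) C"
    using OU_covariance_decay[OF H \<theta> S X even] by blast
  then interpret covariance_decay kap "\<lambda>d. stationary_cov \<theta> H (real d)" "decay_exp H" C .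
  have bh: "decay_exp H < - 1 / 2" using H34 by (auto simp: decay_exp_def)
  \<comment> \<open>The sum over nonzero integers is twice the sum over positive lags, which
    accounts for the factor 4 in \<open>limvar\<close>.\<close>
  have sig: "\<sigma> = sqrt limvar"
  proof -
    have "(\<Sum>\<^sub>\<infinity>i\<in>UNIV - {0}. (rho P Z i)\<^sup>2) = 2 * (\<Sum>d. (rho P Z (int (Suc d)))\<^sup>2)"
    proof (rule infsum_nonzero_int)
      show "summable (\<lambda>d. (rho P Z (int (Suc d)))\<^sup>2)" using r_square_summable[OF bh] by (simp add: rho)
    qed (auto simp: rho even)
    then show ?thesis using H34 unfolding \<sigma> sigma_H_def limvar_def by (simp add: rho)
  qed
  have r0: "stationary_cov \<theta> H (real 0) = f_lim H \<theta>" using stationary_cov_0[OF \<theta> H] by simp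
  \<comment> \<open>The lag 0 term alone makes the limiting variance positive.\<close>
  have "0 < (f_lim H \<theta>)\<^sup>2" using f_lim_pos by simp
  moreover have "0 \<le> (\<Sum>d. (stationary_cov \<theta> H (real (Suc d)))\<^sup>2)" by (intro suminf_nonneg r_square_summable bh) auto
  ultimately have lv: "0 < limvar" unfolding limvar_def r0 by linarith
  have s0: "0 < \<sigma>" and s2: "\<sigma>\<^sup>2 = limvar" using lv by (auto simp: sig)
  obtain B1 where B1: "0 \<le> B1" "\<And>n. 1 \<le> n \<Longrightarrow> \<bar>(\<Sum>i=1..n. kap i i) - real n * stationary_cov \<theta> H (real 0)\<bar> \<le> B1 * real n powr growth_exp (decay_exp H)"
    using trace_bound by blast
  obtain B2 where B2: "0 \<le> B2" "\<And>n i. 1 \<le> i \<Longrightarrow> i \<le> n \<Longrightarrow> (\<Sum>j=1..n. \<bar>kap i j\<bar>) \<le> B2 * real n powr growth_exp (decay_exp H)"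
    using row_sum_bound by blast
  obtain B3 where B3: "0 \<le> B3" "\<And>n. 1 \<le> n \<Longrightarrow> \<bar>2 / real n * (\<Sum>i=1..n. \<Sum>j=1..n. (kap i j)\<^sup>2) - limvar\<bar> \<le> B3 * real n powr (growth_exp (decay_exp H) - 1 / 2)"
    using variance_rate[OF bh] by blast
  define E where "E = B3 / limvar + B1 / \<sigma> + 12 * B2 / \<sigma>"
  have E0: "0 \<le> B3 / limvar" "0 \<le> B1 / \<sigma>" "0 \<le> 12 * B2 / \<sigma>" using B1 B2 B3 lv s0 by auto
  show thesis
  proof (rule that[of "3 * E + 1"])
    show "0 < 3 * E + 1" using E0 by (simp add: E_def)
    fix n :: nat and h :: "real \<Rightarrow> real" assume n: "1 \<le> n" and h: "1-lipschitz_on UNIV h"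
    define q where "q = real n powr (growth_exp (decay_exp H) - 1 / 2)"
    have q: "0 \<le> q" by (simp add: q_def)
    define s where "s = sqrt (real n) * \<sigma>"
    have s: "0 < s" using n s0 by (simp add: s_def)
    have ss: "s\<^sup>2 = real n * limvar" by (simp add: s_def power_mult_distrib s2)
    \<comment> \<open>Bias and row sums are O(q sqrt n), so division by s = \<sigma> sqrt n leaves
      O(q).\<close>
    have gq: "real n powr growth_exp (decay_exp H) = q * sqrt (real n)"
      using n by (simp add: q_def powr_half_sqrt[symmetric] powr_add[symmetric])
    have "\<bar>(LINT \<omega>|M. h (real n / s * (f_hat X n \<omega> - f_lim H \<theta>))) - integral\<^sup>L std_gauss h\<bar> \<le> 3 * (E * q)"
    proof (rule OU_wasserstein[OF n s _ _ _ _ _ h])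
      show "0 \<le> B2 * real n powr growth_exp (decay_exp H)" using B2 by simp
      show "(\<Sum>j=1..n. \<bar>kap i j\<bar>) \<le> B2 * real n powr growth_exp (decay_exp H)" if "1 \<le> i" "i \<le> n" for i by (rule B2(2)[OF that])
      have "2 * (\<Sum>i=1..n. \<Sum>j=1..n. (kap i j)\<^sup>2) / s\<^sup>2 - 1 = (2 / real n * (\<Sum>i=1..n. \<Sum>j=1..n. (kap i j)\<^sup>2) - limvar) / limvar"
        unfolding ss using n lv by (simp add: field_simps)
      also have "\<bar>\<dots>\<bar> \<le> B3 * q / limvar"
        unfolding abs_divide using B3(2)[OF n] lv by (simp add: q_def divide_right_mono)
      also have "\<dots> \<le> E * q" using mult_right_mono[OF _ q, of "B3 / limvar" E] E0 by (simp add: E_def)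
      finally show "\<bar>2 * (\<Sum>i=1..n. \<Sum>j=1..n. (kap i j)\<^sup>2) / s\<^sup>2 - 1\<bar> \<le> E * q" .
      have "\<bar>(\<Sum>i=1..n. kap i i) - real n * f_lim H \<theta>\<bar> / s \<le> B1 * (q * sqrt (real n)) / s"
        using B1(2)[OF n] s unfolding r0 gq by (intro divide_right_mono) auto
      also have "\<dots> = B1 / \<sigma> * q" using n s0 by (simp add: s_def)
      also have "\<dots> \<le> E * q" using E0 q by (intro mult_right_mono) (auto simp: E_def)
      finally show "\<bar>(\<Sum>i=1..n. kap i i) - real n * f_lim H \<theta>\<bar> / s \<le> E * q" .
      have "12 * (B2 * real n powr growth_exp (decay_exp H)) / s = 12 * B2 / \<sigma> * q" unfolding gq using n s0 by (simp add: s_def)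
      also have "\<dots> \<le> E * q" using E0 q by (intro mult_right_mono) (auto simp: E_def)
      finally show "12 * (B2 * real n powr growth_exp (decay_exp H)) / s \<le> E * q" .
    qed
    also have "real n / s = sqrt (real n) / \<sigma>"
      using n s0 real_sqrt_mult_self[of "real n"] by (simp add: s_def field_simps)
    also have "3 * (E * q) \<le> (3 * E + 1) * q" using q by (simp add: distrib_right)
    finally show "\<bar>(LINT \<omega>|M. h (sqrt (real n) / \<sigma> * (f_hat X n \<omega> - f_lim H \<theta>))) - integral\<^sup>L std_gauss h\<bar>
      \<le> (3 * E + 1) * real n powr (growth_exp (decay_exp H) - 1 / 2)" by (simp add: q_def)
  qed (rule s0)
qed

lemma critical_rate:
  assumes H34: "H = 3 / 4"
  obtains D where "0 < D" "0 < \<sigma>" "\<And>n h. 1 < n \<Longrightarrow> 1-lipschitz_on UNIV h \<Longrightarrow>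
    \<bar>(LINT \<omega>|M. h (sqrt (real n) * (f_hat X n \<omega> - f_lim H \<theta>) / (\<sigma> * sqrt (ln (real n))))) - integral\<^sup>L std_gauss h\<bar>
      \<le> D * ln (real n) powr (- (1 / 2))"
proof -
  note even = stationary_cov_even[OF H \<theta> B Z]
  obtain C where "covariance_decay kap (\<lambda>d. stationary_cov \<theta> H (real d)) (decay_exp H) C"
    using OU_covariance_decay[OF H \<theta> S X even] by blast
  then interpret covariance_decay kap "\<lambda>d. stationary_cov \<theta> H (real d)" "decay_exp H" C .
  have bh: "decay_exp H = - 1 / 2" using H34 by (simp add: decay_exp_def)
  have g: "growth_exp (decay_exp H) = 1 / 2" by (simp add: growth_exp_def bh)
  \<comment> \<open>At H = 3/4 this is 3/(8 \<theta>^2), and 4 c^2 = 9/(16 \<theta>^4) is the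
    prescribed squared normalisation.\<close>
  define c where "c = H * (2 * H - 1) / \<theta>\<^sup>2"
  have sig: "\<sigma>\<^sup>2 = 4 * c\<^sup>2" "0 < \<sigma>"
    using \<theta> unfolding \<sigma> sigma_H_def c_def H34 by (auto simp: power_divide power_mult_distrib field_simps)
  have r0: "stationary_cov \<theta> H (real 0) = f_lim H \<theta>" using stationary_cov_0[OF \<theta> H] by simp
  obtain C3 where C3: "0 \<le> C3" "\<And>k. 1 \<le> k \<Longrightarrow> \<bar>stationary_cov \<theta> H k - c * k powr (2 * H - 2)\<bar> \<le> C3 * k powr (2 * H - 3)"
    using stationary_cov_asymptotic[OF \<theta> H] unfolding c_def by blast
  have asym: "\<bar>stationary_cov \<theta> H (real d) - c * real d powr (- 1 / 2)\<bar> \<le> C3 * real d powr (- 3 / 2)" if "1 \<le> d" for d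
  proof -
    have e: "2 * H - 2 = - 1 / 2" "2 * H - 3 = - 3 / 2" using H34 by auto
    show ?thesis using C3(2)[of "real d"] that unfolding e by simp
  qed
  obtain B1 where B1: "0 \<le> B1" "\<And>n. 1 \<le> n \<Longrightarrow> \<bar>(\<Sum>i=1..n. kap i i) - real n * stationary_cov \<theta> H (real 0)\<bar> \<le> B1 * real n powr growth_exp (decay_exp H)"
    using trace_bound by blast
  obtain B2 where B2: "0 \<le> B2" "\<And>n i. 1 \<le> i \<Longrightarrow> i \<le> n \<Longrightarrow> (\<Sum>j=1..n. \<bar>kap i j\<bar>) \<le> B2 * real n powr growth_exp (decay_exp H)"
    using row_sum_bound by blast
  obtain B3 where B3: "0 \<le> B3" "\<And>n. 1 \<le> n \<Longrightarrow> \<bar>2 / real n * (\<Sum>i=1..n. \<Sum>j=1..n. (kap i j)\<^sup>2) - 4 * c\<^sup>2 * ln (real n)\<bar> \<le> B3"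
    using variance_rate_critical[OF bh C3(1) asym] by blast
  \<comment> \<open>The relative variance error is O(1 / ln n), better than the target 1 / sqrt(ln
    n); ln n \<ge> ln 2 converts it with a constant valid for all n > 1.\<close>
  define l2 where "l2 = sqrt (ln (2::real))"
  have l2: "0 < l2" by (simp add: l2_def)
  define E where "E = B3 / (\<sigma>\<^sup>2 * l2) + B1 / \<sigma> + 12 * B2 / \<sigma>"
  have E0: "0 \<le> B3 / (\<sigma>\<^sup>2 * l2)" "0 \<le> B1 / \<sigma>" "0 \<le> 12 * B2 / \<sigma>" using B1 B2 B3 sig l2 by auto
  show thesis
  proof (rule that[of "3 * E + 1"])
    show "0 < 3 * E + 1" using E0 by (simp add: E_def)
    fix n :: nat and h :: "real \<Rightarrow> real" assume n: "1 < n" and h: "1-lipschitz_on UNIV h"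
    have n1: "1 \<le> n" using n by simp
    define l where "l = ln (real n)"
    have l: "0 < l" "ln 2 \<le> l" using n by (auto simp: l_def)
    define q where "q = 1 / sqrt l"
    have q: "0 \<le> q" using l by (simp add: q_def)
    have q_eq: "l powr (- (1 / 2)) = q" using l by (simp add: q_def powr_minus_divide powr_half_sqrt)
    have lq: "1 / l \<le> q / l2"
    proof -
      have "1 / l = q * q" using l by (simp add: q_def)
      also have "\<dots> \<le> q * (1 / l2)"
        using l q l2 by (intro mult_left_mono) (auto simp: q_def l2_def intro!: divide_left_mono)
      finally show ?thesis by simp
    qed
    define s where "s = sqrt (real n) * \<sigma> * sqrt l"
    have s: "0 < s" using n sig l by (simp add: s_def)
    have ss: "s\<^sup>2 = real n * (\<sigma>\<^sup>2 * l)" using l by (simp add: s_def power_mult_distrib)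
    have gs: "real n powr growth_exp (decay_exp H) = sqrt (real n)" unfolding g by (simp add: powr_half_sqrt)
    have "\<bar>(LINT \<omega>|M. h (real n / s * (f_hat X n \<omega> - f_lim H \<theta>))) - integral\<^sup>L std_gauss h\<bar> \<le> 3 * (E * q)"
    proof (rule OU_wasserstein[OF n1 s _ _ _ _ _ h])
      show "0 \<le> B2 * real n powr growth_exp (decay_exp H)" using B2 by simp
      show "(\<Sum>j=1..n. \<bar>kap i j\<bar>) \<le> B2 * real n powr growth_exp (decay_exp H)" if "1 \<le> i" "i \<le> n" for i by (rule B2(2)[OF that])
      have "2 * (\<Sum>i=1..n. \<Sum>j=1..n. (kap i j)\<^sup>2) / s\<^sup>2 - 1 = (2 / real n * (\<Sum>i=1..n. \<Sum>j=1..n. (kap i j)\<^sup>2) - 4 * c\<^sup>2 * ln (real n)) / (\<sigma>\<^sup>2 * l)"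
        unfolding ss sig(1)[symmetric] l_def[symmetric] using n sig(2) l by (simp add: field_simps)
      also have "\<bar>\<dots>\<bar> \<le> B3 / (\<sigma>\<^sup>2 * l)"
        unfolding abs_divide using B3(2)[OF n1] sig(2) l by (simp add: divide_right_mono)
      also have "\<dots> = B3 / \<sigma>\<^sup>2 * (1 / l)" by simp
      also have "\<dots> \<le> B3 / \<sigma>\<^sup>2 * (q / l2)" using B3(1) by (intro mult_left_mono lq) auto
      also have "\<dots> = B3 / (\<sigma>\<^sup>2 * l2) * q" by simp
      also have "\<dots> \<le> E * q" using E0 q by (intro mult_right_mono) (auto simp: E_def)
      finally show "\<bar>2 * (\<Sum>i=1..n. \<Sum>j=1..n. (kap i j)\<^sup>2) / s\<^sup>2 - 1\<bar> \<le> E * q" .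
      have "\<bar>(\<Sum>i=1..n. kap i i) - real n * f_lim H \<theta>\<bar> / s \<le> B1 * sqrt (real n) / s"
        using B1(2)[OF n1] s unfolding r0 gs by (intro divide_right_mono) auto
      also have "\<dots> = B1 / \<sigma> * q" using n sig(2) by (simp add: s_def q_def)
      also have "\<dots> \<le> E * q" using E0 q by (intro mult_right_mono) (auto simp: E_def)
      finally show "\<bar>(\<Sum>i=1..n. kap i i) - real n * f_lim H \<theta>\<bar> / s \<le> E * q" .
      have "12 * (B2 * real n powr growth_exp (decay_exp H)) / s = 12 * B2 / \<sigma> * q" unfolding gs using n sig(2) by (simp add: s_def q_def)
      also have "\<dots> \<le> E * q" using E0 q by (intro mult_right_mono) (auto simp: E_def)
      finally show "12 * (B2 * real n powr growth_exp (decay_exp H)) / s \<le> E * q" .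
    qed
    also have "(\<lambda>\<omega>. h (real n / s * (f_hat X n \<omega> - f_lim H \<theta>))) = (\<lambda>\<omega>. h (sqrt (real n) * (f_hat X n \<omega> - f_lim H \<theta>) / (\<sigma> * sqrt (ln (real n)))))"
    proof -
      have "real n / s = sqrt (real n) / (\<sigma> * sqrt (ln (real n)))"
        using n sig(2) l real_sqrt_mult_self[of "real n"] by (simp add: s_def l_def field_simps)
      then show ?thesis by simp
    qed
    also have "3 * (E * q) \<le> (3 * E + 1) * q" using q by (simp add: distrib_right)
    finally show "\<bar>(LINT \<omega>|M. h (sqrt (real n) * (f_hat X n \<omega> - f_lim H \<theta>) / (\<sigma> * sqrt (ln (real n))))) - integral\<^sup>L std_gauss h\<bar>
      \<le> (3 * E + 1) * ln (real n) powr (- (1 / 2))" by (simp add: q_eq l_def[symmetric])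
  qed (rule sig(2))
qed

end

theorem theorem13:
  fixes H \<theta> :: real
    and M :: "'a measure" and S X :: "real \<Rightarrow> 'a \<Rightarrow> real"
    and P :: "'b measure" and B Z :: "real \<Rightarrow> 'b \<Rightarrow> real"
    and \<sigma> :: real
  assumes H: "0 < H" "H < 1"
    and theta: "\<theta> > 0"
    and S: "sub_fractional_BM M H S"
    and X: "sub_fractional_OU M \<theta> S X"
    and B: "two_sided_fractional_BM P H B"
    and Z: "stationary_fractional_OU P \<theta> B Z"
  defines "\<sigma> \<equiv> sigma_H H \<theta> (rho P Z)"
  shows "(H < 3 / 4 \<longrightarrow>
            (\<exists>C>0. \<forall>n>1.
               wasserstein_dist
                 (distr M borel (\<lambda>\<omega>. sqrt (real n) / \<sigma> * (f_hat X n \<omega> - f_lim H \<theta>)))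
                 std_normal_distribution
               \<le> ennreal (C * sqrt (psi H n))))
       \<and> (H = 3 / 4 \<longrightarrow>
            (\<exists>C>0. \<forall>n>1.
               wasserstein_dist
                 (distr M borel (\<lambda>\<omega>. sqrt (real n) * (f_hat X n \<omega> - f_lim H \<theta>)
                                      / (\<sigma> * sqrt (ln (real n)))))
                 std_normal_distribution
               \<le> ennreal (C * ln (real n) powr (- (1 / 2)))))
       \<and> (H < 3 / 4 \<longrightarrow>
            weak_conv_m
              (\<lambda>n. distr M borel (\<lambda>\<omega>. sqrt (real n) * (f_hat X n \<omega> - f_lim H \<theta>)))
              (density lborel (normal_density 0 \<sigma>)))
       \<and> (H = 3 / 4 \<longrightarrow>
            weak_conv_m
              (\<lambda>n. distr M borel (\<lambda>\<omega>. sqrt (real n) * (f_hat X n \<omega> - f_lim H \<theta>)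
                                        / sqrt (ln (real n))))
              (density lborel (normal_density 0 \<sigma>)))"
proof -
  have \<sigma>: "\<sigma> = sigma_H H \<theta> (rho P Z)" by (simp add: \<sigma>_def)
  note model = H theta S X B Z \<sigma>
  have M: "prob_space M" using S by (simp add: sub_fractional_BM_def continuous_centred_gaussian_def)
  have meas: "(\<lambda>\<omega>. c * (f_hat X n \<omega> - d)) \<in> borel_measurable M" for c d n
    by (rule W_measurable[OF model])
  have meas': "(\<lambda>\<omega>. a * (f_hat X n \<omega> - d) / c) \<in> borel_measurable M" for a c d n
    by (intro borel_measurable_divide meas) auto
  have sub: "\<exists>C>0. \<forall>n>1. wasserstein_dist (distr M borel (\<lambda>\<omega>. sqrt (real n) / \<sigma> * (f_hat X n \<omega> - f_lim H \<theta>))) std_gauss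
               \<le> ennreal (C * sqrt (psi H n))"
    and sub_weak: "weak_conv_m (\<lambda>n. distr M borel (\<lambda>\<omega>. sqrt (real n) * (f_hat X n \<omega> - f_lim H \<theta>)))
              (density lborel (normal_density 0 \<sigma>))" if H34: "H < 3 / 4"
  proof -
    obtain D where D: "0 < D" "0 < \<sigma>" "\<And>n h. 1 \<le> n \<Longrightarrow> 1-lipschitz_on UNIV h \<Longrightarrow>
      \<bar>(LINT \<omega>|M. h (sqrt (real n) / \<sigma> * (f_hat X n \<omega> - f_lim H \<theta>))) - integral\<^sup>L std_gauss h\<bar>
      \<le> D * real n powr (growth_exp (decay_exp H) - 1 / 2)"
      using subcritical_rate[OF model H34] by blast
    show "\<exists>C>0. \<forall>n>1. wasserstein_dist (distr M borel (\<lambda>\<omega>. sqrt (real n) / \<sigma> * (f_hat X n \<omega> - f_lim H \<theta>))) std_gauss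
               \<le> ennreal (C * sqrt (psi H n))"
    proof (intro exI[of _ D] conjI allI impI D(1) wasserstein_distI M meas)
      fix n :: nat and h :: "real \<Rightarrow> real" assume n: "1 < n" and h: "1-lipschitz_on UNIV h"
      then show "\<bar>(LINT \<omega>|M. h (sqrt (real n) / \<sigma> * (f_hat X n \<omega> - f_lim H \<theta>))) - integral\<^sup>L std_gauss h\<bar> \<le> D * sqrt (psi H n)"
        using D(3)[of n h] sqrt_psi[of n H] H by simp
    qed
    have g: "growth_exp (decay_exp H) < 1 / 2" using H34 by (auto simp: growth_exp_def decay_exp_def max_def)
    \<comment> \<open>Multiplying the standardised statistic by \<open>\<sigma>\<close> returns the
      unscaled one, with limit variance \<open>\<sigma>\<^sup>2\<close>.\<close>
    have "weak_conv_m (\<lambda>n. distr M borel (\<lambda>\<omega>. \<sigma> * (sqrt (real n) / \<sigma> * (f_hat X n \<omega> - f_lim H \<theta>))))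
              (density lborel (normal_density 0 \<sigma>))"
    proof (rule wasserstein_imp_weak_conv[OF M meas D(2)])
      show "\<bar>(LINT \<omega>|M. h (sqrt (real n) / \<sigma> * (f_hat X n \<omega> - f_lim H \<theta>))) - integral\<^sup>L std_gauss h\<bar> \<le> D * real n powr (growth_exp (decay_exp H) - 1 / 2)"
        if "1 < n" "1-lipschitz_on UNIV h" for n h using D(3)[of n h] that by simp
      have "(\<lambda>n. real n powr (growth_exp (decay_exp H) - 1 / 2)) \<longlonglongrightarrow> 0"
        by (rule tendsto_neg_powr[OF _ filterlim_real_sequentially]) (use g in simp)
      then show "(\<lambda>n. D * real n powr (growth_exp (decay_exp H) - 1 / 2)) \<longlonglongrightarrow> 0" by (rule tendsto_mult_right_zero)
    qed
    then show "weak_conv_m (\<lambda>n. distr M borel (\<lambda>\<omega>. sqrt (real n) * (f_hat X n \<omega> - f_lim H \<theta>)))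
              (density lborel (normal_density 0 \<sigma>))" using D(2) by simp
  qed
  have crit: "\<exists>C>0. \<forall>n>1. wasserstein_dist (distr M borel (\<lambda>\<omega>. sqrt (real n) * (f_hat X n \<omega> - f_lim H \<theta>) / (\<sigma> * sqrt (ln (real n))))) std_gauss
               \<le> ennreal (C * ln (real n) powr (- (1 / 2)))"
    and crit_weak: "weak_conv_m (\<lambda>n. distr M borel (\<lambda>\<omega>. sqrt (real n) * (f_hat X n \<omega> - f_lim H \<theta>) / sqrt (ln (real n))))
              (density lborel (normal_density 0 \<sigma>))" if H34: "H = 3 / 4"
  proof -
    obtain D where D: "0 < D" "0 < \<sigma>" "\<And>n h. 1 < n \<Longrightarrow> 1-lipschitz_on UNIV h \<Longrightarrow>
      \<bar>(LINT \<omega>|M. h (sqrt (real n) * (f_hat X n \<omega> - f_lim H \<theta>) / (\<sigma> * sqrt (ln (real n))))) - integral\<^sup>L std_gauss h\<bar>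
      \<le> D * ln (real n) powr (- (1 / 2))"
      using critical_rate[OF model H34] by blast
    show "\<exists>C>0. \<forall>n>1. wasserstein_dist (distr M borel (\<lambda>\<omega>. sqrt (real n) * (f_hat X n \<omega> - f_lim H \<theta>) / (\<sigma> * sqrt (ln (real n))))) std_gauss
               \<le> ennreal (C * ln (real n) powr (- (1 / 2)))"
      using D by (intro exI[of _ D] conjI allI impI wasserstein_distI M meas') auto
    have "weak_conv_m (\<lambda>n. distr M borel (\<lambda>\<omega>. \<sigma> * (sqrt (real n) * (f_hat X n \<omega> - f_lim H \<theta>) / (\<sigma> * sqrt (ln (real n))))))
              (density lborel (normal_density 0 \<sigma>))"
    proof (rule wasserstein_imp_weak_conv[OF M meas' D(2,3)])
      have "(\<lambda>n. ln (real n) powr (- (1 / 2))) \<longlonglongrightarrow> 0"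
        by (rule tendsto_neg_powr) (auto intro: filterlim_compose[OF ln_at_top filterlim_real_sequentially])
      then show "(\<lambda>n. D * ln (real n) powr (- (1 / 2))) \<longlonglongrightarrow> 0" by (rule tendsto_mult_right_zero)
    qed
    then show "weak_conv_m (\<lambda>n. distr M borel (\<lambda>\<omega>. sqrt (real n) * (f_hat X n \<omega> - f_lim H \<theta>) / sqrt (ln (real n))))
              (density lborel (normal_density 0 \<sigma>))" using D(2) by simp
  qed
  show ?thesis using sub sub_weak crit crit_weak by blast
qed

end
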